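(* Let $\Gamma$ be a non-elementary hyperbolic group, let $\mathcal{C}=\{[g,h]\mid g,h\in\Gamma\}$ be its set of commutators and $\mathcal{D}=[\Gamma,\Gamma]$ its derived subgroup, and let $\rho\in\mathrm{Hom}(\Gamma,PSL_2(\mathbb{C}))$. The following are equivalent: (i) $\rho$ is convex cocompact; (ii) $\rho$ is $\mathcal{C}$-stable; (iii) $\rho$ is $\mathcal{D}$-well-displacing.
   Context: $PSL_2(\mathbb{C})$ is identified with $\mathrm{Isom}^+(\mathbb{H}^3)$, $X=\mathbb{H}^3$. $\rho$ is convex cocompact if $\ker\rho$ is finite and $\rho(\Gamma)$ is a discrete subgroup admitting a convex $\rho(\Gamma)$-invariant subset of $\mathbb{H}^3$ on which it acts cocompactly. Fix a finite generating set $S$, Cayley graph $C_S(\Gamma)$ with word metric, $l_S(\gamma)$ the translation length of $\gamma$ on $C_S(\Gamma)$, $l(g)=\inf_{x}d(x,gx)$ for $g\in PSL_2(\mathbb{C})$. Orbit map $\tau_{\rho,x}$: $\rho$-equivariant, $\gamma\mapsto\rho(\gamma)x$ on vertices, edges to geodesic segments. For infinite order $a$, $L_S(a)$ is the set of geodesics of $C_S(\Gamma)$ joining the fixed points $a^\pm\in\partial C_S(\Gamma)$. $\rho$ is $\mathcal{C}$-stable if there are $K\geqslant1,C\geqslant0,x\in\mathbb{H}^3$ such that for every infinite order $c\in\mathcal{C}$ and every $l\in L_S(c)$, $\tau_{\rho,x}(l)$ is a $(K,C)$ quasi-geodesic (image of a map $f$ with $\frac1K|s-t|-C\leqslant d(f(s),f(t))\leqslant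 K|s-t|+C$). $\rho$ is $\mathcal{D}$-well-displacing if there are $J\geqslant1,B\geqslant0$ with $\frac1J l_S(a)-B\leqslant l(\rho(a))\leqslant Jl_S(a)+B$ for all $a\in\mathcal{D}$. Non-elementary: contains a free subgroup of rank 2. *)

theory Defs
  imports "HOL-Analysis.Analysis" "HOL-Algebra.Generated_Groups"
begin

definition H3 :: "(complex \<times> real) set" where
  "H3 = {p. snd p > 0}"

definition hdist :: "complex \<times> real \<Rightarrow> complex \<times> real \<Rightarrow> real" where
  "hdist p q = arcosh (1 + ((cmod (fst p - fst q))\<^sup>2 + (snd p - snd q)\<^sup>2) / (2 * snd p * snd q))"

text \<open>Geodesic segment between two points (H^3 is uniquely geodesic).\<close>
definition hseg :: "complex \<times> real \<Rightarrow> complex \<times> real \<Rightarrow> (complex \<times> real) set" where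
  "hseg p q = {r \<in> H3. hdist p r + hdist r q = hdist p q}"

definition hconvex :: "(complex \<times> real) set \<Rightarrow> bool" where
  "hconvex C \<longleftrightarrow> C \<subseteq> H3 \<and> (\<forall>p\<in>C. \<forall>q\<in>C. hseg p q \<subseteq> C)"

text \<open>Action of a matrix [[a,b],[c,d]] of determinant 1 on H^3
  (Poincare extension of the Moebius transformation).\<close>
definition mob :: "complex^2^2 \<Rightarrow> complex \<times> real \<Rightarrow> complex \<times> real" where
  "mob M p = (let a = M$1$1; b = M$1$2; c = M$2$1; d = M$2$2; z = fst p; t = snd p;
                  D = (cmod (c * z + d))\<^sup>2 + (cmod c)\<^sup>2 * t\<^sup>2
              in (((a * z + b) * cnj (c * z + d) + a * cnj c * complex_of_real (t\<^sup>2)) / complex_of_real D,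
                  t / D))"

definition PSL2 :: "(complex^2^2) set monoid" where
  "PSL2 = \<lparr> carrier = {{M, -M} | M. det M = 1},
            mult = (\<lambda>X Y. {M ** N | M N. M \<in> X \<and> N \<in> Y}),
            one = {mat 1, - mat 1} \<rparr>"

text \<open>Action of an element of PSL(2,C) on H^3 (independent of the representative).\<close>
definition pact :: "(complex^2^2) set \<Rightarrow> complex \<times> real \<Rightarrow> complex \<times> real" where
  "pact X p = mob (SOME M. M \<in> X) p"

definition tlen :: "(complex^2^2) set \<Rightarrow> real" where
  "tlen X = Inf {hdist p (pact X p) | p. p \<in> H3}"

definition convex_cocompact :: "('g, 'b) monoid_scheme \<Rightarrow> ('g \<Rightarrow> (complex^2^2) set) \<Rightarrow> bool" where
  "convex_cocompact G \<rho> \<longleftrightarrow>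
     finite {g \<in> carrier G. \<rho> g = \<one>\<^bsub>PSL2\<^esub>}
   \<and> (\<exists>\<epsilon>>0. \<forall>g\<in>carrier G. \<rho> g \<noteq> \<one>\<^bsub>PSL2\<^esub> \<longrightarrow> (\<forall>M\<in>\<rho> g. norm (M - mat 1) \<ge> \<epsilon>))
   \<and> (\<exists>C. C \<noteq> {} \<and> hconvex C \<and> (\<forall>g\<in>carrier G. pact (\<rho> g) ` C \<subseteq> C)
        \<and> (\<exists>K. compact K \<and> K \<subseteq> C \<and> C \<subseteq> (\<Union>g\<in>carrier G. pact (\<rho> g) ` K)))"

definition word_len :: "('g, 'b) monoid_scheme \<Rightarrow> 'g set \<Rightarrow> 'g \<Rightarrow> nat" where
  "word_len G S g = (LEAST n. \<exists>w. length w = n \<and> set w \<subseteq> S \<union> m_inv G ` S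
                                    \<and> foldr (\<otimes>\<^bsub>G\<^esub>) w \<one>\<^bsub>G\<^esub> = g)"

definition word_dist :: "('g, 'b) monoid_scheme \<Rightarrow> 'g set \<Rightarrow> 'g \<Rightarrow> 'g \<Rightarrow> real" where
  "word_dist G S g h = real (word_len G S (inv\<^bsub>G\<^esub> g \<otimes>\<^bsub>G\<^esub> h))"

definition gromov :: "('g, 'b) monoid_scheme \<Rightarrow> 'g set \<Rightarrow> 'g \<Rightarrow> 'g \<Rightarrow> 'g \<Rightarrow> real" where
  "gromov G S w x y = (word_dist G S w x + word_dist G S w y - word_dist G S x y) / 2"

definition finite_gen_set :: "('g, 'b) monoid_scheme \<Rightarrow> 'g set \<Rightarrow> bool" where
  "finite_gen_set G S \<longleftrightarrow> finite S \<and> S \<subseteq> carrier G \<and> generate G S = carrier G"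

definition hyperbolic_group :: "('g, 'b) monoid_scheme \<Rightarrow> bool" where
  "hyperbolic_group G \<longleftrightarrow> group G \<and> (\<exists>S. finite_gen_set G S \<and>
     (\<exists>\<delta>\<ge>0. \<forall>w\<in>carrier G. \<forall>x\<in>carrier G. \<forall>y\<in>carrier G. \<forall>z\<in>carrier G.
        gromov G S w x z \<ge> min (gromov G S w x y) (gromov G S w y z) - \<delta>))"

text \<open>Words in two letters: (False,_) is a, (True,_) is b; second component = inverse.\<close>
definition reduced2 :: "(bool \<times> bool) list \<Rightarrow> bool" where
  "reduced2 w \<longleftrightarrow> (\<forall>i. Suc i < length w \<longrightarrow>
      \<not> (fst (w!i) = fst (w!Suc i) \<and> snd (w!i) \<noteq> snd (w!Suc i)))"

definition eval2 :: "('g, 'b) monoid_scheme \<Rightarrow> 'g \<Rightarrow> 'g \<Rightarrow> (bool \<times> bool) list \<Rightarrow> 'g" where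
  "eval2 G a b w = foldr (\<otimes>\<^bsub>G\<^esub>)
      (map (\<lambda>(x, e). let y = (if x then b else a) in if e then inv\<^bsub>G\<^esub> y else y) w) \<one>\<^bsub>G\<^esub>"

definition non_elementary :: "('g, 'b) monoid_scheme \<Rightarrow> bool" where
  "non_elementary G \<longleftrightarrow> (\<exists>a\<in>carrier G. \<exists>b\<in>carrier G.
      \<forall>w. w \<noteq> [] \<and> reduced2 w \<longrightarrow> eval2 G a b w \<noteq> \<one>\<^bsub>G\<^esub>)"

definition infinite_order :: "('g, 'b) monoid_scheme \<Rightarrow> 'g \<Rightarrow> bool" where
  "infinite_order G a \<longleftrightarrow> (\<forall>n::nat. n > 0 \<longrightarrow> a [^]\<^bsub>G\<^esub> n \<noteq> \<one>\<^bsub>G\<^esub>)"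

definition word_tlen :: "('g, 'b) monoid_scheme \<Rightarrow> 'g set \<Rightarrow> 'g \<Rightarrow> real" where
  "word_tlen G S a = Inf {word_dist G S g (a \<otimes>\<^bsub>G\<^esub> g) | g. g \<in> carrier G}"

text \<open>L_S(a): bi-infinite geodesics of the Cayley graph (sequences of vertices,
  consecutive ones joined by edges) going from a^- (at -infinity) to a^+ (at +infinity).
  Convergence to a boundary point is convergence of the Gromov product to infinity.\<close>
definition geodesics_axis :: "('g, 'b) monoid_scheme \<Rightarrow> 'g set \<Rightarrow> 'g \<Rightarrow> (int \<Rightarrow> 'g) set" where
  "geodesics_axis G S a = {l. (\<forall>i. l i \<in> carrier G)
      \<and> (\<forall>i j. word_dist G S (l i) (l j) = real_of_int \<bar>i - j\<bar>)
      \<and> filterlim (\<lambda>(i, n). gromov G S \<one>\<^bsub>G\<^esub> (l (int i)) (a [^]\<^bsub>G\<^esub> (n::nat)))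
                  at_top (sequentially \<times>\<^sub>F sequentially)
      \<and> filterlim (\<lambda>(i, n). gromov G S \<one>\<^bsub>G\<^esub> (l (- int i)) (inv\<^bsub>G\<^esub> a [^]\<^bsub>G\<^esub> (n::nat)))
                  at_top (sequentially \<times>\<^sub>F sequentially)}"

definition orbit_image :: "('g \<Rightarrow> (complex^2^2) set) \<Rightarrow> complex \<times> real \<Rightarrow> (int \<Rightarrow> 'g) \<Rightarrow> (complex \<times> real) set" where
  "orbit_image \<rho> x l = (\<Union>i. hseg (pact (\<rho> (l i)) x) (pact (\<rho> (l (i + 1))) x))"

definition quasi_geodesic :: "real \<Rightarrow> real \<Rightarrow> (complex \<times> real) set \<Rightarrow> bool" where
  "quasi_geodesic K C Y \<longleftrightarrow> (\<exists>f :: real \<Rightarrow> complex \<times> real. range f = Y \<and>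
      (\<forall>s t. \<bar>s - t\<bar> / K - C \<le> hdist (f s) (f t) \<and> hdist (f s) (f t) \<le> K * \<bar>s - t\<bar> + C))"

definition stable_on :: "('g, 'b) monoid_scheme \<Rightarrow> 'g set \<Rightarrow> 'g set \<Rightarrow> ('g \<Rightarrow> (complex^2^2) set) \<Rightarrow> bool" where
  "stable_on G S \<C> \<rho> \<longleftrightarrow> (\<exists>K\<ge>1. \<exists>C\<ge>0. \<exists>x\<in>H3. \<forall>c\<in>\<C>. infinite_order G c \<longrightarrow>
      (\<forall>l\<in>geodesics_axis G S c. quasi_geodesic K C (orbit_image \<rho> x l)))"

definition well_displacing_on :: "('g, 'b) monoid_scheme \<Rightarrow> 'g set \<Rightarrow> 'g set \<Rightarrow> ('g \<Rightarrow> (complex^2^2) set) \<Rightarrow> bool" where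
  "well_displacing_on G S \<D> \<rho> \<longleftrightarrow> (\<exists>J\<ge>1. \<exists>B\<ge>0. \<forall>a\<in>\<D>.
      word_tlen G S a / J - B \<le> tlen (\<rho> a) \<and> tlen (\<rho> a) \<le> J * word_tlen G S a + B)"

end

theory Submission
  imports Defs "HOL-Real_Asymp.Real_Asymp" "HOL-Complex_Analysis.Great_Picard"
begin

text \<open>All three conditions are equivalent to the orbit map of \<open>\<rho>\<close> being a quasi-isometric embedding
  (the predicate \<open>qi\<close>). For convex cocompactness this is the Svarc--Milnor lemma and, conversely, the
  Morse lemma, by which the convex hull of an orbit stays near the orbit.

  For the other two conditions, let \<open>a\<close>, \<open>b\<close> generate a free group. By counting, finitely many words
  \<open>h\<close> in the squares of \<open>a\<close> and \<open>b\<close> suffice to make \<open>[W, h]\<close>, for every long \<open>W\<close> and some \<open>h\<close> among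
  them, a commutator of translation length about \<open>2 |W|\<close> whose axis passes near \<open>1\<close> and \<open>W\<close>. If \<open>\<rho>\<close> is
  well-displacing on commutators, then \<open>d(x, \<rho>(W)x)\<close> is therefore at least linear in \<open>|W|\<close>. If \<open>\<rho>\<close> is
  stable, then \<open>\<rho>\<close> maps each geodesic from \<open>1\<close> to \<open>W\<close> into a uniform quasi-line, although a priori at an
  uncontrolled speed: any three of its points are uniformly aligned up to order. Some orbit points form an
  unaligned tripod, so a long \<open>w\<close> that moves finitely many orbit points by at most 1 cannot exist, as it
  could be inserted between words to turn a tripod into a geodesic. Thus the orbit map is proper, and a
  proper map into a quasi-line has uniformly linear speed.\<close>

section \<open>Gromov hyperbolic spaces\<close>

text \<open>Stability says only that the orbit points and segments along an axis form, as a set, the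
  image of some quasi-geodesic. Its parametrization is not tied to the axis and may visit the orbit
  points in another order. This is why alignment up to order is all that is available at first, and
  why properness has to come before speed. Commutators enter through [W, h] = W (h
  \<open>inv W\<close> \<open>inv h\<close>): two consecutive pieces of length about |W|, which do
  not backtrack if h is chosen well, while the displacement under \<rho> is at most twice that of W
  plus a constant. The same h must control two junctions, one seen from W and one from its inverse;
  this is why words are separated for two pairs of elements at once. Counting achieves this without
  any dynamics on the boundary. Hyperbolicity is given for some generating set while S is arbitrary,
  so it must be transported between generating sets. The Morse lemma does this, and it serves
  hyperbolic space as well because both spaces are instances of one locale.\<close>

definition gprod :: "('a \<Rightarrow> 'a \<Rightarrow> real) \<Rightarrow> 'a \<Rightarrow> 'a \<Rightarrow> 'a \<Rightarrow> real" where
  "gprod d w x y = (d w x + d w y - d x y) / 2"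

text \<open>Points on geodesics are required only up to an error of 1, so that the axioms hold both
  for the vertices of a Cayley graph, whose distances are integers, and for hyperbolic
  space.\<close>

locale coarse_geodesic_space =
  fixes X :: "'a set" and d :: "'a \<Rightarrow> 'a \<Rightarrow> real"
  assumes d_nonneg: "\<lbrakk>x \<in> X; y \<in> X\<rbrakk> \<Longrightarrow> 0 \<le> d x y"
    and d_refl: "x \<in> X \<Longrightarrow> d x x = 0"
    and d_sym: "\<lbrakk>x \<in> X; y \<in> X\<rbrakk> \<Longrightarrow> d x y = d y x"
    and d_tri: "\<lbrakk>x \<in> X; y \<in> X; z \<in> X\<rbrakk> \<Longrightarrow> d x z \<le> d x y + d y z"
    and coarse_geodesic: "\<lbrakk>x \<in> X; y \<in> X; 0 \<le> t; t \<le> d x y\<rbrakk> \<Longrightarrow>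
          \<exists>z\<in>X. d x z + d z y = d x y \<and> \<bar>d x z - t\<bar> \<le> 1"
begin

abbreviation gp where "gp \<equiv> gprod d"

lemma gp_nonneg: "\<lbrakk>w \<in> X; x \<in> X; y \<in> X\<rbrakk> \<Longrightarrow> 0 \<le> gp w x y"
  using d_tri[of x w y] d_sym[of x w] by (simp add: gprod_def)

lemma gp_sym: "\<lbrakk>x \<in> X; y \<in> X\<rbrakk> \<Longrightarrow> gp w x y = gp w y x"
  using d_sym[of x y] by (simp add: gprod_def)

lemma gp_le_dist: "\<lbrakk>w \<in> X; x \<in> X; y \<in> X\<rbrakk> \<Longrightarrow> gp w x y \<le> d w x"
  using d_tri[of w x y] by (simp add: gprod_def)

lemma gp_base: "\<lbrakk>w \<in> X; x \<in> X\<rbrakk> \<Longrightarrow> gp w w x = 0"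
  using d_refl[of w] by (simp add: gprod_def)

lemma gp_rotate: "\<lbrakk>w \<in> X; x \<in> X; y \<in> X\<rbrakk> \<Longrightarrow> gp w x y + gp x w y = d w x"
  using d_sym[of x w] by (simp add: gprod_def field_simps)

lemma gp_change_base: "\<lbrakk>w \<in> X; v \<in> X; x \<in> X; y \<in> X\<rbrakk> \<Longrightarrow> gp w x y \<le> gp v x y + d w v"
  using d_tri[of w v x] d_tri[of w v y] by (simp add: gprod_def field_simps)

lemma gp_change_arg: "\<lbrakk>w \<in> X; x \<in> X; x' \<in> X; y \<in> X\<rbrakk> \<Longrightarrow> gp w x y \<le> gp w x' y + d x x'"
  using d_tri[of w x' x] d_tri[of x' x y] d_sym[of x x'] by (simp add: gprod_def field_simps)

lemma gp_change_args:
  "\<lbrakk>w \<in> X; x \<in> X; x' \<in> X; y \<in> X; y' \<in> X\<rbrakk> \<Longrightarrow> gp w x y \<le> gp w x' y' + d x x' + d y y'"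
  using gp_change_arg[of w x x' y] gp_change_arg[of w y y' x'] gp_sym[of x' y w] gp_sym[of x' y' w]
  by linarith

lemma gp_le_dist_between:
  "\<lbrakk>w \<in> X; x \<in> X; y \<in> X; q \<in> X; d x q + d q y = d x y\<rbrakk> \<Longrightarrow> gp w x y \<le> d w q"
  using d_tri[of w q x] d_tri[of w q y] d_sym[of x q] by (simp add: gprod_def field_simps)

end

text \<open>The four-point condition compares the three ways of pairing four points and so needs no
  base point; \<open>gp_min\<close> is its usual form with Gromov products.\<close>

locale gromov_hyperbolic = coarse_geodesic_space +
  fixes dl :: real
  assumes dl_nonneg: "0 \<le> dl"
    and four_point: "\<lbrakk>w \<in> X; x \<in> X; y \<in> X; z \<in> X\<rbrakk> \<Longrightarrow>
      d w y + d x z \<le> d w x + d y z + 2 * dl \<or> d w y + d x z \<le> d w z + d x y + 2 * dl"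
begin

lemma gp_min: "\<lbrakk>w \<in> X; x \<in> X; y \<in> X; z \<in> X\<rbrakk> \<Longrightarrow> gp w x y - dl \<le> gp w x z \<or> gp w y z - dl \<le> gp w x z"
  using four_point[of w x y z] d_sym[of x y] d_sym[of z x] d_sym[of z y]
  by (auto simp: gprod_def field_simps)

lemma gp_min4:
  assumes "w \<in> X" "x \<in> X" "y \<in> X" "z \<in> X" "u \<in> X"
  shows "gp w x y - 2 * dl \<le> gp w x u \<or> gp w y z - 2 * dl \<le> gp w x u \<or> gp w z u - 2 * dl \<le> gp w x u"
  using gp_min[of w x y u] gp_min[of w y z u] assms dl_nonneg by force

text \<open>By \<open>gp_rotate\<close>, the product of z and u seen from y is d(y, z) minus a
  quantity of at most c', hence larger than c + dl. Seen from y, the points z and u thus lie in the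
  same direction, and the bound for x and z passes to x and u.\<close>

lemma two_step:
  assumes "x \<in> X" "y \<in> X" "z \<in> X" "u \<in> X"
    and "gp y x z \<le> c" "gp z y u \<le> c'" "d y z > c + c' + dl"
  shows "gp y x u \<le> c + dl"
  using gp_min[of y x u z] gp_rotate[of y z u] gp_sym[of u z y] assms by force

text \<open>In a tree, the point of the geodesic from p to q at distance \<open>gp p u q\<close>
  from p is the foot of u, and \<open>gp u p q\<close> is the distance to it. Hyperbolicity costs
  \<open>2 * dl\<close>, and misplacing v costs at most s.\<close>

lemma proximity:
  assumes "u \<in> X" "p \<in> X" "q \<in> X" "v \<in> X" "d p v + d v q = d p q"
    and "\<bar>d p v - gp p u q\<bar> \<le> s"
  shows "d u v \<le> gp u p q + 2 * dl + s"
  using four_point[of u p v q] d_sym[of u p] d_sym[of u q] assms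
  by (auto simp: gprod_def field_simps abs_le_iff)

lemma proximity_ex:
  assumes "u \<in> X" "p \<in> X" "q \<in> X"
  shows "\<exists>v\<in>X. d p v + d v q = d p q \<and> d u v \<le> gp u p q + 2 * dl + 1"
proof -
  have "0 \<le> gp p u q" "gp p u q \<le> d p q"
    using gp_nonneg[of p u q] gp_le_dist[of p q u] gp_sym[of u q p] assms by auto
  from coarse_geodesic[OF assms(2,3) this] obtain v where
    "v \<in> X" "d p v + d v q = d p q" "\<bar>d p v - gp p u q\<bar> \<le> 1" by blast
  then show ?thesis using proximity[of u p q v 1] assms by blast
qed

lemma between_close:
  assumes "p \<in> X" "q \<in> X" "v \<in> X" "v' \<in> X"
    and "d p v + d v q = d p q" "d p v' + d v' q = d p q"
  shows "d v v' \<le> \<bar>d p v - d p v'\<bar> + 2 * dl"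
  using four_point[of v p v' q] d_sym[of v p] d_sym[of v q] assms by auto

subsection \<open>Chains with small Gromov products at the joints\<close>

context
  fixes p :: "int \<Rightarrow> 'a" and c L :: real
  assumes pX: "\<And>i. p i \<in> X"
    and joint: "\<And>i. gp (p i) (p (i - 1)) (p (i + 1)) \<le> c"
    and long_step: "\<And>i. L \<le> d (p i) (p (i + 1))"
    and L_large: "2 * c + 3 * dl < L"
begin

lemma chain_c_nonneg: "0 \<le> c"
  using gp_nonneg[of "p 0" "p (-1)" "p 1"] joint[of 0] pX by force

text \<open>If the product is small at one joint, then seen from the next joint the points p i and p
  (i + k) have product at least L - c - dl, so they lie in the same direction. The local bound c
  thus passes to p i at a cost of dl, and this loss does not accumulate along the induction.\<close>

lemma chain_forward: "gp (p (i + int k)) (p i) (p (i + int k + 1)) \<le> c + dl"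
proof (induction k)
  case 0
  then show ?case using gp_base[of "p i" "p (i+1)"] pX dl_nonneg chain_c_nonneg by simp
next
  case (Suc k)
  let ?j = "i + int k"
  have j: "i + int (Suc k) = ?j + 1" by simp
  have "gp (p (?j+1)) (p ?j) (p (?j+1+1)) \<le> c" using joint[of "?j+1"] by simp
  moreover have "gp (p (?j+1)) (p ?j) (p i) + gp (p ?j) (p (?j+1)) (p i) = d (p (?j+1)) (p ?j)"
    using gp_rotate pX by blast
  moreover have "gp (p ?j) (p (?j+1)) (p i) \<le> c + dl" using Suc gp_sym pX by metis
  moreover have "L \<le> d (p (?j+1)) (p ?j)" using long_step[of ?j] d_sym pX by metis
  moreover have "gp (p (?j+1)) (p ?j) (p i) - dl \<le> gp (p (?j+1)) (p ?j) (p (?j+1+1)) \<or>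
      gp (p (?j+1)) (p i) (p (?j+1+1)) - dl \<le> gp (p (?j+1)) (p ?j) (p (?j+1+1))"
    using gp_min pX by blast
  ultimately show ?case unfolding j using L_large dl_nonneg by force
qed

end

lemma chain_backward:
  fixes p :: "int \<Rightarrow> 'a"
  assumes pX: "\<And>i. p i \<in> X"
    and joint: "\<And>i. gp (p i) (p (i - 1)) (p (i + 1)) \<le> c"
    and long_step: "\<And>i. L \<le> d (p i) (p (i + 1))"
    and L_large: "2 * c + 3 * dl < L"
  shows "gp (p (i - int k)) (p i) (p (i - int k - 1)) \<le> c + dl"
proof -
  have "gp ((\<lambda>j. p (-j)) (-i + int k)) ((\<lambda>j. p (-j)) (-i)) ((\<lambda>j. p (-j)) (-i + int k + 1)) \<le> c + dl"
  proof (rule chain_forward[OF _ _ _ L_large])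
    show "p (- i) \<in> X" for i by (rule pX)
    show "gp (p (- i)) (p (- (i - 1))) (p (- (i + 1))) \<le> c" for i
    proof -
      have "- (i - 1) = - i + 1" "- (i + 1) = - i - 1" by auto
      then show ?thesis using joint[of "-i"] gp_sym[OF pX pX, of _ "- i + 1" "- i - 1"] by simp
    qed
    show "L \<le> d (p (- i)) (p (- (i + 1)))" for i
    proof -
      have "- (i + 1) = - i - 1" by simp
      then show ?thesis using long_step[of "-i-1"] d_sym[OF pX pX, of "- i" "- i - 1"] by simp
    qed
  qed
  then show ?thesis by (simp add: algebra_simps)
qed

lemma chain_between:
  fixes p :: "int \<Rightarrow> 'a"
  assumes pX: "\<And>i. p i \<in> X"
    and joint: "\<And>i. gp (p i) (p (i - 1)) (p (i + 1)) \<le> c"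
    and long_step: "\<And>i. L \<le> d (p i) (p (i + 1))"
    and L_large: "2 * c + 3 * dl < L"
    and ij: "i \<le> j" "j \<le> k"
  shows "gp (p j) (p i) (p k) \<le> c + 2 * dl"
proof -
  have c0: "0 \<le> c" using chain_c_nonneg[where p = p, OF assms(1-4)] .
  show ?thesis
  proof (cases "j = k")
    case True
    then show ?thesis using gp_base[of "p j" "p i"] gp_sym[OF pX pX] pX c0 dl_nonneg by (metis add_nonneg_nonneg mult_2)
  next
    case False
    define n where "n = nat (k - j - 1)"
    have k: "k = j + 1 + int n" using False ij n_def by simp
    have a: "gp (p j) (p i) (p (j + 1)) \<le> c + dl"
      using chain_forward[where p = p, OF assms(1-4), of i "nat (j - i)"] ij by simp
    have b: "gp (p (j + 1)) (p k) (p j) \<le> c + dl"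
      using chain_backward[where p = p, OF assms(1-4), of k n] k by simp
    have "gp (p j) (p (j+1)) (p k) + gp (p (j+1)) (p j) (p k) = d (p j) (p (j+1))"
      using gp_rotate pX by blast
    then have "L - (c + dl) \<le> gp (p j) (p k) (p (j+1))" using long_step[of j] b gp_sym[OF pX pX]
      by (smt (verit))
    then show ?thesis using gp_min[OF pX[of j] pX[of i] pX[of k] pX[of "j+1"]] a L_large by linarith
  qed
qed

text \<open>By \<open>chain_forward\<close> the chain backtracks by at most c + dl at each joint as
  seen from p i, so every step gains its length minus \<open>2 * c + 2 * dl\<close>.\<close>

lemma chain_growth:
  fixes p :: "int \<Rightarrow> 'a"
  assumes pX: "\<And>i. p i \<in> X"
    and joint: "\<And>i. gp (p i) (p (i - 1)) (p (i + 1)) \<le> c"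
    and long_step: "\<And>i. L \<le> d (p i) (p (i + 1))"
    and L_large: "2 * c + 3 * dl < L"
  shows "real k * (L - 2 * c - 2 * dl) \<le> d (p i) (p (i + int k))"
proof (induction k)
  case 0
  then show ?case using d_refl[OF pX] by simp
next
  case (Suc k)
  have "gp (p (i + int k)) (p i) (p (i + int k + 1)) \<le> c + dl"
    by (rule chain_forward[where p = p, OF assms])
  moreover have "d (p (i + int k)) (p i) = d (p i) (p (i + int k))" using d_sym pX by blast
  ultimately show ?case using Suc long_step[of "i + int k"] by (simp add: gprod_def algebra_simps)
qed

subsection \<open>The Morse lemma\<close>

text \<open>Each bisection of the path costs one dl, so the loss is logarithmic in the number of
  steps. Read the other way round: a path around a large ball whose endpoints lie on opposite sides
  of it must be exponentially long.\<close>

lemma log_bound: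
  assumes "w \<in> X" "\<And>i. f i \<in> X" "j - i \<le> 2 ^ k" "i \<le> j"
    and "\<And>a. i \<le> a \<Longrightarrow> a \<le> j \<Longrightarrow> r \<le> d w (f a)"
    and "\<And>a. i \<le> a \<Longrightarrow> a < j \<Longrightarrow> d (f a) (f (Suc a)) \<le> \<Lambda>" "0 \<le> \<Lambda>"
  shows "r - \<Lambda> \<le> gp w (f i) (f j) + real k * dl"
  using assms(3-6)
proof (induction k arbitrary: i j)
  case 0
  have "gp w (f i) (f j) \<ge> r - \<Lambda>"
  proof (cases "i = j")
    case True
    then show ?thesis using 0 assms(1,2,7) d_refl[of "f i"] by (simp add: gprod_def)
  next
    case False
    then have j: "j = Suc i" using 0 by simp
    have "r \<le> d w (f i)" "r \<le> d w (f j)" "d (f i) (f j) \<le> \<Lambda>" using 0 j by auto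
    then show ?thesis using assms(7) by (simp add: gprod_def)
  qed
  then show ?case by simp
next
  case (Suc k)
  define m where "m = (if i + 2 ^ k \<le> j then i + 2 ^ k else j)"
  have m: "i \<le> m" "m \<le> j" "m - i \<le> 2 ^ k" "j - m \<le> 2 ^ k"
    using Suc.prems(1,2) by (auto simp: m_def)
  have "r - \<Lambda> \<le> gp w (f i) (f m) + real k * dl"
    by (rule Suc.IH) (use m Suc.prems in auto)
  moreover have "r - \<Lambda> \<le> gp w (f m) (f j) + real k * dl"
    by (rule Suc.IH) (use m Suc.prems in auto)
  ultimately show ?case using gp_min[OF assms(1,2,2,2), of i m j] by (auto simp: algebra_simps)
qed

end

text \<open>The two conditions on k say that D is at most a constant plus a multiple of log D, which
  bounds D.\<close>

lemma log_le_bound: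
  fixes A B dl :: real
  shows "\<exists>M. \<forall>D\<ge>0. \<forall>k::nat. D \<le> A + dl * real k \<and> 2 ^ k \<le> max 1 (B * (D + 1)) \<longrightarrow> D \<le> M"
proof -
  have "eventually (\<lambda>D::real. A + \<bar>dl\<bar> * log 2 ((\<bar>B\<bar> + 1) * (D + 1)) < D) at_top"
    by real_asymp
  then obtain M where M: "\<And>D. D \<ge> M \<Longrightarrow> A + \<bar>dl\<bar> * log 2 ((\<bar>B\<bar> + 1) * (D + 1)) < D"
    by (auto simp: eventually_at_top_linorder)
  have "D \<le> M" if D: "D \<ge> 0" "D \<le> A + dl * real k" "2 ^ k \<le> max 1 (B * (D + 1))" for D :: real and k :: nat
  proof (rule ccontr)
    assume "\<not> D \<le> M"
    have "max 1 (B * (D + 1)) \<le> (\<bar>B\<bar> + 1) * (D + 1)"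
    proof -
      have "B * (D+1) \<le> \<bar>B\<bar> * (D+1)" using D by (simp add: mult_right_mono)
      then show ?thesis using D by (simp add: algebra_simps)
    qed
    then have p: "2 ^ k \<le> (\<bar>B\<bar> + 1) * (D + 1)" using D by linarith
    then have "real k \<le> log 2 ((\<bar>B\<bar> + 1) * (D + 1))"
      by (metis le_log_of_power numeral_le_iff one_less_numeral_iff semiring_norm(76))
    then have "dl * real k \<le> \<bar>dl\<bar> * log 2 ((\<bar>B\<bar> + 1) * (D + 1))"
      by (meson abs_ge_self abs_ge_zero mult_mono of_nat_0_le_iff)
    then show False using M[of D] \<open>\<not> D \<le> M\<close> D by force
  qed
  then show ?thesis by blast
qed

context gromov_hyperbolic
begin

definition quasi_path :: "real \<Rightarrow> real \<Rightarrow> (nat \<Rightarrow> 'a) \<Rightarrow> nat \<Rightarrow> bool" where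
  "quasi_path K C f n \<longleftrightarrow> (\<forall>i. f i \<in> X) \<and> (\<forall>i\<le>n. \<forall>j\<le>n.
      \<bar>real i - real j\<bar> / K - C \<le> d (f i) (f j) \<and> d (f i) (f j) \<le> K * \<bar>real i - real j\<bar> + C)"

lemma quasi_path_index:
  assumes "quasi_path K C f n" "i \<le> n" "j \<le> n" "1 \<le> K" "d (f i) (f j) \<le> r"
  shows "\<bar>real i - real j\<bar> \<le> K * (r + C)"
proof -
  have "\<bar>real i - real j\<bar> / K - C \<le> r" using assms unfolding quasi_path_def by force
  then have "\<bar>real i - real j\<bar> / K \<le> r + C" by simp
  then show ?thesis using assms(4) by (simp add: pos_divide_le_eq mult.commute)
qed

text \<open>Here v is an almost farthest point of the geodesic from the path. Points y and z of the
  geodesic on either side of v are joined, through nearby path points, by a detour of O(D) steps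
  that keeps distance D - 1 from v. By \<open>log_bound\<close> the product of y and z seen from v
  is at least D minus O(log D), but it is 0 because v lies between them.\<close>

lemma geodesic_near_quasi_path_aux:
  assumes f: "quasi_path K C f n" and K: "1 \<le> K" and C: "0 \<le> C"
    and D: "\<And>u. \<lbrakk>u \<in> X; d (f 0) u + d u (f n) = d (f 0) (f n)\<rbrakk> \<Longrightarrow> \<exists>i\<le>n. d u (f i) \<le> D"
    and D0: "0 \<le> D"
    and v: "v \<in> X" "d (f 0) v + d v (f n) = d (f 0) (f n)" "\<And>i. i \<le> n \<Longrightarrow> D - 1 \<le> d v (f i)"
  shows "\<exists>k. D \<le> (1 + K + C + 2 * dl) + dl * real k \<and> 2 ^ k \<le> max 1 (2 * K * (8 + C) * (D + 1))"
proof -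
  have fX: "\<And>i. f i \<in> X" using f by (auto simp: quasi_path_def)
  \<comment> \<open>The distance \<open>2 * D + 3\<close>, met up to an error of 1, is large enough
    that the jump of length at most D from y to the path stays far from v. If the end e is nearer
    than this, then e serves as y, being itself a point of the path.\<close>
  have pt: "\<exists>y\<in>X. \<exists>i\<le>n. d y v \<le> 2 * D + 4 \<and> d y (f i) \<le> D \<and> d e y + d y v = d e v \<and> D - 1 \<le> gp v y (f i)"
    if e: "e \<in> X" "e' \<in> X" "d e v + d v e' = d e e'" "k \<le> n" "e = f k"
      "\<And>u. \<lbrakk>u \<in> X; d e u + d u e' = d e e'\<rbrakk> \<Longrightarrow> \<exists>i\<le>n. d u (f i) \<le> D" for e e' k
  proof (cases "d e v \<le> 2 * D + 3")
    case True
    have "gp v e e = d v e" using d_refl e by (simp add: gprod_def)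
    then have "D - 1 \<le> gp v e (f k)" using v(3)[of k] e by simp
    moreover have "d e (f k) \<le> D" using e d_refl D0 by simp
    moreover have "d e e + d e v = d e v" using d_refl e by simp
    ultimately show ?thesis using True e by force
  next
    case False
    then have "0 \<le> d e v - (2 * D + 3)" "d e v - (2 * D + 3) \<le> d e v" using D0 by auto
    from coarse_geodesic[OF e(1) v(1) this] obtain y where
      y: "y \<in> X" "d e y + d y v = d e v" "\<bar>d e y - (d e v - (2 * D + 3))\<bar> \<le> 1" by blast
    have "d e y + d y e' = d e e'"
      using d_tri[of y v e'] d_tri[of e y e'] y v(1) e by linarith
    then obtain i where i: "i \<le> n" "d y (f i) \<le> D" using e(6) y(1) by blast
    have "2 * D + 2 \<le> d y v" "d y v \<le> 2 * D + 4" using y by auto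
    moreover have "d v y - d y (f i) \<le> gp v y (f i)"
      using d_tri[of v "f i" y] d_sym[of "f i" y] y(1) v(1) fX by (simp add: gprod_def)
    moreover have "d v y = d y v" using d_sym y v by blast
    ultimately show ?thesis using i y by (intro bexI[of _ y] exI[of _ i]) auto
  qed
  obtain y i where y: "y \<in> X" "i \<le> n" "d y v \<le> 2 * D + 4" "d y (f i) \<le> D" "d (f 0) y + d y v = d (f 0) v"
    "D - 1 \<le> gp v y (f i)"
    using pt[of "f 0" "f n" 0] v fX D by blast
  have "d (f n) v + d v (f 0) = d (f n) (f 0)" using v d_sym fX by (metis add.commute)
  moreover have "\<exists>i\<le>n. d u (f i) \<le> D" if "u \<in> X" "d (f n) u + d u (f 0) = d (f n) (f 0)" for u
    using D[of u] that d_sym fX by (metis add.commute)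
  ultimately obtain z j where z: "z \<in> X" "j \<le> n" "d z v \<le> 2 * D + 4" "d z (f j) \<le> D" "d (f n) z + d z v = d (f n) v"
    "D - 1 \<le> gp v z (f j)"
    using pt[of "f n" "f 0" n] fX by blast
  have gyz: "gp v y z \<le> 0"
    using d_tri[of "f 0" y "f n"] d_tri[of y z "f n"] d_sym[of "f n" z] d_sym[of "f n" v] d_sym[of y v] d_sym[of z v]
      v y z fX by (simp add: gprod_def)
  have dij: "d (f i) (f j) \<le> 6 * D + 8"
    using d_tri[OF fX y(1) fX, of i j] d_tri[OF y(1) v(1) fX, of j] d_tri[OF v(1) z(1) fX, of j]
      d_sym[OF fX y(1), of i] d_sym[OF z(1) v(1)] y(3,4) z(3,4) by linarith
  define N where "N = max i j - min i j"
  have N: "real N = \<bar>real i - real j\<bar>" unfolding N_def by (auto simp: max_def min_def)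
  have N_le: "real N \<le> K * (6 * D + 8 + C)" using quasi_path_index[OF f y(2) z(2) K dij] N by simp
  have "\<exists>k. N \<le> 2 ^ k \<and> (2::real) ^ k \<le> max 1 (2 * real N)"
  proof (cases "N = 0")
    case False
    then obtain k where k: "2 ^ k \<le> N" "N < 2 ^ (k + 1)" using ex_power_ivl1[of 2 N] by auto
    then have "real (2 ^ k) \<le> real N" using of_nat_le_iff by blast
    then show ?thesis using k by (intro exI[of _ "k+1"]) (auto simp: less_imp_le)
  qed (auto intro: exI[of _ 0])
  then obtain k where k: "N \<le> 2 ^ k" "(2::real) ^ k \<le> max 1 (2 * real N)" by blast
  have "D - 1 - (K + C) \<le> gp v (f (min i j)) (f (max i j)) + real k * dl"
  proof (rule log_bound)
    show "max i j - min i j \<le> 2 ^ k" using k N_def by simp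
    show "D - 1 \<le> d v (f a)" if "min i j \<le> a" "a \<le> max i j" for a
      using v(3)[of a] that y z by auto
    show "d (f a) (f (Suc a)) \<le> K + C" if "min i j \<le> a" "a < max i j" for a
    proof -
      have a: "a \<le> n" "Suc a \<le> n" using that y z by auto
      have "d (f a) (f (Suc a)) \<le> K * \<bar>real a - real (Suc a)\<bar> + C"
        using f a unfolding quasi_path_def by blast
      then show ?thesis by simp
    qed
  qed (use v K C fX in auto)
  then have lb: "D - 1 - (K + C) \<le> gp v (f i) (f j) + real k * dl"
    using gp_sym[OF fX fX] by (auto simp: max_def min_def split: if_splits)
  have "gp v y (f i) - 2 * dl \<le> gp v y z \<or> gp v (f i) (f j) - 2 * dl \<le> gp v y z \<or> gp v (f j) z - 2 * dl \<le> gp v y z"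
    using gp_min4 v y z fX by blast
  then have "D \<le> (1 + K + C + 2 * dl) + dl * real k"
    using gyz lb y(6) z(6) gp_sym[OF z(1) fX, of v j] K C dl_nonneg
    by (smt (verit) mult.commute mult_nonneg_nonneg of_nat_0_le_iff)
  moreover have "2 * real N \<le> 2 * K * (8 + C) * (D + 1)"
  proof -
    have "6 * D + 8 + C \<le> (8 + C) * (D + 1)" using D0 C by (simp add: algebra_simps)
    then have "K * (6 * D + 8 + C) \<le> K * ((8 + C) * (D + 1))" using K by (intro mult_left_mono) auto
    then show ?thesis using N_le by (simp add: algebra_simps)
  qed
  ultimately show ?thesis using k by (intro exI[of _ k]) auto
qed

lemma geodesic_near_quasi_path:
  assumes K: "1 \<le> K" and C: "0 \<le> C"
  shows "\<exists>M\<ge>0. \<forall>f n v. quasi_path K C f n \<and> v \<in> X \<and> d (f 0) v + d v (f n) = d (f 0) (f n)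
     \<longrightarrow> (\<exists>i\<le>n. d v (f i) \<le> M)"
proof -
  obtain M where M: "\<And>D k. \<lbrakk>0 \<le> D; D \<le> (1 + K + C + 2 * dl) + dl * real k; 2 ^ k \<le> max 1 (2 * K * (8 + C) * (D + 1))\<rbrakk> \<Longrightarrow> D \<le> M"
    using log_le_bound[of "1 + K + C + 2 * dl" dl "2 * K * (8 + C)"] by blast
  have "\<exists>i\<le>n. d v (f i) \<le> max M 0"
    if f: "quasi_path K C f n" and v: "v \<in> X" "d (f 0) v + d v (f n) = d (f 0) (f n)" for f n v
  proof -
    have fX: "\<And>i. f i \<in> X" using f by (auto simp: quasi_path_def)
    define \<Gamma> where "\<Gamma> = {u \<in> X. d (f 0) u + d u (f n) = d (f 0) (f n)}"
    define g where "g u = Min ((\<lambda>i. d u (f i)) ` {..n})" for u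
    have g_le: "g u \<le> d u (f i)" if "i \<le> n" for u i unfolding g_def using that by (intro Min_le) auto
    have g_ex: "\<exists>i\<le>n. d u (f i) = g u" for u
    proof -
      have "g u \<in> (\<lambda>i. d u (f i)) ` {..n}" unfolding g_def by (intro Min_in) auto
      then show ?thesis by auto
    qed
    have f0: "f 0 \<in> \<Gamma>" using fX d_refl by (auto simp: \<Gamma>_def)
    have bd: "g u \<le> d (f 0) (f n)" if "u \<in> \<Gamma>" for u
    proof -
      have "g u \<le> d u (f n)" using g_le[of n u] by simp
      then show ?thesis using that d_nonneg[of "f 0" u] fX unfolding \<Gamma>_def by force
    qed
    \<comment> \<open>The supremum need not be attained, so the farthest point is replaced by one
      that misses it by less than 1; this is the origin of the D - 1 in the auxiliary lemma.\<close>
    define D where "D = Sup (g ` \<Gamma>)"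
    have bdd: "bdd_above (g ` \<Gamma>)" using bd by (auto simp: bdd_above_def)
    have gD: "g u \<le> D" if "u \<in> \<Gamma>" for u unfolding D_def using bdd that by (intro cSup_upper) auto
    have "0 \<le> g (f 0)" using g_ex[of "f 0"] d_nonneg fX by metis
    then have D0: "0 \<le> D" using gD[OF f0] by simp
    obtain v' where v': "v' \<in> \<Gamma>" "D - 1 < g v'"
      using less_cSup_iff[of "g ` \<Gamma>" "D - 1"] bdd f0 unfolding D_def by auto
    have "\<exists>k. D \<le> (1 + K + C + 2 * dl) + dl * real k \<and> 2 ^ k \<le> max 1 (2 * K * (8 + C) * (D + 1))"
    proof (rule geodesic_near_quasi_path_aux[OF f K C])
      show "\<exists>i\<le>n. d u (f i) \<le> D" if "u \<in> X" "d (f 0) u + d u (f n) = d (f 0) (f n)" for u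
        using gD[of u] g_ex[of u] that unfolding \<Gamma>_def by force
      show "v' \<in> X" "d (f 0) v' + d v' (f n) = d (f 0) (f n)" using v' by (auto simp: \<Gamma>_def)
      show "D - 1 \<le> d v' (f i)" if "i \<le> n" for i using g_le[OF that, of v'] v' by simp
    qed (rule D0)
    then have "D \<le> M" using M D0 by blast
    then show ?thesis using gD[of v] g_ex[of v] v unfolding \<Gamma>_def by force
  qed
  then show ?thesis by (intro exI[of _ "max M 0"]) auto
qed

lemma morse_near:
  assumes "1 \<le> K" "0 \<le> C"
  shows "\<exists>M\<ge>0. \<forall>f n u m. quasi_path K C f n \<and> u \<in> X \<and> gp u (f 0) (f n) \<le> m
     \<longrightarrow> (\<exists>i\<le>n. d u (f i) \<le> M + m)"
proof -
  obtain M where M: "0 \<le> M" "\<And>f n v. \<lbrakk>quasi_path K C f n; v \<in> X; d (f 0) v + d v (f n) = d (f 0) (f n)\<rbrakk>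
    \<Longrightarrow> \<exists>i\<le>n. d v (f i) \<le> M"
    using geodesic_near_quasi_path[OF assms] by blast
  have "\<exists>i\<le>n. d u (f i) \<le> (M + 2 * dl + 1) + m"
    if f: "quasi_path K C f n" and u: "u \<in> X" "gp u (f 0) (f n) \<le> m" for f n u m
  proof -
    have fX: "\<And>i. f i \<in> X" using f by (auto simp: quasi_path_def)
    obtain v where v: "v \<in> X" "d (f 0) v + d v (f n) = d (f 0) (f n)" "d u v \<le> gp u (f 0) (f n) + 2 * dl + 1"
      using proximity_ex[OF u(1) fX fX] by blast
    then obtain i where "i \<le> n" "d v (f i) \<le> M" using M f by blast
    then show ?thesis using d_tri[of u v "f i"] u v fX by force
  qed
  then show ?thesis using M(1) dl_nonneg by (intro exI[of _ "M + 2 * dl + 1"]) auto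
qed

text \<open>A connectedness argument along the geodesic. Near the last position that is close to
  path points of index at most j, there is also a position close to path points of index at least j.
  Two such path points i and k are a bounded distance apart, hence their indices are, and j lies
  between them.\<close>

lemma morse_between:
  assumes K: "1 \<le> K" and C: "0 \<le> C"
  shows "\<exists>M\<ge>0. \<forall>f n j. quasi_path K C f n \<and> j \<le> n \<longrightarrow> gp (f j) (f 0) (f n) \<le> M"
proof -
  obtain M where M: "0 \<le> M" "\<And>f n v. \<lbrakk>quasi_path K C f n; v \<in> X; d (f 0) v + d v (f n) = d (f 0) (f n)\<rbrakk>
    \<Longrightarrow> \<exists>i\<le>n. d v (f i) \<le> M"
    using geodesic_near_quasi_path[OF assms] by blast
  define r where "r = 2 * M + 4 + 2 * dl"
  \<comment> \<open>Here r bounds the distance between the path points i and k on both sides of j,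
    \<open>K * (r + C)\<close> the difference of their indices, and the final M the step from the
    path to the geodesic.\<close>
  define M' where "M' = K * (K * (r + C)) + C + M"
  have "gp (f j) (f 0) (f n) \<le> M'"
    if f: "quasi_path K C f n" and j: "j \<le> n" for f n j
  proof -
    have fX: "\<And>i. f i \<in> X" using f by (auto simp: quasi_path_def)
    define \<Gamma> where "\<Gamma> = {u \<in> X. d (f 0) u + d u (f n) = d (f 0) (f n)}"
    define T where "T = {t. \<exists>v\<in>\<Gamma>. \<exists>i\<le>j. d v (f i) \<le> M \<and> t = d (f 0) v}"
    have G: "f 0 \<in> \<Gamma>" "f n \<in> \<Gamma>" using fX d_refl by (auto simp: \<Gamma>_def)
    have T0: "0 \<in> T" unfolding T_def using G(1) d_refl[OF fX, of 0] M(1) by force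
    have bdd: "bdd_above T" unfolding T_def \<Gamma>_def bdd_above_def
      using d_nonneg[OF _ fX, of _ n] by (intro exI[of _ "d (f 0) (f n)"]) force
    define t where "t = Sup T"
    have t0: "0 \<le> t" unfolding t_def using T0 bdd by (intro cSup_upper)
    obtain v i where v: "v \<in> \<Gamma>" "i \<le> j" "d v (f i) \<le> M" "t - 1 < d (f 0) v"
      using less_cSup_iff[of T "t - 1"] T0 bdd unfolding t_def T_def by auto
    have vt: "d (f 0) v \<le> t" unfolding t_def using v bdd by (intro cSup_upper) (auto simp: T_def)
    have "\<exists>v'\<in>\<Gamma>. \<exists>k\<ge>j. k \<le> n \<and> d v' (f k) \<le> M \<and> \<bar>d (f 0) v - d (f 0) v'\<bar> \<le> 4"
    proof (cases "t + 2 \<le> d (f 0) (f n)")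
      case True
      obtain v' where v': "v' \<in> X" "d (f 0) v' + d v' (f n) = d (f 0) (f n)" "\<bar>d (f 0) v' - (t + 2)\<bar> \<le> 1"
        using coarse_geodesic[OF fX fX, of "t + 2" 0 n] True t0 by auto
      then obtain k where k: "k \<le> n" "d v' (f k) \<le> M" using M f by blast
      have "\<not> k \<le> j"
      proof
        assume "k \<le> j"
        then have "d (f 0) v' \<in> T" using v' k unfolding T_def \<Gamma>_def by blast
        then have "d (f 0) v' \<le> t" unfolding t_def using bdd by (intro cSup_upper)
        then show False using v' by linarith
      qed
      then show ?thesis using v' k v vt unfolding \<Gamma>_def by (intro bexI[of _ v'] exI[of _ k]) auto
    next
      case False
      then have "\<bar>d (f 0) v - d (f 0) (f n)\<bar> \<le> 4"
        using v vt d_nonneg[of v "f n"] fX unfolding \<Gamma>_def by force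
      then show ?thesis using G(2) j d_refl[OF fX, of n] M(1) by (intro bexI[of _ "f n"] exI[of _ n]) auto
    qed
    then obtain v' k where v': "v' \<in> \<Gamma>" "j \<le> k" "k \<le> n" "d v' (f k) \<le> M" "\<bar>d (f 0) v - d (f 0) v'\<bar> \<le> 4"
      by blast
    have X: "v \<in> X" "v' \<in> X" using v v' by (auto simp: \<Gamma>_def)
    have "d v v' \<le> 4 + 2 * dl"
      using between_close[OF fX fX X, of 0 n] v v' unfolding \<Gamma>_def by auto
    then have "d (f i) (f k) \<le> r"
      using d_tri[of "f i" v "f k"] d_tri[of v v' "f k"] d_sym[of "f i" v] X fX v v' unfolding r_def by force
    then have "\<bar>real i - real k\<bar> \<le> K * (r + C)"
      using quasi_path_index[OF f _ v'(3) K, of i r] v v' by simp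
    then have ij: "\<bar>real j - real i\<bar> \<le> K * (r + C)" using v v' by simp
    have "d (f j) (f i) \<le> K * \<bar>real j - real i\<bar> + C"
      using f j order_trans[OF v(2) j] unfolding quasi_path_def by blast
    also have "\<dots> \<le> K * (K * (r + C)) + C" using ij K by (intro add_mono mult_left_mono) auto
    finally have "d (f j) v \<le> M'" using d_tri[of "f j" "f i" v] d_sym[of v "f i"] X fX v unfolding M'_def by force
    moreover have "gp (f j) (f 0) (f n) \<le> d (f j) v"
      using gp_le_dist_between fX X v unfolding \<Gamma>_def by blast
    ultimately show ?thesis by linarith
  qed
  moreover have "0 \<le> M'" unfolding M'_def r_def using K C M(1) dl_nonneg by auto
  ultimately show ?thesis by blast
qed

end

section \<open>Hyperbolic groups\<close>

locale cayley = group G for G (structure) +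
  fixes S :: "'a set"
  assumes gen: "finite_gen_set G S"
begin

definition letters where "letters = S \<union> m_inv G ` S"
abbreviation wprod where "wprod w \<equiv> foldr (\<otimes>) w \<one>"
abbreviation wl where "wl \<equiv> word_len G S"
abbreviation e where "e \<equiv> word_dist G S"

lemma S_carrier: "S \<subseteq> carrier G" using gen by (simp add: finite_gen_set_def)

lemma letters_carrier: "letters \<subseteq> carrier G" using S_carrier by (auto simp: letters_def)

lemma finite_letters: "finite letters" using gen by (simp add: finite_gen_set_def letters_def)

lemma letters_inv: "t \<in> letters \<Longrightarrow> inv t \<in> letters" using S_carrier by (auto simp: letters_def)

lemma wprod_closed: "set w \<subseteq> letters \<Longrightarrow> wprod w \<in> carrier G"
  using letters_carrier by (induction w) auto

lemma wprod_append: "\<lbrakk>set u \<subseteq> letters; set v \<subseteq> letters\<rbrakk> \<Longrightarrow> wprod (u @ v) = wprod u \<otimes> wprod v"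
  using letters_carrier wprod_closed by (induction u) (auto simp: m_assoc subset_iff)

lemma cancel_left [simp]: "\<lbrakk>x \<in> carrier G; y \<in> carrier G\<rbrakk> \<Longrightarrow> inv x \<otimes> (x \<otimes> y) = y"
  "\<lbrakk>x \<in> carrier G; y \<in> carrier G\<rbrakk> \<Longrightarrow> x \<otimes> (inv x \<otimes> y) = y"
  by (simp_all add: m_assoc[symmetric])

lemma wprod_ex:
  assumes "g \<in> carrier G"
  shows "\<exists>w. set w \<subseteq> letters \<and> wprod w = g"
proof -
  have "g \<in> generate G S" using gen assms by (simp add: finite_gen_set_def)
  then show ?thesis
  proof (induction rule: generate.induct)
    case one
    then show ?case by (intro exI[of _ "[]"]) auto
  next
    case (incl h)
    then show ?case using S_carrier by (intro exI[of _ "[h]"]) (auto simp: letters_def)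
  next
    case (inv h)
    then show ?case using S_carrier by (intro exI[of _ "[inv h]"]) (auto simp: letters_def)
  next
    case (eng h1 h2)
    then obtain u v where "set u \<subseteq> letters" "wprod u = h1" "set v \<subseteq> letters" "wprod v = h2" by blast
    then show ?case using wprod_append by (intro exI[of _ "u @ v"]) auto
  qed
qed

lemma wl_ex:
  assumes "g \<in> carrier G"
  shows "\<exists>w. length w = wl g \<and> set w \<subseteq> letters \<and> wprod w = g"
proof -
  obtain w where "set w \<subseteq> letters" "wprod w = g" using wprod_ex[OF assms] by blast
  then have "\<exists>n. \<exists>w. length w = n \<and> set w \<subseteq> letters \<and> wprod w = g" by blast
  then show ?thesis unfolding word_len_def letters_def by (rule LeastI_ex)
qed

lemma wl_le: "\<lbrakk>set w \<subseteq> letters; wprod w = g\<rbrakk> \<Longrightarrow> wl g \<le> length w"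
  unfolding word_len_def letters_def by (intro Least_le) auto

lemma wl_one: "wl \<one> = 0" using wl_le[of "[]" \<one>] by simp

lemma wl_mult: "\<lbrakk>g \<in> carrier G; h \<in> carrier G\<rbrakk> \<Longrightarrow> wl (g \<otimes> h) \<le> wl g + wl h"
proof -
  assume "g \<in> carrier G" "h \<in> carrier G"
  then obtain u v where "length u = wl g" "set u \<subseteq> letters" "wprod u = g" "length v = wl h" "set v \<subseteq> letters" "wprod v = h"
    using wl_ex by metis
  then show ?thesis using wl_le[of "u @ v" "g \<otimes> h"] wprod_append[of u v] by simp
qed

lemma wprod_inv_ex:
  assumes "set w \<subseteq> letters"
  shows "\<exists>w'. length w' = length w \<and> set w' \<subseteq> letters \<and> wprod w' = inv (wprod w)"
  using assms
proof (induction w)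
  case Nil
  show ?case by (intro exI[of _ "[]"]) simp
next
  case (Cons t w)
  have t: "t \<in> letters" and w: "set w \<subseteq> letters" using Cons.prems by simp_all
  obtain w' where w': "length w' = length w" "set w' \<subseteq> letters" "wprod w' = inv (wprod w)"
    using Cons.IH[OF w] by blast
  have it: "set [inv t] \<subseteq> letters" using letters_inv[OF t] by simp
  have tc: "t \<in> carrier G" using t letters_carrier by blast
  have "wprod (w' @ [inv t]) = inv (wprod w) \<otimes> wprod [inv t]"
    using wprod_append[OF w'(2) it] w'(3) by metis
  also have "wprod [inv t] = inv t" using tc by simp
  also have "inv (wprod w) \<otimes> inv t = inv (wprod (t # w))"
    using inv_mult_group[OF tc wprod_closed[OF w]] by simp
  finally have "wprod (w' @ [inv t]) = inv (wprod (t # w))" .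
  moreover have "set (w' @ [inv t]) \<subseteq> letters" using w'(2) it unfolding set_append by (rule Un_least)
  moreover have "length (w' @ [inv t]) = length (t # w)" using w'(1) by simp
  ultimately show ?case by (intro exI conjI)
qed

lemma wl_inv_le:
  assumes "g \<in> carrier G"
  shows "wl (inv g) \<le> wl g"
proof -
  obtain w where w: "length w = wl g" "set w \<subseteq> letters" "wprod w = g" using wl_ex[OF assms] by blast
  then obtain w' where "length w' = length w" "set w' \<subseteq> letters" "wprod w' = inv g"
    using wprod_inv_ex by blast
  then show ?thesis using wl_le[of w' "inv g"] w(1) by metis
qed

lemma wl_inv: "g \<in> carrier G \<Longrightarrow> wl (inv g) = wl g"
  using wl_inv_le[of g] wl_inv_le[of "inv g"] by simp

text \<open>Used for the word length of another generating set and for the displacement of a point: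
  a subadditive function grows at most as fast as its maximum on the letters.\<close>

lemma wl_bound:
  fixes \<phi> :: "'a \<Rightarrow> real"
  assumes "\<phi> \<one> \<le> 0" "\<And>g h. \<lbrakk>g \<in> carrier G; h \<in> carrier G\<rbrakk> \<Longrightarrow> \<phi> (g \<otimes> h) \<le> \<phi> g + \<phi> h"
  shows "\<exists>L\<ge>1. \<forall>g\<in>carrier G. \<phi> g \<le> L * real (wl g)"
proof -
  define L where "L = Max (insert 1 (\<phi> ` letters))"
  have fin: "finite (insert 1 (\<phi> ` letters))" using finite_letters by blast
  have L: "\<phi> t \<le> L" if "t \<in> letters" for t unfolding L_def using fin that by (intro Max_ge) auto
  have L1: "1 \<le> L" unfolding L_def using fin by (intro Max_ge) auto
  have "\<phi> (wprod w) \<le> L * real (length w)" if "set w \<subseteq> letters" for w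
    using that
  proof (induction w)
    case (Cons t w)
    then have t: "t \<in> letters" and "set w \<subseteq> letters" by auto
    then have "\<phi> (t \<otimes> wprod w) \<le> \<phi> t + \<phi> (wprod w)"
      using letters_carrier wprod_closed assms(2) by blast
    then show ?case using L[OF t] Cons.IH[OF \<open>set w \<subseteq> letters\<close>] by (simp add: algebra_simps)
  qed (simp add: assms)
  note wb = this
  have "\<phi> g \<le> L * real (wl g)" if "g \<in> carrier G" for g
  proof -
    obtain w where w: "length w = wl g" "set w \<subseteq> letters" "wprod w = g" using wl_ex[OF \<open>g \<in> carrier G\<close>] by blast
    show ?thesis using wb[OF w(2)] unfolding w(1) w(3) .
  qed
  then show ?thesis using L1 by blast
qed

lemma finite_ball: "finite {g \<in> carrier G. real (wl g) \<le> r}"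
proof -
  define n where "n = nat \<lfloor>r\<rfloor>"
  have "{g \<in> carrier G. real (wl g) \<le> r} \<subseteq> wprod ` {w. set w \<subseteq> letters \<and> length w \<le> n}"
  proof
    fix g assume g: "g \<in> {g \<in> carrier G. real (wl g) \<le> r}"
    then have "wl g \<le> n" unfolding n_def by (simp add: le_nat_floor)
    then show "g \<in> wprod ` {w. set w \<subseteq> letters \<and> length w \<le> n}" using wl_ex[of g] g by force
  qed
  then show ?thesis using finite_lists_length_le[OF finite_letters] finite_surj by blast
qed

lemma e_eq: "e g h = real (wl (inv g \<otimes> h))" by (simp add: word_dist_def)

lemma e_one: "g \<in> carrier G \<Longrightarrow> e \<one> g = real (wl g)" by (simp add: e_eq)

lemma e_left: "\<lbrakk>k \<in> carrier G; g \<in> carrier G; h \<in> carrier G\<rbrakk> \<Longrightarrow> e (k \<otimes> g) (k \<otimes> h) = e g h"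
  by (simp add: e_eq inv_mult_group m_assoc)

lemma e_right: "\<lbrakk>g \<in> carrier G; h \<in> carrier G\<rbrakk> \<Longrightarrow> e g (g \<otimes> h) = real (wl h)"
  by (simp add: e_eq)

lemma e_sym: "\<lbrakk>g \<in> carrier G; h \<in> carrier G\<rbrakk> \<Longrightarrow> e g h = e h g"
  using wl_inv[of "inv g \<otimes> h"] by (simp add: e_eq inv_mult_group)

lemma e_tri: "\<lbrakk>g \<in> carrier G; h \<in> carrier G; k \<in> carrier G\<rbrakk> \<Longrightarrow> e g k \<le> e g h + e h k"
proof -
  assume c: "g \<in> carrier G" "h \<in> carrier G" "k \<in> carrier G"
  then have "inv g \<otimes> k = (inv g \<otimes> h) \<otimes> (inv h \<otimes> k)" by (simp add: m_assoc)
  then show ?thesis using wl_mult[of "inv g \<otimes> h" "inv h \<otimes> k"] c by (simp add: e_eq)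
qed

text \<open>The prefixes of a shortest word. Their distances are at most the differences of their
  lengths, and since the total length is attained, equality holds throughout.\<close>

lemma geodesic_path:
  assumes x: "x \<in> carrier G" and y: "y \<in> carrier G"
  shows "\<exists>f n. (\<forall>i. f i \<in> carrier G) \<and> f 0 = x \<and> f n = y \<and> real n = e x y \<and>
     (\<forall>i\<le>n. \<forall>j\<le>n. e (f i) (f j) = \<bar>real i - real j\<bar>)"
proof -
  obtain w where w: "length w = wl (inv x \<otimes> y)" "set w \<subseteq> letters" "wprod w = inv x \<otimes> y"
    using wl_ex x y by blast
  define f where "f i = x \<otimes> wprod (take i w)" for i
  define n where "n = length w"
  have tk: "set (take i w) \<subseteq> letters" for i using w(2) set_take_subset by fast
  have fX: "f i \<in> carrier G" for i unfolding f_def using x wprod_closed[OF tk] by simp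
  have f0: "f 0 = x" using x by (simp add: f_def)
  have fn: "f n = y" using x y w(3) unfolding f_def n_def by simp
  have up: "e (f i) (f j) \<le> real j - real i" if "i \<le> j" "j \<le> n" for i j
  proof -
    define u where "u = take (j - i) (drop i w)"
    have u: "set u \<subseteq> letters" unfolding u_def using w(2) by (meson order_trans set_drop_subset set_take_subset)
    have "take j w = take i w @ u" unfolding u_def using that take_add[of i "j - i" w] by simp
    then have "f j = f i \<otimes> wprod u"
      unfolding f_def using wprod_append[OF tk u] x wprod_closed[OF tk] wprod_closed[OF u] by (simp add: m_assoc)
    then have "e (f i) (f j) = real (wl (wprod u))" using e_right[OF fX wprod_closed[OF u]] by simp
    also have "\<dots> \<le> real (length u)" using wl_le[OF u refl] by simp
    also have "length u = j - i" unfolding u_def using that n_def by simp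
    finally show ?thesis using that by simp
  qed
  have tot: "e (f 0) (f n) = real n" unfolding f0 fn by (simp add: e_eq w(1) n_def)
  have eq: "e (f i) (f j) = real j - real i" if "i \<le> j" "j \<le> n" for i j
    using up[OF that] up[of 0 i] up[of j n] that tot e_tri[OF fX fX fX, of 0 n i] e_tri[OF fX fX fX, of i n j]
    by force
  have "e (f i) (f j) = \<bar>real i - real j\<bar>" if "i \<le> n" "j \<le> n" for i j
    using eq[of i j] eq[of j i] that e_sym[OF fX fX, of i j] by (cases "i \<le> j") auto
  moreover have "real n = e x y" using tot f0 fn by simp
  ultimately show ?thesis using fX f0 fn by (intro exI[of _ f] exI[of _ n] conjI allI impI) simp_all
qed

sublocale coarse_geodesic_space "carrier G" e
proof
  show "0 \<le> e x y" for x y by (simp add: e_eq)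
  show "e x x = 0" if "x \<in> carrier G" for x using that by (simp add: e_eq wl_one)
  fix x y t assume xy: "x \<in> carrier G" "y \<in> carrier G" "0 \<le> t" "t \<le> e x y"
  obtain f n where f: "\<And>i. f i \<in> carrier G" "f 0 = x" "f n = y" "real n = e x y"
     "\<And>i j. i\<le>n \<Longrightarrow> j\<le>n \<Longrightarrow> e (f i) (f j) = \<bar>real i - real j\<bar>"
    using geodesic_path[OF xy(1,2)] by blast
  define i where "i = nat \<lfloor>t\<rfloor>"
  have i: "real i \<le> t" "t < real i + 1" unfolding i_def using xy by linarith+
  then have "i \<le> n" using xy f(4) by linarith
  then have "e x (f i) = i" "e (f i) y = real n - real i" using f(5)[of 0 i] f(5)[of i n] f(2,3) by auto
  then show "\<exists>z\<in>carrier G. e x z + e z y = e x y \<and> \<bar>e x z - t\<bar> \<le> 1"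
    using i f by (intro bexI[of _ "f i"]) auto
qed (use e_sym e_tri in auto)

lemma gp_left: "\<lbrakk>k \<in> carrier G; w \<in> carrier G; x \<in> carrier G; y \<in> carrier G\<rbrakk> \<Longrightarrow>
    gp (k \<otimes> w) (k \<otimes> x) (k \<otimes> y) = gp w x y"
  by (simp add: gprod_def e_left)

lemma gromov_gp: "gromov G S w x y = gp w x y" by (simp add: gromov_def gprod_def)

text \<open>A point of a geodesic from x to y that is close to both other sides of the triangle with
  w realises the product of x and y as its distance from w, up to \<open>2 * D + 1\<close>. Moving
  such a point for x and z by D onto a side through y gives the inequality between products.\<close>

lemma slim_imp_hyperbolic:
  assumes D: "0 \<le> D"
    and slim: "\<And>x y z p. \<lbrakk>x \<in> carrier G; y \<in> carrier G; z \<in> carrier G; p \<in> carrier G; e x p + e p z = e x z\<rbrakk>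
      \<Longrightarrow> \<exists>q\<in>carrier G. (e x q + e q y = e x y \<or> e y q + e q z = e y z) \<and> e p q \<le> D"
  shows "gromov_hyperbolic (carrier G) e (3 * D + 1)"
proof -
  have near: "\<exists>p\<in>carrier G. e x p + e p y = e x y \<and> e w p \<le> gp w x y + 2 * D + 1"
    if X: "x \<in> carrier G" "y \<in> carrier G" "w \<in> carrier G" for x y w
  proof -
    obtain f n where f: "\<And>i. f i \<in> carrier G" "f 0 = x" "f n = y" "real n = e x y"
     "\<And>i j. i\<le>n \<Longrightarrow> j\<le>n \<Longrightarrow> e (f i) (f j) = \<bar>real i - real j\<bar>"
      using geodesic_path[OF X(1,2)] by blast
    define A where "A i \<longleftrightarrow> (\<exists>q\<in>carrier G. e x q + e q w = e x w \<and> e (f i) q \<le> D)" for i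
    define B where "B i \<longleftrightarrow> (\<exists>q\<in>carrier G. e w q + e q y = e w y \<and> e (f i) q \<le> D)" for i
    have AB: "A i \<or> B i" if "i \<le> n" for i
    proof -
      have "e x (f i) + e (f i) y = e x y" using f(5)[of 0 i] f(5)[of i n] f(2,3,4) that by auto
      then show ?thesis using slim[of x w y "f i"] X f(1) unfolding A_def B_def by blast
    qed
    have A0: "A 0" unfolding A_def using X f(2) d_refl D by (intro bexI[of _ x]) auto
    have Bn: "B n" unfolding B_def using X f(3) d_refl D by (intro bexI[of _ y]) auto
    \<comment> \<open>Discrete connectedness: every index satisfies A or B, the first satisfies A
      and the last satisfies B, so A and B hold at indices at most 1 apart.\<close>
    have "\<exists>i\<le>n. \<exists>j\<le>n. A i \<and> B j \<and> \<bar>real i - real j\<bar> \<le> 1"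
    proof (rule ccontr)
      assume no: "\<not> ?thesis"
      have "i \<le> n \<Longrightarrow> \<not> B i \<and> A i" for i
      proof (induction i)
        case 0
        then show ?case using no A0 by force
      next
        case (Suc i)
        then have "i \<le> n" "A i" by auto
        moreover have "\<bar>real i - real (Suc i)\<bar> \<le> 1" by simp
        ultimately have "\<not> B (Suc i)" using no Suc.prems by blast
        then show ?case using AB Suc.prems by blast
      qed
      then show False using Bn by blast
    qed
    then obtain i j where ij: "i \<le> n" "j \<le> n" "A i" "B j" "\<bar>real i - real j\<bar> \<le> 1" by blast
    obtain u where u: "u \<in> carrier G" "e x u + e u w = e x w" "e (f i) u \<le> D" using ij(3) A_def by blast
    obtain v where v: "v \<in> carrier G" "e w v + e v y = e w y" "e (f j) v \<le> D" using ij(4) B_def by blast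
    have "e (f i) (f j) \<le> 1" using f(5)[OF ij(1,2)] ij(5) by simp
    then have iv: "e (f i) v \<le> D + 1" using e_tri[OF f(1) f(1) v(1), of i j] v(3) by linarith
    have b: "e x (f i) + e (f i) y = e x y" using f(5)[of 0 i] f(5)[of i n] f(2,3,4) ij by auto
    have "e x (f i) + e w (f i) \<le> e x w + 2 * D"
      using e_tri[OF X(1) u(1) f(1)[of i]] e_tri[OF f(1)[of i] u(1) X(3)] e_sym[OF f(1)[of i] u(1)] e_sym[OF f(1)[of i] X(3)] u by linarith
    moreover have "e (f i) y \<le> D + 1 + e v y"
      using e_tri[OF f(1)[of i] v(1) X(2)] iv by linarith
    moreover have "e w (f i) \<le> D + 1 + e w v"
      using e_tri[OF f(1)[of i] v(1) X(3)] iv e_sym[OF f(1)[of i] X(3)] e_sym[OF X(3) v(1)] by linarith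
    moreover have "2 * gp w x y = e w x + e w y - e x y" by (simp add: gprod_def)
    ultimately have "2 * e w (f i) \<le> 2 * gp w x y + 4 * D + 2"
      using e_sym[OF X(3) X(1)] b v(2) by linarith
    then have "e w (f i) \<le> gp w x y + 2 * D + 1" by simp
    then show ?thesis using b f(1) by blast
  qed
  have gp_min: "gp w x y - (3 * D + 1) \<le> gp w x z \<or> gp w y z - (3 * D + 1) \<le> gp w x z"
    if X: "w \<in> carrier G" "x \<in> carrier G" "y \<in> carrier G" "z \<in> carrier G" for w x y z
  proof -
    obtain p where p: "p \<in> carrier G" "e x p + e p z = e x z" "e w p \<le> gp w x z + 2 * D + 1"
      using near X by blast
    obtain q where q: "q \<in> carrier G" "e x q + e q y = e x y \<or> e y q + e q z = e y z" "e p q \<le> D"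
      using slim[of x y z p] X p by blast
    have "e w q \<le> gp w x z + 3 * D + 1" using e_tri[OF X(1) p(1) q(1)] p q by linarith
    then show ?thesis using gp_le_dist_between[OF X(1,2,3) q(1)] gp_le_dist_between[OF X(1,3,4) q(1)] q(2) by force
  qed
  show ?thesis
  proof (unfold_locales)
    fix w x y z assume X: "w \<in> carrier G" "x \<in> carrier G" "y \<in> carrier G" "z \<in> carrier G"
    show "e w y + e x z \<le> e w x + e y z + 2 * (3 * D + 1) \<or> e w y + e x z \<le> e w z + e x y + 2 * (3 * D + 1)"
      using gp_min[OF X] e_sym X unfolding gprod_def by (auto simp: field_simps)
  qed (use D in simp)
qed

end

text \<open>Geodesics for S are quasi-geodesics for S', so by the Morse lemma a point on one side of
  an S-triangle has a small S'-product with respect to the ends of that side. Hyperbolicity for S'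
  passes this to another side, and the Morse lemma supplies a nearby point there. Thus S-triangles
  are slim.\<close>

lemma hyperbolic_change_generators:
  fixes G (structure)
  assumes "cayley G S" "cayley G S'" "gromov_hyperbolic (carrier G) (word_dist G S') dl"
  shows "\<exists>dl'. gromov_hyperbolic (carrier G) (word_dist G S) dl'"
proof -
  interpret A: cayley G S by fact
  interpret B: cayley G S' by fact
  interpret H: gromov_hyperbolic "carrier G" B.e dl by fact
  have "\<exists>L\<ge>1. \<forall>g\<in>carrier G. real (B.wl g) \<le> L * real (A.wl g)"
  proof (rule A.wl_bound)
    show "real (B.wl (g \<otimes> h)) \<le> real (B.wl g) + real (B.wl h)" if "g \<in> carrier G" "h \<in> carrier G" for g h
      using B.wl_mult[OF that] by linarith
  qed (simp add: B.wl_one)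
  then obtain L1 where L1: "1 \<le> L1" "\<And>g. g \<in> carrier G \<Longrightarrow> real (B.wl g) \<le> L1 * real (A.wl g)"
    by blast
  have "\<exists>L\<ge>1. \<forall>g\<in>carrier G. real (A.wl g) \<le> L * real (B.wl g)"
  proof (rule B.wl_bound)
    show "real (A.wl (g \<otimes> h)) \<le> real (A.wl g) + real (A.wl h)" if "g \<in> carrier G" "h \<in> carrier G" for g h
      using A.wl_mult[OF that] by linarith
  qed (simp add: A.wl_one)
  then obtain L2 where L2: "1 \<le> L2" "\<And>g. g \<in> carrier G \<Longrightarrow> real (A.wl g) \<le> L2 * real (B.wl g)"
    by blast
  define L where "L = max L1 L2"
  have L: "1 \<le> L" "\<And>g h. \<lbrakk>g \<in> carrier G; h \<in> carrier G\<rbrakk> \<Longrightarrow> B.e g h \<le> L * A.e g h"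
    "\<And>g h. \<lbrakk>g \<in> carrier G; h \<in> carrier G\<rbrakk> \<Longrightarrow> A.e g h \<le> L * B.e g h"
  proof -
    show "1 \<le> L" using L1 L_def by simp
    fix g h assume gh: "g \<in> carrier G" "h \<in> carrier G"
    then have gh': "inv g \<otimes> h \<in> carrier G" by simp
    show "B.e g h \<le> L * A.e g h" unfolding A.e_eq B.e_eq
      using L1(2)[OF gh'] unfolding L_def by (smt (verit) mult_right_mono of_nat_0_le_iff)
    show "A.e g h \<le> L * B.e g h" unfolding A.e_eq B.e_eq
      using L2(2)[OF gh'] unfolding L_def by (smt (verit) mult_right_mono of_nat_0_le_iff)
  qed
  have qp: "\<exists>f n. H.quasi_path L 0 f n \<and> f 0 = x \<and> f n = z \<and> (\<forall>i\<le>n. A.e x (f i) + A.e (f i) z = A.e x z \<and> A.e x (f i) = real i)"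
    if X: "x \<in> carrier G" "z \<in> carrier G" for x z
  proof -
    obtain f n where f: "\<And>i. f i \<in> carrier G" "f 0 = x" "f n = z" "real n = A.e x z"
      "\<And>i j. i\<le>n \<Longrightarrow> j\<le>n \<Longrightarrow> A.e (f i) (f j) = \<bar>real i - real j\<bar>"
      using A.geodesic_path[OF X] by blast
    have "\<bar>real i - real j\<bar> / L - 0 \<le> B.e (f i) (f j) \<and> B.e (f i) (f j) \<le> L * \<bar>real i - real j\<bar> + 0"
      if "i \<le> n" "j \<le> n" for i j
      using L(2)[OF f(1) f(1), of i j] L(3)[OF f(1) f(1), of i j] f(5)[OF that] L(1)
      by (simp add: pos_divide_le_eq mult.commute)
    then have "H.quasi_path L 0 f n" unfolding H.quasi_path_def using f(1) by blast
    moreover have "A.e x (f i) + A.e (f i) z = A.e x z \<and> A.e x (f i) = real i" if "i \<le> n" for i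
      using f(5)[of 0 i] f(5)[of i n] f(2,3,4) that by auto
    ultimately show ?thesis using f by blast
  qed
  obtain M1 where M1: "0 \<le> M1" "\<And>f n u m. \<lbrakk>H.quasi_path L 0 f n; u \<in> carrier G; B.gp u (f 0) (f n) \<le> m\<rbrakk> \<Longrightarrow> \<exists>i\<le>n. B.e u (f i) \<le> M1 + m"
    using H.morse_near[of L 0] L(1) by auto
  obtain M2 where M2: "0 \<le> M2" "\<And>f n j. \<lbrakk>H.quasi_path L 0 f n; j \<le> n\<rbrakk> \<Longrightarrow> B.gp (f j) (f 0) (f n) \<le> M2"
    using H.morse_between[of L 0] L(1) by auto
  define D where "D = L * (M1 + (M2 + dl))"
  have "gromov_hyperbolic (carrier G) A.e (3 * D + 1)"
  proof (rule A.slim_imp_hyperbolic)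
    show "0 \<le> D" unfolding D_def using L(1) M1 M2 H.dl_nonneg by simp
    fix x y z p
    assume X: "x \<in> carrier G" "y \<in> carrier G" "z \<in> carrier G" "p \<in> carrier G" and p: "A.e x p + A.e p z = A.e x z"
    have "B.gp p x z \<le> M2"
    proof -
      obtain f n where f: "\<And>i. f i \<in> carrier G" "f 0 = x" "f n = p" "real n = A.e x p"
        "\<And>i j. i\<le>n \<Longrightarrow> j\<le>n \<Longrightarrow> A.e (f i) (f j) = \<bar>real i - real j\<bar>"
        using A.geodesic_path[OF X(1,4)] by blast
      obtain g m where g: "\<And>i. g i \<in> carrier G" "g 0 = p" "g m = z" "real m = A.e p z"
        "\<And>i j. i\<le>m \<Longrightarrow> j\<le>m \<Longrightarrow> A.e (g i) (g j) = \<bar>real i - real j\<bar>"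
        using A.geodesic_path[OF X(4,3)] by blast
      \<comment> \<open>Since p is given only as a point between x and z, a geodesic through it is
        built by joining geodesics from x to p and from p to z; the lengths add up, so the union is
        again geodesic.\<close>
      define k where "k i = (if i \<le> n then f i else g (i - n))" for i
      have kX: "k i \<in> carrier G" for i using f g by (simp add: k_def)
      have k0: "k 0 = x" "k (n + m) = z" "k n = p" using f g by (auto simp: k_def)
      have up: "A.e (k i) (k j) \<le> real j - real i" if ij: "i \<le> j" "j \<le> n + m" for i j
      proof -
        consider "j \<le> n" | "n < i" | "i \<le> n" "n < j" using ij by linarith
        then show ?thesis
        proof cases
          case 1 then show ?thesis using f(5)[of i j] ij by (simp add: k_def)
        next
          case 2 then show ?thesis using g(5)[of "i - n" "j - n"] ij by (simp add: k_def of_nat_diff)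
        next
          case 3
          have "A.e (k i) p = real n - real i" using f(5)[of i n] f(3) 3 by (simp add: k_def)
          moreover have "A.e p (k j) = real j - real n" using g(5)[of 0 "j - n"] g(2) 3 ij by (simp add: k_def of_nat_diff)
          ultimately show ?thesis using A.e_tri[OF kX X(4) kX, of i j] by simp
        qed
      qed
      have tot: "A.e (k 0) (k (n + m)) = real (n + m)" unfolding k0 using p f(4) g(4) by simp
      have eq: "A.e (k i) (k j) = real j - real i" if "i \<le> j" "j \<le> n + m" for i j
        using up[OF that] up[of 0 i] up[of j "n + m"] that tot
          A.e_tri[OF kX kX kX, of 0 "n + m" i] A.e_tri[OF kX kX kX, of i "n + m" j] by force
      have eq': "A.e (k i) (k j) = \<bar>real i - real j\<bar>" if "i \<le> n + m" "j \<le> n + m" for i j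
        using eq[of i j] eq[of j i] that A.e_sym[OF kX kX, of i j] by (cases "i \<le> j") auto
      have "\<bar>real i - real j\<bar> / L - 0 \<le> B.e (k i) (k j) \<and> B.e (k i) (k j) \<le> L * \<bar>real i - real j\<bar> + 0"
        if "i \<le> n + m" "j \<le> n + m" for i j
        using L(2)[OF kX kX, of i j] L(3)[OF kX kX, of i j] eq'[OF that] L(1)
        by (simp add: pos_divide_le_eq mult.commute)
      then have "H.quasi_path L 0 k (n + m)" unfolding H.quasi_path_def using kX by blast
      from M2(2)[OF this, of n] show ?thesis using k0 by simp
    qed
    then consider "B.gp p x y \<le> M2 + dl" | "B.gp p y z \<le> M2 + dl" using H.gp_min[of p x y z] X by force
    then show "\<exists>q\<in>carrier G. (A.e x q + A.e q y = A.e x y \<or> A.e y q + A.e q z = A.e y z) \<and> A.e p q \<le> D"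
    proof cases
      case 1
      obtain f n where f: "H.quasi_path L 0 f n" "f 0 = x" "f n = y" "\<And>i. i \<le> n \<Longrightarrow> A.e x (f i) + A.e (f i) y = A.e x y"
        using qp[OF X(1,2)] by blast
      obtain i where i: "i \<le> n" "B.e p (f i) \<le> M1 + (M2 + dl)" using M1(2)[OF f(1) X(4)] 1 f(2,3) by blast
      have fi: "f i \<in> carrier G" using f(1) unfolding H.quasi_path_def by blast
      have "A.e p (f i) \<le> D" unfolding D_def
        using L(3)[OF X(4) fi] i(2) L(1) by (smt (verit) mult_left_mono)
      then show ?thesis using fi f(4)[OF i(1)] by blast
    next
      case 2
      obtain f n where f: "H.quasi_path L 0 f n" "f 0 = y" "f n = z" "\<And>i. i \<le> n \<Longrightarrow> A.e y (f i) + A.e (f i) z = A.e y z"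
        using qp[OF X(2,3)] by blast
      obtain i where i: "i \<le> n" "B.e p (f i) \<le> M1 + (M2 + dl)" using M1(2)[OF f(1) X(4)] 2 f(2,3) by blast
      have fi: "f i \<in> carrier G" using f(1) unfolding H.quasi_path_def by blast
      have "A.e p (f i) \<le> D" unfolding D_def
        using L(3)[OF X(4) fi] i(2) L(1) by (smt (verit) mult_left_mono)
      then show ?thesis using fi f(4)[OF i(1)] by blast
    qed
  qed
  then show ?thesis by blast
qed

lemma hyperbolic_group_any_generators:
  assumes "hyperbolic_group G" "finite_gen_set G S"
  shows "\<exists>dl. cayley G S \<and> gromov_hyperbolic (carrier G) (word_dist G S) dl"
proof -
  obtain S' dl where S': "group G" "finite_gen_set G S'" "0 \<le> dl"
    "\<And>w x y z. \<lbrakk>w\<in>carrier G; x\<in>carrier G; y\<in>carrier G; z\<in>carrier G\<rbrakk> \<Longrightarrow>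
        gromov G S' w x z \<ge> min (gromov G S' w x y) (gromov G S' w y z) - dl"
    using assms(1) unfolding hyperbolic_group_def by blast
  interpret B: cayley G S' using S' by (simp add: cayley_def cayley_axioms_def)
  interpret A: cayley G S using S' assms(2) by (simp add: cayley_def cayley_axioms_def)
  have "gromov_hyperbolic (carrier G) B.e dl"
  proof (unfold_locales)
    fix w x y z assume X: "w \<in> carrier G" "x \<in> carrier G" "y \<in> carrier G" "z \<in> carrier G"
    show "B.e w y + B.e x z \<le> B.e w x + B.e y z + 2 * dl \<or> B.e w y + B.e x z \<le> B.e w z + B.e x y + 2 * dl"
      using S'(4)[OF X] B.e_sym X unfolding B.gromov_gp gprod_def by (auto simp: field_simps min_def split: if_splits)
  qed (use S' in simp)
  then show ?thesis using hyperbolic_change_generators A.cayley_axioms B.cayley_axioms by blast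
qed

section \<open>Hyperbolic three-space\<close>

definition hcosh :: "complex \<times> real \<Rightarrow> complex \<times> real \<Rightarrow> real" where
  "hcosh p q = 1 + ((cmod (fst p - fst q))\<^sup>2 + (snd p - snd q)\<^sup>2) / (2 * snd p * snd q)"

lemma H3_iff: "(z, t) \<in> H3 \<longleftrightarrow> 0 < t" by (simp add: H3_def)

lemma hcosh_ge_1: "\<lbrakk>p \<in> H3; q \<in> H3\<rbrakk> \<Longrightarrow> 1 \<le> hcosh p q"
  by (auto simp: hcosh_def H3_def)

lemma hdist_nonneg: "\<lbrakk>p \<in> H3; q \<in> H3\<rbrakk> \<Longrightarrow> 0 \<le> hdist p q"
  using hcosh_ge_1[of p q] by (simp add: hdist_def hcosh_def arcosh_nonneg_real)

lemma cosh_hdist: "\<lbrakk>p \<in> H3; q \<in> H3\<rbrakk> \<Longrightarrow> cosh (hdist p q) = hcosh p q"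
  using hcosh_ge_1[of p q] by (simp add: hdist_def hcosh_def cosh_arcosh_real)

lemma hcosh_sym: "hcosh p q = hcosh q p"
  by (simp add: hcosh_def norm_minus_commute power2_commute mult.commute mult.left_commute)

lemma hdist_sym: "hdist p q = hdist q p"
  using hcosh_sym[of p q] by (simp add: hdist_def hcosh_def)

lemma hdist_refl: "hdist p p = 0"
  by (simp add: hdist_def)

lemma hdist_le_iff: "\<lbrakk>p \<in> H3; q \<in> H3; 0 \<le> r\<rbrakk> \<Longrightarrow> hdist p q \<le> r \<longleftrightarrow> hcosh p q \<le> cosh r"
  using cosh_real_nonneg_le_iff[of "hdist p q" r] hdist_nonneg[of p q] by (simp add: cosh_hdist)

lemma hdist_eqI: "\<lbrakk>p \<in> H3; q \<in> H3; 0 \<le> r; hcosh p q = cosh r\<rbrakk> \<Longrightarrow> hdist p q = r"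
  by (simp add: hdist_def hcosh_def arcosh_cosh_real)

lemma hdist_le_hdist_iff:
  "\<lbrakk>p \<in> H3; q \<in> H3; p' \<in> H3; q' \<in> H3\<rbrakk> \<Longrightarrow> hdist p q \<le> hdist p' q' \<longleftrightarrow> hcosh p q \<le> hcosh p' q'"
  using hdist_le_iff[of p q "hdist p' q'"] hdist_nonneg[of p' q'] by (simp add: cosh_hdist)

lemma hdist_eq_0: "\<lbrakk>p \<in> H3; q \<in> H3; hdist p q = 0\<rbrakk> \<Longrightarrow> p = q"
proof -
  assume a: "p \<in> H3" "q \<in> H3" "hdist p q = 0"
  then have "hcosh p q = 1" using cosh_hdist[of p q] by simp
  moreover have "0 < snd p" "0 < snd q" using a by (auto simp: H3_def)
  ultimately have "(cmod (fst p - fst q))\<^sup>2 + (snd p - snd q)\<^sup>2 = 0" by (simp add: hcosh_def)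
  then show "p = q" by (simp add: sum_power2_eq_zero_iff prod_eq_iff)
qed

text \<open>The spatial part of \<open>p\<close> in the hyperboloid model with base point \<open>q\<close>;
  its norm is the hyperbolic sine of the distance.\<close>
definition hvec :: "complex \<times> real \<Rightarrow> complex \<times> real \<Rightarrow> real \<times> complex" where
  "hvec q p = (((cmod (fst p - fst q))\<^sup>2 + (snd p)\<^sup>2 - (snd q)\<^sup>2) / (2 * snd p * snd q),
               (fst p - fst q) / complex_of_real (snd p))"

lemma hcosh_alt: "\<lbrakk>p \<in> H3; q \<in> H3\<rbrakk> \<Longrightarrow>
    hcosh p q = ((cmod (fst p - fst q))\<^sup>2 + (snd p)\<^sup>2 + (snd q)\<^sup>2) / (2 * snd p * snd q)"
  by (simp add: hcosh_def H3_def field_simps power2_eq_square)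

text \<open>The Lorentz product of p and r in the hyperboloid model, in coordinates centred at q:
  hcosh is the time coordinate and \<open>hvec\<close> the spatial one.\<close>

lemma law_of_cosines:
  assumes "p \<in> H3" "q \<in> H3" "r \<in> H3"
  shows "hcosh p r = hcosh q p * hcosh q r - inner (hvec q p) (hvec q r)"
proof -
  obtain x y s where p: "p = (Complex x y, s)" by (metis complex.exhaust surj_pair)
  obtain x' y' t where r: "r = (Complex x' y', t)" by (metis complex.exhaust surj_pair)
  obtain x0 y0 u where q: "q = (Complex x0 y0, u)" by (metis complex.exhaust surj_pair)
  have pos: "s > 0" "t > 0" "u > 0" using assms p q r by (auto simp: H3_iff)
  have ip: "inner (Complex a b / complex_of_real c) (Complex a' b' / complex_of_real c') = (a * a' + b * b') / (c * c')"
    if "c > 0" "c' > 0" for a b c a' b' c' using that by (simp add: inner_complex_def field_simps)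
  have e: "((x - x')\<^sup>2 + (y - y')\<^sup>2 + s\<^sup>2 + t\<^sup>2) / (2 * s * t) =
      ((x - x0)\<^sup>2 + (y - y0)\<^sup>2 + s\<^sup>2 + u\<^sup>2) / (2 * s * u) * (((x' - x0)\<^sup>2 + (y' - y0)\<^sup>2 + t\<^sup>2 + u\<^sup>2) / (2 * t * u))
    - (((x - x0)\<^sup>2 + (y - y0)\<^sup>2 + s\<^sup>2 - u\<^sup>2) / (2 * s * u) * (((x' - x0)\<^sup>2 + (y' - y0)\<^sup>2 + t\<^sup>2 - u\<^sup>2) / (2 * t * u))
       + ((x - x0) * (x' - x0) + (y - y0) * (y' - y0)) / (s * t))"
  proof -
    define A where "A = (x - x0)\<^sup>2 + (y - y0)\<^sup>2 + s\<^sup>2"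
    define B where "B = (x' - x0)\<^sup>2 + (y' - y0)\<^sup>2 + t\<^sup>2"
    define I where "I = (x - x0) * (x' - x0) + (y - y0) * (y' - y0)"
    have l: "(x - x')\<^sup>2 + (y - y')\<^sup>2 + s\<^sup>2 + t\<^sup>2 = A + B - 2 * I"
      unfolding A_def B_def I_def by (simp add: power2_eq_square algebra_simps)
    have "(A + B - 2 * I) / (2 * s * t) = (A + u\<^sup>2) / (2 * s * u) * ((B + u\<^sup>2) / (2 * t * u))
      - ((A - u\<^sup>2) / (2 * s * u) * ((B - u\<^sup>2) / (2 * t * u)) + I / (s * t))"
      using pos by (simp add: field_simps power2_eq_square)
    then show ?thesis unfolding l unfolding A_def B_def I_def .
  qed
  have cm: "(cmod (Complex a b - Complex a' b'))\<^sup>2 = (a - a')\<^sup>2 + (b - b')\<^sup>2" for a b a' b'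
    by (simp add: cmod_power2)
  have ip': "inner ((Complex a b - Complex a' b') / complex_of_real c) ((Complex a'' b'' - Complex a' b') / complex_of_real c')
      = ((a - a') * (a'' - a') + (b - b') * (b'' - b')) / (c * c')" if "c > 0" "c' > 0" for a b a' b' a'' b'' c c'
    using ip[OF that, of "a - a'" "b - b'" "a'' - a'" "b'' - b'"] by (simp add: complex_diff)
  have s1: "hcosh q p = hcosh p q" by (rule hcosh_sym)
  have s2: "hcosh q r = hcosh r q" by (rule hcosh_sym)
  show ?thesis
    using e pos unfolding s1 s2 hcosh_alt[OF assms(1,3)] hcosh_alt[OF assms(1,2)] hcosh_alt[OF assms(3,2)] hvec_def
    unfolding p q r by (simp add: cm ip' inner_Pair)
qed

lemma hvec_norm:
  assumes "p \<in> H3" "q \<in> H3"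
  shows "norm (hvec q p) = sinh (hdist q p)"
proof -
  have "hcosh p p = 1" by (simp add: hcosh_def)
  then have "inner (hvec q p) (hvec q p) = (hcosh q p)\<^sup>2 - 1"
    using law_of_cosines[of p q p] assms by (simp add: power2_eq_square)
  also have "\<dots> = (sinh (hdist q p))\<^sup>2"
    using cosh_hdist[of q p] assms by (metis cosh_square_eq add_diff_cancel_right')
  finally have "(norm (hvec q p))\<^sup>2 = (sinh (hdist q p))\<^sup>2" by (simp add: power2_norm_eq_inner)
  then show ?thesis using hdist_nonneg[of q p] assms by (simp add: power2_eq_iff_nonneg)
qed

lemma hdist_triangle:
  assumes "p \<in> H3" "q \<in> H3" "r \<in> H3"
  shows "hdist p r \<le> hdist p q + hdist q r"
proof -
  have "hcosh p r \<le> hcosh q p * hcosh q r + norm (hvec q p) * norm (hvec q r)"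
    using law_of_cosines[OF assms] Cauchy_Schwarz_ineq2[of "hvec q p" "hvec q r"] by linarith
  also have "\<dots> = cosh (hdist q p + hdist q r)"
    using assms by (simp add: cosh_add hvec_norm cosh_hdist)
  finally show ?thesis using hdist_le_iff[of p r "hdist q p + hdist q r"] hdist_nonneg assms hdist_sym[of p q] by simp
qed

text \<open>In the hyperboloid model a point q of the segment from p to r satisfies sinh d(p, r) q =
  sinh d(q, r) p + sinh d(p, q) r. The identity is the Lorentz product of this relation with
  y.\<close>

lemma hseg_interpolate:
  assumes "p \<in> H3" "q \<in> H3" "r \<in> H3" "y \<in> H3" and eq: "hdist p q + hdist q r = hdist p r"
  shows "sinh (hdist p r) * hcosh q y = sinh (hdist q r) * hcosh y p + sinh (hdist p q) * hcosh y r"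
proof -
  let ?v = "hvec q p" and ?w = "hvec q r"
  have "cosh (hdist p r) = cosh (hdist q p + hdist q r)" using eq hdist_sym[of p q] by simp
  then have "hcosh p r = hcosh q p * hcosh q r + norm ?v * norm ?w"
    using assms by (simp add: cosh_add hvec_norm cosh_hdist)
  \<comment> \<open>Additivity of the distances is the equality case of Cauchy-Schwarz, so the two
    directions at q are opposite.\<close>
  then have "inner ?v (- ?w) = norm ?v * norm (- ?w)" using law_of_cosines[OF assms(1-3)] by simp
  then have "norm ?v *\<^sub>R (- ?w) = norm (- ?w) *\<^sub>R ?v" by (simp only: norm_cauchy_schwarz_eq)
  then have "norm ?w *\<^sub>R ?v = - (norm ?v *\<^sub>R ?w)" by simp
  then have z: "norm ?w *\<^sub>R ?v + norm ?v *\<^sub>R ?w = 0" by simp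
  have "norm ?w * inner (hvec q y) ?v + norm ?v * inner (hvec q y) ?w = inner (hvec q y) (norm ?w *\<^sub>R ?v + norm ?v *\<^sub>R ?w)"
    by (simp add: inner_add_right)
  then have z': "norm ?w * inner (hvec q y) ?v + norm ?v * inner (hvec q y) ?w = 0" unfolding z by simp
  have "norm ?w * hcosh y p + norm ?v * hcosh y r = hcosh q y * (norm ?w * hcosh q p + norm ?v * hcosh q r)
      - (norm ?w * inner (hvec q y) ?v + norm ?v * inner (hvec q y) ?w)"
    unfolding law_of_cosines[OF assms(4,2,1)] law_of_cosines[OF assms(4,2,3)] by (simp add: algebra_simps)
  also have "norm ?w * hcosh q p + norm ?v * hcosh q r = sinh (hdist q p + hdist q r)"
    using assms by (simp add: sinh_add hvec_norm cosh_hdist mult.commute add.commute)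
  finally show ?thesis
    unfolding z' using hvec_norm assms eq hdist_sym[of p q] by (simp add: mult.commute)
qed

text \<open>By \<open>hseg_interpolate\<close>, hcosh at q is a combination of its values at p and r
  with nonnegative coefficients that do not depend on the other point. So half-spaces bounded by
  bisectors are convex.\<close>

lemma bisector_hconvex:
  assumes "p \<in> H3" "q \<in> H3" "r \<in> H3" "hdist p q + hdist q r = hdist p r"
    and "a \<in> H3" "b \<in> H3" "hdist p a \<le> hdist p b" "hdist r a \<le> hdist r b"
  shows "hdist q a \<le> hdist q b"
proof (cases "hdist p r = 0")
  case True
  then have "hdist p q = 0" using hdist_nonneg[OF assms(1,2)] hdist_nonneg[OF assms(2,3)] assms(4) by linarith
  then show ?thesis using hdist_eq_0 assms by blast
next
  case False
  then have s: "0 < sinh (hdist p r)" using hdist_nonneg[OF assms(1,3)] by simp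
  have "hcosh a p \<le> hcosh b p" "hcosh a r \<le> hcosh b r"
    using assms hdist_le_hdist_iff hcosh_sym by metis+
  then have "sinh (hdist q r) * hcosh a p + sinh (hdist p q) * hcosh a r \<le> sinh (hdist q r) * hcosh b p + sinh (hdist p q) * hcosh b r"
    using hdist_nonneg assms(1-3) by (intro add_mono mult_left_mono) auto
  then have "sinh (hdist p r) * hcosh q a \<le> sinh (hdist p r) * hcosh q b"
    using hseg_interpolate[OF assms(1-3) assms(5) assms(4)] hseg_interpolate[OF assms(1-3) assms(6) assms(4)] by simp
  then have "hcosh q a \<le> hcosh q b" using s by simp
  then show ?thesis using hdist_le_hdist_iff assms by blast
qed

lemma hvec_surj:
  assumes q: "q \<in> H3"
  shows "\<exists>p\<in>H3. hvec q p = v \<and> hcosh q p = sqrt (1 + (norm v)\<^sup>2)"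
proof -
  obtain v0 v1 where v: "v = (v0, v1)" by force
  obtain z0 u where q': "q = (z0, u)" by force
  have u: "u > 0" using q q' by (simp add: H3_iff)
  define c where "c = sqrt (1 + (norm v)\<^sup>2)"
  have c2: "c\<^sup>2 = 1 + v0\<^sup>2 + (cmod v1)\<^sup>2" unfolding c_def v by (simp add: norm_Pair)
  have "v0\<^sup>2 < c\<^sup>2" unfolding c2 by (simp add: add.commute add_pos_nonneg add_strict_increasing2)
  then have "\<bar>v0\<bar> < c" unfolding c_def by (metis abs_ge_zero abs_le_square_iff abs_of_nonneg linorder_not_le real_sqrt_ge_zero add_nonneg_nonneg zero_le_one zero_le_power2)
  \<comment> \<open>The difference of hcosh and the first coordinate of \<open>hvec\<close> is u /
    s, the ratio of the heights of q and p; this determines the height s.\<close>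
  define k where "k = c - v0"
  have k: "k > 0" using \<open>\<bar>v0\<bar> < c\<close> by (simp add: k_def)
  define s where "s = u / k"
  have s: "s > 0" using u k by (simp add: s_def)
  define p where "p = (z0 + complex_of_real s * v1, s)"
  have p: "p \<in> H3" using s by (simp add: p_def H3_iff)
  have nz: "(cmod (fst p - fst q))\<^sup>2 = s\<^sup>2 * (cmod v1)\<^sup>2" using s by (simp add: p_def q' norm_mult power_mult_distrib)
  have us: "u = k * s" using k by (simp add: s_def)
  have key: "(cmod v1)\<^sup>2 + 1 = k * (k + 2 * v0)" using c2 by (simp add: k_def power2_eq_square algebra_simps)
  have n1: "s\<^sup>2 * (cmod v1)\<^sup>2 + s\<^sup>2 - u\<^sup>2 = v0 * (2 * s * u)"
  proof -
    have "s\<^sup>2 * (cmod v1)\<^sup>2 + s\<^sup>2 - u\<^sup>2 = s\<^sup>2 * ((cmod v1)\<^sup>2 + 1) - u\<^sup>2" by (simp add: algebra_simps)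
    also have "\<dots> = v0 * (2 * s * u)" unfolding key us by (simp add: power2_eq_square algebra_simps)
    finally show ?thesis .
  qed
  have "hvec q p = (v0, v1)"
    unfolding hvec_def nz using n1 s u by (simp add: p_def q')
  moreover have "hcosh q p = c"
  proof -
    have "s\<^sup>2 * (cmod v1)\<^sup>2 + s\<^sup>2 + u\<^sup>2 = 2 * u * (u + s * v0)"
      using n1 by (simp add: power2_eq_square algebra_simps)
    also have "u + s * v0 = c * s" unfolding us k_def by (simp add: algebra_simps)
    finally have "s\<^sup>2 * (cmod v1)\<^sup>2 + s\<^sup>2 + u\<^sup>2 = c * (2 * s * u)" by (simp add: mult_ac)
    then show ?thesis using hcosh_alt[OF p q] nz s u hcosh_sym[of p q] by (simp add: p_def q')
  qed
  ultimately show ?thesis using p v c_def by blast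
qed

lemma hseg_point:
  assumes p: "p \<in> H3" and r: "r \<in> H3" and t: "0 \<le> t" "t \<le> hdist p r"
  shows "\<exists>q\<in>H3. hdist p q = t \<and> hdist q r = hdist p r - t"
proof (cases "hdist p r = 0")
  case True
  then show ?thesis using t p hdist_refl by (intro bexI[of _ p]) auto
next
  case False
  then have s: "0 < sinh (hdist p r)" using hdist_nonneg[OF p r] by simp
  define v where "v = (sinh t / sinh (hdist p r)) *\<^sub>R hvec p r"
  have nv: "norm v = sinh t" using s hvec_norm[OF r p] t by (simp add: v_def)
  obtain q where q: "q \<in> H3" "hvec p q = v" "hcosh p q = sqrt (1 + (norm v)\<^sup>2)" using hvec_surj[OF p] by blast
  have "hcosh p q = cosh t" unfolding q(3) nv using cosh_square_eq[of t] by (metis add.commute cosh_real_nonneg real_sqrt_unique)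
  then have d1: "hdist p q = t" using hdist_eqI p q t by blast
  have "hcosh q r = cosh t * hcosh p r - inner v (hvec p r)"
    using law_of_cosines[OF q(1) p r] q(2) \<open>hcosh p q = cosh t\<close> by simp
  also have "inner v (hvec p r) = sinh t * sinh (hdist p r)"
    using hvec_norm[OF r p] s by (simp add: v_def power2_norm_eq_inner[symmetric] power2_eq_square)
  finally have "hcosh q r = cosh (hdist p r - t)" using p r by (simp add: cosh_diff cosh_hdist)
  then have "hdist q r = hdist p r - t" using hdist_eqI q r t by simp
  then show ?thesis using q d1 by blast
qed

section \<open>Ptolemy's inequality and hyperbolicity of hyperbolic three-space\<close>

lemma ptolemy_origin:
  fixes x y w :: "'a::real_inner"
  shows "norm x * norm (y - w) \<le> norm y * norm (x - w) + norm w * norm (x - y)"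
proof (cases "x = 0 \<or> y = 0 \<or> w = 0")
  case True
  then show ?thesis by (auto simp: norm_minus_commute)
next
  case False
  \<comment> \<open>Inversion in the unit sphere divides the distance of a and b by the product of
    their norms, so Ptolemy's inequality with one point at the origin is the triangle inequality for
    the images of the other three.\<close>
  define i where "i a = a /\<^sub>R (norm a)\<^sup>2" for a :: 'a
  have ii: "norm (i a - i b) * (norm a * norm b) = norm (a - b)" if "a \<noteq> 0" "b \<noteq> 0" for a b
  proof -
    have na: "norm a > 0" "norm b > 0" using that by auto
    have "(norm (i a - i b))\<^sup>2 = inner (i a) (i a) - 2 * inner (i a) (i b) + inner (i b) (i b)"
      by (simp add: power2_norm_eq_inner inner_diff inner_commute)
    also have "\<dots> = 1 / (norm a)\<^sup>2 - 2 * (inner a b / ((norm a)\<^sup>2 * (norm b)\<^sup>2)) + 1 / (norm b)\<^sup>2"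
    proof -
      have "inner (i a) (i a) = 1 / (norm a)\<^sup>2" "inner (i b) (i b) = 1 / (norm b)\<^sup>2"
        using na by (simp_all add: i_def dot_square_norm power2_eq_square field_simps)
      moreover have "inner (i a) (i b) = inner a b / ((norm a)\<^sup>2 * (norm b)\<^sup>2)"
        by (simp add: i_def divide_inverse)
      ultimately show ?thesis by simp
    qed
    also have "1 / (norm a)\<^sup>2 - 2 * (inner a b / ((norm a)\<^sup>2 * (norm b)\<^sup>2)) + 1 / (norm b)\<^sup>2
        = ((norm a)\<^sup>2 - 2 * inner a b + (norm b)\<^sup>2) / (norm a * norm b)\<^sup>2"
      using na by (simp add: field_simps power_mult_distrib)
    also have "(norm a)\<^sup>2 - 2 * inner a b + (norm b)\<^sup>2 = (norm (a - b))\<^sup>2"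
      by (simp add: power2_norm_eq_inner inner_diff inner_commute)
    finally have "(norm (i a - i b))\<^sup>2 = (norm (a - b) / (norm a * norm b))\<^sup>2" by (simp add: power_divide)
    then have "norm (i a - i b) = norm (a - b) / (norm a * norm b)"
      using na by (simp add: power2_eq_iff_nonneg)
    then show ?thesis using na by simp
  qed
  have "norm (i y - i w) \<le> norm (i x - i y) + norm (i x - i w)"
    using norm_triangle_ineq[of "i y - i x" "i x - i w"] by (simp add: norm_minus_commute)
  then have "norm (i y - i w) * (norm x * norm y * norm w) \<le> (norm (i x - i y) + norm (i x - i w)) * (norm x * norm y * norm w)"
    by (intro mult_right_mono) auto
  then have "norm x * (norm (i y - i w) * (norm y * norm w)) \<le> norm w * (norm (i x - i y) * (norm x * norm y)) + norm y * (norm (i x - i w) * (norm x * norm w))"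
    by (simp add: algebra_simps)
  then show ?thesis using False by (simp add: ii)
qed

lemma ptolemy:
  fixes p q r s :: "'a::real_inner"
  shows "dist p q * dist r s \<le> dist p r * dist q s + dist p s * dist q r"
  using ptolemy_origin[of "q - p" "r - p" "s - p"] by (simp add: dist_norm norm_minus_commute)

lemma sinh_half_hdist:
  assumes "p \<in> H3" "q \<in> H3"
  shows "sinh (hdist p q / 2) = dist p q / (2 * sqrt (snd p) * sqrt (snd q))"
proof -
  have pos: "snd p > 0" "snd q > 0" using assms by (auto simp: H3_def)
  have "cosh (hdist p q) = 2 * (sinh (hdist p q / 2))\<^sup>2 + 1"
    using cosh_add[of "hdist p q / 2" "hdist p q / 2"] cosh_square_eq[of "hdist p q / 2"]
    by (simp add: power2_eq_square)
  then have "2 * (sinh (hdist p q / 2))\<^sup>2 = hcosh p q - 1" using cosh_hdist assms by simp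
  then have "(sinh (hdist p q / 2))\<^sup>2 = (dist p q)\<^sup>2 / (4 * snd p * snd q)"
    by (simp add: hcosh_def dist_prod_def dist_norm)
  also have "\<dots> = (dist p q / (2 * sqrt (snd p) * sqrt (snd q)))\<^sup>2"
    using pos by (simp add: power_divide power_mult_distrib)
  finally show ?thesis using hdist_nonneg[OF assms] pos by (subst (asm) power2_eq_iff_nonneg) auto
qed

text \<open>Every term of Ptolemy's inequality involves each of the four points once, so the heights
  in \<open>sinh_half_hdist\<close> contribute the same factor to all terms.\<close>

lemma sinh_half_ptolemy:
  assumes "p \<in> H3" "q \<in> H3" "r \<in> H3" "s \<in> H3"
  shows "sinh (hdist p q / 2) * sinh (hdist r s / 2) \<le>
     sinh (hdist p r / 2) * sinh (hdist q s / 2) + sinh (hdist p s / 2) * sinh (hdist q r / 2)"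
proof -
  have pos: "snd p > 0" "snd q > 0" "snd r > 0" "snd s > 0" using assms by (auto simp: H3_def)
  define N where "N = 4 * (sqrt (snd p) * sqrt (snd q) * sqrt (snd r) * sqrt (snd s))"
  have "dist p q * dist r s / N \<le> (dist p r * dist q s + dist p s * dist q r) / N"
    using pos by (intro divide_right_mono ptolemy) (auto simp: N_def)
  then show ?thesis unfolding sinh_half_hdist[OF assms(1,2)] sinh_half_hdist[OF assms(3,4)] sinh_half_hdist[OF assms(1,3)]
    sinh_half_hdist[OF assms(2,4)] sinh_half_hdist[OF assms(1,4)] sinh_half_hdist[OF assms(2,3)] N_def
    by (simp add: add_divide_distrib mult_ac)
qed

lemma sinh_ge_exp_quarter:
  fixes x :: real
  assumes "1 \<le> 2 * x"
  shows "exp x / 4 \<le> sinh x"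
proof -
  have "2 \<le> exp (2 * x)" using exp_ge_add_one_self[of "2 * x"] assms by linarith
  then have "2 * exp (- x) \<le> exp (2 * x) * exp (- x)" by (intro mult_right_mono) auto
  also have "\<dots> = exp x" by (simp add: exp_add[symmetric])
  finally show ?thesis by (simp add: sinh_def)
qed

lemma hdist_four_point:
  assumes X: "p \<in> H3" "q \<in> H3" "r \<in> H3" "s \<in> H3"
  shows "hdist p q + hdist r s \<le> max (hdist p r + hdist q s) (hdist p s + hdist q r) + 2 * ln 8"
proof -
  have "exp (1::real) \<le> 8" using exp_le by linarith
  then have l8: "1 \<le> ln (8::real)" by (subst ln_ge_iff) auto
  consider "hdist p q \<le> 1" | "hdist r s \<le> 1" | "1 < hdist p q" "1 < hdist r s" by linarith
  then show ?thesis
  proof cases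
    case 1
    then show ?thesis using hdist_triangle[OF X(3,1,4)] hdist_triangle[OF X(1,2,4)] hdist_sym[of r p] l8 by linarith
  next
    case 2
    then show ?thesis using hdist_triangle[OF X(1,3,2)] hdist_triangle[OF X(3,4,2)] hdist_sym[of s q] l8 by linarith
  next
    case 3
    let ?M = "max (hdist p r + hdist q s) (hdist p s + hdist q r)"
    have sl: "sinh x * sinh y \<le> exp (x + y) / 4" if "0 \<le> x" "0 \<le> y" for x y :: real
    proof -
      have "sinh x \<le> exp x / 2" "sinh y \<le> exp y / 2" by (simp_all add: sinh_def)
      then have "sinh x * sinh y \<le> (exp x / 2) * (exp y / 2)" using that by (intro mult_mono) auto
      then show ?thesis by (simp add: exp_add)
    qed
    have "exp (hdist p q / 2) / 4 \<le> sinh (hdist p q / 2)" "exp (hdist r s / 2) / 4 \<le> sinh (hdist r s / 2)"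
      using sinh_ge_exp_quarter[of "hdist p q / 2"] sinh_ge_exp_quarter[of "hdist r s / 2"] 3 by auto
    then have "exp (hdist p q / 2) / 4 * (exp (hdist r s / 2) / 4) \<le> sinh (hdist p q / 2) * sinh (hdist r s / 2)"
      using hdist_nonneg[OF X(1,2)] by (intro mult_mono) auto
    also have "\<dots> \<le> sinh (hdist p r / 2) * sinh (hdist q s / 2) + sinh (hdist p s / 2) * sinh (hdist q r / 2)"
      by (rule sinh_half_ptolemy[OF X])
    also have "\<dots> \<le> exp (hdist p r / 2 + hdist q s / 2) / 4 + exp (hdist p s / 2 + hdist q r / 2) / 4"
      using X by (intro add_mono sl) (auto intro: hdist_nonneg)
    also have "\<dots> \<le> exp (?M / 2) / 4 + exp (?M / 2) / 4" by (intro add_mono divide_right_mono) auto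
    finally have "exp ((hdist p q + hdist r s) / 2) \<le> 8 * exp (?M / 2)" by (simp add: exp_add add_divide_distrib)
    also have "\<dots> = exp (?M / 2 + ln 8)" by (simp add: exp_add)
    finally have "(hdist p q + hdist r s) / 2 \<le> ?M / 2 + ln 8" by simp
    then show ?thesis by simp
  qed
qed

interpretation H3: gromov_hyperbolic H3 hdist "ln 8"
proof
  fix w x y z assume "w \<in> H3" "x \<in> H3" "y \<in> H3" "z \<in> H3"
  then show "hdist w y + hdist x z \<le> hdist w x + hdist y z + 2 * ln 8 \<or> hdist w y + hdist x z \<le> hdist w z + hdist x y + 2 * ln 8"
    using hdist_four_point[of w y x z] hdist_sym[of y x] by (auto simp: max_def split: if_splits)
next
  fix x y t assume "x \<in> H3" "y \<in> H3" "0 \<le> t" "t \<le> hdist x y"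
  then show "\<exists>z\<in>H3. hdist x z + hdist z y = hdist x y \<and> \<bar>hdist x z - t\<bar> \<le> 1"
    using hseg_point[of x y t] by force
qed (use hdist_nonneg hdist_refl hdist_sym hdist_triangle in auto)

lemma hball_compact:
  assumes x: "x \<in> H3"
  shows "compact {p \<in> H3. hdist x p \<le> r}"
proof (cases "0 \<le> r")
  case False
  then have "\<not> hdist x p \<le> r" if "p \<in> H3" for p using hdist_nonneg[OF x that] by linarith
  then have "{p \<in> H3. hdist x p \<le> r} = {}" by blast
  then show ?thesis by (simp only: compact_empty)
next
  case True
  obtain z0 u where x': "x = (z0, u)" by force
  have u: "u > 0" using x x' by (simp add: H3_iff)
  define k where "k = cosh r"
  have k: "k \<ge> 1" by (simp add: k_def cosh_real_ge_1)
  have iff: "hdist x (z, s) \<le> r \<longleftrightarrow> (cmod (z0 - z))\<^sup>2 + s\<^sup>2 + u\<^sup>2 \<le> k * (2 * u * s)" if "s > 0" for z s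
    using hdist_le_iff[OF x _ True, of "(z, s)"] hcosh_alt[OF x, of "(z, s)"] that u
    by (simp add: k_def x' H3_iff pos_divide_le_eq add.commute add.left_commute)
  \<comment> \<open>The bound \<open>u / (2 * k)\<close> on the height follows from the quadratic
    inequality. It replaces the open condition of positive height, so that the set is visibly closed
    in the ambient vector space.\<close>
  have eq: "{p \<in> H3. hdist x p \<le> r} = {p. u / (2 * k) \<le> snd p \<and> (cmod (z0 - fst p))\<^sup>2 + (snd p)\<^sup>2 + u\<^sup>2 \<le> k * (2 * u * snd p)}"
  proof (intro equalityI subsetI)
    fix p :: "complex \<times> real" assume "p \<in> {p \<in> H3. hdist x p \<le> r}"
    moreover obtain z s where p: "p = (z, s)" by force
    ultimately have s: "s > 0" and le: "(cmod (z0 - z))\<^sup>2 + s\<^sup>2 + u\<^sup>2 \<le> k * (2 * u * s)"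
      using iff by (auto simp: H3_iff)
    have "u\<^sup>2 \<le> k * (2 * u * s)" using le by (smt (verit) zero_le_power2)
    then have "u * u \<le> u * (2 * k * s)" by (simp add: power2_eq_square algebra_simps)
    then have "u \<le> 2 * k * s" using u by simp
    then have "u / (2 * k) \<le> s" using k by (simp add: pos_divide_le_eq mult_ac)
    then show "p \<in> {p. u / (2 * k) \<le> snd p \<and> (cmod (z0 - fst p))\<^sup>2 + (snd p)\<^sup>2 + u\<^sup>2 \<le> k * (2 * u * snd p)}"
      using le p by simp
  next
    fix p assume "p \<in> {p. u / (2 * k) \<le> snd p \<and> (cmod (z0 - fst p))\<^sup>2 + (snd p)\<^sup>2 + u\<^sup>2 \<le> k * (2 * u * snd p)}"
    moreover obtain z s where p: "p = (z, s)" by force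
    moreover have "0 < u / (2 * k)" using u k by simp
    ultimately show "p \<in> {p \<in> H3. hdist x p \<le> r}" using iff[of s z] by (auto simp: H3_iff)
  qed
  have "closed {p :: complex \<times> real. u / (2 * k) \<le> snd p \<and> (cmod (z0 - fst p))\<^sup>2 + (snd p)\<^sup>2 + u\<^sup>2 \<le> k * (2 * u * snd p)}"
    by (intro closed_Collect_conj closed_Collect_le continuous_intros)
  moreover have "bounded {p :: complex \<times> real. u / (2 * k) \<le> snd p \<and> (cmod (z0 - fst p))\<^sup>2 + (snd p)\<^sup>2 + u\<^sup>2 \<le> k * (2 * u * snd p)}"
  proof -
    have "dist (z0, 0) p \<le> 2 * k * u" if h: "u / (2 * k) \<le> snd p" "(cmod (z0 - fst p))\<^sup>2 + (snd p)\<^sup>2 + u\<^sup>2 \<le> k * (2 * u * snd p)" for p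
    proof -
      have "0 < u / (2 * k)" using u k by simp
      then have s: "snd p > 0" using h by linarith
      have "k * (2 * u * snd p) = 2 * k * u * snd p" by simp
      then have a: "(cmod (z0 - fst p))\<^sup>2 + (snd p)\<^sup>2 \<le> 2 * k * u * snd p"
        using h(2) zero_le_power2[of u] by linarith
      then have "(snd p)\<^sup>2 \<le> 2 * k * u * snd p" using zero_le_power2[of "cmod (z0 - fst p)"] by linarith
      then have "snd p \<le> 2 * k * u" using s by (simp add: power2_eq_square)
      then have "2 * k * u * snd p \<le> (2 * k * u) * (2 * k * u)" using k u by (intro mult_left_mono) auto
      then have "(cmod (z0 - fst p))\<^sup>2 + (snd p)\<^sup>2 \<le> (2 * k * u)\<^sup>2"
        using a unfolding power2_eq_square[of "2 * k * u"] by linarith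
      then have "sqrt ((cmod (z0 - fst p))\<^sup>2 + (snd p)\<^sup>2) \<le> 2 * k * u" using k u by (intro real_le_lsqrt) auto
      then show ?thesis by (simp add: dist_prod_def dist_norm)
    qed
    then show ?thesis unfolding bounded_def by blast
  qed
  ultimately show ?thesis unfolding eq using compact_eq_bounded_closed by blast
qed

lemma compact_hdist_bounded:
  assumes "compact K" "K \<subseteq> H3" "x \<in> H3"
  shows "\<exists>r\<ge>0. \<forall>p\<in>K. hdist x p \<le> r"
proof -
  have "continuous_on K (\<lambda>p. hcosh x p)"
    unfolding hcosh_def using assms by (intro continuous_intros) (auto simp: H3_def)
  then have "bounded ((\<lambda>p. hcosh x p) ` K)" using assms(1) compact_continuous_image compact_imp_bounded by blast
  then obtain b where b: "\<And>p. p \<in> K \<Longrightarrow> hcosh x p \<le> b" unfolding bounded_iff by (metis abs_le_D1 imageI real_norm_def)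
  have "hdist x p \<le> arcosh (max 1 b)" if "p \<in> K" for p
    using hdist_le_iff[of x p "arcosh (max 1 b)"] b[OF that] assms that by (auto simp: arcosh_nonneg_real cosh_arcosh_real)
  then show ?thesis by (intro exI[of _ "arcosh (max 1 b)"]) (auto simp: arcosh_nonneg_real)
qed

section \<open>The action of \<open>PSL(2,C)\<close>\<close>

text \<open>The point \<open>(z, t)\<close> corresponds to the positive Hermitian matrix
  \<open>[[hA, hB], [cnj hB, hD]]\<close> of determinant 1, on which \<open>M\<close> acts by \<open>X \<mapsto> M X M*\<close>.\<close>
definition hA :: "complex \<times> real \<Rightarrow> complex" where
  "hA p = (fst p * cnj (fst p) + complex_of_real (snd p) * complex_of_real (snd p)) / complex_of_real (snd p)"
definition hB :: "complex \<times> real \<Rightarrow> complex" where "hB p = fst p / complex_of_real (snd p)"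
definition hD :: "complex \<times> real \<Rightarrow> complex" where "hD p = 1 / complex_of_real (snd p)"

text \<open>The symmetric bilinear form whose quadratic form is the determinant, evaluated at the
  Hermitian matrices of p and q. Isometry of the action thereby becomes multiplicativity of
  determinants.\<close>

lemma hcosh_herm:
  assumes "p \<in> H3" "q \<in> H3"
  shows "complex_of_real (hcosh p q) = (hA p * hD q + hD p * hA q - hB p * cnj (hB q) - cnj (hB p) * hB q) / 2"
proof -
  obtain z s where p: "p = (z, s)" by force
  obtain w t where q: "q = (w, t)" by force
  have st: "s \<noteq> 0" "t \<noteq> 0" using assms p q by (auto simp: H3_iff)
  have n: "complex_of_real ((cmod (z - w))\<^sup>2) = (z - w) * cnj (z - w)"
    by (rule complex_norm_square)
  show ?thesis
    unfolding hcosh_alt[OF assms] unfolding p q hA_def hB_def hD_def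
    unfolding of_real_divide of_real_add of_real_mult fst_conv snd_conv n
    using st by (simp add: field_simps power2_eq_square)
qed

lemma herm_inj: "\<lbrakk>p \<in> H3; q \<in> H3; hB p = hB q; hD p = hD q\<rbrakk> \<Longrightarrow> p = q"
  by (auto simp: hB_def hD_def H3_def prod_eq_iff field_simps)

lemma det2: "det (M :: complex^2^2) = M$1$1 * M$2$2 - M$1$2 * M$2$1" by (rule det_2)

lemma mob_denominator:
  fixes M :: "complex^2^2"
  assumes "det M = 1" "0 < t"
  shows "0 < (cmod (M$2$1 * z + M$2$2))\<^sup>2 + (cmod (M$2$1))\<^sup>2 * t\<^sup>2"
proof (cases "M$2$1 = 0")
  case True
  then have "M$2$2 \<noteq> 0" using assms(1) by (auto simp: det2)
  then show ?thesis using True by simp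
next
  case False
  then show ?thesis using assms(2) by (simp add: add_nonneg_pos)
qed

lemma mob_H3: "\<lbrakk>det M = 1; p \<in> H3\<rbrakk> \<Longrightarrow> mob M p \<in> H3"
  using mob_denominator[of M "snd p" "fst p"] by (simp add: H3_def mob_def Let_def)

lemma herm_mob:
  assumes M: "det M = 1" and p: "p \<in> H3"
  defines "a \<equiv> M$1$1" and "b \<equiv> M$1$2" and "c \<equiv> M$2$1" and "d \<equiv> M$2$2"
  shows "hD (mob M p) = c * hA p * cnj c + c * hB p * cnj d + d * cnj (hB p) * cnj c + d * hD p * cnj d"
    and "hB (mob M p) = a * hA p * cnj c + a * hB p * cnj d + b * cnj (hB p) * cnj c + b * hD p * cnj d"
    and "hA (mob M p) = a * hA p * cnj a + a * hB p * cnj b + b * cnj (hB p) * cnj a + b * hD p * cnj b"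
proof -
  obtain z t where zt: "p = (z, t)" by force
  have t: "t > 0" using p zt by (simp add: H3_iff)
  define T where "T = complex_of_real t"
  have T: "T \<noteq> 0" "cnj T = T" using t by (auto simp: T_def)
  have det: "a * d - b * c = 1" using M unfolding a_def b_def c_def d_def det2 by simp
  define D where "D = (cmod (c * z + d))\<^sup>2 + (cmod c)\<^sup>2 * t\<^sup>2"
  have D0: "D > 0" unfolding D_def c_def d_def by (rule mob_denominator[OF M t])
  define u where "u = a * z + b"
  define v where "v = c * z + d"
  define DD where "DD = v * cnj v + c * cnj c * (T * T)"
  have DD: "complex_of_real D = DD"
    unfolding D_def DD_def T_def v_def of_real_add of_real_mult complex_norm_square by (simp add: power2_eq_square)
  then have DD0: "DD \<noteq> 0" "cnj DD = DD" using D0 by (auto simp flip: DD)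
  define N where "N = u * cnj v + a * cnj c * (T * T)"
  have mob: "mob M p = (N / DD, t / D)"
    unfolding mob_def Let_def zt fst_conv snd_conv a_def[symmetric] b_def[symmetric] c_def[symmetric] d_def[symmetric]
      D_def[symmetric] DD N_def u_def v_def T_def by (simp add: power2_eq_square)
  have sm: "complex_of_real (t / D) = T / DD" by (simp add: T_def DD)
  have A: "hA p = (z * cnj z + T * T) / T" and B: "hB p = z / T" and Dp: "hD p = 1 / T"
    by (simp_all add: hA_def hB_def hD_def zt T_def)
  have "hD (mob M p) = DD / T" unfolding hD_def mob snd_conv sm by simp
  also have "\<dots> = c * hA p * cnj c + c * hB p * cnj d + d * cnj (hB p) * cnj c + d * hD p * cnj d"
    unfolding A B Dp DD_def v_def using T by (simp add: field_simps)
  finally show "hD (mob M p) = c * hA p * cnj c + c * hB p * cnj d + d * cnj (hB p) * cnj c + d * hD p * cnj d" .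
  have "hB (mob M p) = N / T" unfolding hB_def mob snd_conv fst_conv sm using DD0 by simp
  also have "\<dots> = a * hA p * cnj c + a * hB p * cnj d + b * cnj (hB p) * cnj c + b * hD p * cnj d"
    unfolding A B Dp N_def u_def v_def using T by (simp add: field_simps)
  finally show "hB (mob M p) = a * hA p * cnj c + a * hB p * cnj d + b * cnj (hB p) * cnj c + b * hD p * cnj d" .
  \<comment> \<open>This is the determinant of M. It turns the difference of \<open>NA * DD\<close>
    and \<open>N * cnj N\<close> into \<open>T * T\<close>, that is, it says that the transformed
    Hermitian matrix again has determinant 1.\<close>
  have uv: "u * c - a * v = - 1" using det by (simp add: u_def v_def algebra_simps)
  define NA where "NA = u * cnj u + a * cnj a * (T * T)"
  have "NA * DD - N * cnj N = T * T * ((u * c - a * v) * (cnj u * cnj c - cnj a * cnj v))"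
    unfolding NA_def DD_def N_def using T by (simp add: algebra_simps)
  also have "cnj u * cnj c - cnj a * cnj v = cnj (u * c - a * v)" by simp
  finally have NAD: "N * cnj N + T * T = NA * DD" unfolding uv by (simp add: algebra_simps)
  have "hA (mob M p) = ((N / DD) * cnj (N / DD) + (T / DD) * (T / DD)) / (T / DD)"
    unfolding hA_def mob snd_conv fst_conv sm by simp
  also have "\<dots> = (N * cnj N + T * T) / (T * DD)" using DD0 T by (simp add: field_simps)
  also have "\<dots> = NA / T" unfolding NAD using DD0 T by simp
  also have "\<dots> = a * hA p * cnj a + a * hB p * cnj b + b * cnj (hB p) * cnj a + b * hD p * cnj b"
    unfolding A B Dp NA_def u_def v_def using T by (simp add: field_simps)
  finally show "hA (mob M p) = a * hA p * cnj a + a * hB p * cnj b + b * cnj (hB p) * cnj a + b * hD p * cnj b" .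
qed

lemma hA_real: "cnj (hA p) = hA p" and hD_real: "cnj (hD p) = hD p"
  by (simp_all add: hA_def hD_def)

text \<open>The polarised determinant of M X M* picks up det M and its conjugate. Conjugates are
  separate variables here, so that this is a polynomial identity.\<close>

lemma herm_form_invariant:
  fixes a b c d a' b' c' d' A B C D A2 B2 C2 D2 :: complex
  shows "(a*A*a' + a*B*b' + b*C*a' + b*D*b') * (c*A2*c' + c*B2*d' + d*C2*c' + d*D2*d')
       + (c*A*c' + c*B*d' + d*C*c' + d*D*d') * (a*A2*a' + a*B2*b' + b*C2*a' + b*D2*b')
       - (a*A*c' + a*B*d' + b*C*c' + b*D*d') * (c*A2*a' + c*B2*b' + d*C2*a' + d*D2*b')
       - (c*A*a' + c*B*b' + d*C*a' + d*D*b') * (a*A2*c' + a*B2*d' + b*C2*c' + b*D2*d')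
     = (a*d - b*c) * (a'*d' - b'*c') * (A*D2 + D*A2 - B*C2 - C*B2)"
  by (simp add: algebra_simps)

lemma mob_isometry:
  assumes M: "det M = 1" and p: "p \<in> H3" and q: "q \<in> H3"
  shows "hdist (mob M p) (mob M q) = hdist p q"
proof -
  define a where "a = M$1$1" 
  define b where "b = M$1$2"
  define c where "c = M$2$1"
  define d where "d = M$2$2"
  have det: "a * d - b * c = 1" using M unfolding a_def b_def c_def d_def det2 by simp
  then have det': "cnj a * cnj d - cnj b * cnj c = 1" by (metis complex_cnj_diff complex_cnj_mult complex_cnj_one)
  note hm = herm_mob[OF M p, folded a_def b_def c_def d_def] herm_mob[OF M q, folded a_def b_def c_def d_def]
  have cB: "cnj (hB (mob M r)) = c * hA r * cnj a + c * hB r * cnj b + d * cnj (hB r) * cnj a + d * hD r * cnj b"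
    if "r \<in> H3" for r
    unfolding herm_mob(2)[OF M that, folded a_def b_def c_def d_def] by (simp add: hA_real hD_real algebra_simps)
  have "hA (mob M p) * hD (mob M q) + hD (mob M p) * hA (mob M q) - hB (mob M p) * cnj (hB (mob M q)) - cnj (hB (mob M p)) * hB (mob M q)
      = hA p * hD q + hD p * hA q - hB p * cnj (hB q) - cnj (hB p) * hB q"
    unfolding cB[OF p] cB[OF q] unfolding hm
    by (rule trans[OF herm_form_invariant]) (simp add: det det')
  then have "complex_of_real (hcosh (mob M p) (mob M q)) = complex_of_real (hcosh p q)"
    unfolding hcosh_herm[OF mob_H3[OF M p] mob_H3[OF M q]] hcosh_herm[OF p q] by (rule arg_cong)
  then have "hcosh (mob M p) (mob M q) = hcosh p q" by (simp only: of_real_eq_iff)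
  then show ?thesis by (simp add: hdist_def hcosh_def)
qed

lemma mat2_mult:
  fixes M N :: "complex^2^2"
  shows "(M ** N)$i$j = M$i$1 * N$1$j + M$i$2 * N$2$j"
  by (simp add: matrix_matrix_mult_def sum_2)

lemma mob_mult:
  assumes M: "det M = 1" and N: "det N = 1" and p: "p \<in> H3"
  shows "mob (M ** N) p = mob M (mob N p)"
proof (rule herm_inj)
  have MN: "det (M ** N) = 1" using M N by (simp add: det_mul)
  have Np: "mob N p \<in> H3" using mob_H3 N p by blast
  show "mob (M ** N) p \<in> H3" "mob M (mob N p) \<in> H3" using mob_H3 MN M Np p by auto
  have cB: "cnj (hB (mob N p)) = N$2$1 * hA p * cnj (N$1$1) + N$2$1 * hB p * cnj (N$1$2) + N$2$2 * cnj (hB p) * cnj (N$1$1) + N$2$2 * hD p * cnj (N$1$2)"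
    unfolding herm_mob(2)[OF N p] by (simp add: hA_real hD_real algebra_simps)
  show "hB (mob (M ** N) p) = hB (mob M (mob N p))"
    unfolding herm_mob(2)[OF MN p] herm_mob(2)[OF M Np] cB herm_mob[OF N p] mat2_mult
    by (simp add: hA_real hD_real algebra_simps)
  show "hD (mob (M ** N) p) = hD (mob M (mob N p))"
    unfolding herm_mob(1)[OF MN p] herm_mob(1)[OF M Np] cB herm_mob[OF N p] mat2_mult
    by (simp add: hA_real hD_real algebra_simps)
qed

lemma mob_uminus: "mob (- M) p = mob M p"
proof -
  have n: "cmod (- (M$2$1 * fst p) - M$2$2) = cmod (M$2$1 * fst p + M$2$2)"
    using norm_minus_cancel[of "M$2$1 * fst p + M$2$2"] by simp
  show ?thesis unfolding mob_def Let_def by (simp add: n) (simp add: algebra_simps)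
qed

abbreviation pair :: "complex^2^2 \<Rightarrow> (complex^2^2) set" where "pair M \<equiv> {M, - M}"

lemma pact_pair: "pact (pair M) p = mob M p"
proof -
  have "(SOME N. N \<in> pair M) \<in> pair M" by (rule someI[of _ M]) simp
  then show ?thesis unfolding pact_def using mob_uminus[of M p] by auto
qed

lemma minus_mat_mult: "(- M) ** N = - (M ** N)" "M ** (- N) = - (M ** N)" for M N :: "complex^2^2"
  by (simp_all add: vec_eq_iff mat2_mult forall_2)

lemma det_minus2: "det (- M) = det (M :: complex^2^2)" by (simp add: det2)

lemma PSL2_mult: "pair M \<otimes>\<^bsub>PSL2\<^esub> pair N = pair (M ** N)"
  by (auto simp: PSL2_def minus_mat_mult) (metis minus_mat_mult minus_minus)+

lemma pair_eq: "pair M = pair N \<longleftrightarrow> M = N \<or> M = - N"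
  by (auto simp: doubleton_eq_iff)

lemma norm_mat2: "(norm (M :: complex^2^2))\<^sup>2 = (cmod (M$1$1))\<^sup>2 + (cmod (M$1$2))\<^sup>2 + (cmod (M$2$1))\<^sup>2 + (cmod (M$2$2))\<^sup>2"
  by (simp add: norm_vec_def L2_set_def sum_2 UNIV_2)

definition base :: "complex \<times> real" where "base = (0, 1)"

lemma base_H3: "base \<in> H3" by (simp add: base_def H3_iff)

text \<open>Half the trace of M M*. It converts displacement of the base point into matrix norm, and
  so links discreteness of the matrices with properness of the action.\<close>

lemma hcosh_base:
  assumes M: "det M = 1"
  shows "hcosh base (mob M base) = (norm M)\<^sup>2 / 2"
proof -
  have "complex_of_real (hcosh base (mob M base)) = (hD (mob M base) + hA (mob M base)) / 2"
    unfolding hcosh_herm[OF base_H3 mob_H3[OF M base_H3]] by (simp add: hA_def hB_def hD_def base_def)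
  also have "\<dots> = complex_of_real ((norm M)\<^sup>2 / 2)"
    unfolding herm_mob(1,3)[OF M base_H3] norm_mat2 of_real_add of_real_divide complex_norm_square
    by (simp add: hA_def hB_def hD_def base_def)
  finally show ?thesis by (simp only: of_real_eq_iff)
qed

lemma norm_le_of_hdist_base:
  assumes "det M = 1" "hdist base (mob M base) \<le> r"
  shows "norm M \<le> sqrt (2 * cosh r)"
proof -
  have H: "mob M base \<in> H3" using mob_H3 assms base_H3 by blast
  then have "0 \<le> r" using hdist_nonneg[OF base_H3 H] assms by linarith
  then have "(norm M)\<^sup>2 / 2 \<le> cosh r" using hdist_le_iff[OF base_H3 H] assms hcosh_base by simp
  then show ?thesis by (intro real_le_rsqrt) simp
qed

lemma hdist_base_le:
  assumes M: "det M = 1" and R: "norm M \<le> R" "1 \<le> R"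
  shows "hdist base (mob M base) \<le> 2 * ln R + 1"
proof -
  have H: "mob M base \<in> H3" using mob_H3 assms base_H3 by blast
  have r: "0 \<le> 2 * ln R + 1" using R by (simp add: add_nonneg_nonneg)
  have "2 \<le> exp (1::real)" using exp_ge_add_one_self[of 1] by simp
  have "(norm M)\<^sup>2 \<le> R\<^sup>2" using R by (intro power_mono) auto
  also have "\<dots> = exp (2 * ln R)" using R by (simp add: exp_double ln_ge_zero)
  finally have "(norm M)\<^sup>2 / 2 \<le> exp (2 * ln R) * exp 1 / 2" using \<open>2 \<le> exp (1::real)\<close>
    by (smt (verit) divide_right_mono exp_ge_zero mult_left_mono mult_cancel_left2)
  also have "\<dots> \<le> cosh (2 * ln R + 1)" by (simp add: cosh_def exp_add)
  finally show ?thesis using hdist_le_iff[OF base_H3 H r] hcosh_base[OF M] by simp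
qed

lemma norm_mat2_entry: "cmod (M$i$j) \<le> norm (M :: complex^2^2)"
  by (rule order_trans[OF Finite_Cartesian_Product.norm_nth_le Finite_Cartesian_Product.norm_nth_le])

lemma norm_mat2_sum: "norm (M :: complex^2^2) \<le> cmod (M$1$1) + cmod (M$1$2) + cmod (M$2$1) + cmod (M$2$2)"
proof -
  have "norm M \<le> norm (M$1) + norm (M$2)" unfolding norm_vec_def[of M] using L2_set_le_sum[of UNIV "\<lambda>i. norm (M$i)"] by (simp add: sum_2)
  have "norm (M$i) \<le> cmod (M$i$1) + cmod (M$i$2)" for i
    unfolding norm_vec_def[of "M$i"] using L2_set_le_sum[of UNIV "\<lambda>j. norm (M$i$j)"] by (simp add: sum_2)
  from add_mono[OF this[of 1] this[of 2]] show ?thesis using \<open>norm M \<le> norm (M$1) + norm (M$2)\<close> by linarith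
qed

lemma norm_mat2_mult:
  fixes M N :: "complex^2^2"
  shows "norm (M ** N) \<le> 8 * (norm M * norm N)"
proof -
  have "cmod ((M ** N)$i$j) \<le> 2 * (norm M * norm N)" for i j
  proof -
    have "cmod ((M ** N)$i$j) \<le> cmod (M$i$1) * cmod (N$1$j) + cmod (M$i$2) * cmod (N$2$j)"
      using norm_triangle_ineq[of "M$i$1 * N$1$j" "M$i$2 * N$2$j"] unfolding mat2_mult norm_mult .
    also have "\<dots> \<le> norm M * norm N + norm M * norm N"
      by (intro add_mono mult_mono norm_mat2_entry) auto
    finally show ?thesis by simp
  qed
  from add_mono[OF add_mono[OF add_mono[OF this[of 1 1] this[of 1 2]] this[of 2 1]] this[of 2 2]]
  show ?thesis using norm_mat2_sum[of "M ** N"] by linarith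
qed

section \<open>Representations\<close>

locale rep = cayley G S for G (structure) and S :: "'a set" +
  fixes \<rho> :: "'a \<Rightarrow> (complex^2^2) set"
  assumes rho_hom: "\<rho> \<in> hom G PSL2"
begin

text \<open>A lift to a matrix of determinant 1. Lifts cannot in general be chosen multiplicatively,
  so identities between them hold up to sign.\<close>

definition R :: "'a \<Rightarrow> complex^2^2" where "R g = (SOME M. \<rho> g = pair M \<and> det M = 1)"

lemma R: assumes "g \<in> carrier G" shows "\<rho> g = pair (R g)" "det (R g) = 1"
proof -
  have "\<rho> g \<in> carrier PSL2" using rho_hom assms by (auto simp: hom_def)
  then have "\<exists>M. \<rho> g = pair M \<and> det M = 1" by (auto simp: PSL2_def)
  then have "\<rho> g = pair (R g) \<and> det (R g) = 1" unfolding R_def by (rule someI_ex)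
  then show "\<rho> g = pair (R g)" "det (R g) = 1" by auto
qed

definition act :: "'a \<Rightarrow> complex \<times> real \<Rightarrow> complex \<times> real" where "act g = pact (\<rho> g)"

lemma act_mob: "g \<in> carrier G \<Longrightarrow> act g p = mob (R g) p"
  unfolding act_def using R(1)[of g] pact_pair[of "R g"] by simp

lemma R_mult:
  assumes "g \<in> carrier G" "h \<in> carrier G"
  shows "R (g \<otimes> h) = R g ** R h \<or> R (g \<otimes> h) = - (R g ** R h)"
proof -
  have "\<rho> (g \<otimes> h) = \<rho> g \<otimes>\<^bsub>PSL2\<^esub> \<rho> h" using rho_hom assms by (auto simp: hom_def)
  then have "pair (R (g \<otimes> h)) = pair (R g ** R h)"
    unfolding R(1)[OF assms(1)] R(1)[OF assms(2)] R(1)[OF m_closed[OF assms]] PSL2_mult .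
  then show ?thesis by (simp only: pair_eq)
qed

lemma act_H3: "\<lbrakk>g \<in> carrier G; p \<in> H3\<rbrakk> \<Longrightarrow> act g p \<in> H3"
  using act_mob[of g p] mob_H3[of "R g" p] R(2)[of g] by metis

lemma act_mult: "\<lbrakk>g \<in> carrier G; h \<in> carrier G; p \<in> H3\<rbrakk> \<Longrightarrow> act (g \<otimes> h) p = act g (act h p)"
proof -
  assume a: "g \<in> carrier G" "h \<in> carrier G" "p \<in> H3"
  have "mob (R (g \<otimes> h)) p = mob (R g ** R h) p"
    using R_mult[OF a(1,2)] mob_uminus[of "R g ** R h" p] by metis
  then show ?thesis
    using mob_mult[OF R(2)[OF a(1)] R(2)[OF a(2)] a(3)] act_mob[of "g \<otimes> h" p] act_mob[OF a(1)] act_mob[OF a(2)] a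
    by (metis m_closed)
qed

lemma act_isometry: "\<lbrakk>g \<in> carrier G; p \<in> H3; q \<in> H3\<rbrakk> \<Longrightarrow> hdist (act g p) (act g q) = hdist p q"
  using mob_isometry[of "R g" p q] R(2)[of g] act_mob[of g] by metis

lemma act_one: "p \<in> H3 \<Longrightarrow> act \<one> p = p"
proof -
  assume p: "p \<in> H3"
  have q: "act \<one> p \<in> H3" using act_H3 p by blast
  have "act \<one> (act \<one> p) = act \<one> p" using act_mult[of \<one> \<one> p] p by simp
  moreover have "hdist (act \<one> (act \<one> p)) (act \<one> p) = hdist (act \<one> p) p" using act_isometry[OF one_closed q p] .
  ultimately show ?thesis using hdist_eq_0[OF q p] hdist_refl[of "act \<one> p"] by metis
qed

lemma act_inv: "\<lbrakk>g \<in> carrier G; p \<in> H3\<rbrakk> \<Longrightarrow> act (inv g) (act g p) = p" "\<lbrakk>g \<in> carrier G; p \<in> H3\<rbrakk> \<Longrightarrow> act g (act (inv g) p) = p"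
  using act_mult[of "inv g" g p] act_mult[of g "inv g" p] act_one[of p] by simp_all

lemma R_one: "R \<one> = mat 1 \<or> R \<one> = - mat 1"
proof -
  define M where "M = R \<one>"
  have d: "det M = 1" using R(2)[OF one_closed] M_def by simp
  have MM: "M = M ** M \<or> M = - (M ** M)" using R_mult[of \<one> \<one>] M_def by simp
  have "invertible M" using d by (simp add: invertible_det_nz)
  then obtain N where "N ** M = mat 1" unfolding invertible_def by blast
  then have "N ** (M ** M) = M" by (simp add: matrix_mul_assoc)
  moreover have "N ** M = N ** (M ** M) \<or> N ** M = - (N ** (M ** M))"
    using MM minus_mat_mult(2)[of N "M ** M"] by metis
  ultimately show ?thesis using \<open>N ** M = mat 1\<close> unfolding M_def[symmetric] by auto
qed

lemma rho_one: "\<rho> \<one> = \<one>\<^bsub>PSL2\<^esub>"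
proof -
  have "pair (R \<one>) = pair (mat 1)" using R_one pair_eq[of "R \<one>" "mat 1"] by metis
  then show ?thesis using R(1)[OF one_closed] by (simp add: PSL2_def)
qed

lemma rho_eq_one_iff: "g \<in> carrier G \<Longrightarrow> \<rho> g = \<one>\<^bsub>PSL2\<^esub> \<longleftrightarrow> R g = mat 1 \<or> R g = - mat 1"
proof -
  assume "g \<in> carrier G"
  then have "\<rho> g = pair (R g)" by (rule R(1))
  moreover have "\<one>\<^bsub>PSL2\<^esub> = pair (mat 1)" by (simp add: PSL2_def)
  ultimately show ?thesis using pair_eq[of "R g" "mat 1"] by metis
qed

end

section \<open>Extraction of pointwise eventually constant subsequences\<close>

lemma finite_range_convergent:
  fixes X :: "nat \<Rightarrow> 'b::t1_space"
  assumes "X \<longlonglongrightarrow> x" "finite (range X)"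
  shows "eventually (\<lambda>n. X n = x) sequentially"
proof -
  have "open (- (range X - {x}))" using assms(2) by (intro open_Compl finite_imp_closed) auto
  then have "eventually (\<lambda>n. X n \<in> - (range X - {x})) sequentially"
    using assms(1) topological_tendstoD by fastforce
  then show ?thesis by (rule eventually_mono) auto
qed

text \<open>The values are injected into the interval from 0 to 1, where the diagonal argument for
  bounded real functions gives pointwise convergence. With finitely many values at each index,
  convergence means being eventually constant.\<close>

lemma diagonal_subsequence:
  fixes \<gamma> :: "nat \<Rightarrow> int \<Rightarrow> 'a"
  assumes fin: "\<And>i. finite (range (\<lambda>n. \<gamma> n i))"
  shows "\<exists>k l. strict_mono (k :: nat \<Rightarrow> nat) \<and> (\<forall>i. eventually (\<lambda>n. \<gamma> (k n) i = l i) sequentially)"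
proof -
  define U where "U = (\<Union>i. range (\<lambda>n. \<gamma> n i))"
  have cU: "countable U" unfolding U_def using fin by (intro countable_UN) (auto intro: countable_finite)
  define \<phi> where "\<phi> x = 1 / (1 + real (to_nat_on U x))" for x
  have inj: "\<phi> x = \<phi> y \<longleftrightarrow> x = y" if "x \<in> U" "y \<in> U" for x y
    using to_nat_on_inj[OF cU that] by (simp add: \<phi>_def)
  have in_U: "\<gamma> n i \<in> U" for n i unfolding U_def by blast
  have b: "norm (\<phi> (\<gamma> n i)) \<le> 1" for n i by (simp add: \<phi>_def)
  have cnt: "countable (UNIV :: int set)" by simp
  obtain k where k: "strict_mono (k :: nat \<Rightarrow> nat)" "\<And>i. \<exists>l. (\<lambda>n. \<phi> (\<gamma> (k n) i)) \<longlonglongrightarrow> l"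
    using function_convergent_subsequence[OF cnt, of "\<lambda>n i. \<phi> (\<gamma> n i)" 1] b by (metis UNIV_I)
  have "\<exists>x. eventually (\<lambda>n. \<gamma> (k n) i = x) sequentially" for i
  proof -
    obtain l where l: "(\<lambda>n. \<phi> (\<gamma> (k n) i)) \<longlonglongrightarrow> l" using k by blast
    have "range (\<lambda>n. \<phi> (\<gamma> (k n) i)) \<subseteq> \<phi> ` range (\<lambda>n. \<gamma> n i)" by auto
    then have "finite (range (\<lambda>n. \<phi> (\<gamma> (k n) i)))" using fin finite_surj by blast
    then have ev: "eventually (\<lambda>n. \<phi> (\<gamma> (k n) i) = l) sequentially" using finite_range_convergent[OF l] by blast
    then obtain N where N: "\<And>n. n \<ge> N \<Longrightarrow> \<phi> (\<gamma> (k n) i) = l" unfolding eventually_sequentially by blast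
    have "\<gamma> (k n) i = \<gamma> (k N) i" if "n \<ge> N" for n
    proof -
      have "\<phi> (\<gamma> (k n) i) = \<phi> (\<gamma> (k N) i)" using N[OF that] N[of N] by simp
      then show ?thesis by (simp only: inj[OF in_U in_U])
    qed
    then show ?thesis unfolding eventually_sequentially by blast
  qed
  then obtain l where "\<And>i. eventually (\<lambda>n. \<gamma> (k n) i = l i) sequentially" by metis
  then show ?thesis using k(1) by blast
qed

locale hyp_cayley = cayley G S + gromov_hyperbolic "carrier G" "word_dist G S" dl
  for G (structure) and S :: "'a set" and dl :: real
begin

subsection \<open>Few elements coarsely fix a direction\<close>

text \<open>An h that coarsely fixes the direction of v maps a fixed point f t of the geodesic from
  1 to v close to another point f s of it. So h = f s y \<open>inv (f t)\<close> with y in a fixed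
  ball, and s is at most r + t. As t is r plus a constant, the count is linear in r.\<close>

lemma coarse_stabilizer_bound:
  "\<exists>A B :: nat. \<forall>r :: nat. \<exists>N. \<forall>v\<in>carrier G.
     card {h \<in> carrier G. wl h \<le> r \<and> N < gp \<one> v (h \<otimes> v)} \<le> A * r + B"
proof -
  define ball where "ball = {y \<in> carrier G. real (wl y) \<le> 4 * dl + 1}"
  have fin: "finite ball" unfolding ball_def by (rule finite_ball)
  define q where "q = nat \<lceil>2 * dl\<rceil> + 1"
  have q: "2 * dl < real q" using dl_nonneg unfolding q_def by (simp add: of_nat_ceiling less_add_one) linarith
  have "card {h \<in> carrier G. wl h \<le> r \<and> real (3 * r + 2 * q) < gp \<one> v (h \<otimes> v)} \<le> (2 * card ball) * r + (q + 1) * card ball"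
    if v: "v \<in> carrier G" for r v
  proof -
    \<comment> \<open>The image u of f t must be seen well inside: t exceeds r by q >
      \<open>2 * dl\<close>, so h and 1 have a large product from u, and N is large enough that v
      and h v do too. Since u lies between h and h v, this leaves it coarsely between 1 and
      v.\<close>
    define t where "t = r + q"
    define N where "N = real (3 * r + 2 * q)"
    obtain f n where f: "\<And>i. f i \<in> carrier G" "f 0 = \<one>" "f n = v" "real n = e \<one> v"
      "\<And>i j. i\<le>n \<Longrightarrow> j\<le>n \<Longrightarrow> e (f i) (f j) = \<bar>real i - real j\<bar>"
      using geodesic_path[OF one_closed v] by blast
    have "\<exists>s y. s \<le> r + t \<and> y \<in> ball \<and> h = f s \<otimes> y \<otimes> inv (f t)"
      if h: "h \<in> carrier G" "wl h \<le> r" "N < gp \<one> v (h \<otimes> v)" for h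
    proof -
      have "gp \<one> v (h \<otimes> v) \<le> e \<one> v" using gp_le_dist v h by simp
      then have "t \<le> n" using h(3) f(4) unfolding N_def t_def by linarith
      define u where "u = h \<otimes> f t"
      have u: "u \<in> carrier G" using h f by (simp add: u_def)
      have hv: "h \<otimes> v \<in> carrier G" using h v by simp
      have e1h: "e \<one> h \<le> real r" using h by (simp add: e_one)
      have d1: "e u h = real t"
        using e_left[OF h(1) f(1) one_closed, of t] f(5)[of t 0] f(2) h(1) \<open>t \<le> n\<close> by (simp add: u_def)
      have d2: "e u (h \<otimes> v) = real n - real t"
        using e_left[OF h(1) f(1) v, of t] f(5)[of t n] f(3) \<open>t \<le> n\<close> by (simp add: u_def)
      have d3: "e h (h \<otimes> v) = real n" using e_left[OF h(1) one_closed v] h f(4) by simp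
      have g0: "gp u h (h \<otimes> v) = 0" using d1 d2 d3 by (simp add: gprod_def)
      have d4: "e \<one> u \<le> real r + real t"
        using e_tri[OF one_closed h(1) u] e1h d1 e_sym[OF h(1) u] by linarith
      have g1: "2 * gp u h \<one> \<ge> 2 * real t - 2 * real r"
      proof -
        have "2 * gp u h \<one> = e u h + e u \<one> - e h \<one>" by (simp add: gprod_def)
        then show ?thesis using e_tri[OF u one_closed h(1)] e_sym[OF one_closed h(1)] d1 e1h by linarith
      qed
      have g2: "2 * gp u v (h \<otimes> v) \<ge> 2 * N - 2 * real t - 2 * real r"
      proof -
        have a: "2 * gp u v (h \<otimes> v) = e u v + e u (h \<otimes> v) - e v (h \<otimes> v)"
          and b: "2 * gp \<one> v (h \<otimes> v) = e \<one> v + e \<one> (h \<otimes> v) - e v (h \<otimes> v)" by (simp_all add: gprod_def)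
        have "e \<one> (h \<otimes> v) \<le> real r + real n" using e_tri[OF one_closed h(1) hv] d3 e1h by linarith
        moreover have "real n \<le> e \<one> u + e u v" using e_tri[OF one_closed u v] f(4) by linarith
        ultimately show ?thesis using a b d2 d4 h(3) f(4) by linarith
      qed
      have "gp u \<one> v \<le> 2 * dl"
        using gp_min4[OF u h(1) one_closed v hv] g0 g1 g2 q unfolding N_def t_def by auto
      define s where "s = nat \<lfloor>gp \<one> u v\<rfloor>"
      have gn: "0 \<le> gp \<one> u v" using gp_nonneg u v by simp
      then have s: "real s \<le> gp \<one> u v" "gp \<one> u v < real s + 1" unfolding s_def by linarith+
      have "gp \<one> u v \<le> e \<one> u" using gp_le_dist u v by simp
      then have sr: "s \<le> r + t" using s d4 by linarith
      have "gp \<one> u v \<le> e \<one> v" using gp_le_dist[of \<one> v u] gp_sym[of u v \<one>] u v by simp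
      then have sn: "s \<le> n" using s f(4) by linarith
      have "e u (f s) \<le> gp u \<one> v + 2 * dl + 1"
      proof (rule proximity[OF u one_closed v f(1)])
        show "e \<one> (f s) + e (f s) v = e \<one> v" using f(5)[of 0 s] f(5)[of s n] sn f(2,3,4) by simp
        show "\<bar>e \<one> (f s) - gp \<one> u v\<bar> \<le> 1" using f(5)[of 0 s] sn f(2) s by simp
      qed
      then have us: "e u (f s) \<le> 4 * dl + 1" using \<open>gp u \<one> v \<le> 2 * dl\<close> by linarith
      define y where "y = inv (f s) \<otimes> u"
      have "real (wl y) \<le> 4 * dl + 1" using us e_sym[OF u f(1), of s] by (simp add: y_def e_eq)
      then have "y \<in> ball" using u f by (simp add: ball_def y_def)
      moreover have "h = f s \<otimes> y \<otimes> inv (f t)"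
        using u f(1) h(1) by (simp add: y_def u_def m_assoc)
      ultimately show ?thesis using sr by blast
    qed
    then have "{h \<in> carrier G. wl h \<le> r \<and> N < gp \<one> v (h \<otimes> v)} \<subseteq>
        (\<lambda>(s, y). f s \<otimes> y \<otimes> inv (f t)) ` ({..r + t} \<times> ball)" by fastforce
    then have "card {h \<in> carrier G. wl h \<le> r \<and> N < gp \<one> v (h \<otimes> v)} \<le> card ({..r + t} \<times> ball)"
      using fin by (meson card_image_le card_mono finite_SigmaI finite_atMost finite_imageI order_trans)
    also have "\<dots> = (2 * card ball) * r + (q + 1) * card ball"
      by (simp add: card_cartesian_product t_def algebra_simps)
    finally show ?thesis unfolding N_def .
  qed
  then show ?thesis by blast
qed

end

subsection \<open>Positive words in two squares\<close>

definition sqw :: "('g, 'b) monoid_scheme \<Rightarrow> 'g \<Rightarrow> 'g \<Rightarrow> bool list \<Rightarrow> 'g" where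
  "sqw G a b w = foldr (\<lambda>x g. (if x then b else a) \<otimes>\<^bsub>G\<^esub> ((if x then b else a) \<otimes>\<^bsub>G\<^esub> g)) w \<one>\<^bsub>G\<^esub>"

context group
begin

lemma sqw_simps:
  "sqw G a b [] = \<one>"
  "sqw G a b (x # w) = (if x then b else a) \<otimes> ((if x then b else a) \<otimes> sqw G a b w)"
  by (simp_all add: sqw_def)

lemma sqw_closed: "\<lbrakk>a \<in> carrier G; b \<in> carrier G\<rbrakk> \<Longrightarrow> sqw G a b w \<in> carrier G"
  by (induction w) (auto simp: sqw_simps)

lemma eval2_simps:
  "eval2 G a b [] = \<one>"
  "eval2 G a b ((x, i) # w) = (let y = (if x then b else a) in if i then inv y else y) \<otimes> eval2 G a b w"
  by (simp_all add: eval2_def)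

lemma eval2_closed: "\<lbrakk>a \<in> carrier G; b \<in> carrier G\<rbrakk> \<Longrightarrow> eval2 G a b w \<in> carrier G"
  by (induction w) (auto simp: eval2_simps Let_def)

lemma eval2_append:
  "\<lbrakk>a \<in> carrier G; b \<in> carrier G\<rbrakk> \<Longrightarrow> eval2 G a b (u @ v) = eval2 G a b u \<otimes> eval2 G a b v"
  by (induction u) (auto simp: eval2_simps Let_def eval2_closed m_assoc)

text \<open>At the first letter where two words differ, the inverse of one remaining word times the
  other is reduced: inverse letters come first, positive ones follow, and different generators meet
  at the only junction. It would represent 1.\<close>

lemma sqw_inj:
  assumes ab: "a \<in> carrier G" "b \<in> carrier G"
    and free: "\<And>w. \<lbrakk>w \<noteq> []; reduced2 w\<rbrakk> \<Longrightarrow> eval2 G a b w \<noteq> \<one>"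
    and "length u = length v" "sqw G a b u = sqw G a b v"
  shows "u = v"
  using assms(4,5)
proof (induction u v rule: list_induct2)
  case (Cons x u y v)
  define dbl where "dbl = (\<lambda>w :: bool list. concat (map (\<lambda>x. [(x, False), (x, False)]) w))"
  define idbl where "idbl = (\<lambda>w :: bool list. concat (map (\<lambda>x. [(x, True), (x, True)]) (rev w)))"
  have ed: "eval2 G a b (dbl w) = sqw G a b w" for w
    by (induction w) (auto simp: dbl_def eval2_simps sqw_simps)
  have ei: "eval2 G a b (idbl w) = inv (sqw G a b w)" for w
  proof (induction w)
    case (Cons z w)
    have "idbl (z # w) = idbl w @ [(z, True), (z, True)]" by (simp add: idbl_def)
    then show ?case using Cons ab sqw_closed[OF ab, of w]
      by (simp add: eval2_append[OF ab] sqw_simps eval2_simps Let_def inv_mult_group m_assoc)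
  qed (simp add: idbl_def eval2_simps sqw_simps)
  have "x = y"
  proof (rule ccontr)
    assume xy: "x \<noteq> y"
    define P where "P = idbl (y # v)"
    define Q where "Q = dbl (x # u)"
    have P: "P = idbl v @ [(y, True), (y, True)]" by (simp add: P_def idbl_def)
    have Q: "Q = (x, False) # (x, False) # dbl u" by (simp add: Q_def dbl_def)
    have sP: "snd p" if "p \<in> set P" for p using that unfolding P_def idbl_def by auto
    have sQ: "\<not> snd p" if "p \<in> set Q" for p using that unfolding Q_def dbl_def by auto
    have "reduced2 (P @ Q)"
      unfolding reduced2_def
    proof (intro allI impI notI)
      fix i assume i: "Suc i < length (P @ Q)"
        and bad: "fst ((P @ Q) ! i) = fst ((P @ Q) ! Suc i) \<and> snd ((P @ Q) ! i) \<noteq> snd ((P @ Q) ! Suc i)"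
      consider "Suc i < length P" | "Suc i = length P" | "length P \<le> i" by linarith
      then show False
      proof cases
        case 1
        then have "snd ((P @ Q) ! i)" "snd ((P @ Q) ! Suc i)" using sP by (simp_all add: nth_append)
        then show False using bad by simp
      next
        case 2
        then have "(P @ Q) ! i = last P" "(P @ Q) ! Suc i = Q ! 0"
          by (auto simp: nth_append last_conv_nth Q P)
        then show False using bad xy by (simp add: P Q)
      next
        case 3
        then have "\<not> snd ((P @ Q) ! i)" "\<not> snd ((P @ Q) ! Suc i)" using sQ i by (simp_all add: nth_append)
        then show False using bad by simp
      qed
    qed
    moreover have "P @ Q \<noteq> []" by (simp add: Q)
    moreover have "eval2 G a b (P @ Q) = \<one>"
      unfolding eval2_append[OF ab] P_def Q_def ed ei Cons.prems using sqw_closed[OF ab] by simp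
    ultimately show False using free by blast
  qed
  then have "sqw G a b u = sqw G a b v" using Cons.prems sqw_closed[OF ab] ab by (simp add: sqw_simps)
  then show ?case using Cons.IH \<open>x = y\<close> by simp
qed simp

end

context hyp_cayley
begin

lemma wl_sqw: 
  assumes ab: "a \<in> carrier G" "b \<in> carrier G"
  shows "wl (sqw G a b w) \<le> length w * (2 * max (wl a) (wl b))"
proof (induction w)
  case (Cons x w)
  let ?y = "if x then b else a"
  have y: "?y \<in> carrier G" using ab by simp
  have "wl (sqw G a b (x # w)) \<le> wl ?y + (wl ?y + wl (sqw G a b w))"
    unfolding sqw_simps using wl_mult[OF y m_closed[OF y sqw_closed[OF ab, of w]]] wl_mult[OF y sqw_closed[OF ab, of w]] by linarith
  moreover have "wl ?y \<le> max (wl a) (wl b)" by simp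
  ultimately show ?case using Cons by simp
qed (simp add: sqw_simps wl_one)

text \<open>There are exponentially many words of length \<open>n\<close>, but only linearly many of them
  can send \<open>v\<close> far in the direction of \<open>u\<close>.\<close>
lemma separating_word:
  assumes ab: "a \<in> carrier G" "b \<in> carrier G"
    and free: "\<And>w. \<lbrakk>w \<noteq> []; reduced2 w\<rbrakk> \<Longrightarrow> eval2 G a b w \<noteq> \<one>"
  shows "\<exists>n c. \<forall>u\<in>carrier G. \<forall>v\<in>carrier G. \<forall>u'\<in>carrier G. \<forall>v'\<in>carrier G.
     \<exists>w. length w = n \<and> gp \<one> u (sqw G a b w \<otimes> v) \<le> c \<and> gp \<one> u' (sqw G a b w \<otimes> v') \<le> c"
proof -
  obtain A B :: nat where AB: "\<And>r. \<exists>N. \<forall>v\<in>carrier G.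
     card {h \<in> carrier G. wl h \<le> r \<and> N < gp \<one> v (h \<otimes> v)} \<le> A * r + B"
    using coarse_stabilizer_bound by blast
  define M where "M = 2 * max (wl a) (wl b)"
  have "eventually (\<lambda>n::nat. real (2 * (A * 2 * M)) * real n + real (2 * B) < 2 ^ n) sequentially"
    by real_asymp
  then obtain n where n: "real (2 * (A * 2 * M)) * real n + real (2 * B) < 2 ^ n"
    unfolding eventually_sequentially by blast
  define r where "r = 2 * (n * M)"
  \<comment> \<open>Each of the two requirements excludes at most A r + B words, where r is linear
    in n; the number of words is 2 to the power n.\<close>
  have nr: "(A * r + B) + (A * r + B) < 2 ^ n"
  proof -
    have "real (2 * (A * r + B)) < real (2 ^ n)" using n unfolding r_def by (simp add: algebra_simps)
    then show ?thesis by (simp only: of_nat_less_iff mult_2)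
  qed
  obtain N where N: "\<And>v. v \<in> carrier G \<Longrightarrow> card {h \<in> carrier G. wl h \<le> r \<and> N < gp \<one> v (h \<otimes> v)} \<le> A * r + B"
    using AB[of r] by blast
  define c where "c = N + dl + real (n * M)"
  define W where "W = {w :: bool list. length w = n}"
  have cW: "card W = 2 ^ n" unfolding W_def using card_lists_length_eq[of "UNIV :: bool set" n] by simp
  have fW: "finite W" by (rule card_ge_0_finite) (simp add: cW)
  have wlw: "wl (sqw G a b w) \<le> n * M" if "w \<in> W" for w using wl_sqw[OF ab, of w] that by (simp add: W_def M_def)
  have sC: "sqw G a b w \<in> carrier G" for w by (rule sqw_closed[OF ab])
  \<comment> \<open>Compare all bad words with a single bad word w0. Both images of v lie in the
    direction of u, hence in each other's direction, so \<open>inv h0\<close> times the new word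
    coarsely fixes the direction of v. In c, the summand dl pays for passing through u and
    \<open>n * M\<close> for moving the base point.\<close>
  have bad: "card {w \<in> W. c < gp \<one> u (sqw G a b w \<otimes> v)} \<le> A * r + B" if uv: "u \<in> carrier G" "v \<in> carrier G" for u v
  proof (cases "{w \<in> W. c < gp \<one> u (sqw G a b w \<otimes> v)} = {}")
    case False
    then obtain w0 where w0: "w0 \<in> W" "c < gp \<one> u (sqw G a b w0 \<otimes> v)" by blast
    define h0 where "h0 = sqw G a b w0"
    have h0: "h0 \<in> carrier G" using sC h0_def by simp
    define \<psi> where "\<psi> w = inv h0 \<otimes> sqw G a b w" for w
    have "inj_on \<psi> {w \<in> W. c < gp \<one> u (sqw G a b w \<otimes> v)}"
    proof (rule inj_onI)
      fix w w' assume w: "w \<in> {w \<in> W. c < gp \<one> u (sqw G a b w \<otimes> v)}" "w' \<in> {w \<in> W. c < gp \<one> u (sqw G a b w \<otimes> v)}"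
        and "\<psi> w = \<psi> w'"
      then have "sqw G a b w = sqw G a b w'" using h0 sC by (simp add: \<psi>_def)
      moreover have "length w = length w'" using w by (simp add: W_def)
      ultimately show "w = w'" using sqw_inj[OF ab free] by blast
    qed
    moreover have "\<psi> ` {w \<in> W. c < gp \<one> u (sqw G a b w \<otimes> v)} \<subseteq> {h \<in> carrier G. wl h \<le> r \<and> N < gp \<one> v (h \<otimes> v)}"
    proof
      fix k assume "k \<in> \<psi> ` {w \<in> W. c < gp \<one> u (sqw G a b w \<otimes> v)}"
      then obtain w where w: "w \<in> W" "c < gp \<one> u (sqw G a b w \<otimes> v)" and k: "k = \<psi> w" by blast
      define h where "h = sqw G a b w"
      have h: "h \<in> carrier G" using sC h_def by simp
      have kC: "k \<in> carrier G" using k h h0 by (simp add: \<psi>_def h_def)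
      have "wl k \<le> r" using wl_mult[of "inv h0" h] wl_inv[OF h0] wlw[OF w(1)] wlw[OF w0(1)] h h0
        unfolding k \<psi>_def r_def h_def[symmetric] h0_def[symmetric] by simp
      have "c - dl < gp \<one> (h \<otimes> v) (h0 \<otimes> v)"
        using gp_min[of \<one> "h \<otimes> v" u "h0 \<otimes> v"] gp_sym[of u "h \<otimes> v" \<one>] w(2) w0(2) h h0 uv
        unfolding h_def[symmetric] h0_def[symmetric] by auto
      moreover have "gp \<one> (h \<otimes> v) (h0 \<otimes> v) \<le> gp h0 (h \<otimes> v) (h0 \<otimes> v) + e \<one> h0"
        using gp_change_base h h0 uv by simp
      moreover have "gp h0 (h \<otimes> v) (h0 \<otimes> v) = gp \<one> (k \<otimes> v) v"
      proof -
        have "gp (h0 \<otimes> \<one>) (h0 \<otimes> (k \<otimes> v)) (h0 \<otimes> v) = gp \<one> (k \<otimes> v) v"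
          using gp_left[OF h0 one_closed _ uv(2), of "k \<otimes> v"] kC uv by simp
        moreover have "h0 \<otimes> (k \<otimes> v) = h \<otimes> v" using h0 h uv unfolding k \<psi>_def h_def[symmetric] by (simp add: m_assoc)
        ultimately show ?thesis using h0 by simp
      qed
      moreover have "e \<one> h0 \<le> real (n * M)" using wlw[OF w0(1)] h0 unfolding h0_def[symmetric] by (simp only: e_one of_nat_le_iff)
      moreover have "gp \<one> (k \<otimes> v) v = gp \<one> v (k \<otimes> v)" using gp_sym kC uv by simp
      ultimately have "N < gp \<one> v (k \<otimes> v)" unfolding c_def by linarith
      then show "k \<in> {h \<in> carrier G. wl h \<le> r \<and> N < gp \<one> v (h \<otimes> v)}" using kC \<open>wl k \<le> r\<close> by blast
    qed
    moreover have "finite {h \<in> carrier G. wl h \<le> r \<and> N < gp \<one> v (h \<otimes> v)}"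
      by (rule finite_subset[OF _ finite_ball[of "real r"]]) auto
    ultimately have "card {w \<in> W. c < gp \<one> u (sqw G a b w \<otimes> v)} \<le> card {h \<in> carrier G. wl h \<le> r \<and> N < gp \<one> v (h \<otimes> v)}"
      using card_inj_on_le by blast
    then show ?thesis using N[OF uv(2)] by linarith
  next
    case True
    then show ?thesis by (simp only: card.empty)
  qed
  have "\<exists>w. length w = n \<and> gp \<one> u (sqw G a b w \<otimes> v) \<le> c \<and> gp \<one> u' (sqw G a b w \<otimes> v') \<le> c"
    if uv: "u \<in> carrier G" "v \<in> carrier G" "u' \<in> carrier G" "v' \<in> carrier G" for u v u' v'
  proof (rule ccontr)
    assume no: "\<not> ?thesis"
    let ?X = "{w \<in> W. c < gp \<one> u (sqw G a b w \<otimes> v)}" and ?Y = "{w \<in> W. c < gp \<one> u' (sqw G a b w \<otimes> v')}"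
    have "W \<subseteq> ?X \<union> ?Y" using no unfolding W_def by force
    moreover have "finite (?X \<union> ?Y)" using fW by simp
    ultimately have "card W \<le> card (?X \<union> ?Y)" by (rule card_mono[rotated])
    also have "\<dots> \<le> card ?X + card ?Y" by (rule card_Un_le)
    finally have "card W \<le> card ?X + card ?Y" .
    then show False using bad[OF uv(1,2)] bad[OF uv(3,4)] nr cW by linarith
  qed
  then show ?thesis by blast
qed

end

context hyp_cayley
begin

subsection \<open>Axes\<close>

text \<open>The additional 1 in the last clause makes the distance grow by at least 1 per step, as
  used in \<open>is_chain_dist\<close>.\<close>

definition is_chain :: "real \<Rightarrow> real \<Rightarrow> (int \<Rightarrow> 'a) \<Rightarrow> bool" where
  "is_chain c L p \<longleftrightarrow> (\<forall>i. p i \<in> carrier G) \<and> (\<forall>i. gp (p i) (p (i - 1)) (p (i + 1)) \<le> c)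
     \<and> (\<forall>i. L \<le> e (p i) (p (i + 1))) \<and> 2 * c + 3 * dl + 1 \<le> L"

lemma is_chainD:
  assumes "is_chain c L p"
  shows "p i \<in> carrier G" "gp (p i) (p (i - 1)) (p (i + 1)) \<le> c" "L \<le> e (p i) (p (i + 1))" "2 * c + 3 * dl < L"
    "2 * c + 3 * dl + 1 \<le> L"
  using assms by (auto simp: is_chain_def)

lemma is_chain_between:
  assumes "is_chain c L p" "i \<le> j" "j \<le> k"
  shows "gp (p j) (p i) (p k) \<le> c + 2 * dl"
  using chain_between[where p = p and c = c and L = L, OF is_chainD(1,2,3,4)[OF assms(1)] assms(2,3)] .

lemma is_chain_growth:
  assumes "is_chain c L p"
  shows "real k * (L - 2 * c - 2 * dl) \<le> e (p i) (p (i + int k))"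
  using chain_growth[where p = p and c = c and L = L, OF is_chainD(1,2,3,4)[OF assms]] .

lemma is_chain_dist:
  assumes "is_chain c L p" "i \<le> j"
  shows "real_of_int (j - i) \<le> e (p i) (p j)"
proof -
  have "real (nat (j - i)) * 1 \<le> real (nat (j - i)) * (L - 2 * c - 2 * dl)"
    using is_chainD(5)[OF assms(1)] dl_nonneg by (intro mult_left_mono) auto
  also have "\<dots> \<le> e (p i) (p j)" using is_chain_growth[OF assms(1), of "nat (j - i)" i] assms(2) by simp
  finally show ?thesis using assms(2) by simp
qed

lemma is_chain_c_nonneg: "is_chain c L p \<Longrightarrow> 0 \<le> c"
  using gp_nonneg[of "p 0" "p (0 - 1)" "p (0 + 1)"] is_chainD(1,2)[of c L p] by (meson order_trans)

text \<open>Displacement at h is at least the average growth of the powers: the n-th power moves h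
  by at most n times as much, while replacing h by 1 changes its displacement by at most
  \<open>2 * wl h\<close>, which disappears after division by n.\<close>

lemma tlen_lower_bound:
  assumes g: "g \<in> carrier G" and T: "\<And>n::nat. real n * T \<le> real (wl (g [^] n))"
  shows "T \<le> word_tlen G S g"
  unfolding word_tlen_def
proof (rule cInf_greatest)
  show "{e h (g \<otimes> h) |h. h \<in> carrier G} \<noteq> {}" by blast
  fix x assume "x \<in> {e h (g \<otimes> h) |h. h \<in> carrier G}"
  then obtain h where h: "h \<in> carrier G" and x: "x = e h (g \<otimes> h)" by blast
  have up: "e h (g [^] n \<otimes> h) \<le> real n * x" for n :: nat
  proof (induction n)
    case 0
    then show ?case using h d_refl by simp
  next
    case (Suc n)
    have gn: "g [^] n \<in> carrier G" using g by simp
    have "g [^] Suc n \<otimes> h = g [^] n \<otimes> (g \<otimes> h)" using g h gn by (simp add: m_assoc)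
    moreover have "e (g [^] n \<otimes> h) (g [^] n \<otimes> (g \<otimes> h)) = x"
      using e_left[OF gn h m_closed[OF g h]] x by simp
    ultimately have "e h (g [^] Suc n \<otimes> h) \<le> e h (g [^] n \<otimes> h) + x"
      using e_tri[OF h m_closed[OF gn h], of "g [^] n \<otimes> (g \<otimes> h)"] g h gn by simp
    then show ?case using Suc by (simp add: algebra_simps)
  qed
  have low: "real n * T - 2 * real (wl h) \<le> real n * x" for n :: nat
  proof -
    have gn: "g [^] n \<in> carrier G" using g by simp
    have "e \<one> (g [^] n) \<le> e \<one> h + e h (g [^] n \<otimes> h) + e (g [^] n \<otimes> h) (g [^] n)"
      using e_tri[OF one_closed h gn] e_tri[OF h m_closed[OF gn h] gn] by linarith
    moreover have "e (g [^] n \<otimes> h) (g [^] n) = real (wl h)"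
      using e_right[OF gn h] e_sym[OF gn m_closed[OF gn h]] by simp
    moreover have "e \<one> h = real (wl h)" "e \<one> (g [^] n) = real (wl (g [^] n))" using h gn by (simp_all add: e_one)
    ultimately show ?thesis using up[of n] T[of n] by linarith
  qed
  show "T \<le> x"
  proof (rule ccontr)
    assume "\<not> T \<le> x"
    then have d: "T - x > 0" by simp
    obtain n :: nat where "2 * real (wl h) / (T - x) < real n" using reals_Archimedean2 by blast
    then have "2 * real (wl h) < real n * (T - x)" using d by (simp add: pos_divide_less_eq)
    then show False using low[of n] by (simp add: algebra_simps)
  qed
qed

lemma geodesic_projection:
  assumes u: "u \<in> carrier G" and f: "\<And>i. f i \<in> carrier G"
    and geo: "\<And>i j. i \<le> n \<Longrightarrow> j \<le> n \<Longrightarrow> e (f i) (f j) = \<bar>real i - real j\<bar>"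
  shows "\<exists>s\<le>n. e u (f s) \<le> gp u (f 0) (f n) + 2 * dl + 1"
proof -
  define s where "s = nat \<lfloor>gp (f 0) u (f n)\<rfloor>"
  have "0 \<le> gp (f 0) u (f n)" using gp_nonneg u f by simp
  then have s: "real s \<le> gp (f 0) u (f n)" "gp (f 0) u (f n) < real s + 1" unfolding s_def by linarith+
  have "gp (f 0) u (f n) \<le> e (f 0) (f n)" using gp_le_dist[of "f 0" "f n" u] gp_sym[of u "f n" "f 0"] u f by simp
  then have sn: "s \<le> n" using s geo[of 0 n] by simp
  have "e u (f s) \<le> gp u (f 0) (f n) + 2 * dl + 1"
  proof (rule proximity[OF u f f f])
    show "e (f 0) (f s) + e (f s) (f n) = e (f 0) (f n)" using geo[of 0 s] geo[of s n] geo[of 0 n] sn by simp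
    show "\<bar>e (f 0) (f s) - gp (f 0) u (f n)\<bar> \<le> 1" using geo[of 0 s] sn s by simp
  qed
  then show ?thesis using sn by blast
qed

text \<open>Geodesics between the far ends p (-n) and p n pass within D of all chain points between.
  Indexed so that 0 falls near p 0, they take finitely many values at each index, and a diagonal
  subsequence stabilises to a line. The inequalities between i and j record that the line traverses
  the chain in the right direction.\<close>

lemma limit_geodesic:
  assumes ch: "is_chain c L p"
  defines "D \<equiv> c + 4 * dl + 1"
  shows "\<exists>l :: int \<Rightarrow> 'a. (\<forall>i. l i \<in> carrier G) \<and> (\<forall>i j. e (l i) (l j) = real_of_int \<bar>i - j\<bar>) \<and>
    (\<forall>j. \<exists>i. e (p j) (l i) \<le> D \<and> (0 \<le> j \<longrightarrow> j - (2 * c + 4 * dl + 2 * D) \<le> i) \<and> (j \<le> 0 \<longrightarrow> i \<le> j + (2 * c + 4 * dl + 2 * D)))"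
proof -
  define m where "m = c + 2 * dl"
  note pX = is_chainD(1)[OF ch]
  have c0: "0 \<le> c" by (rule is_chain_c_nonneg[OF ch])
  have D0: "0 \<le> D" "m + 2 * dl + 1 = D" unfolding D_def m_def using c0 dl_nonneg by auto
  have btw: "gp (p j) (p i) (p k) \<le> m" if "i \<le> j" "j \<le> k" for i j k
    using is_chain_between[OF ch that] m_def by simp
  \<comment> \<open>The clauses are chosen to survive the limit: the second makes the values at each
    index finite in number, and the bound on the index i in the last one, independent of n, confines
    the witness to a finite window.\<close>
  define \<Phi> where "\<Phi> n \<gamma> \<longleftrightarrow> (\<forall>i. \<gamma> i \<in> carrier G) \<and> (\<forall>i. e (\<gamma> i) (p 0) \<le> real_of_int \<bar>i\<bar> + D) \<and>
     (\<forall>i j. \<bar>i\<bar> \<le> real n - D \<longrightarrow> \<bar>j\<bar> \<le> real n - D \<longrightarrow> e (\<gamma> i) (\<gamma> j) = real_of_int \<bar>i - j\<bar>) \<and>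
     (\<forall>j. \<bar>j\<bar> \<le> int n \<longrightarrow> (\<exists>i. \<bar>i\<bar> \<le> e (p 0) (p j) + 2 * D \<and> e (p j) (\<gamma> i) \<le> D \<and>
       (0 \<le> j \<longrightarrow> j - (2 * m + 2 * D) \<le> i) \<and> (j \<le> 0 \<longrightarrow> i \<le> j + (2 * m + 2 * D))))" for n :: nat and \<gamma> :: "int \<Rightarrow> 'a"
  have ex: "\<exists>\<gamma>. \<Phi> n \<gamma>" for n
  proof -
    define P where "P = p (- int n)"
    define Q where "Q = p (int n)"
    obtain f N where f: "\<And>i. f i \<in> carrier G" "f 0 = P" "f N = Q" "real N = e P Q"
      "\<And>i j. i\<le>N \<Longrightarrow> j\<le>N \<Longrightarrow> e (f i) (f j) = \<bar>real i - real j\<bar>"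
      using geodesic_path[of P Q] pX unfolding P_def Q_def by blast
    have "\<exists>s\<le>N. e (p j) (f s) \<le> D" if "\<bar>j\<bar> \<le> int n" for j
    proof -
      have "gp (p j) (f 0) (f N) \<le> m" unfolding f(2,3) P_def Q_def using btw that by simp
      moreover obtain s where "s \<le> N" "e (p j) (f s) \<le> gp (p j) (f 0) (f N) + 2 * dl + 1"
        using geodesic_projection[of "p j" f N, OF pX f(1) f(5)] by blast
      ultimately have "e (p j) (f s) \<le> D" using D0(2) by linarith
      then show ?thesis using \<open>s \<le> N\<close> by blast
    qed
    then have "\<forall>j. \<exists>s. \<bar>j\<bar> \<le> int n \<longrightarrow> s \<le> N \<and> e (p j) (f s) \<le> D" by blast
    from choice[OF this] obtain s where s: "\<And>j. \<bar>j\<bar> \<le> int n \<Longrightarrow> s j \<le> N" "\<And>j. \<bar>j\<bar> \<le> int n \<Longrightarrow> e (p j) (f (s j)) \<le> D"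
      by blast
    define A where "A = int (s 0)"
    have AN: "0 \<le> A" "A \<le> int N" using s(1)[of 0] by (auto simp: A_def)
    have ePf: "e P (f i) = real i" if "i \<le> N" for i using f(5)[of 0 i] f(2) that by simp
    have efQ: "e (f i) Q = real N - real i" if "i \<le> N" for i using f(5)[of i N] f(3) that by simp
    have A1: "real n - D \<le> A"
    proof -
      have "real n \<le> e P (p 0)" using is_chain_dist[OF ch, of "- int n" 0] by (simp add: P_def)
      also have "\<dots> \<le> e P (f (s 0)) + e (f (s 0)) (p 0)" using e_tri pX f(1) unfolding P_def by blast
      also have "e (f (s 0)) (p 0) \<le> D" using s(2)[of 0] e_sym[OF f(1) pX] by simp
      finally show ?thesis using ePf[OF s(1)[of 0]] by (simp add: A_def)
    qed
    have A2: "real n - D \<le> real N - A"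
    proof -
      have "real n \<le> e (p 0) Q" using is_chain_dist[OF ch, of 0 "int n"] by (simp add: Q_def)
      also have "\<dots> \<le> e (p 0) (f (s 0)) + e (f (s 0)) Q" using e_tri pX f(1) unfolding Q_def by blast
      also have "e (p 0) (f (s 0)) \<le> D" using s(2)[of 0] by simp
      finally show ?thesis using efQ[OF s(1)[of 0]] by (simp add: A_def)
    qed
    \<comment> \<open>Clamping to the interval from 0 to N makes the segment a function on all
      integers; it is geodesic on the range where no clamping occurs.\<close>
    define cl where "cl i = nat (min (max 0 (A + i)) (int N))" for i
    have clN: "cl i \<le> N" for i by (simp add: cl_def)
    have clA: "\<bar>real (cl i) - real_of_int A\<bar> \<le> real_of_int \<bar>i\<bar>" for i using AN unfolding cl_def by linarith
    define \<gamma> where "\<gamma> i = f (cl i)" for i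
    have sA: "f (s 0) = f (nat A)" by (simp add: A_def)
    have "e (\<gamma> i) (p 0) \<le> real_of_int \<bar>i\<bar> + D" for i
    proof -
      have "e (\<gamma> i) (f (s 0)) = \<bar>real (cl i) - real_of_int A\<bar>" using f(5)[OF clN[of i] s(1)[of 0]] by (simp add: \<gamma>_def A_def)
      moreover have "e (f (s 0)) (p 0) \<le> D" using s(2)[of 0] e_sym[OF f(1) pX] by simp
      moreover have "e (\<gamma> i) (p 0) \<le> e (\<gamma> i) (f (s 0)) + e (f (s 0)) (p 0)" unfolding \<gamma>_def using e_tri f(1) pX by blast
      ultimately show ?thesis using clA[of i] by linarith
    qed
    moreover have "e (\<gamma> i) (\<gamma> j) = real_of_int \<bar>i - j\<bar>" if ij: "\<bar>i\<bar> \<le> real n - D" "\<bar>j\<bar> \<le> real n - D" for i j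
    proof -
      have "real (cl i) = A + i" if "\<bar>i\<bar> \<le> real n - D" for i
      proof -
        have "0 \<le> real_of_int A + real_of_int i" "real_of_int A + real_of_int i \<le> real N" using that A1 A2 by linarith+
        then have "0 \<le> A + i" "A + i \<le> int N" by linarith+
        then show ?thesis by (simp add: cl_def)
      qed
      then have "real (cl i) = A + i" "real (cl j) = A + j" using ij by blast+
      then show ?thesis unfolding \<gamma>_def using f(5)[OF clN clN, of i j] by simp
    qed
    moreover have "\<exists>i. \<bar>i\<bar> \<le> e (p 0) (p j) + 2 * D \<and> e (p j) (\<gamma> i) \<le> D \<and>
       (0 \<le> j \<longrightarrow> j - (2 * m + 2 * D) \<le> i) \<and> (j \<le> 0 \<longrightarrow> i \<le> j + (2 * m + 2 * D))" if j: "\<bar>j\<bar> \<le> int n" for j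
    proof -
      define i where "i = int (s j) - A"
      have sN: "s j \<le> N" "s 0 \<le> N" using s(1) j by auto
      have g: "\<gamma> i = f (s j)" unfolding \<gamma>_def i_def cl_def using sN by simp
      have s0D: "e (p 0) (f (s 0)) \<le> D" "e (f (s 0)) (p 0) \<le> D" using s(2)[of 0] e_sym[OF f(1) pX] by auto
      have sjD: "e (p j) (f (s j)) \<le> D" "e (f (s j)) (p j) \<le> D" using s(2)[OF j] e_sym[OF f(1) pX] by auto
      have i_eq: "real_of_int \<bar>i\<bar> = e (f (s 0)) (f (s j))" using f(5)[OF sN(2,1)] by (simp add: i_def A_def)
      have "real_of_int \<bar>i\<bar> \<le> e (p 0) (p j) + 2 * D"
        unfolding i_eq using e_tri[OF f(1) pX f(1), of "s 0" "s j" 0] e_tri[OF pX pX f(1), of 0 "s j" j] s0D sjD by linarith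
      \<comment> \<open>As p 0 is coarsely between P and p j, the point p j is farther from P than p
        0 by at least j - 2 m, and indices along f measure the distance from P.\<close>
      moreover have "j - (2 * m + 2 * D) \<le> i" if "0 \<le> j"
      proof -
        have "2 * gp (p 0) P (p j) = e (p 0) P + e (p 0) (p j) - e P (p j)" by (simp add: gprod_def)
        moreover have "gp (p 0) P (p j) \<le> m" unfolding P_def using btw that by simp
        moreover have "e P (p j) \<le> e P (f (s j)) + D" using e_tri[OF _ f(1) pX, of P j "s j"] pX sjD P_def by force
        moreover have "e P (f (s 0)) \<le> e P (p 0) + D" using e_tri[OF _ pX f(1), of P "s 0" 0] pX s0D P_def by force
        moreover have "e (p 0) P = e P (p 0)" using e_sym pX P_def by simp
        moreover have "real_of_int j \<le> e (p 0) (p j)" using is_chain_dist[OF ch that] by simp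
        ultimately show ?thesis using ePf[OF sN(1)] ePf[OF sN(2)] by (simp add: i_def A_def)
      qed
      moreover have "i \<le> j + (2 * m + 2 * D)" if "j \<le> 0"
      proof -
        have "2 * gp (p 0) (p j) Q = e (p 0) (p j) + e (p 0) Q - e (p j) Q" by (simp add: gprod_def)
        moreover have "gp (p 0) (p j) Q \<le> m" unfolding Q_def using btw that by simp
        moreover have "e (p j) Q \<le> D + e (f (s j)) Q" using e_tri[OF pX f(1), of Q j "s j"] pX sjD Q_def by force
        moreover have "e (f (s 0)) Q \<le> D + e (p 0) Q" using e_tri[OF f(1) pX, of Q "s 0" 0] pX s0D Q_def by force
        moreover have "real_of_int (- j) \<le> e (p 0) (p j)" using is_chain_dist[OF ch that] e_sym[OF pX pX, of 0 j] by simp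
        ultimately show ?thesis using efQ[OF sN(1)] efQ[OF sN(2)] by (simp add: i_def A_def)
      qed
      ultimately show ?thesis using g sjD by (intro exI[of _ i]) simp
    qed
    moreover have "\<gamma> i \<in> carrier G" for i using f(1) by (simp add: \<gamma>_def)
    ultimately have "\<Phi> n \<gamma>" unfolding \<Phi>_def by blast
    then show ?thesis by blast
  qed
  from choice[OF allI[of "\<lambda>n. \<exists>\<gamma>. \<Phi> n \<gamma>", OF ex]] obtain \<gamma> where \<gamma>: "\<And>n. \<Phi> n (\<gamma> n)" by blast
  have gX: "\<And>n i. \<gamma> n i \<in> carrier G" and g0: "\<And>n i. e (\<gamma> n i) (p 0) \<le> real_of_int \<bar>i\<bar> + D" and
    gd: "\<And>n i j. \<bar>i\<bar> \<le> real n - D \<Longrightarrow> \<bar>j\<bar> \<le> real n - D \<Longrightarrow> e (\<gamma> n i) (\<gamma> n j) = real_of_int \<bar>i - j\<bar>" and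
    gp: "\<And>n j. \<bar>j\<bar> \<le> int n \<Longrightarrow> (\<exists>i. \<bar>i\<bar> \<le> e (p 0) (p j) + 2 * D \<and> e (p j) (\<gamma> n i) \<le> D \<and>
       (0 \<le> j \<longrightarrow> j - (2 * m + 2 * D) \<le> i) \<and> (j \<le> 0 \<longrightarrow> i \<le> j + (2 * m + 2 * D)))"
    using \<gamma> unfolding \<Phi>_def by blast+
  have "finite (range (\<lambda>n. \<gamma> n i))" for i
  proof (rule finite_subset)
    show "finite ((\<lambda>y. p 0 \<otimes> y) ` {y \<in> carrier G. real (wl y) \<le> real_of_int \<bar>i\<bar> + D})"
      using finite_ball by blast
    show "range (\<lambda>n. \<gamma> n i) \<subseteq> (\<lambda>y. p 0 \<otimes> y) ` {y \<in> carrier G. real (wl y) \<le> real_of_int \<bar>i\<bar> + D}"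
    proof
      fix x assume "x \<in> range (\<lambda>n. \<gamma> n i)"
      then obtain n where x: "x = \<gamma> n i" by blast
      have "e (p 0) x \<le> real_of_int \<bar>i\<bar> + D" using g0[of n i] e_sym[OF gX pX] x by simp
      then show "x \<in> (\<lambda>y. p 0 \<otimes> y) ` {y \<in> carrier G. real (wl y) \<le> real_of_int \<bar>i\<bar> + D}"
        using gX pX x by (intro image_eqI[of _ _ "inv (p 0) \<otimes> x"]) (auto simp: e_eq)
    qed
  qed
  from diagonal_subsequence[of \<gamma>, OF this] obtain k l where k: "strict_mono (k :: nat \<Rightarrow> nat)"
    and l: "\<And>i. eventually (\<lambda>n. \<gamma> (k n) i = l i) sequentially" by blast
  have kn: "n \<le> k n" for n using k by (rule strict_mono_imp_increasing)
  have lX: "l i \<in> carrier G" for i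
  proof -
    obtain n where "\<gamma> (k n) i = l i" using l[of i] by (auto simp: eventually_sequentially)
    then show ?thesis using gX by metis
  qed
  have ld: "e (l i) (l j) = real_of_int \<bar>i - j\<bar>" for i j
  proof -
    obtain M :: nat where M: "real_of_int \<bar>i\<bar> + real_of_int \<bar>j\<bar> + D \<le> real M" using real_arch_simple by blast
    have "eventually (\<lambda>n. \<gamma> (k n) i = l i \<and> \<gamma> (k n) j = l j \<and> M \<le> n) sequentially"
      using l[of i] l[of j] eventually_ge_at_top[of M] by (intro eventually_conj)
    then obtain n where n: "\<gamma> (k n) i = l i" "\<gamma> (k n) j = l j" "M \<le> n"
      by (auto simp: eventually_sequentially)
    have "real M \<le> real (k n)" using n(3) kn[of n] by simp
    then show ?thesis using gd[of i "k n" j] M n(1,2) by simp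
  qed
  have lp: "\<exists>i. e (p j) (l i) \<le> D \<and> (0 \<le> j \<longrightarrow> j - (2 * m + 2 * D) \<le> i) \<and> (j \<le> 0 \<longrightarrow> i \<le> j + (2 * m + 2 * D))" for j
  proof -
    \<comment> \<open>All possible indices of the witness lie in this finite set, so a single n can
      be chosen at which the segment agrees with the limit at whichever witness occurs.\<close>
    define I where "I = {i :: int. \<bar>i\<bar> \<le> e (p 0) (p j) + 2 * D}"
    have "I \<subseteq> {- \<lceil>e (p 0) (p j) + 2 * D\<rceil> .. \<lceil>e (p 0) (p j) + 2 * D\<rceil>}" unfolding I_def by (auto, linarith+)
    then have fI: "finite I" using finite_subset by blast
    have "eventually (\<lambda>n. (\<forall>i\<in>I. \<gamma> (k n) i = l i) \<and> nat \<bar>j\<bar> \<le> n) sequentially"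
      using eventually_ball_finite[OF fI, of "\<lambda>n i. \<gamma> (k n) i = l i"] l eventually_ge_at_top[of "nat \<bar>j\<bar>"]
      by (intro eventually_conj) auto
    then obtain n where n: "\<And>i. i \<in> I \<Longrightarrow> \<gamma> (k n) i = l i" "nat \<bar>j\<bar> \<le> n"
      by (auto simp: eventually_sequentially)
    have "\<bar>j\<bar> \<le> int (k n)" using n(2) kn[of n] by linarith
    from gp[OF this] obtain i where i: "i \<in> I" "e (p j) (\<gamma> (k n) i) \<le> D"
       "0 \<le> j \<longrightarrow> j - (2 * m + 2 * D) \<le> i" "j \<le> 0 \<longrightarrow> i \<le> j + (2 * m + 2 * D)" unfolding I_def by blast
    then show ?thesis using n(1)[OF i(1)] by (intro exI[of _ i]) simp
  qed
  have "2 * m + 2 * D = 2 * c + 4 * dl + 2 * D" by (simp add: m_def)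
  then show ?thesis using lX ld lp by (intro exI[of _ l]) simp
qed

text \<open>The rate \<open>2 * n\<close> fits chains in which the n-th power of an element stands
  at index 2 n. It makes q n close to a far point of the ray, and two far points of a ray have a
  large product.\<close>

lemma ray_gromov_at_top:
  assumes l: "\<And>i. l i \<in> carrier G" and geo: "\<And>i j. e (l i) (l j) = real_of_int \<bar>i - j\<bar>"
    and q: "\<And>n. q n \<in> carrier G" and near: "\<And>n. \<exists>i. e (q n) (l i) \<le> D \<and> real (2 * n) - D' \<le> real_of_int i"
  shows "filterlim (\<lambda>(i, n). gromov G S \<one> (l (int i)) (q n)) at_top (sequentially \<times>\<^sub>F sequentially)"
  unfolding filterlim_at_top
proof
  fix Z :: real
  define E where "E = e \<one> (l 0)"
  obtain N :: nat where N: "\<bar>Z\<bar> + \<bar>D\<bar> + \<bar>E\<bar> + \<bar>D'\<bar> \<le> real N" using real_arch_simple by blast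
  have "Z \<le> gromov G S \<one> (l (int i)) (q n)" if inN: "N \<le> i" "N \<le> n" for i n
  proof -
    obtain j where j: "e (q n) (l j) \<le> D" "real (2 * n) - D' \<le> real_of_int j" using near by blast
    have jN: "real N - \<bar>D'\<bar> \<le> real_of_int j" and iN: "real N \<le> real i" using j(2) inN by linarith+
    have "2 * gp (l 0) (l (int i)) (l j) = real i + real_of_int \<bar>j\<bar> - real_of_int \<bar>int i - j\<bar>"
      by (simp add: gprod_def geo)
    moreover have "real_of_int \<bar>int i - j\<bar> = \<bar>real i - real_of_int j\<bar>" "real_of_int \<bar>j\<bar> = \<bar>real_of_int j\<bar>" by simp_all
    ultimately have "real N - \<bar>D'\<bar> \<le> gp (l 0) (l (int i)) (l j)" using jN iN by linarith
    moreover have "gp (l 0) (l (int i)) (l j) \<le> gp \<one> (l (int i)) (l j) + e (l 0) \<one>"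
      using gp_change_base l by simp
    moreover have "e (l 0) \<one> = E" unfolding E_def using e_sym l by simp
    moreover have "gp \<one> (l j) (l (int i)) \<le> gp \<one> (q n) (l (int i)) + e (l j) (q n)"
      using gp_change_arg l q by simp
    moreover have "e (l j) (q n) = e (q n) (l j)" "gp \<one> (l j) (l (int i)) = gp \<one> (l (int i)) (l j)"
      "gp \<one> (q n) (l (int i)) = gp \<one> (l (int i)) (q n)" using e_sym gp_sym l q by auto
    ultimately show ?thesis unfolding gromov_gp using j(1) N by linarith
  qed
  then show "eventually (\<lambda>x. Z \<le> (case x of (i, n) \<Rightarrow> gromov G S \<one> (l (int i)) (q n))) (sequentially \<times>\<^sub>F sequentially)"
    unfolding eventually_prod_sequentially by (intro exI[of _ N]) auto
qed

text \<open>Besides the axis itself this records that the powers of g are coarsely dense along it;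
  the existence of tripods in the orbit rests on that.\<close>

lemma axis_exists:
  assumes g: "g \<in> carrier G" and ch: "is_chain c L p" and pow: "\<And>k :: int. p (2 * k) = g [^] k"
    and U: "\<And>j. e (p j) (p (j + 1)) \<le> U"
  shows "\<exists>l\<in>geodesics_axis G S g. (\<forall>j. \<exists>i. e (p j) (l i) \<le> c + 4 * dl + 1) \<and>
     (\<exists>B. \<forall>i. \<exists>k :: int. e (l i) (g [^] k) \<le> B)"
proof -
  define D where "D = c + 4 * dl + 1"
  define D' where "D' = 2 * c + 4 * dl + 2 * D"
  note pX = is_chainD(1)[OF ch]
  obtain l :: "int \<Rightarrow> 'a" where lX: "\<And>i. l i \<in> carrier G" and geo: "\<And>i j. e (l i) (l j) = real_of_int \<bar>i - j\<bar>"
    and near: "\<And>j. \<exists>i. e (p j) (l i) \<le> D \<and> (0 \<le> j \<longrightarrow> j - D' \<le> i) \<and> (j \<le> 0 \<longrightarrow> i \<le> j + D')"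
    using limit_geodesic[OF ch] unfolding D_def D'_def by blast
  have gn: "g [^] k \<in> carrier G" for k :: int using g by simp
  have p_nat: "p (int (2 * n)) = g [^] n" for n :: nat
    using pow[of "int n"] by (simp add: int_pow_int)
  have p_neg: "p (- int (2 * n)) = inv g [^] n" for n :: nat
    using pow[of "- int n"] g by (simp add: int_pow_neg int_pow_int nat_pow_inv)
  have "filterlim (\<lambda>(i, n). gromov G S \<one> (l (int i)) (g [^] (n::nat))) at_top (sequentially \<times>\<^sub>F sequentially)"
  proof (rule ray_gromov_at_top[OF lX geo, where D = D and D' = D'])
    show "\<exists>i. e (g [^] n) (l i) \<le> D \<and> real (2 * n) - D' \<le> real_of_int i" for n :: nat
      using near[of "int (2 * n)"] unfolding p_nat by auto
  qed (use g in simp)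
  moreover have "filterlim (\<lambda>(i, n). gromov G S \<one> (l (- int i)) (inv g [^] (n::nat))) at_top (sequentially \<times>\<^sub>F sequentially)"
  proof (rule ray_gromov_at_top[where l = "\<lambda>i. l (- i)" and D = D and D' = D'])
    show "e (l (- i)) (l (- j)) = real_of_int \<bar>i - j\<bar>" for i j using geo[of "- i" "- j"] by simp
    show "\<exists>i. e (inv g [^] n) (l (- i)) \<le> D \<and> real (2 * n) - D' \<le> real_of_int i" for n :: nat
    proof -
      obtain i where i: "e (inv g [^] n) (l i) \<le> D" "real_of_int i \<le> real_of_int (- int (2 * n)) + D'"
        using near[of "- int (2 * n)"] unfolding p_neg by auto
      then show ?thesis by (intro exI[of _ "- i"]) auto
    qed
  qed (use g lX in auto)
  ultimately have ax: "l \<in> geodesics_axis G S g" unfolding geodesics_axis_def using lX geo by simp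
  have "\<exists>k :: int. e (l i) (g [^] k) \<le> 3 * D + 2 * U" for i
  proof -
    define \<Psi> where "\<Psi> j i \<longleftrightarrow> e (p j) (l i) \<le> D \<and> (0 \<le> j \<longrightarrow> j - D' \<le> i) \<and> (j \<le> 0 \<longrightarrow> i \<le> j + D')" for j i :: int
    have "\<forall>j. \<exists>i. \<Psi> j i" using near unfolding \<Psi>_def by (intro allI)
    from choice[OF this] obtain x where x0: "\<forall>j. \<Psi> j (x j)" ..
    have x: "\<And>j. e (p j) (l (x j)) \<le> D" "\<And>j. 0 \<le> j \<Longrightarrow> j - D' \<le> x j" "\<And>j. j \<le> 0 \<Longrightarrow> x j \<le> j + D'"
      using x0 unfolding \<Psi>_def by auto
    obtain J :: nat where J: "real_of_int \<bar>i\<bar> + \<bar>D'\<bar> + 1 \<le> real J" using real_arch_simple by blast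
    \<comment> \<open>The largest j in the window whose index x j does not exceed i: then i lies
      between x j and x (j + 1), which belong to neighbouring chain points and so are at most 2 D +
      U apart. J is so large that x lies below i at -J and above i at J.\<close>
    define T where "T = {j \<in> {- int J .. int J}. x j \<le> i}"
    have fT: "finite T" unfolding T_def by (rule finite_subset[of _ "{- int J .. int J}"]) auto
    have "real_of_int (x (- int J)) \<le> real_of_int i" using x(3)[of "- int J"] J by simp
    then have T0: "- int J \<in> T" by (simp add: T_def)
    define j where "j = Max T"
    have jT: "j \<in> T" unfolding j_def using fT T0 by (intro Max_in) auto
    have "real_of_int i < real_of_int (x (int J))" using x(2)[of "int J"] J by simp
    then have "int J \<notin> T" by (simp add: T_def)
    then have jJ: "j < int J" using jT by (cases "j = int J") (auto simp: T_def)
    have "j + 1 \<notin> T"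
    proof
      assume "j + 1 \<in> T"
      then have "j + 1 \<le> j" using Max_ge[OF fT] j_def by blast
      then show False by simp
    qed
    then have xi: "x j \<le> i" "i < x (j + 1)" using jT jJ by (auto simp: T_def)
    have "e (l (x j)) (l (x (j + 1))) \<le> D + U + D"
      using e_tri[OF lX pX lX, of "x j" "x (j + 1)" j] e_tri[OF pX pX lX, of j "x (j + 1)" "j + 1"]
        e_sym[OF lX pX, of "x j" j] x(1)[of j] x(1)[of "j + 1"] U[of j] by linarith
    then have "e (l i) (l (x j)) \<le> 2 * D + U" using xi by (simp add: geo)
    then have lp: "e (l i) (p j) \<le> 3 * D + U"
      using e_tri[OF lX lX pX, of i j "x j"] e_sym[OF lX pX, of "x j" j] x(1)[of j] by linarith
    have U0: "0 \<le> U" using U[of 0] d_nonneg[OF pX pX, of 0 1] by simp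
    show ?thesis
    proof (cases "even j")
      case True
      then obtain k where "j = 2 * k" by blast
      then show ?thesis using lp U0 pow by (intro exI[of _ k]) simp
    next
      case False
      then obtain k where k: "j = 2 * k + 1" by (blast elim: oddE)
      have "e (l i) (g [^] k) \<le> 3 * D + U + U"
        using e_tri[OF lX pX pX, of i "2 * k" j] lp e_sym[OF pX pX, of j "2 * k"] U[of "2 * k"] unfolding k pow by linarith
      then show ?thesis by (intro exI[of _ k]) linarith
    qed
  qed
  moreover have "\<exists>i. e (p j) (l i) \<le> D" for j using near[of j] by blast
  ultimately show ?thesis using ax unfolding D_def by (intro bexI[of _ l]) auto
qed

lemma near_geodesic:
  assumes l: "\<And>i. l i \<in> carrier G" and geo: "\<And>i j. e (l i) (l j) = real_of_int \<bar>i - j\<bar>"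
    and X: "u \<in> carrier G" "x \<in> carrier G" "y \<in> carrier G"
    and near: "e x (l i) \<le> D" "e y (l j) \<le> D" and m: "gp u x y \<le> m"
  shows "\<exists>k. e u (l k) \<le> m + 2 * D + 2 * dl + 1"
proof -
  have main: "\<exists>k. e u (l k) \<le> m + 2 * D + 2 * dl + 1"
    if "i \<le> j" "x \<in> carrier G" "y \<in> carrier G" "e x (l i) \<le> D" "e y (l j) \<le> D" "gp u x y \<le> m" for i j x y
  proof -
    define n where "n = nat (j - i)"
    have j: "j = i + int n" using that by (simp add: n_def)
    have "\<exists>s\<le>n. e u (l (i + int s)) \<le> gp u (l (i + int 0)) (l (i + int n)) + 2 * dl + 1"
      by (rule geodesic_projection[OF X(1), of "\<lambda>s. l (i + int s)"]) (auto simp: l geo)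
    then obtain s where s: "e u (l (i + int s)) \<le> gp u (l i) (l j) + 2 * dl + 1" unfolding j by auto
    have "gp u (l i) (l j) \<le> gp u x y + e (l i) x + e (l j) y"
      using gp_change_args[OF X(1) l that(2) l that(3)] .
    then have "e u (l (i + int s)) \<le> m + 2 * D + 2 * dl + 1"
      using s that(4,5,6) e_sym[OF l that(2), of i] e_sym[OF l that(3), of j] by linarith
    then show ?thesis by blast
  qed
  show ?thesis
  proof (cases "i \<le> j")
    case True
    then show ?thesis using main X near m by blast
  next
    case False
    moreover have "gp u y x \<le> m" using m gp_sym[OF X(2,3), of u] by simp
    ultimately show ?thesis using main[of j i y x] X near by simp
  qed
qed

subsection \<open>Commutators with quasi-geodesic axes\<close>

definition cmt :: "'a \<Rightarrow> 'a \<Rightarrow> 'a" where "cmt g h = g \<otimes> h \<otimes> inv g \<otimes> inv h"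

lemma cmt_closed: "\<lbrakk>g \<in> carrier G; h \<in> carrier G\<rbrakk> \<Longrightarrow> cmt g h \<in> carrier G"
  by (simp add: cmt_def)

text \<open>The sequence ..., 1, W, g, g W, g g, ... with g = [W, h]. Its steps are alternately W
  and h \<open>inv W\<close> \<open>inv h\<close>.\<close>

definition cmt_chain :: "'a \<Rightarrow> 'a \<Rightarrow> int \<Rightarrow> 'a" where
  "cmt_chain W h k = cmt W h [^] (k div 2) \<otimes> (if odd k then W else \<one>)"

text \<open>After translation, the neighbours of a power of g are h W \<open>inv h\<close> and W,
  and those of the points in between are \<open>inv W\<close> and h \<open>inv W\<close>
  \<open>inv h\<close>. Dropping the final \<open>inv h\<close> costs at most r and leaves the two
  products that are assumed small.\<close>

lemma cmt_chain_is_chain: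
  assumes W: "W \<in> carrier G" and h: "h \<in> carrier G"
    and g1: "gp \<one> W (h \<otimes> W) \<le> c" and g2: "gp \<one> (inv W) (h \<otimes> inv W) \<le> c"
    and r: "real (wl h) \<le> r" and long: "2 * (c + r) + 3 * dl + 1 \<le> real (wl W) - 2 * r"
  shows "is_chain (c + r) (real (wl W) - 2 * r) (cmt_chain W h)"
    and "e (cmt_chain W h j) (cmt_chain W h (j + 1)) \<le> real (wl W) + 2 * r"
proof -
  let ?z = "cmt_chain W h"
  define g where "g = cmt W h"
  have g: "g \<in> carrier G" using cmt_closed W h g_def by simp
  have gk: "g [^] k \<in> carrier G" for k :: int using g by simp
  have zX: "?z k \<in> carrier G" for k using gk W by (simp add: cmt_chain_def g_def[symmetric])
  have z0: "?z (2 * k) = g [^] k" for k using gk by (simp add: cmt_chain_def g_def[symmetric])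
  have z1: "?z (2 * k + 1) = g [^] k \<otimes> W" for k by (simp add: cmt_chain_def g_def[symmetric])
  have z2: "?z (2 * k + 2) = g [^] k \<otimes> g" for k
    using z0[of "k + 1"] g by (simp add: int_pow_mult int_pow_1)
  have zm: "?z (2 * k - 1) = g [^] k \<otimes> (h \<otimes> W \<otimes> inv h)" for k
  proof -
    have "?z (2 * k - 1) = g [^] (k - 1) \<otimes> W" using z1[of "k - 1"] by simp
    also have "g [^] (k - 1) = g [^] k \<otimes> inv g" using int_pow_diff[of g k 1] g by (simp add: int_pow_1)
    also have "g [^] k \<otimes> inv g \<otimes> W = g [^] k \<otimes> (inv g \<otimes> W)" using gk g W by (simp add: m_assoc)
    also have "inv g \<otimes> W = h \<otimes> W \<otimes> inv h" using W h by (simp add: g_def cmt_def inv_mult_group m_assoc)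
    finally show ?thesis .
  qed
  have gW: "inv W \<otimes> g = h \<otimes> inv W \<otimes> inv h" using W h by (simp add: g_def cmt_def m_assoc)
  have hW: "h \<otimes> W \<otimes> inv h \<in> carrier G" "h \<otimes> inv W \<otimes> inv h \<in> carrier G" using W h by auto
  have r': "wl (inv h) = wl h" using wl_inv h by simp
  have joint: "gp (?z i) (?z (i - 1)) (?z (i + 1)) \<le> c + r" for i
  proof (cases "even i")
    case True
    then obtain k where k: "i = 2 * k" by blast
    have "gp (?z i) (?z (i - 1)) (?z (i + 1)) = gp (g [^] k \<otimes> \<one>) (g [^] k \<otimes> (h \<otimes> W \<otimes> inv h)) (g [^] k \<otimes> W)"
      unfolding k z0 z1 zm using gk by simp
    also have "\<dots> = gp \<one> (h \<otimes> W \<otimes> inv h) W" using gp_left[OF gk one_closed hW(1) W] .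
    also have "\<dots> \<le> gp \<one> (h \<otimes> W) W + e (h \<otimes> W \<otimes> inv h) (h \<otimes> W)" using gp_change_arg hW W h by simp
    also have "e (h \<otimes> W \<otimes> inv h) (h \<otimes> W) = real (wl h)"
      using e_right[of "h \<otimes> W" "inv h"] e_sym[of "h \<otimes> W" "h \<otimes> W \<otimes> inv h"] W h r' by simp
    also have "gp \<one> (h \<otimes> W) W = gp \<one> W (h \<otimes> W)" using gp_sym W h by simp
    finally show ?thesis using g1 r by linarith
  next
    case False
    then obtain k where k: "i = 2 * k + 1" by (blast elim: oddE)
    have "gp (?z i) (?z (i - 1)) (?z (i + 1)) = gp (?z (2 * k + 1)) (?z (2 * k)) (?z (2 * k + 2))"
      unfolding k by (simp add: algebra_simps)
    also have "\<dots> = gp (g [^] k \<otimes> W \<otimes> \<one>) (g [^] k \<otimes> W \<otimes> inv W) (g [^] k \<otimes> W \<otimes> (inv W \<otimes> g))"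
      unfolding z0 z1 z2 using gk W g by (simp add: m_assoc)
    also have "\<dots> = gp \<one> (inv W) (inv W \<otimes> g)" using gp_left[of "g [^] k \<otimes> W" \<one> "inv W" "inv W \<otimes> g"] gk W g by simp
    also have "\<dots> = gp \<one> (h \<otimes> inv W \<otimes> inv h) (inv W)" unfolding gW using gp_sym W hW by simp
    also have "\<dots> \<le> gp \<one> (h \<otimes> inv W) (inv W) + e (h \<otimes> inv W \<otimes> inv h) (h \<otimes> inv W)" using gp_change_arg hW W h by simp
    also have "e (h \<otimes> inv W \<otimes> inv h) (h \<otimes> inv W) = real (wl h)"
      using e_right[of "h \<otimes> inv W" "inv h"] e_sym[of "h \<otimes> inv W" "h \<otimes> inv W \<otimes> inv h"] W h r' by simp
    also have "gp \<one> (h \<otimes> inv W) (inv W) = gp \<one> (inv W) (h \<otimes> inv W)" using gp_sym W h by simp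
    finally show ?thesis using g2 r by linarith
  qed
  have step: "e (?z i) (?z (i + 1)) = (if even i then real (wl W) else real (wl (h \<otimes> inv W \<otimes> inv h)))" for i
  proof (cases "even i")
    case True
    then obtain k where k: "i = 2 * k" by blast
    then show ?thesis unfolding k z0 z1 using e_right gk W by simp
  next
    case False
    then obtain k where k: "i = 2 * k + 1" by (blast elim: oddE)
    have "e (?z i) (?z (i + 1)) = e (?z (2 * k + 1)) (?z (2 * k + 2))" unfolding k by (simp add: algebra_simps)
    also have "\<dots> = e (g [^] k \<otimes> W \<otimes> \<one>) (g [^] k \<otimes> W \<otimes> (inv W \<otimes> g))"
      unfolding z1 z2 using gk W g by (simp add: m_assoc)
    also have "\<dots> = e \<one> (inv W \<otimes> g)" using e_left[of "g [^] k \<otimes> W" \<one> "inv W \<otimes> g"] gk W g by simp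
    also have "\<dots> = real (wl (h \<otimes> inv W \<otimes> inv h))" unfolding gW using e_one hW by simp
    finally show ?thesis using False by simp
  qed
  have up: "wl (h \<otimes> inv W \<otimes> inv h) \<le> wl W + 2 * wl h"
    using wl_mult[of "h \<otimes> inv W" "inv h"] wl_mult[of h "inv W"] wl_inv[of W] r' W h by simp
  have low: "wl W \<le> wl (h \<otimes> inv W \<otimes> inv h) + 2 * wl h"
  proof -
    have "inv W = inv h \<otimes> (h \<otimes> inv W \<otimes> inv h) \<otimes> h" using W h by (simp add: m_assoc)
    then have "wl (inv W) \<le> wl (inv h \<otimes> (h \<otimes> inv W \<otimes> inv h)) + wl h"
      using wl_mult[of "inv h \<otimes> (h \<otimes> inv W \<otimes> inv h)" h] hW h by simp
    also have "\<dots> \<le> wl (inv h) + wl (h \<otimes> inv W \<otimes> inv h) + wl h" using wl_mult[of "inv h" "h \<otimes> inv W \<otimes> inv h"] hW h by simp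
    finally show ?thesis using wl_inv[OF W] r' by simp
  qed
  have stepL: "real (wl W) - 2 * r \<le> e (?z i) (?z (i + 1))" for i
    unfolding step using low r by (cases "even i") auto
  show "is_chain (c + r) (real (wl W) - 2 * r) ?z"
    unfolding is_chain_def using zX joint stepL long by blast
  show "e (?z j) (?z (j + 1)) \<le> real (wl W) + 2 * r"
    unfolding step using up r by (cases "even j") auto
qed

text \<open>Separating words for W and for its inverse give the two joints of the commutator chain.
  One factor g spans two steps of the chain, hence the translation length near
  \<open>2 * wl W\<close>.\<close>

lemma good_commutators:
  assumes ab: "a \<in> carrier G" "b \<in> carrier G"
    and free: "\<And>w. \<lbrakk>w \<noteq> []; reduced2 w\<rbrakk> \<Longrightarrow> eval2 G a b w \<noteq> \<one>"
  shows "\<exists>n. \<exists>M\<ge>0. \<forall>W\<in>carrier G. M \<le> real (wl W) \<longrightarrow> (\<exists>w. length w = n \<and>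
     (let g = cmt W (sqw G a b w) in infinite_order G g \<and> 2 * real (wl W) - M \<le> word_tlen G S g \<and>
       (\<exists>l\<in>geodesics_axis G S g. (\<forall>k :: int. \<exists>i. e (g [^] k) (l i) \<le> M) \<and> (\<exists>i. e W (l i) \<le> M) \<and>
          (\<exists>B. \<forall>i. \<exists>k :: int. e (l i) (g [^] k) \<le> B))))"
proof -
  obtain n c where nc: "\<forall>u\<in>carrier G. \<forall>v\<in>carrier G. \<forall>u'\<in>carrier G. \<forall>v'\<in>carrier G.
     \<exists>w. length w = n \<and> gp \<one> u (sqw G a b w \<otimes> v) \<le> c \<and> gp \<one> u' (sqw G a b w \<otimes> v') \<le> c"
    using separating_word[OF ab free] by blast
  define r where "r = real (n * (2 * max (wl a) (wl b)))"
  have r0: "0 \<le> r" by (simp add: r_def)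
  \<comment> \<open>Two steps of \<open>chain_growth\<close> lose 4 c + 8 r + 4 dl; the remaining
    terms let the same M bound the distance c + r + 4 dl + 1 to the axis and ensure that the steps
    are long.\<close>
  define M where "M = 4 * \<bar>c\<bar> + 8 * r + 4 * dl + 4 * dl + 1"
  have M0: "0 \<le> M" unfolding M_def using r0 dl_nonneg by simp
  have "\<exists>w. length w = n \<and>
     (let g = cmt W (sqw G a b w) in infinite_order G g \<and> 2 * real (wl W) - M \<le> word_tlen G S g \<and>
       (\<exists>l\<in>geodesics_axis G S g. (\<forall>k :: int. \<exists>i. e (g [^] k) (l i) \<le> M) \<and> (\<exists>i. e W (l i) \<le> M) \<and>
          (\<exists>B. \<forall>i. \<exists>k :: int. e (l i) (g [^] k) \<le> B)))"
    if W: "W \<in> carrier G" "M \<le> real (wl W)" for W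
  proof -
    obtain w where w: "length w = n" "gp \<one> W (sqw G a b w \<otimes> W) \<le> c" "gp \<one> (inv W) (sqw G a b w \<otimes> inv W) \<le> c"
      using nc W(1) inv_closed[OF W(1)] by blast
    define h where "h = sqw G a b w"
    define g where "g = cmt W h"
    have h: "h \<in> carrier G" using sqw_closed[OF ab] h_def by simp
    have g: "g \<in> carrier G" using cmt_closed W h g_def by simp
    have hr: "real (wl h) \<le> r" unfolding h_def r_def using wl_sqw[OF ab, of w] w(1) by (simp only: of_nat_le_iff)
    have long: "2 * (c + r) + 3 * dl + 1 \<le> real (wl W) - 2 * r"
    proof -
      have "2 * (c + r) = 2 * c + 2 * r" by simp
      then show ?thesis using W(2) r0 dl_nonneg unfolding M_def by linarith
    qed
    note ch = cmt_chain_is_chain[OF W(1) h w(2,3)[folded h_def] hr long]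
    define L where "L = real (wl W) - 2 * r"
    have z0: "cmt_chain W h (2 * k) = g [^] k" for k using g by (simp add: cmt_chain_def g_def[symmetric])
    have z1: "cmt_chain W h 1 = W" using W by (simp add: cmt_chain_def)
    have z00: "cmt_chain W h 0 = \<one>" using z0[of 0] by simp
    have grow: "real k * (2 * real (wl W) - M) \<le> real (wl (g [^] k))" for k :: nat
    proof -
      have "real (2 * k) * (L - 2 * (c + r) - 2 * dl) \<le> e (cmt_chain W h 0) (cmt_chain W h (0 + int (2 * k)))"
        using is_chain_growth[OF ch(1), of "2 * k" 0] unfolding L_def by blast
      also have "cmt_chain W h (0 + int (2 * k)) = g [^] k" using z0[of "int k"] by (simp add: int_pow_int)
      finally have "real (2 * k) * (L - 2 * (c + r) - 2 * dl) \<le> real (wl (g [^] k))" using z00 g by (simp add: e_one)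
      moreover have "real k * (2 * real (wl W) - M) \<le> real k * (2 * (L - 2 * (c + r) - 2 * dl))"
      proof (rule mult_left_mono)
        have "2 * (L - 2 * (c + r) - 2 * dl) = 2 * real (wl W) - 4 * r - 4 * c - 4 * r - 4 * dl"
          unfolding L_def by (simp add: algebra_simps)
        then show "2 * real (wl W) - M \<le> 2 * (L - 2 * (c + r) - 2 * dl)"
          unfolding M_def using dl_nonneg by linarith
      qed simp
      ultimately show ?thesis by (simp add: mult_ac)
    qed
    have "infinite_order G g"
      unfolding infinite_order_def
    proof (intro allI impI notI)
      fix k :: nat assume k: "0 < k" "g [^] k = \<one>"
      have "0 < 2 * real (wl W) - M" using W(2) M0 long r0 dl_nonneg unfolding M_def by linarith
      then have "0 < real k * (2 * real (wl W) - M)" using k(1) by simp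
      then show False using grow[of k] k(2) by (simp add: wl_one)
    qed
    moreover have "2 * real (wl W) - M \<le> word_tlen G S g" by (rule tlen_lower_bound[OF g grow])
    moreover obtain l where l: "l \<in> geodesics_axis G S g" "\<And>j. \<exists>i. e (cmt_chain W h j) (l i) \<le> c + r + 4 * dl + 1"
      "\<exists>B. \<forall>i. \<exists>k :: int. e (l i) (g [^] k) \<le> B"
      using axis_exists[OF g ch(1) z0 ch(2)] by blast
    moreover have cM: "c + r + 4 * dl + 1 \<le> M" unfolding M_def using r0 dl_nonneg by linarith
    moreover have "\<exists>i. e (g [^] k) (l i) \<le> M" for k :: int using l(2)[of "2 * k"] cM unfolding z0 by (meson order_trans)
    moreover have "\<exists>i. e W (l i) \<le> M" using l(2)[of 1] cM unfolding z1 by (meson order_trans)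
    ultimately show ?thesis using w(1) unfolding Let_def g_def h_def by (intro exI[of _ w] conjI bexI[of _ l]) auto
  qed
  then show ?thesis using M0 by (intro exI[of _ n] exI[of _ M]) blast
qed

subsection \<open>Translation length and stable length\<close>

text \<open>Take a conjugate b of a of least length. Conjugation by the midpoint of a geodesic from
  1 to b cannot shorten it, which prevents that geodesic and its translate by b from backtracking at
  b. The powers of b then form a chain, unless b is short, in which case the bound is
  trivial.\<close>

lemma translation_length_stable:
  assumes a: "a \<in> carrier G"
  shows "\<exists>h\<in>carrier G. \<forall>n :: nat. real n * (word_tlen G S a - (10 * dl + 10)) \<le> real (wl ((inv h \<otimes> a \<otimes> h) [^] n))"
proof -
  define f where "f h = wl (inv h \<otimes> a \<otimes> h)" for h
  obtain h where h: "h \<in> carrier G" "\<And>k. k \<in> carrier G \<Longrightarrow> f h \<le> f k"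
    using ex_has_least_nat[of "\<lambda>h. h \<in> carrier G" \<one> f] one_closed by blast
  define b where "b = inv h \<otimes> a \<otimes> h"
  have b: "b \<in> carrier G" using h a by (simp add: b_def)
  have min: "wl b \<le> wl (inv k \<otimes> b \<otimes> k)" if k: "k \<in> carrier G" for k
  proof -
    have "inv (h \<otimes> k) \<otimes> a \<otimes> (h \<otimes> k) = inv k \<otimes> b \<otimes> k" using h a k by (simp add: b_def inv_mult_group m_assoc)
    then show ?thesis using h(2)[of "h \<otimes> k"] h(1) k unfolding f_def b_def by simp
  qed
  have "word_tlen G S a \<le> e h (a \<otimes> h)"
    unfolding word_tlen_def
  proof (rule cInf_lower)
    show "bdd_below {e g (a \<otimes> g) |g. g \<in> carrier G}" by (rule bdd_belowI[of _ 0]) (auto simp: e_eq)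
  qed (use h in blast)
  also have "e h (a \<otimes> h) = real (wl b)" using h a by (simp add: e_eq b_def m_assoc)
  finally have tb: "word_tlen G S a \<le> real (wl b)" .
  have "real n * (word_tlen G S a - (10 * dl + 10)) \<le> real (wl (b [^] n))" for n :: nat
  proof (cases "real (wl b) \<le> 10 * dl + 10")
    case True
    then have "real n * (word_tlen G S a - (10 * dl + 10)) \<le> 0" using tb by (intro mult_nonneg_nonpos) auto
    then show ?thesis by (meson of_nat_0_le_iff order_trans)
  next
    case False
    obtain F L where F: "\<And>i. F i \<in> carrier G" "F 0 = \<one>" "F L = b" "real L = e \<one> b"
      "\<And>i j. i\<le>L \<Longrightarrow> j\<le>L \<Longrightarrow> e (F i) (F j) = \<bar>real i - real j\<bar>"
      using geodesic_path[OF one_closed b] by blast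
    have L: "L = wl b" using F(4) b by (simp add: e_one)
    define t where "t = L div 2"
    have t: "t \<le> L" "real L \<le> 2 * real t + 1" "2 * real t \<le> real L" unfolding t_def by linarith+
    define y where "y = F t"
    have y: "y \<in> carrier G" using F y_def by simp
    have by': "b \<otimes> y \<in> carrier G" "b \<otimes> b \<in> carrier G" using b y by auto
    have d1: "e \<one> y = real t" using F(5)[of 0 t] F(2) t by (simp add: y_def)
    have d2: "e y b = real L - real t" using F(5)[of t L] F(3) t by (simp add: y_def)
    have d3: "e b (b \<otimes> y) = real t" using e_right[OF b y] d1 y by (simp add: e_one)
    have d4: "e (b \<otimes> y) (b \<otimes> b) = real L - real t" using e_left[OF b y b] d2 by simp
    have d5: "e b (b \<otimes> b) = real L" using e_right[OF b b] L by simp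
    have d6: "real L \<le> e y (b \<otimes> y)" using min[OF y] L y b by (simp add: e_eq m_assoc)
    have d7: "e b \<one> = real L" using F(4) e_sym b by simp
    have "2 * gp b y (b \<otimes> y) \<le> 0" "2 * gp b y \<one> = 2 * real L - 2 * real t" "2 * gp b (b \<otimes> b) (b \<otimes> y) = 2 * real t"
      using d1 d2 d3 d4 d5 d6 d7 e_sym[OF b y] e_sym[OF y one_closed] e_sym[OF by'] by (simp_all add: gprod_def)
    \<comment> \<open>Seen from b, the midpoints y and b y have product at most 0 by minimality,
      while y and 1, and likewise b y and b b, have product about L / 2. Only 1 and b b are left to
      have a small product.\<close>
    then have gb: "gp b \<one> (b \<otimes> b) \<le> 2 * dl"
      using gp_min4[OF b y one_closed by'(2) by'(1)] t False L by auto
    have bk: "b [^] k \<in> carrier G" for k :: int using b by simp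
    define p where "p k = b [^] k" for k :: int
    have ps: "p (k + 1) = b [^] (k - 1) \<otimes> (b \<otimes> b)" "p k = b [^] (k - 1) \<otimes> b" "p (k - 1) = b [^] (k - 1) \<otimes> \<one>" for k
    proof -
      show "p k = b [^] (k - 1) \<otimes> b" unfolding p_def using int_pow_mult[of b "k - 1" 1] b by (simp add: int_pow_1)
      moreover have "p (k + 1) = p k \<otimes> b" unfolding p_def using int_pow_mult[of b k 1] b by (simp add: int_pow_1)
      ultimately show "p (k + 1) = b [^] (k - 1) \<otimes> (b \<otimes> b)" using bk b by (simp add: m_assoc)
      show "p (k - 1) = b [^] (k - 1) \<otimes> \<one>" unfolding p_def using bk by simp
    qed
    have ch: "is_chain (2 * dl) (real L) p"
      unfolding is_chain_def
    proof (intro conjI allI)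
      fix k
      show "p k \<in> carrier G" using bk p_def by simp
      show "gp (p k) (p (k - 1)) (p (k + 1)) \<le> 2 * dl"
        unfolding ps(1)[of k] ps(2)[of k] ps(3)[of k] using gp_left[OF bk[of "k - 1"] b one_closed by'(2)] gb by metis
      have "p (k + 1) = p k \<otimes> b" unfolding p_def using int_pow_mult[of b k 1] b by (simp add: int_pow_1)
      then show "real L \<le> e (p k) (p (k + 1))" using e_right[of "p k" b] bk b L by (simp add: p_def)
      show "2 * (2 * dl) + 3 * dl + 1 \<le> real L" using False L dl_nonneg by simp
    qed
    have "real n * (real L - 2 * (2 * dl) - 2 * dl) \<le> e (p 0) (p (0 + int n))" by (rule is_chain_growth[OF ch])
    also have "\<dots> = real (wl (b [^] n))" using b by (simp add: p_def int_pow_int e_one)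
    finally have "real n * (real L - 6 * dl) \<le> real (wl (b [^] n))" by simp
    moreover have "real n * (word_tlen G S a - (10 * dl + 10)) \<le> real n * (real L - 6 * dl)"
      using tb L dl_nonneg by (intro mult_left_mono) auto
    ultimately show ?thesis by linarith
  qed
  then show ?thesis using h(1) unfolding b_def by blast
qed

end

section \<open>Displacement of orbit points\<close>

context rep
begin

definition disp :: "complex \<times> real \<Rightarrow> 'a \<Rightarrow> real" where "disp x g = hdist x (act g x)"

lemma disp_nonneg: "\<lbrakk>x \<in> H3; g \<in> carrier G\<rbrakk> \<Longrightarrow> 0 \<le> disp x g"
  using hdist_nonneg act_H3 by (simp add: disp_def)

lemma hdist_act: "\<lbrakk>x \<in> H3; g \<in> carrier G; h \<in> carrier G\<rbrakk> \<Longrightarrow> hdist (act g x) (act h x) = disp x (inv g \<otimes> h)"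
proof -
  assume a: "x \<in> H3" "g \<in> carrier G" "h \<in> carrier G"
  have "hdist (act g x) (act h x) = hdist (act (inv g) (act g x)) (act (inv g) (act h x))"
    using act_isometry[of "inv g"] act_H3 a by simp
  also have "act (inv g) (act g x) = x" using act_inv a by simp
  also have "act (inv g) (act h x) = act (inv g \<otimes> h) x" using act_mult a by simp
  finally show ?thesis by (simp add: disp_def)
qed

lemma disp_one: "x \<in> H3 \<Longrightarrow> disp x \<one> = 0"
  using act_one hdist_refl by (simp add: disp_def)

lemma disp_mult: "\<lbrakk>x \<in> H3; g \<in> carrier G; h \<in> carrier G\<rbrakk> \<Longrightarrow> disp x (g \<otimes> h) \<le> disp x g + disp x h"
proof -
  assume a: "x \<in> H3" "g \<in> carrier G" "h \<in> carrier G"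
  have "hdist x (act (g \<otimes> h) x) \<le> hdist x (act g x) + hdist (act g x) (act g (act h x))"
    using hdist_triangle[of x "act g x" "act g (act h x)"] act_mult a act_H3 by simp
  also have "hdist (act g x) (act g (act h x)) = hdist x (act h x)" using act_isometry act_H3 a by simp
  finally show ?thesis by (simp add: disp_def)
qed

lemma disp_inv: "\<lbrakk>x \<in> H3; g \<in> carrier G\<rbrakk> \<Longrightarrow> disp x (inv g) = disp x g"
proof -
  assume a: "x \<in> H3" "g \<in> carrier G"
  have "disp x (inv g) = hdist (act g x) (act \<one> x)" using hdist_act[of x g \<one>] a by simp
  also have "\<dots> = disp x g" using a act_one hdist_sym by (simp add: disp_def)
  finally show ?thesis .
qed

lemma disp_lipschitz:
  assumes "x \<in> H3"
  shows "\<exists>L\<ge>1. \<forall>g\<in>carrier G. disp x g \<le> L * real (wl g)"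
  using wl_bound[of "disp x"] disp_one disp_mult assms by simp

lemma disp_change_base:
  assumes "x \<in> H3" "y \<in> H3" "g \<in> carrier G"
  shows "disp y g \<le> disp x g + 2 * hdist x y"
proof -
  have "hdist y (act g y) \<le> hdist y x + hdist x (act g x) + hdist (act g x) (act g y)"
    using hdist_triangle[OF assms(2,1) act_H3[OF assms(3,2)]]
      hdist_triangle[OF assms(1) act_H3[OF assms(3,1)] act_H3[OF assms(3,2)]] by linarith
  also have "hdist (act g x) (act g y) = hdist x y" using act_isometry assms by simp
  also have "hdist y x = hdist x y" by (rule hdist_sym)
  finally show ?thesis by (simp add: disp_def)
qed

text \<open>Only the lower estimate appears, because the upper one holds for every representation by
  \<open>disp_lipschitz\<close>.\<close>

definition qi :: bool where
  "qi \<longleftrightarrow> (\<exists>x\<in>H3. \<exists>J\<ge>1. \<exists>B\<ge>0. \<forall>g\<in>carrier G. real (wl g) \<le> J * disp x g + B)"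

lemma qiE:
  assumes qi "y \<in> H3"
  obtains J B where "1 \<le> J" "0 \<le> B" "\<And>g. g \<in> carrier G \<Longrightarrow> real (wl g) \<le> J * disp y g + B"
proof -
  obtain x J B where x: "x \<in> H3" "1 \<le> J" "0 \<le> B" "\<And>g. g \<in> carrier G \<Longrightarrow> real (wl g) \<le> J * disp x g + B"
    using assms(1) unfolding qi_def by blast
  have "real (wl g) \<le> J * disp y g + (J * (2 * hdist x y) + B)" if g: "g \<in> carrier G" for g
  proof -
    have "disp x g \<le> disp y g + 2 * hdist x y" using disp_change_base[OF assms(2) x(1) g] hdist_sym[of y x] by simp
    then have "J * disp x g \<le> J * (disp y g + 2 * hdist x y)" using x(2) by (intro mult_left_mono) auto
    then show ?thesis using x(4)[OF g] by (simp add: distrib_left)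
  qed
  moreover have "0 \<le> J * (2 * hdist x y) + B" using x hdist_nonneg[OF x(1) assms(2)] by simp
  ultimately show ?thesis using that x(2) by blast
qed

subsection \<open>Convex cocompact representations have quasi-isometric orbit maps\<close>

lemma R_close:
  assumes g: "g \<in> carrier G" and g0: "g0 \<in> carrier G" and b: "norm (R (inv g0)) \<le> b"
    and close: "8 * (b * norm (R g - R g0)) < \<epsilon>"
  shows "\<exists>M\<in>\<rho> (inv g0 \<otimes> g). norm (M - mat 1) < \<epsilon>"
proof -
  define N where "N = R (inv g0)"
  have k: "inv g0 \<otimes> g \<in> carrier G" using g g0 by simp
  have rk: "N ** R g \<in> \<rho> (inv g0 \<otimes> g)" "- (N ** R g) \<in> \<rho> (inv g0 \<otimes> g)"
  proof -
    have "R (inv g0 \<otimes> g) = N ** R g \<or> R (inv g0 \<otimes> g) = - (N ** R g)"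
      using R_mult[OF inv_closed[OF g0] g] unfolding N_def .
    then show "N ** R g \<in> \<rho> (inv g0 \<otimes> g)" "- (N ** R g) \<in> \<rho> (inv g0 \<otimes> g)"
      unfolding R(1)[OF k] by auto
  qed
  have s: "N ** R g0 = mat 1 \<or> N ** R g0 = - mat 1"
  proof -
    have "R \<one> = N ** R g0 \<or> R \<one> = - (N ** R g0)"
      using R_mult[OF inv_closed[OF g0] g0] g0 unfolding N_def by simp
    then show ?thesis using R_one by (metis minus_minus)
  qed
  have d: "N ** R g - N ** R g0 = N ** (R g - R g0)"
    by (simp add: vec_eq_iff mat2_mult forall_2 algebra_simps)
  have "norm (N ** (R g - R g0)) \<le> 8 * (norm N * norm (R g - R g0))" by (rule norm_mat2_mult)
  also have "\<dots> \<le> 8 * (b * norm (R g - R g0))" using b unfolding N_def by (simp add: mult_right_mono)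
  finally have n: "norm (N ** R g - N ** R g0) < \<epsilon>" using close unfolding d by simp
  from s show ?thesis
  proof (elim disjE)
    assume "N ** R g0 = mat 1"
    then show ?thesis using n rk by (intro bexI[of _ "N ** R g"]) auto
  next
    assume "N ** R g0 = - mat 1"
    then have "norm (- (N ** R g) - mat 1) < \<epsilon>" using n norm_minus_cancel[of "N ** R g + mat 1"] by simp
    then show ?thesis using rk by blast
  qed
qed

text \<open>Infinitely many elements of bounded displacement would have lifts in a compact set of
  matrices, so infinitely many of them would be close to one g0. Their quotients by g0 have a lift
  close to the identity, hence lie in the kernel, which is finite.\<close>

lemma discrete_imp_proper:
  assumes ker: "finite {g \<in> carrier G. \<rho> g = \<one>\<^bsub>PSL2\<^esub>}" and \<epsilon>: "0 < \<epsilon>"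
    and disc: "\<And>g M. \<lbrakk>g \<in> carrier G; \<rho> g \<noteq> \<one>\<^bsub>PSL2\<^esub>; M \<in> \<rho> g\<rbrakk> \<Longrightarrow> \<epsilon> \<le> norm (M - mat 1)"
  shows "finite {g \<in> carrier G. disp base g \<le> r}"
proof (rule ccontr)
  define A where "A = {g \<in> carrier G. disp base g \<le> r}"
  assume "\<not> ?thesis"
  then have infA: "infinite A" by (simp add: A_def)
  define b where "b = sqrt (2 * cosh r)"
  have b: "0 < b" by (simp add: b_def)
  have Rb: "norm (R g) \<le> b" if "g \<in> carrier G" "disp base g \<le> r" for g
    using norm_le_of_hdist_base[of "R g" r] R(2)[of g] act_mob[of g] that unfolding b_def disp_def by simp
  \<comment> \<open>Two matrices in one ball differ by less than \<open>2 * \<eta>\<close>, and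
    \<open>R_close\<close> multiplies this by 8 b; the result is \<epsilon> / 2.\<close>
  define \<eta> where "\<eta> = \<epsilon> / (32 * b)"
  have \<eta>: "0 < \<eta>" using \<epsilon> b by (simp add: \<eta>_def)
  have "compact (cball (0 :: complex^2^2) b)" by simp
  then obtain k where k: "finite k" "cball (0 :: complex^2^2) b \<subseteq> (\<Union>x\<in>k. ball x \<eta>)"
    using \<eta> unfolding compact_eq_totally_bounded by blast
  have "\<forall>g\<in>A. \<exists>x\<in>k. R g \<in> ball x \<eta>"
  proof
    fix g assume "g \<in> A"
    then have "R g \<in> cball 0 b" using Rb by (simp add: A_def)
    then show "\<exists>x\<in>k. R g \<in> ball x \<eta>" using k(2) by blast
  qed
  from pigeonhole_infinite_rel[OF infA k(1) this] obtain x where x: "infinite {g \<in> A. R g \<in> ball x \<eta>}" by blast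
  then obtain g0 where g0: "g0 \<in> A" "R g0 \<in> ball x \<eta>" by (metis (mono_tags, lifting) finite.emptyI mem_Collect_eq subsetI subset_empty)
  have g0c: "g0 \<in> carrier G" using g0 by (simp add: A_def)
  have ig: "norm (R (inv g0)) \<le> b" using Rb[of "inv g0"] disp_inv[OF base_H3 g0c] g0 by (simp add: A_def)
  have "{g \<in> A. R g \<in> ball x \<eta>} \<subseteq> (\<lambda>k. g0 \<otimes> k) ` {g \<in> carrier G. \<rho> g = \<one>\<^bsub>PSL2\<^esub>}"
  proof
    fix g assume g: "g \<in> {g \<in> A. R g \<in> ball x \<eta>}"
    then have gc: "g \<in> carrier G" by (simp add: A_def)
    have "dist (R g) (R g0) < 2 * \<eta>"
      using dist_triangle[of "R g" "R g0" x] g g0(2) by (simp add: dist_commute)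
    then have "norm (R g - R g0) < 2 * \<eta>" by (simp add: dist_norm)
    then have "8 * (b * norm (R g - R g0)) < 8 * (b * (2 * \<eta>))" using b by simp
    also have "\<dots> < \<epsilon>" using b \<epsilon> by (simp add: \<eta>_def)
    finally have "\<exists>M\<in>\<rho> (inv g0 \<otimes> g). norm (M - mat 1) < \<epsilon>" using R_close[OF gc g0c ig] by blast
    then have "\<rho> (inv g0 \<otimes> g) = \<one>\<^bsub>PSL2\<^esub>" using disc[of "inv g0 \<otimes> g"] gc g0c by force
    then show "g \<in> (\<lambda>k. g0 \<otimes> k) ` {g \<in> carrier G. \<rho> g = \<one>\<^bsub>PSL2\<^esub>}"
      using gc g0c by (intro image_eqI[of _ _ "inv g0 \<otimes> g"]) auto
  qed
  then show False using x ker finite_subset by blast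
qed

text \<open>Convexity keeps the segment from x to its image inside C. Walking along it in steps of
  at most 1 and replacing each point by an orbit point within r, consecutive group elements differ
  by a member of the finite set F.\<close>

lemma svarc_milnor:
  assumes C: "hconvex C" "x \<in> C" "\<And>g p. \<lbrakk>g \<in> carrier G; p \<in> C\<rbrakk> \<Longrightarrow> act g p \<in> C"
    and cob: "\<And>p. p \<in> C \<Longrightarrow> \<exists>g\<in>carrier G. hdist p (act g x) \<le> r"
    and finF: "finite {g \<in> carrier G. disp x g \<le> 2 * r + 1}"
  shows qi
proof -
  have CH: "C \<subseteq> H3" using C(1) by (simp add: hconvex_def)
  then have xH: "x \<in> H3" using C(2) by blast
  define F where "F = {g \<in> carrier G. disp x g \<le> 2 * r + 1}"
  define M where "M = real (Max (insert 1 (wl ` F)))"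
  have M: "real (wl g) \<le> M" if "g \<in> F" for g
    unfolding M_def using finF that by (simp only: of_nat_le_iff) (intro Max_ge, auto simp: F_def)
  have M1: "1 \<le> M"
  proof -
    have "1 \<le> Max (insert 1 (wl ` F))" using finF by (intro Max_ge) (auto simp: F_def)
    then show ?thesis unfolding M_def by simp
  qed
  have step: "e g h \<le> M" if "g \<in> carrier G" "h \<in> carrier G" "hdist (act g x) (act h x) \<le> 2 * r + 1" for g h
    using M[of "inv g \<otimes> h"] that hdist_act[OF xH that(1,2)] by (simp add: F_def e_eq)
  have main: "e g h \<le> real (n + 1) * M"
    if "g \<in> carrier G" "h \<in> carrier G" "p \<in> C" "q \<in> C" "hdist p (act g x) \<le> r" "hdist q (act h x) \<le> r" "hdist p q \<le> real n"
    for n g h p q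
    using that
  proof (induction n arbitrary: g p)
    case 0
    have H: "p \<in> H3" "q \<in> H3" "act g x \<in> H3" "act h x \<in> H3" using 0 CH act_H3 xH by auto
    have "hdist (act g x) (act h x) \<le> hdist (act g x) p + hdist p q + hdist q (act h x)"
      using hdist_triangle[OF H(3,1,4)] hdist_triangle[OF H(1,2,4)] by linarith
    also have "\<dots> \<le> 2 * r + 1" using 0 hdist_sym[of p "act g x"] by simp
    finally show ?case using step[of g h] 0 by simp
  next
    case (Suc n)
    have H: "p \<in> H3" "q \<in> H3" "act g x \<in> H3" "act h x \<in> H3" using Suc.prems CH act_H3 xH by auto
    define t where "t = min 1 (hdist p q)"
    have t: "0 \<le> t" "t \<le> hdist p q" "t \<le> 1" "hdist p q - t \<le> real n"
      using hdist_nonneg[OF H(1,2)] Suc.prems(7) by (auto simp: t_def)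
    obtain m where m: "m \<in> H3" "hdist p m = t" "hdist m q = hdist p q - t" using hseg_point[OF H(1,2) t(1,2)] by blast
    have "m \<in> hseg p q" using m by (simp add: hseg_def)
    then have mC: "m \<in> C" using C(1) Suc.prems(3,4) unfolding hconvex_def by blast
    obtain k where k: "k \<in> carrier G" "hdist m (act k x) \<le> r" using cob[OF mC] by blast
    have kH: "act k x \<in> H3" using act_H3 k xH by simp
    have "hdist (act g x) (act k x) \<le> hdist (act g x) p + hdist p m + hdist m (act k x)"
      using hdist_triangle[OF H(3,1) kH] hdist_triangle[OF H(1) m(1) kH] by linarith
    also have "\<dots> \<le> 2 * r + 1" using Suc.prems(5) k(2) m(2) t(3) hdist_sym[of p "act g x"] by simp
    finally have "e g k \<le> M" using step Suc.prems(1) k(1) by blast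
    moreover have "e k h \<le> real (n + 1) * M"
      using Suc.IH[OF k(1) Suc.prems(2) mC Suc.prems(4) k(2) Suc.prems(6)] m(3) t(4) by simp
    moreover have "e g h \<le> e g k + e k h" using e_tri Suc.prems(1,2) k(1) by blast
    ultimately show ?case by (simp add: algebra_simps)
  qed
  obtain g1 where g1: "g1 \<in> carrier G" "hdist x (act g1 x) \<le> r" using cob[OF C(2)] by blast
  have r0: "0 \<le> r" using hdist_nonneg[OF xH act_H3[OF g1(1) xH]] g1(2) by linarith
  have "real (wl g) \<le> M * disp x g + 2 * M" if g: "g \<in> carrier G" for g
  proof -
    define n where "n = nat \<lceil>disp x g\<rceil>"
    have n: "disp x g \<le> real n" "real n \<le> disp x g + 1" using disp_nonneg[OF xH g] unfolding n_def by linarith+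
    have "e \<one> g \<le> real (n + 1) * M"
    proof (rule main[OF one_closed g C(2) C(3)[OF g C(2)]])
      show "hdist x (act \<one> x) \<le> r" using act_one[OF xH] hdist_refl r0 by simp
      show "hdist (act g x) (act g x) \<le> r" using hdist_refl r0 by simp
      show "hdist x (act g x) \<le> real n" using n(1) by (simp add: disp_def)
    qed
    also have "\<dots> \<le> (disp x g + 2) * M" using n(2) M1 by (intro mult_right_mono) auto
    finally show ?thesis using g by (simp add: e_one algebra_simps)
  qed
  then show qi unfolding qi_def using xH M1 by (intro bexI[of _ x] exI[of _ M] exI[of _ "2 * M"] conjI) auto
qed

lemma convex_cocompact_imp_qi:
  assumes "convex_cocompact G \<rho>"
  shows qi
proof -
  note cc = assms[unfolded convex_cocompact_def]
  have ker: "finite {g \<in> carrier G. \<rho> g = \<one>\<^bsub>PSL2\<^esub>}" using cc by (rule conjunct1)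
  obtain \<epsilon> where e0: "0 < \<epsilon>" "\<forall>g\<in>carrier G. \<rho> g \<noteq> \<one>\<^bsub>PSL2\<^esub> \<longrightarrow> (\<forall>M\<in>\<rho> g. norm (M - mat 1) \<ge> \<epsilon>)"
    using cc by (elim conjE exE)
  have \<epsilon>: "\<epsilon> \<le> norm (M - mat 1)" if "g \<in> carrier G" "\<rho> g \<noteq> \<one>\<^bsub>PSL2\<^esub>" "M \<in> \<rho> g" for g M
    using e0(2) that by blast
  obtain C K where C: "C \<noteq> {}" "hconvex C" and C3: "\<forall>g\<in>carrier G. pact (\<rho> g) ` C \<subseteq> C"
    and K: "compact K" "K \<subseteq> C" and K3': "C \<subseteq> (\<Union>g\<in>carrier G. pact (\<rho> g) ` K)"
    using cc by (elim conjE exE)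
  have C3': "act g p \<in> C" if "g \<in> carrier G" "p \<in> C" for g p using C3 that unfolding act_def by blast
  have K3: "C \<subseteq> (\<Union>g\<in>carrier G. act g ` K)" using K3' unfolding act_def .
  obtain x where x: "x \<in> C" using C(1) by blast
  have CH: "C \<subseteq> H3" using C(2) by (simp add: hconvex_def)
  then have xH: "x \<in> H3" using x by blast
  have "K \<subseteq> H3" using K(2) CH by blast
  then obtain r where r: "0 \<le> r" "\<And>p. p \<in> K \<Longrightarrow> hdist x p \<le> r" using compact_hdist_bounded[OF K(1) _ xH] by blast
  have cob: "\<exists>g\<in>carrier G. hdist p (act g x) \<le> r" if p: "p \<in> C" for p
  proof -
    obtain g k where g: "g \<in> carrier G" "k \<in> K" "p = act g k" using K3 p by blast
    have "k \<in> H3" using g \<open>K \<subseteq> H3\<close> by blast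
    then have "hdist p (act g x) = hdist x k" using act_isometry[OF g(1) xH] g(3) hdist_sym[of p] by simp
    then show ?thesis using r(2)[OF g(2)] g(1) by (intro bexI[of _ g]) auto
  qed
  have "finite {g \<in> carrier G. disp x g \<le> 2 * r + 1}"
  proof (rule finite_subset)
    show "finite {g \<in> carrier G. disp base g \<le> 2 * r + 1 + 2 * hdist x base}"
      by (rule discrete_imp_proper[OF ker e0(1) \<epsilon>])
    show "{g \<in> carrier G. disp x g \<le> 2 * r + 1} \<subseteq> {g \<in> carrier G. disp base g \<le> 2 * r + 1 + 2 * hdist x base}"
      using disp_change_base[OF xH base_H3] by force
  qed
  then show qi using svarc_milnor[OF C(2) x C3' cob] by blast
qed

subsection \<open>Quasi-isometric orbit maps\<close>

lemma qi_quasi_path: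
  assumes qi "x \<in> H3"
  shows "\<exists>K\<ge>1. \<exists>C\<ge>0. \<forall>g\<in>carrier G. \<forall>h\<in>carrier G.
     e g h / K - C \<le> hdist (act g x) (act h x) \<and> hdist (act g x) (act h x) \<le> K * e g h + C"
proof -
  obtain J B where J: "1 \<le> J" "0 \<le> B" "\<And>g. g \<in> carrier G \<Longrightarrow> real (wl g) \<le> J * disp x g + B"
    by (rule qiE[OF assms]) (rule that)
  obtain L where L: "1 \<le> L" "\<And>g. g \<in> carrier G \<Longrightarrow> disp x g \<le> L * real (wl g)" using disp_lipschitz[OF assms(2)] by blast
  define K where "K = max J L"
  have K: "1 \<le> K" "J \<le> K" "L \<le> K" using J by (auto simp: K_def)
  have "e g h / K - B \<le> hdist (act g x) (act h x) \<and> hdist (act g x) (act h x) \<le> K * e g h + B"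
    if gh: "g \<in> carrier G" "h \<in> carrier G" for g h
  proof -
    define k where "k = inv g \<otimes> h"
    have k: "k \<in> carrier G" using gh by (simp add: k_def)
    have d0: "0 \<le> disp x k" using disp_nonneg assms(2) k by blast
    have "real (wl k) \<le> K * disp x k + B" using J(3)[OF k] mult_right_mono[OF K(2) d0] by linarith
    also have "\<dots> \<le> (disp x k + B) * K" using K(1) J(2) by (simp add: algebra_simps) (simp add: mult_le_cancel_left1)
    finally have "real (wl k) / K \<le> disp x k + B" using K(1) by (simp add: pos_divide_le_eq)
    moreover have "disp x k \<le> K * real (wl k) + B"
      using L(2)[OF k] mult_right_mono[OF K(3), of "real (wl k)"] J(2) by linarith
    ultimately show ?thesis using hdist_act[OF assms(2) gh] by (simp add: e_eq k_def)
  qed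
  then show ?thesis using K(1) J(2) by blast
qed

lemma qi_proper:
  assumes qi "x \<in> H3"
  shows "finite {g \<in> carrier G. disp x g \<le> r}"
proof -
  obtain J B where J: "1 \<le> J" "0 \<le> B" "\<And>g. g \<in> carrier G \<Longrightarrow> real (wl g) \<le> J * disp x g + B"
    by (rule qiE[OF assms]) (rule that)
  have "{g \<in> carrier G. disp x g \<le> r} \<subseteq> {g \<in> carrier G. real (wl g) \<le> J * r + B}"
  proof
    fix g assume g: "g \<in> {g \<in> carrier G. disp x g \<le> r}"
    then have "J * disp x g \<le> J * r" using J(1) by (intro mult_left_mono) auto
    then show "g \<in> {g \<in> carrier G. real (wl g) \<le> J * r + B}" using J(3)[of g] g by simp
  qed
  then show ?thesis using finite_ball finite_subset by blast
qed

text \<open>The Morse lemma for the image of a word geodesic from g to h.\<close>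

lemma orbit_quasiconvex:
  assumes qi "x \<in> H3"
  shows "\<exists>M\<ge>0. \<forall>g\<in>carrier G. \<forall>h\<in>carrier G. \<forall>u\<in>H3. \<exists>k\<in>carrier G.
     hdist u (act k x) \<le> M + gprod hdist u (act g x) (act h x)"
proof -
  obtain K C where KC: "1 \<le> K" "0 \<le> C" "\<And>g h. \<lbrakk>g \<in> carrier G; h \<in> carrier G\<rbrakk> \<Longrightarrow>
     e g h / K - C \<le> hdist (act g x) (act h x) \<and> hdist (act g x) (act h x) \<le> K * e g h + C"
    using qi_quasi_path[OF assms] by blast
  obtain M where M: "0 \<le> M" "\<And>f n u m. \<lbrakk>H3.quasi_path K C f n; u \<in> H3; gprod hdist u (f 0) (f n) \<le> m\<rbrakk> \<Longrightarrow> \<exists>i\<le>n. hdist u (f i) \<le> M + m"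
    using H3.morse_near[OF KC(1,2)] by blast
  have "\<exists>k\<in>carrier G. hdist u (act k x) \<le> M + gprod hdist u (act g x) (act h x)"
    if gh: "g \<in> carrier G" "h \<in> carrier G" "u \<in> H3" for g h u
  proof -
    obtain f n where f: "\<And>i. f i \<in> carrier G" "f 0 = g" "f n = h" "real n = e g h"
      "\<And>i j. i\<le>n \<Longrightarrow> j\<le>n \<Longrightarrow> e (f i) (f j) = \<bar>real i - real j\<bar>"
      using geodesic_path[OF gh(1,2)] by blast
    have "H3.quasi_path K C (\<lambda>i. act (f i) x) n"
      unfolding H3.quasi_path_def using KC(3)[OF f(1) f(1)] f(5) act_H3 assms(2) f(1) by (metis (no_types, lifting))
    from M(2)[OF this gh(3) order_refl] obtain i where "hdist u (act (f i) x) \<le> M + gprod hdist u (act g x) (act h x)"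
      unfolding f(2,3) by blast
    then show ?thesis using f(1) by blast
  qed
  then show ?thesis using M(1) by blast
qed

text \<open>A convex hull of the orbit: the half-spaces containing it are described as sides of bisectors.\<close>
definition ohull :: "complex \<times> real \<Rightarrow> (complex \<times> real) set" where
  "ohull x = {y \<in> H3. \<forall>p\<in>H3. \<forall>q\<in>H3. (\<forall>g\<in>carrier G. hdist (act g x) q \<le> hdist (act g x) p) \<longrightarrow> hdist y q \<le> hdist y p}"

lemma ohull_hconvex: "hconvex (ohull x)"
  unfolding hconvex_def
proof (intro conjI ballI subsetI)
  fix a b y assume a: "a \<in> ohull x" and b: "b \<in> ohull x" and y: "y \<in> hseg a b"
  have H: "a \<in> H3" "b \<in> H3" "y \<in> H3" "hdist a y + hdist y b = hdist a b"
    using a b y by (auto simp: ohull_def hseg_def)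
  show "y \<in> ohull x"
    unfolding ohull_def
  proof (intro CollectI conjI ballI impI)
    fix p q assume pq: "p \<in> H3" "q \<in> H3" "\<forall>g\<in>carrier G. hdist (act g x) q \<le> hdist (act g x) p"
    have "hdist a q \<le> hdist a p" "hdist b q \<le> hdist b p" using a b pq unfolding ohull_def by blast+
    then show "hdist y q \<le> hdist y p" using bisector_hconvex[OF H(1,3,2,4) pq(2,1)] by blast
  qed (rule H(3))
qed (auto simp: ohull_def)

lemma ohull_invariant:
  assumes x: "x \<in> H3" and g: "g \<in> carrier G" and y: "y \<in> ohull x"
  shows "act g y \<in> ohull x"
proof -
  have yH: "y \<in> H3" using y by (simp add: ohull_def)
  show ?thesis
    unfolding ohull_def
  proof (intro CollectI conjI ballI impI)
    show "act g y \<in> H3" using act_H3 g yH by blast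
    fix p q assume pq: "p \<in> H3" "q \<in> H3" "\<forall>h\<in>carrier G. hdist (act h x) q \<le> hdist (act h x) p"
    have tr: "hdist (act (inv g) u) v = hdist u (act g v)" if "u \<in> H3" "v \<in> H3" for u v
      using act_isometry[OF g act_H3[OF inv_closed[OF g] that(1)] that(2)] act_inv(2)[OF g that(1)] by simp
    have ig: "act (inv g) p \<in> H3" "act (inv g) q \<in> H3" using act_H3 g pq by auto
    have "hdist (act h x) (act (inv g) q) \<le> hdist (act h x) (act (inv g) p)" if h: "h \<in> carrier G" for h
    proof -
      have "hdist (act (g \<otimes> h) x) q \<le> hdist (act (g \<otimes> h) x) p" using pq(3) g h by blast
      then have "hdist (act g (act h x)) q \<le> hdist (act g (act h x)) p" using act_mult[OF g h x] by simp
      then show ?thesis using tr[OF pq(1) act_H3[OF h x]] tr[OF pq(2) act_H3[OF h x]] hdist_sym by metis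
    qed
    then have "hdist y (act (inv g) q) \<le> hdist y (act (inv g) p)" using y ig unfolding ohull_def by blast
    then show "hdist (act g y) q \<le> hdist (act g y) p" using tr[OF pq(1) yH] tr[OF pq(2) yH] hdist_sym by metis
  qed
qed

lemma ohull_compact_part:
  assumes x: "x \<in> H3"
  shows "compact {y \<in> ohull x. hdist x y \<le> r}"
proof -
  define Bl where "Bl = {y \<in> H3. hdist x y \<le> r}"
  have cB: "compact Bl" unfolding Bl_def by (rule hball_compact[OF x])
  define I where "I = {(p, q). p \<in> H3 \<and> q \<in> H3 \<and> (\<forall>g\<in>carrier G. hdist (act g x) q \<le> hdist (act g x) p)}"
  have cont: "continuous_on Bl (\<lambda>y. hcosh y p)" if "p \<in> H3" for p
    unfolding hcosh_def using that by (intro continuous_intros) (auto simp: H3_def Bl_def)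
  have "{y \<in> ohull x. hdist x y \<le> r} = Bl \<inter> (\<Inter>(p, q)\<in>I. {y \<in> Bl. hcosh y q \<le> hcosh y p})"
  proof -
    have "hcosh y q \<le> hcosh y p \<longleftrightarrow> hdist y q \<le> hdist y p" if "y \<in> H3" "p \<in> H3" "q \<in> H3" for y p q
      using hdist_le_hdist_iff[OF that(1,3) that(1,2)] by simp
    then show ?thesis unfolding ohull_def Bl_def I_def by (auto simp: split_paired_all)
  qed
  moreover have "closed {y \<in> Bl. hcosh y q \<le> hcosh y p}" if "(p, q) \<in> I" for p q
    using that by (intro continuous_on_closed_Collect_le cont compact_imp_closed[OF cB]) (auto simp: I_def)
  then have "closed (\<Inter>(p, q)\<in>I. {y \<in> Bl. hcosh y q \<le> hcosh y p})" by (intro closed_INT) auto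
  ultimately show ?thesis using compact_Int_closed[OF cB] by simp
qed

text \<open>Suppose y is far from the orbit and q is an almost nearest orbit point. By
  \<open>orbit_quasiconvex\<close> every orbit point has a large product with q seen from y, hence
  is nearer to q than to y. Then the half-space of points nearer to q contains the orbit but not
  y.\<close>

lemma ohull_near_orbit:
  assumes qi and x: "x \<in> H3"
  shows "\<exists>r. \<forall>y\<in>ohull x. \<exists>g\<in>carrier G. hdist y (act g x) \<le> r"
proof -
  obtain M where M: "0 \<le> M" "\<And>g h u. \<lbrakk>g \<in> carrier G; h \<in> carrier G; u \<in> H3\<rbrakk> \<Longrightarrow> \<exists>k\<in>carrier G.
     hdist u (act k x) \<le> M + gprod hdist u (act g x) (act h x)"
    using orbit_quasiconvex[OF assms] by blast
  have "\<exists>g\<in>carrier G. hdist y (act g x) \<le> 2 * M + 2" if y: "y \<in> ohull x" for y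
  proof (rule ccontr)
    assume "\<not> ?thesis"
    then have far: "2 * M + 2 < hdist y (act g x)" if "g \<in> carrier G" for g using that by force
    have yH: "y \<in> H3" using y by (simp add: ohull_def)
    define T where "T = (\<lambda>g. hdist y (act g x)) ` carrier G"
    have T: "T \<noteq> {}" "bdd_below T" unfolding T_def using far by (auto intro!: bdd_belowI2[of _ "2 * M + 2"] less_imp_le)
    define D where "D = Inf T"
    have D_le: "D \<le> hdist y (act g x)" if "g \<in> carrier G" for g
      unfolding D_def using T that by (intro cInf_lower) (auto simp: T_def)
    have D_ge: "2 * M + 2 \<le> D" unfolding D_def using T far by (intro cInf_greatest) (auto simp: T_def less_imp_le)
    obtain g where g: "g \<in> carrier G" "hdist y (act g x) < D + 1"
      using cInf_lessD[OF T(1), of "D + 1"] unfolding D_def T_def by auto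
    define q where "q = act g x"
    have qH: "q \<in> H3" using act_H3 g x by (simp add: q_def)
    have "hdist (act h x) q \<le> hdist (act h x) y" if h: "h \<in> carrier G" for h
    proof -
      obtain k where k: "k \<in> carrier G" "hdist y (act k x) \<le> M + gprod hdist y (act h x) q"
        using M(2)[OF h g(1) yH] unfolding q_def by blast
      have "D \<le> M + gprod hdist y (act h x) q" using D_le[OF k(1)] k(2) by linarith
      moreover have "2 * gprod hdist y (act h x) q = hdist y (act h x) + hdist y q - hdist (act h x) q" by (simp add: gprod_def)
      ultimately show ?thesis using g(2) D_ge hdist_sym[of y "act h x"] unfolding q_def by linarith
    qed
    then have "hdist y q \<le> hdist y y" using y yH qH unfolding ohull_def by blast
    then show False using D_le[OF g(1)] D_ge M(1) hdist_refl[of y] unfolding q_def by linarith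
  qed
  then show ?thesis by blast
qed

lemma qi_imp_convex_cocompact:
  assumes qi
  shows "convex_cocompact G \<rho>"
proof -
  define x where "x = base"
  have x: "x \<in> H3" using base_H3 x_def by simp
  have act_ker: "act g x = x" if "g \<in> carrier G" "\<rho> g = \<one>\<^bsub>PSL2\<^esub>" for g
    using that act_one[OF x] rho_one unfolding act_def by simp
  have "{g \<in> carrier G. \<rho> g = \<one>\<^bsub>PSL2\<^esub>} \<subseteq> {g \<in> carrier G. disp x g \<le> 0}"
    using act_ker hdist_refl[of x] by (auto simp: disp_def)
  then have ker: "finite {g \<in> carrier G. \<rho> g = \<one>\<^bsub>PSL2\<^esub>}" using qi_proper[OF assms x] finite_subset by blast
  have "\<exists>\<epsilon>>0. \<forall>g\<in>carrier G. \<rho> g \<noteq> \<one>\<^bsub>PSL2\<^esub> \<longrightarrow> (\<forall>M\<in>\<rho> g. norm (M - mat 1) \<ge> \<epsilon>)"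
  proof -
    \<comment> \<open>By \<open>hdist_base_le\<close> with bound 3, elements displacing the base
      point by more than this have lifts of norm above 3. As the identity has norm at most 2, such
      lifts are at distance at least 1 from it, so only the finite set F matters.\<close>
    define F where "F = {g \<in> carrier G. disp x g \<le> 2 * ln 3 + 1 \<and> \<rho> g \<noteq> \<one>\<^bsub>PSL2\<^esub>}"
    have fF: "finite F" unfolding F_def by (rule finite_subset[OF _ qi_proper[OF assms x, of "2 * ln 3 + 1"]]) auto
    define T where "T = insert 1 ((\<lambda>M. norm (M - mat 1)) ` (\<Union>g\<in>F. \<rho> g))"
    have rfin: "finite (\<rho> g)" if "g \<in> F" for g
    proof -
      have "\<rho> g = pair (R g)" using R(1)[of g] that by (simp add: F_def)
      then show ?thesis by simp
    qed
    have fT: "finite T" unfolding T_def using fF rfin by blast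
    have not_one: "M \<noteq> mat 1" if "g \<in> F" "M \<in> \<rho> g" for g M
    proof
      assume M: "M = mat 1"
      have g: "g \<in> carrier G" "\<rho> g \<noteq> \<one>\<^bsub>PSL2\<^esub>" using that(1) by (auto simp: F_def)
      have "M \<in> pair (R g)" using that(2) R(1)[OF g(1)] by simp
      then have "R g = mat 1 \<or> R g = - mat 1" unfolding M by (metis insertE minus_minus singletonD)
      then show False using rho_eq_one_iff[OF g(1)] g(2) by blast
    qed
    have pos: "0 < t" if "t \<in> T" for t
    proof -
      consider "t = 1" | g M where "g \<in> F" "M \<in> \<rho> g" "t = norm (M - mat 1)" using \<open>t \<in> T\<close> unfolding T_def by blast
      then show ?thesis using not_one by cases auto
    qed
    have "Min T \<in> T" using fT by (intro Min_in) (auto simp: T_def)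
    then have m0: "0 < Min T" using pos by blast
    have "Min T \<le> norm (M - mat 1)" if g: "g \<in> carrier G" "\<rho> g \<noteq> \<one>\<^bsub>PSL2\<^esub>" "M \<in> \<rho> g" for g M
    proof (cases "g \<in> F")
      case True
      then show ?thesis using fT g(3) by (intro Min_le) (auto simp: T_def)
    next
      case False
      have M: "det M = 1" "act g x = mob M x"
      proof -
        have "M \<in> pair (R g)" using g(3) R(1)[OF g(1)] by simp
        then have MR: "M = R g \<or> M = - R g" by blast
        show "det M = 1" using MR R(2)[OF g(1)] det_minus2[of "R g"] by metis
        show "act g x = mob M x" using MR act_mob[OF g(1)] mob_uminus[of "R g" x] by metis
      qed
      have "\<not> norm M \<le> 3"
      proof
        assume "norm M \<le> 3"
        then have "hdist base (mob M base) \<le> 2 * ln 3 + 1" using hdist_base_le[OF M(1)] by simp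
        then show False using False g M(2) unfolding F_def disp_def x_def by simp
      qed
      moreover have "(norm (mat 1 :: complex^2^2))\<^sup>2 \<le> 2\<^sup>2" by (simp add: norm_mat2 mat_def)
      then have "norm (mat 1 :: complex^2^2) \<le> 2" by (rule power2_le_imp_le) simp
      moreover have "norm M \<le> norm (M - mat 1) + norm (mat 1 :: complex^2^2)"
        using norm_triangle_ineq[of "M - mat 1" "mat 1"] by simp
      ultimately have "1 \<le> norm (M - mat 1)" by linarith
      moreover have "Min T \<le> 1" using fT by (intro Min_le) (auto simp: T_def)
      ultimately show ?thesis by linarith
    qed
    then show ?thesis using m0 by blast
  qed
  moreover have "\<exists>C. C \<noteq> {} \<and> hconvex C \<and> (\<forall>g\<in>carrier G. pact (\<rho> g) ` C \<subseteq> C)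
        \<and> (\<exists>K. compact K \<and> K \<subseteq> C \<and> C \<subseteq> (\<Union>g\<in>carrier G. pact (\<rho> g) ` K))"
  proof -
    obtain r where r: "\<And>y. y \<in> ohull x \<Longrightarrow> \<exists>g\<in>carrier G. hdist y (act g x) \<le> r" using ohull_near_orbit[OF assms x] by blast
    define K where "K = {y \<in> ohull x. hdist x y \<le> r}"
    have "x \<in> ohull x" unfolding ohull_def using x act_one[OF x] one_closed by fastforce
    moreover have "ohull x \<subseteq> (\<Union>g\<in>carrier G. act g ` K)"
    proof
      fix y assume y: "y \<in> ohull x"
      then have yH: "y \<in> H3" by (simp add: ohull_def)
      obtain g where g: "g \<in> carrier G" "hdist y (act g x) \<le> r" using r[OF y] by blast
      define k where "k = act (inv g) y"
      have ki: "k \<in> ohull x" unfolding k_def using ohull_invariant[OF x _ y] g by simp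
      have y': "y = act g k" unfolding k_def using act_inv(2)[OF g(1) yH] by simp
      have "k \<in> H3" using ki by (simp add: ohull_def)
      then have "hdist x k = hdist (act g x) y" using act_isometry[OF g(1) x] y' by simp
      then have "k \<in> K" using ki g(2) hdist_sym[of y] by (simp add: K_def)
      then show "y \<in> (\<Union>g\<in>carrier G. act g ` K)" using y' g(1) by blast
    qed
    moreover have "compact K" unfolding K_def by (rule ohull_compact_part[OF x])
    moreover have "K \<subseteq> ohull x" by (auto simp: K_def)
    ultimately show ?thesis
      using ohull_hconvex[of x] ohull_invariant[OF x] unfolding act_def by (intro exI[of _ "ohull x"] conjI exI[of _ K]) auto
  qed
  ultimately show ?thesis using ker unfolding convex_cocompact_def by blast
qed

end

section \<open>Stability and displacement for quasi-isometric orbit maps\<close>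

lemma hseg_unique:
  assumes "p \<in> H3" "q \<in> H3" "r \<in> hseg p q" "r' \<in> hseg p q" "hdist p r = hdist p r'"
  shows "r = r'"
proof -
  have H: "r \<in> H3" "r' \<in> H3" "hdist p r + hdist r q = hdist p q" "hdist p r' + hdist r' q = hdist p q"
    using assms(3,4) by (auto simp: hseg_def)
  show ?thesis
  proof (cases "hdist p q = 0")
    case True
    then have "hdist p r = 0" "hdist p r' = 0"
      using H hdist_nonneg[OF assms(1) H(1)] hdist_nonneg[OF H(1) assms(2)] assms(5) by linarith+
    then show ?thesis using hdist_eq_0[OF assms(1) H(1)] hdist_eq_0[OF assms(1) H(2)] by simp
  next
    case False
    then have s: "sinh (hdist p q) \<noteq> 0" by simp
    have d: "hdist r q = hdist r' q" using H assms(5) by linarith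
    have "sinh (hdist p q) * hcosh r r' = sinh (hdist p q) * hcosh r' r'"
      using hseg_interpolate[OF assms(1) H(1) assms(2) H(2,3)] hseg_interpolate[OF assms(1) H(2) assms(2) H(2,4)] d assms(5)
      by simp
    then have "hcosh r r' = cosh 0" using s by (simp add: hcosh_def)
    then have "hdist r r' = 0" using hdist_eqI[OF H(1,2), of 0] by simp
    then show ?thesis using hdist_eq_0[OF H(1,2)] by simp
  qed
qed

lemma quasi_geodesic_segments:
  fixes y :: "int \<Rightarrow> complex \<times> real"
  assumes yH: "\<And>i. y i \<in> H3" and K: "1 \<le> K" "0 \<le> C"
    and low: "\<And>i j. real_of_int \<bar>i - j\<bar> / K - C \<le> hdist (y i) (y j)"
    and up: "\<And>i j. hdist (y i) (y j) \<le> K * real_of_int \<bar>i - j\<bar> + C"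
  shows "quasi_geodesic K (4 * K + 3 * C) (\<Union>i. hseg (y i) (y (i + 1)))"
proof -
  define d where "d i = hdist (y i) (y (i + 1))" for i
  have d0: "0 \<le> d i" for i unfolding d_def using hdist_nonneg yH by blast
  have dK: "d i \<le> K + C" for i using up[of i "i + 1"] by (simp add: d_def)
  \<comment> \<open>The image must be exactly the union of the segments. Each one is traversed at
    constant speed in the first half of its unit interval, after which f waits at the end; so every
    point, including the far end, is reached at a time whose integer part is still i.\<close>
  define P where "P i s r \<longleftrightarrow> r \<in> hseg (y i) (y (i + 1)) \<and> hdist (y i) r = min (d i) (2 * s * d i)" for i and s :: real and r
  have exP: "\<exists>r. P i s r" if "0 \<le> s" for i s
  proof -
    have "0 \<le> min (d i) (2 * s * d i)" "min (d i) (2 * s * d i) \<le> hdist (y i) (y (i + 1))" using d0 that by (auto simp: d_def)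
    from hseg_point[OF yH yH this] obtain r where "r \<in> H3" "hdist (y i) r = min (d i) (2 * s * d i)"
      "hdist r (y (i + 1)) = hdist (y i) (y (i + 1)) - min (d i) (2 * s * d i)" by blast
    then show ?thesis by (intro exI[of _ r]) (simp add: P_def hseg_def)
  qed
  define f where "f s = (SOME r. P \<lfloor>s\<rfloor> (frac s) r)" for s
  have fP: "P \<lfloor>s\<rfloor> (frac s) (f s)" for s unfolding f_def by (rule someI_ex) (rule exP, simp)
  have fH: "f s \<in> H3" for s using fP[of s] by (simp add: P_def hseg_def)
  have near: "hdist (y \<lfloor>s\<rfloor>) (f s) \<le> K + C" for s using fP[of s] dK[of "\<lfloor>s\<rfloor>"] by (simp add: P_def)
  have "range f = (\<Union>i. hseg (y i) (y (i + 1)))"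
  proof (intro equalityI subsetI)
    fix r :: "complex \<times> real" assume "r \<in> range f"
    then obtain s where "r = f s" by blast
    then have "r \<in> hseg (y \<lfloor>s\<rfloor>) (y (\<lfloor>s\<rfloor> + 1))" using fP[of s] unfolding P_def by blast
    then show "r \<in> (\<Union>i. hseg (y i) (y (i + 1)))" by blast
  next
    fix r assume "r \<in> (\<Union>i. hseg (y i) (y (i + 1)))"
    then obtain i where r: "r \<in> hseg (y i) (y (i + 1))" by blast
    define t where "t = hdist (y i) r"
    have rH: "r \<in> H3" "t + hdist r (y (i + 1)) = d i" using r by (auto simp: hseg_def t_def d_def)
    have t: "0 \<le> t" "t \<le> d i"
      using hdist_nonneg[OF yH rH(1), of i] hdist_nonneg[OF rH(1) yH, of "i + 1"] rH(2) t_def by linarith+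
    define u where "u = (if d i = 0 then 0 else t / (2 * d i))"
    have u: "0 \<le> u" "u \<le> 1 / 2" using t d0[of i] by (auto simp: u_def field_simps)
    have "2 * u * d i = t" using t by (cases "d i = 0") (auto simp: u_def)
    then have m: "min (d i) (2 * u * d i) = t" using t by simp
    define s where "s = real_of_int i + u"
    have fl: "\<lfloor>s\<rfloor> = i" unfolding s_def using u by (simp add: floor_eq_iff)
    then have fr: "frac s = u" by (simp add: frac_def s_def)
    have "P i u (f s)" using fP[of s] fl fr by simp
    then have "f s = r" using hseg_unique[OF yH yH, of "f s" i "i + 1" r] r m by (simp add: P_def t_def)
    then show "r \<in> range f" by blast
  qed
  moreover have "\<bar>s - t\<bar> / K - (4 * K + 3 * C) \<le> hdist (f s) (f t) \<and> hdist (f s) (f t) \<le> K * \<bar>s - t\<bar> + (4 * K + 3 * C)" for s t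
  proof -
    define i where "i = \<lfloor>s\<rfloor>"
    define j where "j = \<lfloor>t\<rfloor>"
    have n1: "hdist (y i) (f s) \<le> K + C" "hdist (f s) (y i) \<le> K + C" using near[of s] hdist_sym[of "f s"] by (auto simp: i_def)
    have n2: "hdist (y j) (f t) \<le> K + C" "hdist (f t) (y j) \<le> K + C" using near[of t] hdist_sym[of "f t"] by (auto simp: j_def)
    have ij: "real_of_int \<bar>i - j\<bar> \<le> \<bar>s - t\<bar> + 1" "\<bar>s - t\<bar> - 1 \<le> real_of_int \<bar>i - j\<bar>" unfolding i_def j_def by linarith+
    have "K * real_of_int \<bar>i - j\<bar> \<le> K * (\<bar>s - t\<bar> + 1)" using ij K by (intro mult_left_mono) auto
    then have "K * real_of_int \<bar>i - j\<bar> \<le> K * \<bar>s - t\<bar> + K" by (simp add: distrib_left)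
    then have "hdist (f s) (f t) \<le> K * \<bar>s - t\<bar> + (4 * K + 3 * C)"
      using hdist_triangle[OF fH yH fH, of s t i] hdist_triangle[OF yH yH fH, of i t j] n1 n2 up[of i j] K by linarith
    moreover have "(\<bar>s - t\<bar> - 1) / K \<le> real_of_int \<bar>i - j\<bar> / K" using ij K by (intro divide_right_mono) auto
    then have "\<bar>s - t\<bar> / K - 1 / K \<le> real_of_int \<bar>i - j\<bar> / K" by (simp add: diff_divide_distrib)
    moreover have "1 / K \<le> K" using K     proof -
      have "1 / K \<le> 1" using K by simp
      then show ?thesis using K by linarith
    qed
    moreover have "hdist (y i) (y j) \<le> hdist (y i) (f s) + hdist (f s) (f t) + hdist (f t) (y j)"
      using hdist_triangle[OF yH fH yH, of i j s] hdist_triangle[OF fH fH yH, of s j t] by linarith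
    ultimately show ?thesis using n1 n2 low[of i j] K by linarith
  qed
  ultimately show ?thesis unfolding quasi_geodesic_def by blast
qed

locale hyp_rep = rep G S \<rho> + hyp_cayley G S dl for G (structure) and S :: "'a set" and \<rho> and dl
begin

lemma geodesics_axisD:
  assumes "l \<in> geodesics_axis G S c"
  shows "l i \<in> carrier G" "e (l i) (l j) = real_of_int \<bar>i - j\<bar>"
  using assms by (auto simp: geodesics_axis_def)

lemma qi_imp_stable:
  assumes qi
  shows "stable_on G S \<C> \<rho>"
proof -
  obtain K C where KC: "1 \<le> K" "0 \<le> C" "\<forall>g\<in>carrier G. \<forall>h\<in>carrier G.
     e g h / K - C \<le> hdist (act g base) (act h base) \<and> hdist (act g base) (act h base) \<le> K * e g h + C"
    using qi_quasi_path[OF assms base_H3] by blast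
  have "quasi_geodesic K (4 * K + 3 * C) (orbit_image \<rho> base l)" if l: "l \<in> geodesics_axis G S c" for l c
  proof -
    note lX = geodesics_axisD(1)[OF l] and geo = geodesics_axisD(2)[OF l]
    have "quasi_geodesic K (4 * K + 3 * C) (\<Union>i. hseg (act (l i) base) (act (l (i + 1)) base))"
    proof (rule quasi_geodesic_segments[OF _ KC(1,2)])
      show "act (l i) base \<in> H3" for i using act_H3 lX base_H3 by blast
      show "real_of_int \<bar>i - j\<bar> / K - C \<le> hdist (act (l i) base) (act (l j) base)" for i j
        using KC(3) lX[of i] lX[of j] unfolding geo[of i j, symmetric] by blast
      show "hdist (act (l i) base) (act (l j) base) \<le> K * real_of_int \<bar>i - j\<bar> + C" for i j
        using KC(3) lX[of i] lX[of j] unfolding geo[of i j, symmetric] by blast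
    qed
    then show ?thesis by (simp add: orbit_image_def act_def)
  qed
  moreover have "0 \<le> 4 * K + 3 * C" using KC by simp
  ultimately show ?thesis unfolding stable_on_def using KC(1) base_H3
    by (intro exI[of _ K] exI[of _ "4 * K + 3 * C"] conjI bexI[of _ base]) auto
qed

lemma tlen_le:
  assumes "g \<in> carrier G" "p \<in> H3"
  shows "tlen (\<rho> g) \<le> disp p g"
  unfolding tlen_def
proof (rule cInf_lower)
  show "disp p g \<in> {hdist p (pact (\<rho> g) p) |p. p \<in> H3}" unfolding disp_def act_def using assms by blast
  show "bdd_below {hdist p (pact (\<rho> g) p) |p. p \<in> H3}"
  proof (rule bdd_belowI[of _ 0])
    fix v assume "v \<in> {hdist p (pact (\<rho> g) p) |p. p \<in> H3}"
    then obtain q where "q \<in> H3" "v = disp q g" unfolding disp_def act_def by blast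
    then show "0 \<le> v" using disp_nonneg assms by blast
  qed
qed

lemma tlen_ge:
  assumes "\<And>p. p \<in> H3 \<Longrightarrow> t \<le> disp p g"
  shows "t \<le> tlen (\<rho> g)"
  unfolding tlen_def
proof (rule cInf_greatest)
  show "{hdist p (pact (\<rho> g) p) |p. p \<in> H3} \<noteq> {}" using base_H3 by blast
  fix v assume "v \<in> {hdist p (pact (\<rho> g) p) |p. p \<in> H3}"
  then obtain q where "q \<in> H3" "v = disp q g" unfolding disp_def act_def by blast
  then show "t \<le> v" using assms by blast
qed

lemma disp_conj:
  assumes "h \<in> carrier G" "a \<in> carrier G" "q \<in> H3"
  shows "disp (act h q) a = disp q (inv h \<otimes> a \<otimes> h)"
proof -
  have "disp (act h q) a = hdist (act h q) (act (a \<otimes> h) q)" using act_mult assms by (simp add: disp_def)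
  also have "\<dots> = disp q (inv h \<otimes> (a \<otimes> h))" using hdist_act assms by simp
  finally show ?thesis using assms by (simp add: m_assoc)
qed

lemma disp_pow_le: "\<lbrakk>q \<in> H3; b \<in> carrier G\<rbrakk> \<Longrightarrow> disp q (b [^] (n::nat)) \<le> real n * disp q b"
proof (induction n)
  case (Suc n)
  then show ?case using disp_mult[of q "b [^] n" b] by (simp add: algebra_simps)
qed (simp add: disp_one)

lemma word_tlen_nonneg: "0 \<le> word_tlen G S a"
  unfolding word_tlen_def by (rule cInf_greatest) (auto simp: e_eq)

text \<open>Below: the displacement of a at p is that of its conjugate b at another point q, and n
  times it bounds the displacement of b to the power n at q; dividing by n removes the dependence on
  q. Above: a displaces the orbit point of g by at most L times the distance from g to a g.\<close>

lemma qi_imp_well_displacing: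
  assumes qi and D: "\<D> \<subseteq> carrier G"
  shows "well_displacing_on G S \<D> \<rho>"
proof -
  obtain J B where J: "1 \<le> J" "0 \<le> B" "\<And>g. g \<in> carrier G \<Longrightarrow> real (wl g) \<le> J * disp base g + B"
    by (rule qiE[OF assms(1) base_H3]) (rule that)
  obtain L where L: "1 \<le> L" "\<forall>g\<in>carrier G. disp base g \<le> L * real (wl g)" using disp_lipschitz[OF base_H3] by blast
  define K where "K = max J L"
  define k where "k = 10 * dl + 10"
  have k0: "0 \<le> k" using dl_nonneg by (simp add: k_def)
  have K: "1 \<le> K" "J \<le> K" "L \<le> K" using J by (auto simp: K_def)
  have "word_tlen G S a / K - k \<le> tlen (\<rho> a) \<and> tlen (\<rho> a) \<le> K * word_tlen G S a + k" if "a \<in> \<D>" for a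
  proof
    have a: "a \<in> carrier G" using that D by blast
    define t where "t = word_tlen G S a"
    have t0: "0 \<le> t" using word_tlen_nonneg t_def by simp
    obtain h where h: "h \<in> carrier G" "\<forall>n :: nat. real n * (t - k) \<le> real (wl ((inv h \<otimes> a \<otimes> h) [^] n))"
      using translation_length_stable[OF a] unfolding t_def k_def by blast
    define b where "b = inv h \<otimes> a \<otimes> h"
    have b: "b \<in> carrier G" using a h by (simp add: b_def)
    have low: "(t - k) / J \<le> disp p a" if p: "p \<in> H3" for p
    proof -
      define q where "q = act (inv h) p"
      have q: "q \<in> H3" "p = act h q" using act_H3 act_inv(2) h p by (auto simp: q_def)
      have pq: "disp p a = disp q b" unfolding q(2) b_def using disp_conj[OF h(1) a q(1)] .
      have est: "real n * (t - k) \<le> real n * (J * disp q b) + (2 * J * hdist q base + B)" for n :: nat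
      proof -
        have bn: "b [^] n \<in> carrier G" using b by simp
        have "real n * (t - k) \<le> J * disp base (b [^] n) + B" using h(2) J(3)[OF bn] unfolding b_def by (meson order_trans)
        also have "\<dots> \<le> J * (real n * disp q b + 2 * hdist q base) + B"
        proof -
          have "disp base (b [^] n) \<le> real n * disp q b + 2 * hdist q base"
            using disp_change_base[OF q(1) base_H3 bn] disp_pow_le[OF q(1) b, of n] by linarith
          then show ?thesis using J(1) by (intro add_right_mono mult_left_mono) auto
        qed
        finally show ?thesis by (simp add: algebra_simps)
      qed
      have "t - k \<le> J * disp q b"
      proof (rule ccontr)
        assume "\<not> ?thesis"
        then have pos: "0 < (t - k) - J * disp q b" by simp
        obtain n :: nat where "(2 * J * hdist q base + B) / ((t - k) - J * disp q b) < real n" using reals_Archimedean2 by blast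
        then have "2 * J * hdist q base + B < real n * ((t - k) - J * disp q b)" using pos by (simp add: pos_divide_less_eq)
        then show False using est[of n] by (simp add: algebra_simps)
      qed
      then show ?thesis using J(1) pq by (simp add: pos_divide_le_eq mult.commute)
    qed
    have "(t - k) / J \<le> tlen (\<rho> a)" by (rule tlen_ge) (rule low)
    moreover have "t / K \<le> t / J" using t0 K J by (intro divide_left_mono) auto
    moreover have "k / J \<le> k" using k0 J(1) by (simp add: divide_le_eq mult_le_cancel_left1)
    ultimately show "word_tlen G S a / K - k \<le> tlen (\<rho> a)" unfolding t_def[symmetric] by (simp add: diff_divide_distrib)
    have up: "tlen (\<rho> a) \<le> L * e g (a \<otimes> g)" if g: "g \<in> carrier G" for g
    proof -
      have "tlen (\<rho> a) \<le> disp (act g base) a" using tlen_le a act_H3 base_H3 g by blast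
      also have "\<dots> = disp base (inv g \<otimes> a \<otimes> g)" using disp_conj g a base_H3 by blast
      also have "\<dots> \<le> L * real (wl (inv g \<otimes> a \<otimes> g))" using L(2) g a by simp
      also have "real (wl (inv g \<otimes> a \<otimes> g)) = e g (a \<otimes> g)" using g a by (simp add: e_eq m_assoc)
      finally show ?thesis .
    qed
    have "tlen (\<rho> a) / L \<le> t"
      unfolding t_def word_tlen_def
    proof (rule cInf_greatest)
      fix v assume "v \<in> {e g (a \<otimes> g) |g. g \<in> carrier G}"
      then obtain g where "g \<in> carrier G" "v = e g (a \<otimes> g)" by blast
      then show "tlen (\<rho> a) / L \<le> v" using up[of g] L(1) by (simp add: pos_divide_le_eq mult.commute)
    qed blast
    then have "tlen (\<rho> a) \<le> L * t" using L(1) by (simp add: pos_divide_le_eq mult.commute)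
    also have "\<dots> \<le> K * t" using K(3) t0 by (rule mult_right_mono)
    finally show "tlen (\<rho> a) \<le> K * word_tlen G S a + k" using k0 t_def by simp
  qed
  then show ?thesis unfolding well_displacing_on_def using K(1) k0 by (intro exI[of _ K] exI[of _ k] conjI) auto
qed

lemma cmt_derived: "\<lbrakk>g \<in> carrier G; h \<in> carrier G\<rbrakk> \<Longrightarrow> cmt g h \<in> derived_set G (carrier G)"
  by (auto simp: cmt_def)

lemma derived_carrier: "derived G (carrier G) \<subseteq> carrier G"
  by (rule derived_in_carrier) simp

lemma well_displacing_imp_qi:
  assumes ab: "a \<in> carrier G" "b \<in> carrier G"
    and free: "\<And>w. \<lbrakk>w \<noteq> []; reduced2 w\<rbrakk> \<Longrightarrow> eval2 G a b w \<noteq> \<one>"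
    and wd: "well_displacing_on G S (derived G (carrier G)) \<rho>"
  shows qi
proof -
  obtain J B where J: "1 \<le> J" "0 \<le> B" "\<forall>g\<in>derived G (carrier G). word_tlen G S g / J - B \<le> tlen (\<rho> g)"
    using wd unfolding well_displacing_on_def by blast
  obtain n M where M: "0 \<le> M" "\<forall>W\<in>carrier G. M \<le> real (wl W) \<longrightarrow> (\<exists>w. length w = n \<and>
     (let g = cmt W (sqw G a b w) in infinite_order G g \<and> 2 * real (wl W) - M \<le> word_tlen G S g \<and>
       (\<exists>l\<in>geodesics_axis G S g. (\<forall>k :: int. \<exists>i. e (g [^] k) (l i) \<le> M) \<and> (\<exists>i. e W (l i) \<le> M) \<and>
          (\<exists>B. \<forall>i. \<exists>k :: int. e (l i) (g [^] k) \<le> B))))"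
    using good_commutators[OF ab free] by blast
  \<comment> \<open>All auxiliary elements h come from words of one fixed length n, so their
    displacements have a common bound m, whatever W is.\<close>
  define H where "H = (\<lambda>w. disp base (sqw G a b w)) ` {w. length w = n}"
  have "finite {w :: bool list. length w = n}" using finite_lists_length_eq[of "UNIV :: bool set" n] by simp
  then have fH: "finite (insert 0 H)" by (simp add: H_def)
  define m where "m = Max (insert 0 H)"
  have m0: "0 \<le> m" unfolding m_def using fH by (intro Max_ge) auto
  have mH: "disp base (sqw G a b w) \<le> m" if "length w = n" for w
    unfolding m_def using fH that by (intro Max_ge) (auto simp: H_def)
  have "real (wl W) \<le> J * disp base W + (M + J * (m + B))" if W: "W \<in> carrier G" for W
  proof (cases "M \<le> real (wl W)")
    case False
    moreover have "0 \<le> J * disp base W" "0 \<le> J * (m + B)" using J m0 disp_nonneg[OF base_H3 W] by auto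
    ultimately show ?thesis by linarith
  next
    case True
    then obtain w where w: "length w = n" "2 * real (wl W) - M \<le> word_tlen G S (cmt W (sqw G a b w))"
      using M(2) W unfolding Let_def by blast
    define h where "h = sqw G a b w"
    define g where "g = cmt W h"
    have h: "h \<in> carrier G" using sqw_closed[OF ab] by (simp add: h_def)
    have gc: "g \<in> carrier G" using cmt_closed W h by (simp add: g_def)
    have "g \<in> derived G (carrier G)" unfolding derived_def g_def using cmt_derived[OF W h] by (rule generate.incl)
    then have "word_tlen G S g / J - B \<le> tlen (\<rho> g)" using J(3) by blast
    also have "\<dots> \<le> disp base g" using tlen_le gc base_H3 by blast
    also have "\<dots> \<le> disp base (W \<otimes> h \<otimes> inv W) + disp base (inv h)"
      unfolding g_def cmt_def using disp_mult[OF base_H3, of "W \<otimes> h \<otimes> inv W" "inv h"] W h by simp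
    also have "disp base (W \<otimes> h \<otimes> inv W) \<le> disp base W + disp base h + disp base (inv W)"
      using disp_mult[OF base_H3, of "W \<otimes> h" "inv W"] disp_mult[OF base_H3 W h] W h by simp
    finally have "word_tlen G S g / J \<le> 2 * disp base W + 2 * m + B"
      using disp_inv[OF base_H3 W] disp_inv[OF base_H3 h] mH[OF w(1)] unfolding h_def[symmetric] by linarith
    then have "word_tlen G S g \<le> J * (2 * disp base W + 2 * m + B)" using J(1) by (simp add: pos_divide_le_eq mult.commute)
    then have "2 * real (wl W) \<le> J * (2 * disp base W + 2 * m + B) + M" using w(2) unfolding h_def[symmetric] g_def[symmetric] by linarith
    moreover have "J * (2 * disp base W + 2 * m + B) \<le> 2 * (J * disp base W + J * (m + B))" using J by (simp add: algebra_simps)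
    moreover have "0 \<le> J * disp base W" "0 \<le> J * (m + B)" using J m0 disp_nonneg[OF base_H3 W] by auto
    ultimately show ?thesis using M(1) by simp
  qed
  moreover have "0 \<le> M + J * (m + B)" using J m0 M(1) by simp
  ultimately show qi unfolding qi_def using base_H3 J(1) by (intro bexI[of _ base] exI[of _ J] exI[of _ "M + J * (m + B)"] conjI) auto
qed

end

text \<open>A sequence with bounded steps all of whose increments over \<open>N\<close> steps are large is
  eventually monotone in blocks: the increments cannot change sign.\<close>
lemma block_increments_linear:
  fixes s :: "int \<Rightarrow> real" and N :: nat
  assumes step: "\<And>i. \<bar>s (i + 1) - s i\<bar> \<le> c" and big: "\<And>i. c < \<bar>s (i + int N) - s i\<bar>" "\<And>i. 1 \<le> \<bar>s (i + int N) - s i\<bar>"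
  shows "real n / real N - 1 - real N * c \<le> \<bar>s (i + int n) - s i\<bar>"
proof -
  have c0: "0 \<le> c" using step[of 0] by linarith
  have N: "0 < N" using big(2)[of 0] by (cases N) auto
  have main: "real n / real N - 1 - real N * c \<le> \<bar>s (i + int n) - s i\<bar>"
    if step: "\<And>i. \<bar>s (i + 1) - s i\<bar> \<le> c" and big: "\<And>i. c < \<bar>s (i + int N) - s i\<bar>" "\<And>i. 1 \<le> \<bar>s (i + int N) - s i\<bar>"
      and pos: "0 < s (0 + int N) - s 0" for s :: "int \<Rightarrow> real" and i
  proof -
    define g where "g i = s (i + int N) - s i" for i
    have gs: "\<bar>g (i + 1) - g i\<bar> \<le> 2 * c" for i
      using step[of i] step[of "i + int N"] unfolding g_def by (simp add: algebra_simps)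
    have gb: "c < \<bar>g i\<bar>" "1 \<le> \<bar>g i\<bar>" for i using big g_def by auto
    \<comment> \<open>One step changes g by at most 2 c while its absolute value stays above c, so g
      cannot jump from one sign to the other.\<close>
    have "0 < g i" for i
    proof (induction i rule: int_induct[where k = 0])
      case base
      then show ?case using pos by (simp add: g_def)
    next
      case (step1 i)
      then show ?case using gs[of i] gb(1)[of i] gb(1)[of "i + 1"] by linarith
    next
      case (step2 i)
      then show ?case using gs[of "i - 1"] gb(1)[of i] gb(1)[of "i - 1"] by simp
    qed
    then have g1: "1 \<le> g i" for i using gb(2)[of i] by (smt (verit))
    have blk: "real m \<le> s (i + int (m * N)) - s i" for m i
    proof (induction m)
      case (Suc m)
      have "i + int (Suc m * N) = i + int (m * N) + int N" by (simp add: algebra_simps)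
      then have "s (i + int (Suc m * N)) = s (i + int (m * N) + int N)" by (rule arg_cong)
      then have "s (i + int (Suc m * N)) = s (i + int (m * N)) + g (i + int (m * N))" unfolding g_def by linarith
      then show ?case using Suc g1[of "i + int (m * N)"] by linarith
    qed simp
    have few: "\<bar>s (i + int r) - s i\<bar> \<le> real r * c" for i r
    proof (induction r)
      case (Suc r)
      have "i + int (Suc r) = i + int r + 1" by simp
      then have "s (i + int (Suc r)) = s (i + int r + 1)" by (rule arg_cong)
      then have "\<bar>s (i + int (Suc r)) - s (i + int r)\<bar> \<le> c" using step[of "i + int r"] by linarith
      moreover have "real (Suc r) * c = real r * c + c" by (simp add: algebra_simps)
      ultimately show ?case using Suc by linarith
    qed simp
    define m where "m = n div N"
    define r where "r = n mod N"
    have n: "n = m * N + r" "r \<le> N" using N by (auto simp: m_def r_def less_imp_le)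
    have "real n / real N \<le> real m + 1"
      using n N by (simp add: field_simps)
    moreover have "real r * c \<le> real N * c" using n c0 by (simp add: mult_right_mono)
    moreover have "s (i + int n) = s (i + int (m * N) + int r)" unfolding n(1) by (simp add: add.assoc)
    ultimately show ?thesis using blk[of m i] few[of "i + int (m * N)" r] by linarith
  qed
  show ?thesis
  proof (cases "0 < s (0 + int N) - s 0")
    case True
    then show ?thesis using main[of s] step big by blast
  next
    case False
    then have neg: "0 < (- s (0 + int N)) - (- s 0)" using big(2)[of 0] by linarith
    have "real n / real N - 1 - real N * c \<le> \<bar>(- s (i + int n)) - (- s i)\<bar>"
      by (rule main[of "\<lambda>i. - s i", OF _ _ _ neg]) (use step big in \<open>simp_all add: abs_minus_commute\<close>)
    then show ?thesis by (simp add: abs_minus_commute)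
  qed
qed

section \<open>Two by two matrices\<close>

definition smul :: "complex \<Rightarrow> complex^2^2 \<Rightarrow> complex^2^2" where "smul c M = (\<chi> i j. c * M$i$j)"

lemma smul_nth [simp]: "smul c M $ i $ j = c * M$i$j"
  by (simp add: smul_def)

lemma mat2_eq_iff:
  fixes M N :: "complex^2^2"
  shows "M = N \<longleftrightarrow> M$1$1 = N$1$1 \<and> M$1$2 = N$1$2 \<and> M$2$1 = N$2$1 \<and> M$2$2 = N$2$2"
  by (simp add: vec_eq_iff forall_2)

lemma mat1_nth [simp]: "(mat 1 :: complex^2^2)$1$1 = 1" "(mat 1 :: complex^2^2)$1$2 = 0"
  "(mat 1 :: complex^2^2)$2$1 = 0" "(mat 1 :: complex^2^2)$2$2 = 1"
  by (simp_all add: mat_def)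

lemma norm_smul: "norm (smul c M) = cmod c * norm M"
proof -
  have "(norm (smul c M))\<^sup>2 = (cmod c * norm M)\<^sup>2"
    unfolding norm_mat2 power_mult_distrib by (simp add: norm_mult power_mult_distrib distrib_left)
  then show ?thesis by (simp add: power2_eq_iff_nonneg)
qed

lemma smul_mult: "smul c M ** N = smul c (M ** N)" "M ** smul c N = smul c (M ** N)"
  by (simp_all add: mat2_eq_iff mat2_mult algebra_simps)

lemma smul_smul: "smul c (smul d M) = smul (c * d) M"
  by (simp add: mat2_eq_iff)

lemma mat_cancel [simp]: "mat 1 ** M = (M :: complex^2^2)" "M ** mat 1 = (M :: complex^2^2)"
  by (simp_all add: matrix_mul_lid matrix_mul_rid)

definition shift :: "complex \<Rightarrow> complex^2^2 \<Rightarrow> complex^2^2" where "shift c A = A - smul c (mat 1)"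

text \<open>Cayley-Hamilton: (A - l)(A - m) = 0, so the image of A - m consists of eigenvectors for
  l.\<close>

lemma eigen_shift:
  fixes A :: "complex^2^2"
  assumes "det A = 1" "l + m = A$1$1 + A$2$2" "l * m = 1"
  shows "A ** shift m A = smul l (shift m A)" "shift m A ** A = smul l (shift m A)"
proof -
  define a where "a = A$1$1"
  define b where "b = A$1$2"
  define c where "c = A$2$1"
  define d where "d = A$2$2"
  have bc: "b * c = a * d - 1" using assms(1) unfolding det2 a_def b_def c_def d_def by (simp add: algebra_simps)
  have l: "l = a + d - m" using assms(2) unfolding a_def d_def by (simp add: algebra_simps)
  have lm: "(a + d - m) * m = 1" using assms(3) unfolding l .
  have e1: "a * (a - m) + b * c = l * (a - m)" unfolding bc l using lm by (simp add: algebra_simps)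
  have e4: "c * b + d * (d - m) = l * (d - m)" unfolding mult.commute[of c b] bc l using lm by (simp add: algebra_simps)
  show "A ** shift m A = smul l (shift m A)" "shift m A ** A = smul l (shift m A)"
    unfolding mat2_eq_iff mat2_mult shift_def
    using e1 e4 by (simp_all add: a_def[symmetric] b_def[symmetric] c_def[symmetric] d_def[symmetric] l algebra_simps)
qed

primrec mpow :: "complex^2^2 \<Rightarrow> nat \<Rightarrow> complex^2^2" where
  "mpow A 0 = mat 1"
| "mpow A (Suc n) = A ** mpow A n"

lemma mpow_left: "A ** F = smul l F \<Longrightarrow> mpow A n ** F = smul (l ^ n) F"
proof (induction n)
  case 0
  then show ?case by (simp add: mat2_eq_iff)
next
  case (Suc n)
  have "mpow A (Suc n) ** F = A ** (mpow A n ** F)" by (simp add: matrix_mul_assoc)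
  then show ?case using Suc by (simp add: smul_mult smul_smul mult.commute)
qed

lemma mpow_right: "F ** A = smul l F \<Longrightarrow> F ** mpow A n = smul (l ^ n) F"
proof (induction n)
  case 0
  then show ?case by (simp add: mat2_eq_iff)
next
  case (Suc n)
  have "F ** mpow A (Suc n) = (F ** A) ** mpow A n" by (simp add: matrix_mul_assoc)
  then show ?case using Suc by (simp add: smul_mult smul_smul)
qed

lemma geometric_bounded_zero:
  fixes r :: real
  assumes "1 < r" "\<And>n. r ^ n * x \<le> b" "0 \<le> x"
  shows "x = 0"
proof (rule ccontr)
  assume "x \<noteq> 0"
  then have x: "0 < x" using assms(3) by simp
  obtain n where "b / x < r ^ n" using real_arch_pow[OF assms(1)] by blast
  then have "b < r ^ n * x" using x by (simp add: pos_divide_less_eq)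
  then show False using assms(2)[of n] by simp
qed

text \<open>F and F' are multiples of the projections to the two eigenlines, and F' T F, F T F' are
  the off-diagonal blocks of T. Conjugation by powers of A in one direction or the other multiplies
  them by l to the power 2 n, so boundedness forces both to vanish and T is diagonal along with
  A.\<close>

lemma bounded_conjugates_commute:
  fixes A Q T :: "complex^2^2"
  assumes A: "det A = 1" "l + m = A$1$1 + A$2$2" "l * m = 1" "1 < cmod l"
    and Q: "A ** Q = mat 1" "Q ** A = mat 1"
    and b: "\<And>n. norm (mpow Q n ** T ** mpow A n) \<le> b" "\<And>n. norm (mpow A n ** T ** mpow Q n) \<le> b"
  shows "A ** T = T ** A"
proof -
  define F where "F = shift m A"
  define F' where "F' = shift l A"
  have lm: "m + l = A$1$1 + A$2$2" "m * l = 1" using A by (simp_all add: add.commute mult.commute)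
  have FA: "A ** F = smul l F" "F ** A = smul l F" unfolding F_def by (rule eigen_shift[OF A(1-3)])+
  have F'A: "A ** F' = smul m F'" "F' ** A = smul m F'" unfolding F'_def by (rule eigen_shift[OF A(1) lm])+
  have "F' ** A ** Q = smul m (F' ** Q)" unfolding F'A by (simp add: smul_mult)
  then have "F' = smul m (F' ** Q)" unfolding matrix_mul_assoc[symmetric] Q by simp
  then have "smul l F' = smul (l * m) (F' ** Q)" by (metis smul_smul)
  then have F'Q: "F' ** Q = smul l F'" unfolding A(3) by (simp add: mat2_eq_iff)
  have "Q ** (A ** F') = smul m (Q ** F')" unfolding F'A by (simp add: smul_mult)
  then have "F' = smul m (Q ** F')" unfolding matrix_mul_assoc Q by simp
  then have "smul l F' = smul (l * m) (Q ** F')" by (metis smul_smul)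
  then have QF': "Q ** F' = smul l F'" unfolding A(3) by (simp add: mat2_eq_iff)
  have r: "1 < cmod l * cmod l" using A(4) by (metis less_trans mult_strict_mono' norm_ge_zero mult_1 zero_le_one)
  have z: "X = 0" if Y: "\<And>n. \<exists>Y. norm Y \<le> b \<and> U ** Y ** V = smul (l ^ n * l ^ n) X" for X U V :: "complex^2^2"
  proof -
    have "(cmod l * cmod l) ^ n * norm X \<le> 64 * (norm U * b * norm V)" for n
    proof -
      obtain Y where Y': "norm Y \<le> b" "U ** Y ** V = smul (l ^ n * l ^ n) X" using Y[of n] by blast
      have "(cmod l * cmod l) ^ n * norm X = norm (U ** Y ** V)"
        unfolding Y'(2) norm_smul by (simp add: norm_mult norm_power power_mult_distrib)
      also have "\<dots> \<le> 8 * (norm (U ** Y) * norm V)" by (rule norm_mat2_mult)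
      also have "\<dots> \<le> 8 * (8 * (norm U * norm Y) * norm V)" by (intro mult_left_mono mult_right_mono norm_mat2_mult) auto
      also have "\<dots> \<le> 8 * (8 * (norm U * b) * norm V)" using Y'(1) by (intro mult_left_mono mult_right_mono) auto
      finally show ?thesis by simp
    qed
    then have "norm X = 0" by (rule geometric_bounded_zero[OF r]) simp
    then show ?thesis by (simp only: norm_eq_zero)
  qed
  have e1: "F' ** T ** F = 0"
  proof (rule z[of F' F])
    fix n
    have "F' ** (mpow Q n ** T ** mpow A n) ** F = (F' ** mpow Q n) ** T ** (mpow A n ** F)" by (simp add: matrix_mul_assoc)
    also have "\<dots> = smul (l ^ n * l ^ n) (F' ** T ** F)"
      unfolding mpow_left[OF FA(1)] mpow_right[OF F'Q] by (simp add: smul_mult smul_smul)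
    finally show "\<exists>Y. norm Y \<le> b \<and> F' ** Y ** F = smul (l ^ n * l ^ n) (F' ** T ** F)" using b(1) by blast
  qed
  have e2: "F ** T ** F' = 0"
  proof (rule z[of F F'])
    fix n
    have "F ** (mpow A n ** T ** mpow Q n) ** F' = (F ** mpow A n) ** T ** (mpow Q n ** F')" by (simp add: matrix_mul_assoc)
    also have "\<dots> = smul (l ^ n * l ^ n) (F ** T ** F')"
      unfolding mpow_left[OF QF'] mpow_right[OF FA(2)] by (simp add: smul_mult smul_smul)
    finally show "\<exists>Y. norm Y \<le> b \<and> F ** Y ** F' = smul (l ^ n * l ^ n) (F ** T ** F')" using b(2) by blast
  qed
  \<comment> \<open>Expanding (A - m) T (A - l) - (A - l) T (A - m), all terms cancel except (l -
    m)(T A - A T).\<close>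
  have "smul (l - m) (T ** A - A ** T) = F ** T ** F' - F' ** T ** F"
    unfolding F_def F'_def shift_def mat2_eq_iff by (simp add: mat2_mult algebra_simps)
  then have "smul (l - m) (T ** A - A ** T) = 0" using e1 e2 by simp
  moreover have "l \<noteq> m"
  proof
    assume "l = m"
    then have "cmod l * cmod l = 1" using A(3) by (metis norm_mult norm_one)
    then show False using r by simp
  qed
  ultimately have "T ** A - A ** T = 0" unfolding mat2_eq_iff by simp
  then show ?thesis by simp
qed

text \<open>The powers of A have the form m^n + s (A - m), where s satisfies a recursion with
  coefficients of modulus 1 and so grows at most linearly. The displacement of the base point by
  powers of A is then only logarithmic.\<close>

lemma unit_eigenvalue_linear_growth:
  fixes A :: "complex^2^2"
  assumes A: "det A = 1" "l + m = A$1$1 + A$2$2" "l * m = 1" "cmod l = 1"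
  shows "norm (mpow A n) \<le> norm (mat 1 :: complex^2^2) + real n * norm (shift m A)"
proof -
  have m1: "cmod m = 1" using A(3,4) by (metis mult_1 norm_mult norm_one)
  have "\<exists>s. cmod s \<le> real n \<and> mpow A n = smul (m ^ n) (mat 1) + smul s (shift m A)"
  proof (induction n)
    case 0
    show ?case by (intro exI[of _ 0]) (simp add: mat2_eq_iff)
  next
    case (Suc n)
    then obtain s where s: "cmod s \<le> real n" "mpow A n = smul (m ^ n) (mat 1) + smul s (shift m A)" by blast
    have "mpow A (Suc n) = smul (m ^ n) A + smul s (A ** shift m A)"
      unfolding mpow.simps s(2) by (simp add: matrix_add_ldistrib smul_mult)
    also have "\<dots> = smul (m ^ Suc n) (mat 1) + smul (m ^ n + s * l) (shift m A)"
      unfolding eigen_shift[OF A(1-3)] by (simp add: mat2_eq_iff shift_def algebra_simps)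
    finally have "mpow A (Suc n) = smul (m ^ Suc n) (mat 1) + smul (m ^ n + s * l) (shift m A)" .
    moreover have "cmod (m ^ n + s * l) \<le> real (Suc n)"
      using norm_triangle_ineq[of "m ^ n" "s * l"] s(1) m1 A(4) by (simp add: norm_power norm_mult)
    ultimately show ?case by blast
  qed
  then obtain s where s: "cmod s \<le> real n" "mpow A n = smul (m ^ n) (mat 1) + smul s (shift m A)" by blast
  have "norm (mpow A n) \<le> norm (smul (m ^ n) (mat 1)) + norm (smul s (shift m A))" unfolding s(2) by (rule norm_triangle_ineq)
  also have "\<dots> \<le> norm (mat 1 :: complex^2^2) + real n * norm (shift m A)"
    unfolding norm_smul using s(1) m1 by (simp add: norm_power mult_right_mono)
  finally show ?thesis .
qed

lemma eigenvalues_exist: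
  fixes A :: "complex^2^2"
  shows "\<exists>l m. l + m = A$1$1 + A$2$2 \<and> l * m = 1 \<and> 1 \<le> cmod l"
proof -
  define t where "t = A$1$1 + A$2$2"
  define l where "l = (t + csqrt (t\<^sup>2 - 4)) / 2"
  define m where "m = (t - csqrt (t\<^sup>2 - 4)) / 2"
  have s: "l + m = t" by (simp add: l_def m_def field_simps)
  have "l * m = (t\<^sup>2 - (csqrt (t\<^sup>2 - 4))\<^sup>2) / 4" by (simp add: l_def m_def power2_eq_square algebra_simps)
  then have p: "l * m = 1" by simp
  then have pn: "cmod l * cmod m = 1" by (metis norm_mult norm_one)
  show ?thesis
  proof (cases "1 \<le> cmod l")
    case True
    then show ?thesis using s p t_def by blast
  next
    case False
    have "1 \<le> cmod m"
    proof (rule ccontr)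
      assume "\<not> 1 \<le> cmod m"
      then have "cmod l * cmod m \<le> cmod l * 1" by (intro mult_left_mono) auto
      then show False using False pn by simp
    qed
    then show ?thesis using s p t_def by (intro exI[of _ m] exI[of _ l]) (simp add: add.commute mult.commute)
  qed
qed

lemma expanding_not_scalar:
  fixes A :: "complex^2^2"
  assumes A: "det A = 1" "l + m = A$1$1 + A$2$2" "l * m = 1" "1 < cmod l"
  shows "A$1$2 \<noteq> 0 \<or> A$2$1 \<noteq> 0 \<or> A$1$1 \<noteq> A$2$2" "(A$1$1 + A$2$2)\<^sup>2 \<noteq> 4"
proof -
  have "l \<noteq> m"
  proof
    assume "l = m"
    then have "cmod l * cmod l = 1" using A(3) by (metis norm_mult norm_one)
    then show False using A(4) by (metis less_irrefl mult_strict_mono' mult_1 norm_ge_zero zero_le_one)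
  qed
  have "(A$1$1 + A$2$2)\<^sup>2 - 4 = (l - m)\<^sup>2" using A(2,3) by (simp add: power2_eq_square algebra_simps flip: A(2))
  then show t: "(A$1$1 + A$2$2)\<^sup>2 \<noteq> 4" using \<open>l \<noteq> m\<close> by (metis diff_self eq_iff_diff_eq_0 power_eq_0_iff)
  show "A$1$2 \<noteq> 0 \<or> A$2$1 \<noteq> 0 \<or> A$1$1 \<noteq> A$2$2"
  proof (rule ccontr)
    assume "\<not> ?thesis"
    then have z: "A$1$2 = 0" "A$2$1 = 0" "A$1$1 = A$2$2" by auto
    then have "A$2$2 * A$2$2 = 1" using A(1) by (simp add: det2)
    then have "(A$1$1 + A$2$2)\<^sup>2 = 4" using z(3) by (simp add: power2_eq_square algebra_simps)
    then show False using t by simp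
  qed
qed

text \<open>Commuting makes the triples (b, c, a - d) and (q, r, p - s) of the two matrices
  proportional; a nonzero entry of the first gives u.\<close>

lemma centralizer:
  fixes A T :: "complex^2^2"
  assumes ns: "A$1$2 \<noteq> 0 \<or> A$2$1 \<noteq> 0 \<or> A$1$1 \<noteq> A$2$2" and comm: "A ** T = T ** A"
  shows "\<exists>u v. T = smul u A + smul v (mat 1)"
proof -
  define a where "a = A$1$1"
  define b where "b = A$1$2"
  define c where "c = A$2$1"
  define d where "d = A$2$2"
  define p where "p = T$1$1"
  define q where "q = T$1$2"
  define r where "r = T$2$1"
  define s where "s = T$2$2"
  note defs = a_def[symmetric] b_def[symmetric] c_def[symmetric] d_def[symmetric] p_def[symmetric] q_def[symmetric] r_def[symmetric] s_def[symmetric]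
  have "a * p + b * r = p * a + q * c" "a * q + b * s = p * b + q * d" "c * p + d * r = r * a + s * c"
    using comm unfolding mat2_eq_iff mat2_mult defs by auto
  then have e: "b * r = q * c" "q * (a - d) = b * (p - s)" "c * (p - s) = r * (a - d)"
    by (simp_all add: algebra_simps)
  have "\<exists>u v. p = u * a + v \<and> q = u * b \<and> r = u * c \<and> s = u * d + v"
  proof -
    consider "b \<noteq> 0" | "b = 0" "c \<noteq> 0" | "b = 0" "c = 0" "a \<noteq> d" using ns unfolding defs by blast
    then show ?thesis
    proof cases
      case 1
      then show ?thesis using e by (intro exI[of _ "q / b"] exI[of _ "p - q / b * a"]) (auto simp: field_simps)
    next
      case 2
      then show ?thesis using e by (intro exI[of _ "r / c"] exI[of _ "p - r / c * a"]) (auto simp: field_simps)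
    next
      case 3
      define k where "k = (p - s) / (a - d)"
      have "k * (a - d) = p - s" using 3 by (simp add: k_def)
      then show ?thesis using e 3 by (intro exI[of _ k] exI[of _ "p - k * a"]) (auto simp: algebra_simps)
    qed
  qed
  then show ?thesis unfolding mat2_eq_iff by (simp add: defs)
qed

lemma centralizer_commutative:
  fixes A T U :: "complex^2^2"
  assumes ns: "A$1$2 \<noteq> 0 \<or> A$2$1 \<noteq> 0 \<or> A$1$1 \<noteq> A$2$2" and "A ** T = T ** A" "A ** U = U ** A"
  shows "T ** U = U ** T"
proof -
  obtain u v u' v' where "T = smul u A + smul v (mat 1)" "U = smul u' A + smul v' (mat 1)"
    using centralizer[OF ns] assms(2,3) by metis
  then show ?thesis by (simp add: mat2_eq_iff mat2_mult algebra_simps)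
qed

text \<open>If the eigenlines of \<open>B A B\<inverse>\<close> are those of \<open>A\<close>, then \<open>B\<close> preserves or exchanges them.\<close>
lemma square_commutes:
  fixes A B Q :: "complex^2^2"
  assumes A: "det A = 1" and ns: "A$1$2 \<noteq> 0 \<or> A$2$1 \<noteq> 0 \<or> A$1$1 \<noteq> A$2$2" and t: "(A$1$1 + A$2$2)\<^sup>2 \<noteq> 4"
    and Q: "B ** Q = mat 1" "Q ** B = mat 1"
    and comm: "A ** (B ** A ** Q) = (B ** A ** Q) ** A"
  shows "A ** (B ** B) = (B ** B) ** A"
proof -
  define T where "T = B ** A ** Q"
  define \<tau> where "\<tau> = A$1$1 + A$2$2"
  obtain u v where uv: "T = smul u A + smul v (mat 1)" using centralizer[OF ns] comm unfolding T_def by blast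
  have TB: "T ** B = B ** A" unfolding T_def using Q by (simp add: matrix_mul_assoc[symmetric])
  have "trace T = trace (Q ** (B ** A))" unfolding T_def by (rule trace_mul_sym)
  also have "\<dots> = trace A" using Q by (simp add: matrix_mul_assoc)
  finally have tr: "T$1$1 + T$2$2 = \<tau>" by (simp add: trace_def sum_2 \<tau>_def)
  have "det T = det B * det Q" unfolding T_def using A by (simp add: det_mul)
  also have "\<dots> = 1" using Q(1) by (metis det_mul det_I)
  finally have dT: "T$1$1 * T$2$2 - T$1$2 * T$2$1 = 1" by (simp add: det2)
  have dA: "A$1$1 * A$2$2 - A$1$2 * A$2$1 = 1" using A by (simp add: det2)
  have e1: "u * \<tau> + 2 * v = \<tau>" using tr unfolding uv \<tau>_def by (simp add: algebra_simps)
  have "T$1$1 * T$2$2 - T$1$2 * T$2$1 = u * u * (A$1$1 * A$2$2 - A$1$2 * A$2$1) + u * v * \<tau> + v * v"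
    unfolding uv \<tau>_def by (simp add: algebra_simps)
  then have e2: "u * u + u * v * \<tau> + v * v = 1" unfolding dT dA by simp
  have v: "v = \<tau> * (1 - u) / 2" using e1 by (simp add: field_simps)
  \<comment> \<open>As a conjugate of A, the matrix T = u A + v has trace \<tau> and determinant 1.
    Eliminating v leaves this equation, and \<tau> squared is not 4, so u is 1 or -1.\<close>
  have "(u * u - 1) * (4 - \<tau>\<^sup>2) = 4 * (u * u + u * v * \<tau> + v * v - 1)"
    unfolding v by (simp add: power2_eq_square field_simps)
  then have "(u * u - 1) * (4 - \<tau>\<^sup>2) = 0" unfolding e2 by simp
  then have "u * u = 1" using t unfolding \<tau>_def by auto
  then have "u = 1 \<or> u = - 1" by (simp add: square_eq_1_iff)
  then show ?thesis
  proof
    assume "u = 1"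
    then have "T = A" using v uv by (simp add: mat2_eq_iff)
    then have "A ** B = B ** A" using TB by simp
    then show ?thesis by (metis matrix_mul_assoc)
  next
    assume "u = - 1"
    \<comment> \<open>This is the inverse of A: B exchanges the eigenlines, and only its square
      commutes with A.\<close>
    then have T: "T = smul \<tau> (mat 1) - A" using v uv by (simp add: mat2_eq_iff)
    have BA: "B ** A = smul \<tau> B - A ** B" unfolding TB[symmetric] T by (simp add: mat2_eq_iff mat2_mult algebra_simps)
    have dist: "X ** (smul \<tau> Y - Z) = smul \<tau> (X ** Y) - X ** Z" "(smul \<tau> Y - Z) ** X = smul \<tau> (Y ** X) - Z ** X"
      for X Y Z :: "complex^2^2" by (simp_all add: mat2_eq_iff mat2_mult algebra_simps)
    have "B ** B ** A = B ** (B ** A)" by (simp add: matrix_mul_assoc)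
    also have "\<dots> = smul \<tau> (B ** B) - B ** (A ** B)" unfolding BA by (rule dist)
    also have "B ** (A ** B) = (B ** A) ** B" by (simp add: matrix_mul_assoc)
    also have "(B ** A) ** B = smul \<tau> (B ** B) - A ** B ** B" unfolding BA by (rule dist)
    finally show ?thesis by (simp add: matrix_mul_assoc)
  qed
qed

section \<open>Stability implies quasi-isometric orbit maps\<close>

text \<open>One of the three points is coarsely between the other two. Which one is left open, since
  the order along a quasi-geodesic image is not known in advance.\<close>

definition aligned :: "real \<Rightarrow> complex \<times> real \<Rightarrow> complex \<times> real \<Rightarrow> complex \<times> real \<Rightarrow> bool" where
  "aligned M p q r \<longleftrightarrow> gprod hdist p q r \<le> M \<or> gprod hdist q p r \<le> M \<or> gprod hdist r p q \<le> M"

lemma aligned_perturb: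
  assumes H: "p \<in> H3" "q \<in> H3" "r \<in> H3" "p' \<in> H3" "q' \<in> H3" "r' \<in> H3"
    and d: "hdist p p' \<le> \<eta>" "hdist q q' \<le> \<eta>" "hdist r r' \<le> \<eta>" and al: "aligned M p' q' r'"
  shows "aligned (M + 3 * \<eta>) p q r"
proof -
  have *: "gprod hdist p q r \<le> gprod hdist p' q' r' + 3 * \<eta>"
    if "p \<in> H3" "q \<in> H3" "r \<in> H3" "p' \<in> H3" "q' \<in> H3" "r' \<in> H3" "hdist p p' \<le> \<eta>" "hdist q q' \<le> \<eta>" "hdist r r' \<le> \<eta>"
    for p q r p' q' r'
    using H3.gp_change_base[of p p' q r] H3.gp_change_args[of p' q q' r r'] that by simp
  show ?thesis
    using al *[OF H d] *[of q p r q' p' r'] *[of r p q r' p' q'] H d unfolding aligned_def by force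
qed

lemma aligned_swap: "aligned M p q r \<Longrightarrow> aligned M q p r" "aligned M p q r \<Longrightarrow> aligned M p r q"
  using hdist_sym[of p q] hdist_sym[of p r] hdist_sym[of q r] unfolding aligned_def gprod_def by (auto simp: add.commute)

text \<open>The Morse lemma is about sequences, so f is sampled at integer times, which moves each
  point by at most K + C. By symmetry of \<open>aligned\<close> only one order of the three times
  has to be treated.\<close>

lemma quasi_geodesic_aligned:
  assumes K: "1 \<le> K" and C: "0 \<le> C"
  shows "\<exists>M. \<forall>f :: real \<Rightarrow> complex \<times> real. (\<forall>s. f s \<in> H3) \<and>
      (\<forall>s t. \<bar>s - t\<bar> / K - C \<le> hdist (f s) (f t) \<and> hdist (f s) (f t) \<le> K * \<bar>s - t\<bar> + C) \<longrightarrow>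
      (\<forall>s t u. aligned M (f s) (f t) (f u))"
proof -
  obtain M where M: "\<And>f n j. \<lbrakk>H3.quasi_path K C f n; j \<le> n\<rbrakk> \<Longrightarrow> gprod hdist (f j) (f 0) (f n) \<le> M"
    using H3.morse_between[OF K C] by blast
  define M' where "M' = M + 3 * (K + C)"
  have "aligned M' (f s) (f t) (f u)"
    if fH: "\<forall>s. f s \<in> H3" and qg: "\<forall>s t. \<bar>s - t\<bar> / K - C \<le> hdist (f s) (f t) \<and> hdist (f s) (f t) \<le> K * \<bar>s - t\<bar> + C"
    for f :: "real \<Rightarrow> complex \<times> real" and s t u
  proof -
    have main: "aligned M' (f s) (f t) (f u)" if stu: "s \<le> t" "t \<le> u" for s t u
    proof -
      define a where "a = \<lfloor>s\<rfloor>"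
      define n where "n = nat (\<lfloor>u\<rfloor> - a)"
      define j where "j = nat (\<lfloor>t\<rfloor> - a)"
      have m: "a \<le> \<lfloor>t\<rfloor>" "\<lfloor>t\<rfloor> \<le> \<lfloor>u\<rfloor>" unfolding a_def using stu by (auto intro: floor_mono)
      define g where "g i = f (real_of_int (a + int i))" for i
      have "H3.quasi_path K C g n"
        unfolding H3.quasi_path_def
      proof (intro conjI allI impI)
        fix i k :: nat
        have e: "\<bar>real_of_int (a + int i) - real_of_int (a + int k)\<bar> = \<bar>real i - real k\<bar>" by simp
        show "g i \<in> H3" using fH g_def by simp
        show "\<bar>real i - real k\<bar> / K - C \<le> hdist (g i) (g k)" "hdist (g i) (g k) \<le> K * \<bar>real i - real k\<bar> + C"
          using qg unfolding g_def e[symmetric] by blast+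
      qed
      moreover have "j \<le> n" using m by (simp add: j_def n_def)
      ultimately have "gprod hdist (g j) (g 0) (g n) \<le> M" by (rule M)
      then have al: "aligned M (g 0) (g j) (g n)" unfolding aligned_def by blast
      have close: "hdist (f v) (f (real_of_int \<lfloor>v\<rfloor>)) \<le> K + C" for v
      proof -
        have "\<bar>v - real_of_int \<lfloor>v\<rfloor>\<bar> \<le> 1" by linarith
        then have "K * \<bar>v - real_of_int \<lfloor>v\<rfloor>\<bar> \<le> K * 1" using K by (intro mult_left_mono) auto
        then show ?thesis using qg[rule_format, of v "real_of_int \<lfloor>v\<rfloor>"] by simp
      qed
      have g: "g 0 = f (real_of_int \<lfloor>s\<rfloor>)" "g j = f (real_of_int \<lfloor>t\<rfloor>)" "g n = f (real_of_int \<lfloor>u\<rfloor>)"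
        using m by (simp_all add: g_def j_def n_def a_def)
      show ?thesis unfolding M'_def
        by (rule aligned_perturb[OF _ _ _ _ _ _ _ _ _ al]) (use fH close g in simp_all)
    qed
    consider "s \<le> t" "t \<le> u" | "s \<le> u" "u \<le> t" | "t \<le> s" "s \<le> u" | "t \<le> u" "u \<le> s" | "u \<le> s" "s \<le> t" | "u \<le> t" "t \<le> s"
      by linarith
    then show ?thesis
    proof cases
      case 1 then show ?thesis by (rule main)
    next
      case 2 then show ?thesis using main[of s u t] aligned_swap by blast
    next
      case 3 then show ?thesis using main[of t s u] aligned_swap by blast
    next
      case 4 then show ?thesis using main[of t u s] aligned_swap by blast
    next
      case 5 then show ?thesis using main[of u s t] aligned_swap by blast
    next
      case 6 then show ?thesis using main[of u t s] aligned_swap by blast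
    qed
  qed
  then show ?thesis by blast
qed

lemma hball_finite_cover:
  assumes x: "x \<in> H3"
  shows "\<exists>k. finite k \<and> (\<forall>p\<in>H3. hdist x p \<le> r \<longrightarrow> (\<exists>c\<in>k. c \<in> H3 \<and> hdist c p \<le> 1 / 2))"
proof -
  define U where "U c = {p \<in> H3. hcosh c p < cosh (1 / 2 :: real)}" for c
  have oH: "open H3" unfolding H3_def by (intro open_Collect_less continuous_intros)
  have op: "open (U c)" if "c \<in> H3" for c
  proof -
    have "continuous_on H3 (\<lambda>p. hcosh c p)"
      unfolding hcosh_def using that by (intro continuous_intros) (auto simp: H3_def)
    then have "open (H3 \<inter> (\<lambda>p. hcosh c p) -` {..<cosh (1 / 2)})" using continuous_open_preimage oH open_lessThan by blast
    moreover have "H3 \<inter> (\<lambda>p. hcosh c p) -` {..<cosh (1 / 2)} = U c" unfolding U_def by auto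
    ultimately show ?thesis by simp
  qed
  define Bl where "Bl = {p \<in> H3. hdist x p \<le> r}"
  have cB: "compact Bl" unfolding Bl_def by (rule hball_compact[OF x])
  have self: "c \<in> U c" if "c \<in> H3" for c
    using that cosh_real_nonneg_less_iff[of 0 "1 / 2"] by (simp add: U_def hcosh_def)
  have cover: "Bl \<subseteq> (\<Union>c\<in>H3. U c)"
  proof
    fix p assume "p \<in> Bl"
    then have "p \<in> H3" by (simp add: Bl_def)
    then show "p \<in> (\<Union>c\<in>H3. U c)" using self by blast
  qed
  obtain k where k: "k \<subseteq> H3" "finite k" "Bl \<subseteq> (\<Union>c\<in>k. U c)"
    using compactE_image[OF cB op cover] by blast
  have "\<exists>c\<in>k. c \<in> H3 \<and> hdist c p \<le> 1 / 2" if p: "p \<in> H3" "hdist x p \<le> r" for p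
  proof -
    have "p \<in> Bl" using p by (simp add: Bl_def)
    then obtain c where c: "c \<in> k" "hcosh c p < cosh (1 / 2)" using k(3) unfolding U_def by blast
    then have "c \<in> H3" using k(1) by blast
    then show ?thesis using hdist_le_iff[of c p "1 / 2"] c p by (intro bexI[of _ c]) auto
  qed
  then show ?thesis using k(2) by blast
qed

locale stable_rep = hyp_rep G S \<rho> dl for G (structure) and S :: "'a set" and \<rho> and dl +
  fixes a b :: 'a and K C :: real and x :: "complex \<times> real"
  assumes ab: "a \<in> carrier G" "b \<in> carrier G"
    and free: "\<And>w. \<lbrakk>w \<noteq> []; reduced2 w\<rbrakk> \<Longrightarrow> eval2 G a b w \<noteq> \<one>"
    and K: "1 \<le> K" and C: "0 \<le> C" and xH: "x \<in> H3"
    and stable: "\<And>c l. \<lbrakk>c \<in> derived_set G (carrier G); infinite_order G c; l \<in> geodesics_axis G S c\<rbrakk> \<Longrightarrow>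
        quasi_geodesic K C (orbit_image \<rho> x l)"
begin

abbreviation orb where "orb g \<equiv> act g x"

definition Lp :: real where "Lp = (SOME L. 1 \<le> L \<and> (\<forall>g\<in>carrier G. disp x g \<le> L * real (wl g)))"

lemma Lp: "1 \<le> Lp" "\<And>g. g \<in> carrier G \<Longrightarrow> disp x g \<le> Lp * real (wl g)"
proof -
  have "\<exists>L. 1 \<le> L \<and> (\<forall>g\<in>carrier G. disp x g \<le> L * real (wl g))" using disp_lipschitz[OF xH] by blast
  then have "1 \<le> Lp \<and> (\<forall>g\<in>carrier G. disp x g \<le> Lp * real (wl g))" unfolding Lp_def by (rule someI_ex)
  then show "1 \<le> Lp" "\<And>g. g \<in> carrier G \<Longrightarrow> disp x g \<le> Lp * real (wl g)" by auto
qed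

lemma orbH: "g \<in> carrier G \<Longrightarrow> orb g \<in> H3" using act_H3 xH by blast

lemma orb_lipschitz: "\<lbrakk>g \<in> carrier G; h \<in> carrier G\<rbrakk> \<Longrightarrow> hdist (orb g) (orb h) \<le> Lp * e g h"
  using hdist_act[OF xH] Lp(2)[of "inv g \<otimes> h"] by (simp add: e_eq)

lemma orb_lipschitz_le: "\<lbrakk>g \<in> carrier G; h \<in> carrier G; e g h \<le> r\<rbrakk> \<Longrightarrow> hdist (orb g) (orb h) \<le> Lp * r"
  using orb_lipschitz[of g h] Lp(1) mult_left_mono[of "e g h" r Lp] by linarith

text \<open>Here f is the parametrization provided by stability and s i a time at which it visits
  the orbit point of l i. No monotonicity of s is part of the definition.\<close>

definition axis_line :: "(real \<Rightarrow> complex \<times> real) \<Rightarrow> (int \<Rightarrow> 'a) \<Rightarrow> (int \<Rightarrow> real) \<Rightarrow> bool" where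
  "axis_line f l s \<longleftrightarrow> (\<forall>t. f t \<in> H3) \<and>
     (\<forall>t u. \<bar>t - u\<bar> / K - C \<le> hdist (f t) (f u) \<and> hdist (f t) (f u) \<le> K * \<bar>t - u\<bar> + C) \<and>
     (\<forall>i. l i \<in> carrier G) \<and> (\<forall>i j. e (l i) (l j) = real_of_int \<bar>i - j\<bar>) \<and>
     (\<forall>i. f (s i) = orb (l i)) \<and> (\<forall>t. \<exists>i. hdist (f t) (orb (l i)) \<le> Lp)"

lemma axis_lineD:
  assumes "axis_line f l s"
  shows "f t \<in> H3" "\<bar>t - u\<bar> / K - C \<le> hdist (f t) (f u)" "hdist (f t) (f u) \<le> K * \<bar>t - u\<bar> + C"
    "l i \<in> carrier G" "e (l i) (l j) = real_of_int \<bar>i - j\<bar>" "f (s i) = orb (l i)" "\<exists>i. hdist (f t) (orb (l i)) \<le> Lp"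
  using assms unfolding axis_line_def by blast+

lemma axis_line_param:
  assumes "axis_line f l s" "hdist (f t) (f u) \<le> r"
  shows "\<bar>t - u\<bar> \<le> K * (r + C)"
proof -
  have "\<bar>t - u\<bar> / K \<le> r + C" using axis_lineD(2)[OF assms(1), of t u] assms(2) by linarith
  then show ?thesis using K by (simp add: pos_divide_le_eq mult.commute)
qed

lemma axis_line_ex:
  assumes "c \<in> derived_set G (carrier G)" "infinite_order G c" and l: "l \<in> geodesics_axis G S c"
  shows "\<exists>f s. axis_line f l s"
proof -
  note lX = geodesics_axisD(1)[OF l] and geo = geodesics_axisD(2)[OF l]
  obtain f where f: "range f = orbit_image \<rho> x l"
     "\<forall>s t. \<bar>s - t\<bar> / K - C \<le> hdist (f s) (f t) \<and> hdist (f s) (f t) \<le> K * \<bar>s - t\<bar> + C"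
    using stable[OF assms] unfolding quasi_geodesic_def by blast
  have oi: "orbit_image \<rho> x l = (\<Union>i. hseg (orb (l i)) (orb (l (i + 1))))" by (simp add: orbit_image_def act_def)
  have "\<exists>s. f s = orb (l i)" for i
  proof -
    have "orb (l i) \<in> hseg (orb (l i)) (orb (l (i + 1)))" using orbH lX hdist_refl by (simp add: hseg_def)
    then have "orb (l i) \<in> range f" unfolding f(1) oi by blast
    then show ?thesis by (metis imageE)
  qed
  then have "\<forall>i. \<exists>s. f s = orb (l i)" by blast
  from choice[OF this] obtain s where s: "\<forall>i. f (s i) = orb (l i)" ..
  have "f t \<in> H3 \<and> (\<exists>i. hdist (f t) (orb (l i)) \<le> Lp)" for t
  proof -
    have "f t \<in> orbit_image \<rho> x l" using f(1) by blast
    then obtain i where i: "f t \<in> hseg (orb (l i)) (orb (l (i + 1)))" unfolding oi by blast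
    then have H: "f t \<in> H3" "hdist (orb (l i)) (f t) + hdist (f t) (orb (l (i + 1))) = hdist (orb (l i)) (orb (l (i + 1)))"
      by (auto simp: hseg_def)
    have "hdist (orb (l i)) (orb (l (i + 1))) \<le> Lp * 1" using orb_lipschitz_le[OF lX lX, of i "i + 1" 1] geo[of i "i + 1"] by simp
    then have "hdist (f t) (orb (l i)) \<le> Lp" using H(2) hdist_nonneg[OF H(1) orbH[OF lX], of "i + 1"] hdist_sym[of "f t"] by simp
    then show ?thesis using H(1) by blast
  qed
  then have "axis_line f l s" unfolding axis_line_def using f(2) lX geo s by blast
  then show ?thesis by blast
qed

lemma good_lines:
  "\<exists>n. \<exists>M\<ge>0. \<forall>W\<in>carrier G. M \<le> real (wl W) \<longrightarrow> (\<exists>w f l s B. length w = n \<and> axis_line f l s \<and>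
     (\<forall>k :: int. \<exists>i. e (cmt W (sqw G a b w) [^] k) (l i) \<le> M) \<and> (\<exists>i. e W (l i) \<le> M) \<and>
     (\<forall>i. \<exists>k :: int. e (l i) (cmt W (sqw G a b w) [^] k) \<le> B))"
proof -
  obtain n M where M: "0 \<le> M" "\<forall>W\<in>carrier G. M \<le> real (wl W) \<longrightarrow> (\<exists>w. length w = n \<and>
     (let g = cmt W (sqw G a b w) in infinite_order G g \<and> 2 * real (wl W) - M \<le> word_tlen G S g \<and>
       (\<exists>l\<in>geodesics_axis G S g. (\<forall>k :: int. \<exists>i. e (g [^] k) (l i) \<le> M) \<and> (\<exists>i. e W (l i) \<le> M) \<and>
          (\<exists>B. \<forall>i. \<exists>k :: int. e (l i) (g [^] k) \<le> B))))"
    using good_commutators[OF ab free] by blast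
  have "\<exists>w f l s B. length w = n \<and> axis_line f l s \<and>
     (\<forall>k :: int. \<exists>i. e (cmt W (sqw G a b w) [^] k) (l i) \<le> M) \<and> (\<exists>i. e W (l i) \<le> M) \<and>
     (\<forall>i. \<exists>k :: int. e (l i) (cmt W (sqw G a b w) [^] k) \<le> B)" if W: "W \<in> carrier G" "M \<le> real (wl W)" for W
  proof -
    obtain w l B where w: "length w = n" "infinite_order G (cmt W (sqw G a b w))" "l \<in> geodesics_axis G S (cmt W (sqw G a b w))"
      "\<forall>k :: int. \<exists>i. e (cmt W (sqw G a b w) [^] k) (l i) \<le> M" "\<exists>i. e W (l i) \<le> M"
      "\<forall>i. \<exists>k :: int. e (l i) (cmt W (sqw G a b w) [^] k) \<le> B"
      using M(2) W unfolding Let_def by blast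
    obtain f s where "axis_line f l s"
      using axis_line_ex[OF cmt_derived[OF W(1) sqw_closed[OF ab]] w(2,3)] by blast
    then show ?thesis using w by blast
  qed
  then show ?thesis using M(1) by blast
qed

text \<open>The axis of a good commutator passes near 1 and W, hence near every u coarsely between
  them; the three orbit points are therefore close to points of one quasi-geodesic image.\<close>

lemma words_aligned:
  "\<exists>M. \<forall>m. \<exists>M'. \<forall>W\<in>carrier G. M \<le> real (wl W) \<longrightarrow>
     (\<forall>u\<in>carrier G. gp u \<one> W \<le> m \<longrightarrow> aligned M' (orb \<one>) (orb u) (orb W))"
proof -
  obtain n M where M: "0 \<le> M" "\<forall>W\<in>carrier G. M \<le> real (wl W) \<longrightarrow> (\<exists>w f l s B. length w = n \<and> axis_line f l s \<and>
     (\<forall>k :: int. \<exists>i. e (cmt W (sqw G a b w) [^] k) (l i) \<le> M) \<and> (\<exists>i. e W (l i) \<le> M) \<and>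
     (\<forall>i. \<exists>k :: int. e (l i) (cmt W (sqw G a b w) [^] k) \<le> B))" using good_lines by blast
  obtain M2 where M2: "\<And>f s t u. \<lbrakk>\<forall>s. f s \<in> H3; \<forall>s t. \<bar>s - t\<bar> / K - C \<le> hdist (f s) (f t) \<and> hdist (f s) (f t) \<le> K * \<bar>s - t\<bar> + C\<rbrakk>
     \<Longrightarrow> aligned M2 (f s) (f t) (f u)" using quasi_geodesic_aligned[OF K C] by blast
  have "aligned (M2 + 3 * (Lp * (max m 0 + 2 * M + 2 * dl + 1))) (orb \<one>) (orb u) (orb W)"
    if W: "W \<in> carrier G" "M \<le> real (wl W)" and u: "u \<in> carrier G" "gp u \<one> W \<le> m" for m W u
  proof -
    define \<eta> where "\<eta> = max m 0 + 2 * M + 2 * dl + 1"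
    obtain w f l s where w: "axis_line f l s" "\<forall>k :: int. \<exists>i. e (cmt W (sqw G a b w) [^] k) (l i) \<le> M" "\<exists>i. e W (l i) \<le> M"
      using M(2) W by blast
    obtain i0 where i0: "e \<one> (l i0) \<le> M" using w(2)[rule_format, of 0] by auto
    obtain i1 where i1: "e W (l i1) \<le> M" using w(3) by blast
    note lX = axis_lineD(4)[OF w(1)] and geo = axis_lineD(5)[OF w(1)]
    obtain i2 where i2: "e u (l i2) \<le> m + 2 * M + 2 * dl + 1"
      using near_geodesic[OF lX geo u(1) one_closed W(1) i0 i1 u(2)] by blast
    have M\<eta>: "M \<le> \<eta>" "m + 2 * M + 2 * dl + 1 \<le> \<eta>" unfolding \<eta>_def using M(1) dl_nonneg by auto
    have "aligned M2 (f (s i0)) (f (s i2)) (f (s i1))"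
      by (rule M2) (use axis_lineD(1,2,3)[OF w(1)] in blast)+
    then have al: "aligned M2 (orb (l i0)) (orb (l i2)) (orb (l i1))" unfolding axis_lineD(6)[OF w(1)] .
    show ?thesis
    proof (rule aligned_perturb[OF _ _ _ _ _ _ _ _ _ al], fold \<eta>_def)
      show "hdist (orb \<one>) (orb (l i0)) \<le> Lp * \<eta>" using orb_lipschitz_le[OF one_closed lX] i0 M\<eta> by simp
      show "hdist (orb u) (orb (l i2)) \<le> Lp * \<eta>" using orb_lipschitz_le[OF u(1) lX] i2 M\<eta> by simp
      show "hdist (orb W) (orb (l i1)) \<le> Lp * \<eta>" using orb_lipschitz_le[OF W(1) lX] i1 M\<eta> by simp
    qed (use orbH lX u(1) W(1) in auto)
  qed
  then show ?thesis by blast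
qed

lemma aligned_translate:
  assumes g: "g \<in> carrier G" and H: "p \<in> H3" "q \<in> H3" "r \<in> H3"
  shows "aligned M (act g p) (act g q) (act g r) \<longleftrightarrow> aligned M p q r"
  using act_isometry[OF g] H by (simp add: aligned_def gprod_def)

text \<open>A long element moving suitable orbit points very little could be inserted between two
  words, producing an axis that runs through three points which are not aligned.\<close>
lemma almost_trivial_bounded:
  assumes tri: "\<And>M. \<exists>p\<in>carrier G. \<exists>q\<in>carrier G. \<exists>r\<in>carrier G. \<not> aligned M (orb p) (orb q) (orb r)"
  shows "\<exists>Q N. finite Q \<and> Q \<subseteq> carrier G \<and>
     (\<forall>w\<in>carrier G. (\<forall>q\<in>Q. hdist (orb (w \<otimes> q)) (orb q) \<le> 1) \<longrightarrow> real (wl w) < N)"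
proof -
  obtain M where M: "\<And>m. \<exists>M'. \<forall>W\<in>carrier G. M \<le> real (wl W) \<longrightarrow>
     (\<forall>u\<in>carrier G. gp u \<one> W \<le> m \<longrightarrow> aligned M' (orb \<one>) (orb u) (orb W))" using words_aligned by blast
  obtain n c where nc: "\<forall>u\<in>carrier G. \<forall>v\<in>carrier G. \<forall>u'\<in>carrier G. \<forall>v'\<in>carrier G.
     \<exists>w. length w = n \<and> gp \<one> u (sqw G a b w \<otimes> v) \<le> c \<and> gp \<one> u' (sqw G a b w \<otimes> v') \<le> c"
    using separating_word[OF ab free] by blast
  define r where "r = real (n * (2 * max (wl a) (wl b)))"
  define c1 where "c1 = \<bar>c\<bar> + r"
  define m where "m = c1 + dl"
  have r0: "0 \<le> r" "0 \<le> c1" by (simp_all add: r_def c1_def)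
  have m0: "0 \<le> m" using r0 dl_nonneg by (simp add: m_def)
  obtain M' where M': "\<And>W u. \<lbrakk>W \<in> carrier G; M \<le> real (wl W); u \<in> carrier G; gp u \<one> W \<le> m\<rbrakk> \<Longrightarrow> aligned M' (orb \<one>) (orb u) (orb W)"
    using M[of m] by blast
  obtain p1 p2 p3 where p: "p1 \<in> carrier G" "p2 \<in> carrier G" "p3 \<in> carrier G" "\<not> aligned (M' + 3 * 1) (orb p1) (orb p2) (orb p3)"
    using tri by blast
  define r1 where "r1 = inv p1 \<otimes> p2"
  define r2 where "r2 = inv p2 \<otimes> p3"
  have rc: "r1 \<in> carrier G" "r2 \<in> carrier G" using p by (auto simp: r1_def r2_def)
  \<comment> \<open>The third tripod point is p3 = p2 h q with q = \<open>inv h\<close> r2, and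
    inserting the conjugate of w by h replaces it by p2 h w q. One q for each possible h has to be
    nearly fixed, hence a finite set.\<close>
  define Q where "Q = (\<lambda>w. inv (sqw G a b w) \<otimes> r2) ` {w. length w = n}"
  define N where "N = \<bar>M\<bar> + 2 * r + 4 * c1 + 2 * m + dl + 1"
  have "finite {w :: bool list. length w = n}" using finite_lists_length_eq[of "UNIV :: bool set" n] by simp
  then have "finite Q" by (simp add: Q_def)
  moreover have "Q \<subseteq> carrier G" unfolding Q_def using rc sqw_closed[OF ab] by auto
  moreover have "real (wl w) < N" if w: "w \<in> carrier G" and triv: "\<forall>q\<in>Q. hdist (orb (w \<otimes> q)) (orb q) \<le> 1" for w
  proof (rule ccontr)
    assume "\<not> ?thesis"
    then have long: "N \<le> real (wl w)" by simp
    \<comment> \<open>The word h conjugates w so that the inserted element backtracks neither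
      against r1 in front of it nor against r2 behind it.\<close>
    obtain v where v: "length v = n" "gp \<one> (inv r1) (sqw G a b v \<otimes> w) \<le> c" "gp \<one> r2 (sqw G a b v \<otimes> inv w) \<le> c"
      using nc rc w inv_closed by meson
    define h where "h = sqw G a b v"
    have h: "h \<in> carrier G" using sqw_closed[OF ab] h_def by simp
    have hr: "real (wl h) \<le> r" unfolding h_def r_def using wl_sqw[OF ab, of v] v(1) by (simp only: of_nat_le_iff)
    have ih: "wl (inv h) = wl h" using wl_inv h by simp
    define w' where "w' = h \<otimes> w \<otimes> inv h"
    have w': "w' \<in> carrier G" using h w by (simp add: w'_def)
    have iw': "inv w' = h \<otimes> inv w \<otimes> inv h" using h w by (simp add: w'_def inv_mult_group m_assoc)
    have j1: "gp \<one> (inv r1) w' \<le> c1"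
    proof -
      have "gp \<one> w' (inv r1) \<le> gp \<one> (h \<otimes> w) (inv r1) + e w' (h \<otimes> w)" using gp_change_arg w' h w rc by simp
      moreover have "e w' (h \<otimes> w) = real (wl h)"
        using e_right[of "h \<otimes> w" "inv h"] e_sym[of w' "h \<otimes> w"] h w w' ih unfolding w'_def by simp
      moreover have "gp \<one> w' (inv r1) = gp \<one> (inv r1) w'" "gp \<one> (h \<otimes> w) (inv r1) = gp \<one> (inv r1) (h \<otimes> w)"
        using gp_sym w' rc h w by auto
      ultimately show ?thesis using v(2) hr unfolding h_def[symmetric] c1_def by linarith
    qed
    have j2: "gp \<one> (inv w') r2 \<le> c1"
    proof -
      have "gp \<one> (inv w') r2 \<le> gp \<one> (h \<otimes> inv w) r2 + e (inv w') (h \<otimes> inv w)" using gp_change_arg w' h w rc by simp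
      moreover have "e (inv w') (h \<otimes> inv w) = real (wl h)"
        using e_right[of "h \<otimes> inv w" "inv h"] e_sym[of "inv w'" "h \<otimes> inv w"] h w w' ih unfolding iw' by simp
      moreover have "gp \<one> (h \<otimes> inv w) r2 = gp \<one> r2 (h \<otimes> inv w)" using gp_sym rc h w by simp
      ultimately show ?thesis using v(3) hr unfolding h_def[symmetric] c1_def by linarith
    qed
    have ww': "real (wl w) - 2 * r \<le> real (wl w')"
    proof -
      have "w = inv h \<otimes> w' \<otimes> h" using h w by (simp add: w'_def m_assoc)
      then have "wl w \<le> wl (inv h \<otimes> w') + wl h" using wl_mult[of "inv h \<otimes> w'" h] h w' by simp
      moreover have "wl (inv h \<otimes> w') \<le> wl h + wl w'" using wl_mult[of "inv h" w'] h w' ih by simp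
      ultimately show ?thesis using hr by linarith
    qed
    define P where "P = r1 \<otimes> w'"
    define W where "W = r1 \<otimes> w' \<otimes> r2"
    have PW: "P \<in> carrier G" "W \<in> carrier G" using rc w' by (auto simp: P_def W_def)
    have g1: "gp r1 \<one> P \<le> c1"
    proof -
      have "gp (r1 \<otimes> \<one>) (r1 \<otimes> inv r1) (r1 \<otimes> w') = gp \<one> (inv r1) w'" using gp_left rc w' by blast
      then show ?thesis using j1 rc by (simp add: P_def)
    qed
    have g2: "gp P r1 W \<le> c1"
    proof -
      have "gp (P \<otimes> \<one>) (P \<otimes> inv w') (P \<otimes> r2) = gp \<one> (inv w') r2" using gp_left PW rc w' by blast
      moreover have "P \<otimes> inv w' = r1" using rc w' by (simp add: P_def m_assoc)
      ultimately show ?thesis using j2 PW by (simp add: P_def W_def)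
    qed
    have eP: "e r1 P = real (wl w')" unfolding P_def using e_right rc w' by blast
    \<comment> \<open>The inserted element is long, so \<open>two_step\<close> applies however short
      r1 and r2 are: r1 lies coarsely between 1 and W.\<close>
    have g3: "gp r1 \<one> W \<le> m"
      unfolding m_def
    proof (rule two_step[OF one_closed rc(1) PW g1 g2])
      show "c1 + c1 + dl < e r1 P" unfolding eP using ww' long r0 dl_nonneg m0 unfolding N_def by linarith
    qed
    have "M \<le> real (wl W)"
    proof -
      have "2 * gp r1 \<one> W = e r1 \<one> + e r1 W - e \<one> W" "2 * gp P r1 W = e P r1 + e P W - e r1 W" by (simp_all add: gprod_def)
      moreover have "0 \<le> e r1 \<one>" "0 \<le> e P W" "e P r1 = e r1 P" "e \<one> W = real (wl W)"
        using d_nonneg rc PW e_sym e_one by auto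
      ultimately show ?thesis using g2 g3 eP ww' long r0 dl_nonneg unfolding N_def by linarith
    qed
    then have "aligned M' (orb \<one>) (orb r1) (orb W)" using M' PW(2) rc(1) g3 by blast
    then have "aligned M' (act p1 (orb \<one>)) (act p1 (orb r1)) (act p1 (orb W))"
      using aligned_translate[OF p(1)] orbH rc PW by simp
    moreover have "act p1 (orb \<one>) = orb p1" using act_one[OF xH] by simp
    moreover have "act p1 (orb r1) = orb p2" using act_mult[OF p(1) rc(1) xH] p by (simp add: r1_def)
    moreover have "act p1 (orb W) = orb (p2 \<otimes> w' \<otimes> r2)"
      using act_mult[OF p(1) PW(2) xH] p w' rc by (simp add: W_def r1_def m_assoc)
    ultimately have al: "aligned M' (orb p1) (orb p2) (orb (p2 \<otimes> w' \<otimes> r2))" by simp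
    \<comment> \<open>In the orbit the insertion is hardly visible: w moves the orbit point of q by
      at most 1, so the end of the long word lies within 1 of p3, and the alignment of the word
      contradicts the choice of the tripod.\<close>
    define q where "q = inv h \<otimes> r2"
    have q: "q \<in> carrier G" "q \<in> Q" using rc h v(1) by (auto simp: q_def Q_def h_def)
    have "hdist (orb (p2 \<otimes> h \<otimes> (w \<otimes> q))) (orb (p2 \<otimes> h \<otimes> q)) = hdist (orb (w \<otimes> q)) (orb q)"
      using act_isometry[of "p2 \<otimes> h" "orb (w \<otimes> q)" "orb q"] act_mult[of "p2 \<otimes> h" _ x] orbH p h q w xH by simp
    moreover have "p2 \<otimes> h \<otimes> (w \<otimes> q) = p2 \<otimes> w' \<otimes> r2" using p h w rc by (simp add: q_def w'_def m_assoc)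
    moreover have "p2 \<otimes> h \<otimes> q = p3" using p h rc by (simp add: q_def r2_def m_assoc)
    ultimately have near: "hdist (orb p3) (orb (p2 \<otimes> w' \<otimes> r2)) \<le> 1" using triv q(2) hdist_sym by metis
    have "aligned (M' + 3 * 1) (orb p1) (orb p2) (orb p3)"
      by (rule aligned_perturb[OF _ _ _ _ _ _ _ _ near al]) (use orbH p w' rc hdist_refl in auto)
    then show False using p(4) by blast
  qed
  ultimately show ?thesis by blast
qed

text \<open>Of infinitely many elements with bounded displacement, infinitely many agree up to 1 on
  the orbit points of the finite set Q, by repeated use of the pigeonhole principle on bounded sets.
  Quotients of these nearly fix the orbit points of Q, so their lengths are bounded, which leaves
  only finitely many.\<close>

lemma orbit_proper:
  assumes tri: "\<And>M. \<exists>p\<in>carrier G. \<exists>q\<in>carrier G. \<exists>r\<in>carrier G. \<not> aligned M (orb p) (orb q) (orb r)"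
  shows "finite {g \<in> carrier G. disp x g \<le> R0}"
proof (rule ccontr)
  assume inf0: "infinite {g \<in> carrier G. disp x g \<le> R0}"
  obtain Q N where Q: "finite Q" "Q \<subseteq> carrier G"
     "\<And>w. \<lbrakk>w \<in> carrier G; \<forall>q\<in>Q. hdist (orb (w \<otimes> q)) (orb q) \<le> 1\<rbrakk> \<Longrightarrow> real (wl w) < N"
    using almost_trivial_bounded[OF tri] by blast
  have "\<exists>A. infinite A \<and> A \<subseteq> {g \<in> carrier G. disp x g \<le> R0} \<and> (\<forall>g\<in>A. \<forall>h\<in>A. \<forall>q\<in>Q. hdist (orb (g \<otimes> q)) (orb (h \<otimes> q)) \<le> 1)"
    using Q(1,2)
  proof (induction Q rule: finite_induct)
    case empty
    then show ?case using inf0 by blast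
  next
    case (insert q Q)
    then obtain A where A: "infinite A" "A \<subseteq> {g \<in> carrier G. disp x g \<le> R0}"
      "\<forall>g\<in>A. \<forall>h\<in>A. \<forall>q\<in>Q. hdist (orb (g \<otimes> q)) (orb (h \<otimes> q)) \<le> 1" by auto
    have q: "q \<in> carrier G" using insert.prems by simp
    obtain k where k: "finite k" "\<forall>p\<in>H3. hdist x p \<le> R0 + disp x q \<longrightarrow> (\<exists>c\<in>k. c \<in> H3 \<and> hdist c p \<le> 1 / 2)"
      using hball_finite_cover[OF xH] by blast
    have "\<forall>g\<in>A. \<exists>c\<in>k. c \<in> H3 \<and> hdist c (orb (g \<otimes> q)) \<le> 1 / 2"
    proof
      fix g assume "g \<in> A"
      then have g: "g \<in> carrier G" "disp x g \<le> R0" using A(2) by auto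
      then have "hdist x (orb (g \<otimes> q)) \<le> R0 + disp x q" using disp_mult[OF xH g(1) q] by (simp add: disp_def)
      then show "\<exists>c\<in>k. c \<in> H3 \<and> hdist c (orb (g \<otimes> q)) \<le> 1 / 2" using k(2) orbH g(1) q by blast
    qed
    from pigeonhole_infinite_rel[OF A(1) k(1) this] obtain c where
      c: "infinite {g \<in> A. c \<in> H3 \<and> hdist c (orb (g \<otimes> q)) \<le> 1 / 2}" by blast
    define A' where "A' = {g \<in> A. c \<in> H3 \<and> hdist c (orb (g \<otimes> q)) \<le> 1 / 2}"
    have "hdist (orb (g \<otimes> q)) (orb (h \<otimes> q)) \<le> 1" if gh: "g \<in> A'" "h \<in> A'" for g h
    proof -
      have H: "c \<in> H3" "orb (g \<otimes> q) \<in> H3" "orb (h \<otimes> q) \<in> H3" using gh A(2) orbH q by (auto simp: A'_def)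
      show ?thesis using hdist_triangle[OF H(2,1,3)] hdist_sym[of c "orb (g \<otimes> q)"] gh by (simp add: A'_def)
    qed
    moreover have "A' \<subseteq> A" by (auto simp: A'_def)
    ultimately show ?case using A c unfolding A'_def[symmetric] by (intro exI[of _ A']) blast
  qed
  then obtain A where A: "infinite A" "A \<subseteq> {g \<in> carrier G. disp x g \<le> R0}"
    "\<forall>g\<in>A. \<forall>h\<in>A. \<forall>q\<in>Q. hdist (orb (g \<otimes> q)) (orb (h \<otimes> q)) \<le> 1" by blast
  have "A \<noteq> {}" using A(1) by auto
  then obtain g0 where g0: "g0 \<in> A" by blast
  then have g0c: "g0 \<in> carrier G" using A(2) by blast
  have "A \<subseteq> (\<lambda>k. g0 \<otimes> k) ` {g \<in> carrier G. real (wl g) \<le> N}"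
  proof
    fix g assume g: "g \<in> A"
    then have gc: "g \<in> carrier G" using A(2) by blast
    define w where "w = inv g0 \<otimes> g"
    have w: "w \<in> carrier G" using gc g0c by (simp add: w_def)
    have "\<forall>q\<in>Q. hdist (orb (w \<otimes> q)) (orb q) \<le> 1"
    proof
      fix q assume q: "q \<in> Q"
      then have qc: "q \<in> carrier G" using Q(2) by blast
      have "hdist (orb (w \<otimes> q)) (orb q) = hdist (act g0 (orb (w \<otimes> q))) (act g0 (orb q))"
        using act_isometry[OF g0c orbH orbH] w qc by simp
      also have "act g0 (orb (w \<otimes> q)) = orb (g \<otimes> q)" using act_mult[OF g0c _ xH, of "w \<otimes> q"] w qc gc g0c by (simp add: w_def m_assoc)
      also have "act g0 (orb q) = orb (g0 \<otimes> q)" using act_mult[OF g0c qc xH] by simp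
      finally show "hdist (orb (w \<otimes> q)) (orb q) \<le> 1" using A(3) g g0 q by simp
    qed
    then have "real (wl w) < N" using Q(3) w by blast
    then show "g \<in> (\<lambda>k. g0 \<otimes> k) ` {g \<in> carrier G. real (wl g) \<le> N}"
      using w gc g0c by (intro image_eqI[of _ _ w]) (auto simp: w_def)
  qed
  then show False using A(1) finite_ball finite_subset by blast
qed

text \<open>Times of neighbouring points on the axis differ by at most c, and properness forces the
  times of points N apart to differ by more than c + 1. By \<open>block_increments_linear\<close>
  the time then runs at a linear rate along the axis, with constants that do not depend on
  W.\<close>

lemma proper_imp_qi:
  assumes fin: "\<And>r. finite {g \<in> carrier G. disp x g \<le> r}"
  shows qi
proof -
  obtain n M where M: "0 \<le> M" "\<forall>W\<in>carrier G. M \<le> real (wl W) \<longrightarrow> (\<exists>w f l s B. length w = n \<and> axis_line f l s \<and>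
     (\<forall>k :: int. \<exists>i. e (cmt W (sqw G a b w) [^] k) (l i) \<le> M) \<and> (\<exists>i. e W (l i) \<le> M) \<and>
     (\<forall>i. \<exists>k :: int. e (l i) (cmt W (sqw G a b w) [^] k) \<le> B))" using good_lines by blast
  define c where "c = K * (Lp + C)"
  have c0: "0 \<le> c" unfolding c_def using K C Lp(1) by simp
  \<comment> \<open>Times at most c + 1 apart give orbit points at distance at most
    \<open>K * (c + 1) + C\<close>. By properness only finitely many elements realise this, and N is
    chosen larger than all their lengths.\<close>
  define F where "F = {g \<in> carrier G. disp x g \<le> K * (c + 1) + C}"
  define N where "N = Suc (Max (insert 0 (wl ` F)))"
  have fF: "finite F" unfolding F_def by (rule fin)
  have NF: "wl g < N" if "g \<in> F" for g
  proof -
    have "wl g \<le> Max (insert 0 (wl ` F))" using fF that by (intro Max_ge) auto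
    then show ?thesis by (simp add: N_def)
  qed
  define J where "J = real N * K"
  define B where "B = 2 * M + real N * (K * (2 * Lp * M + C) + real N * c + 1)"
  have "real (wl W) \<le> J * disp x W + (B + M)" if W: "W \<in> carrier G" for W
  proof (cases "M \<le> real (wl W)")
    case False
    moreover have "0 \<le> J * disp x W" "0 \<le> B" using disp_nonneg[OF xH W] K M(1) C c0 Lp(1) by (auto simp: J_def B_def)
    ultimately show ?thesis by linarith
  next
    case True
    then obtain w f l s where w: "axis_line f l s" "\<forall>k :: int. \<exists>i. e (cmt W (sqw G a b w) [^] k) (l i) \<le> M" "\<exists>i. e W (l i) \<le> M"
      using M(2) W by blast
    obtain i0 where i0: "e \<one> (l i0) \<le> M" using w(2)[rule_format, of 0] by auto
    obtain i1 where i1: "e W (l i1) \<le> M" using w(3) by blast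
    note lX = axis_lineD(4)[OF w(1)] and geo = axis_lineD(5)[OF w(1)]
    have step: "\<bar>s (i + 1) - s i\<bar> \<le> c" for i
    proof -
      have "hdist (f (s (i + 1))) (f (s i)) \<le> Lp * 1"
        unfolding axis_lineD(6)[OF w(1)] by (rule orb_lipschitz_le[OF lX lX]) (simp add: geo)
      then show ?thesis using axis_line_param[OF w(1)] unfolding c_def by simp
    qed
    have big: "c + 1 < \<bar>s (i + int N) - s i\<bar>" for i
    proof (rule ccontr)
      assume "\<not> ?thesis"
      then have "K * \<bar>s i - s (i + int N)\<bar> \<le> K * (c + 1)" using K by (intro mult_left_mono) auto
      then have "hdist (orb (l i)) (orb (l (i + int N))) \<le> K * (c + 1) + C"
        using axis_lineD(3)[OF w(1), of "s i" "s (i + int N)"] unfolding axis_lineD(6)[OF w(1)] by linarith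
      then have "inv (l i) \<otimes> l (i + int N) \<in> F" using hdist_act[OF xH lX lX] lX by (simp add: F_def)
      then have "wl (inv (l i) \<otimes> l (i + int N)) < N" by (rule NF)
      then show False using geo[of i "i + int N"] by (simp add: e_eq)
    qed
    have lin: "real m / real N - 1 - real N * c \<le> \<bar>s (i + int m) - s i\<bar>" for m i
    proof (rule block_increments_linear[where s = s and c = c and N = N, OF step])
      show "c < \<bar>s (i + int N) - s i\<bar>" for i using big[of i] by linarith
      show "1 \<le> \<bar>s (i + int N) - s i\<bar>" for i using big[of i] c0 by linarith
    qed
    have lin': "real_of_int \<bar>i1 - i0\<bar> / real N - 1 - real N * c \<le> \<bar>s i1 - s i0\<bar>"
    proof (cases "i0 \<le> i1")
      case True
      then show ?thesis using lin[of "nat (i1 - i0)" i0] by simp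
    next
      case False
      then show ?thesis using lin[of "nat (i0 - i1)" i1] by (simp add: abs_minus_commute)
    qed
    have "hdist (orb (l i0)) (orb (l i1)) \<le> disp x W + 2 * (Lp * M)"
    proof -
      have H: "orb \<one> \<in> H3" "orb W \<in> H3" "orb (l i0) \<in> H3" "orb (l i1) \<in> H3" using orbH lX W by auto
      have "hdist (orb (l i0)) (orb (l i1)) \<le> hdist (orb (l i0)) (orb \<one>) + hdist (orb \<one>) (orb W) + hdist (orb W) (orb (l i1))"
        using hdist_triangle[OF H(3,1,4)] hdist_triangle[OF H(1,2,4)] by linarith
      moreover have "hdist (orb \<one>) (orb W) = disp x W" using act_one[OF xH] by (simp add: disp_def)
      moreover have "hdist (orb (l i0)) (orb \<one>) \<le> Lp * M" using orb_lipschitz_le[OF one_closed lX i0] hdist_sym by metis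
      moreover have "hdist (orb W) (orb (l i1)) \<le> Lp * M" using orb_lipschitz_le[OF W lX i1] .
      ultimately show ?thesis by linarith
    qed
    then have "\<bar>s i0 - s i1\<bar> \<le> K * (disp x W + 2 * (Lp * M) + C)"
      using axis_line_param[OF w(1), of "s i0" "s i1"] unfolding axis_lineD(6)[OF w(1)] by blast
    then have "real_of_int \<bar>i1 - i0\<bar> / real N \<le> K * (disp x W + 2 * (Lp * M) + C) + real N * c + 1"
      using lin' abs_minus_commute[of "s i0" "s i1"] by linarith
    then have "real_of_int \<bar>i1 - i0\<bar> \<le> real N * (K * (disp x W + 2 * (Lp * M) + C) + real N * c + 1)"
      by (simp add: pos_divide_le_eq N_def mult.commute)
    also have "\<dots> = J * disp x W + real N * (K * (2 * Lp * M + C) + real N * c + 1)"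
      unfolding J_def by (simp add: algebra_simps)
    finally have "real_of_int \<bar>i1 - i0\<bar> \<le> J * disp x W + B - 2 * M" unfolding B_def by simp
    moreover have "real (wl W) \<le> real_of_int \<bar>i1 - i0\<bar> + 2 * M"
    proof -
      have "e \<one> W \<le> e \<one> (l i0) + e (l i0) (l i1) + e (l i1) W"
        using e_tri[OF one_closed lX W, of i0] e_tri[OF lX lX W, of i0 i1] by linarith
      moreover have "e (l i1) W \<le> M" using i1 e_sym[OF W lX] by simp
      moreover have "e (l i0) (l i1) = real_of_int \<bar>i1 - i0\<bar>" unfolding geo by simp
      ultimately show ?thesis using i0 e_one[OF W] by linarith
    qed
    ultimately show ?thesis using M(1) by linarith
  qed
  moreover have "1 \<le> J"
  proof -
    have "1 * 1 \<le> real N * K" using K by (intro mult_mono) (auto simp: N_def)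
    then show ?thesis by (simp add: J_def)
  qed
  moreover have "0 \<le> B + M" using M(1) K C c0 Lp(1) by (auto simp: B_def)
  ultimately show qi unfolding qi_def using xH by (intro bexI[of _ x] exI[of _ J] exI[of _ "B + M"] conjI) auto
qed

end

text \<open>Matrices are lifts of elements of \<open>PSL(2,C)\<close>, so they multiply up to sign only.\<close>
definition pm :: "complex^2^2 \<Rightarrow> complex^2^2 \<Rightarrow> bool" where "pm M N \<longleftrightarrow> M = N \<or> M = - N"

lemma pm_refl: "pm M M" by (simp add: pm_def)

lemma pm_mult: "\<lbrakk>pm M N; pm M' N'\<rbrakk> \<Longrightarrow> pm (M ** M') (N ** N')"
  by (auto simp: pm_def minus_mat_mult)

lemma pm_trans: "\<lbrakk>pm L M; pm M N\<rbrakk> \<Longrightarrow> pm L N"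
  by (auto simp: pm_def)

lemma pm_norm: "pm M N \<Longrightarrow> norm M = norm N"
  by (auto simp: pm_def)

lemma pm_commute: "\<lbrakk>pm M N; A ** N = N ** A\<rbrakk> \<Longrightarrow> A ** M = M ** A"
  by (auto simp: pm_def minus_mat_mult)

context rep
begin

lemma R_mult_pm: "\<lbrakk>g \<in> carrier G; h \<in> carrier G\<rbrakk> \<Longrightarrow> pm (R (g \<otimes> h)) (R g ** R h)"
  using R_mult[of g h] by (simp add: pm_def)

lemma R_inv_ex:
  assumes "g \<in> carrier G"
  shows "\<exists>Q. pm (R (inv g)) Q \<and> R g ** Q = mat 1 \<and> Q ** R g = mat 1"
proof -
  have "invertible (R g)" using R(2)[OF assms] by (simp add: invertible_det_nz)
  then obtain Q where Q: "R g ** Q = mat 1" "Q ** R g = mat 1" unfolding invertible_def by blast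
  have "pm (R \<one>) (R g ** R (inv g))" using R_mult_pm[of g "inv g"] assms by simp
  then have "R g ** R (inv g) = mat 1 \<or> R g ** R (inv g) = - mat 1"
    using R_one unfolding pm_def by (metis minus_minus)
  moreover have "R (inv g) = Q ** (R g ** R (inv g))" using Q by (simp add: matrix_mul_assoc)
  ultimately have "pm (R (inv g)) Q" unfolding pm_def by (metis mat_cancel(2) minus_mat_mult(2))
  then show ?thesis using Q by blast
qed

lemma R_pow_pm:
  assumes g: "g \<in> carrier G"
  shows "pm (R (g [^] (n::nat))) (mpow (R g) n)"
proof (induction n)
  case 0
  then show ?case using R_one by (simp add: pm_def)
next
  case (Suc n)
  have "g [^] Suc n = g \<otimes> g [^] n" using g nat_pow_comm[of g 1 n] by simp
  then have "pm (R (g [^] Suc n)) (R g ** R (g [^] n))" using R_mult_pm[of g "g [^] n"] g by simp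
  then show ?case using pm_trans[OF _ pm_mult[OF pm_refl Suc]] by simp
qed

lemma mpow_pm: "pm M N \<Longrightarrow> pm (mpow M n) (mpow N n)"
  by (induction n) (auto intro: pm_mult pm_refl)

lemma R_norm_le:
  assumes "g \<in> carrier G" "y \<in> H3" "disp y g \<le> r"
  shows "norm (R g) \<le> sqrt (2 * cosh (r + 2 * hdist y base))"
proof (rule norm_le_of_hdist_base[OF R(2)[OF assms(1)]])
  show "hdist base (mob (R g) base) \<le> r + 2 * hdist y base"
    using disp_change_base[OF assms(2) base_H3 assms(1)] assms(3) act_mob[OF assms(1)] by (simp add: disp_def)
qed

end

context stable_rep
begin

lemma long_square_word: "\<exists>w. r \<le> real (wl (sqw G a b w))"
proof (rule ccontr)
  assume "\<not> ?thesis"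
  then have short: "real (wl (sqw G a b w)) \<le> r" for w by (metis linorder_le_cases)
  define F where "F = {g \<in> carrier G. real (wl g) \<le> r}"
  have fF: "finite F" unfolding F_def by (rule finite_ball)
  obtain n :: nat where n: "card F < 2 ^ n" using less_exp by blast
  define W where "W = {w :: bool list. length w = n}"
  have cW: "card W = 2 ^ n" unfolding W_def using card_lists_length_eq[of "UNIV :: bool set" n] by simp
  have "inj_on (sqw G a b) W"
  proof (rule inj_onI)
    fix u v assume "u \<in> W" "v \<in> W" "sqw G a b u = sqw G a b v"
    then show "u = v" using sqw_inj[OF ab free, of u v] by (simp add: W_def)
  qed
  moreover have "sqw G a b ` W \<subseteq> F" using short sqw_closed[OF ab] by (auto simp: F_def)
  ultimately have "card W \<le> card F" using card_inj_on_le[OF _ _ fF] by blast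
  then show False using n cW by simp
qed

text \<open>Otherwise the whole orbit stays near the image of the axis of one commutator \<open>g = [W, h]\<close>. Conjugating
  \<open>\<rho>(q g q\<inverse>)\<close> by powers of \<open>\<rho>(g)\<close> then keeps it bounded, so it commutes with \<open>\<rho>(g)\<close>, and hence \<open>\<rho>(q)\<^sup>2\<close>
  does. But \<open>W\<close> and \<open>h\<close> are words in squares and the centralizer of \<open>\<rho>(g)\<close> is commutative, so
  \<open>\<rho>(g)\<close> is trivial. This is why squares are used throughout.\<close>
lemma tripod_exists: "\<exists>p\<in>carrier G. \<exists>q\<in>carrier G. \<exists>r\<in>carrier G. \<not> aligned M0 (orb p) (orb q) (orb r)"
proof (rule ccontr)
  assume "\<not> ?thesis"
  then have al: "aligned M0 (orb p) (orb q) (orb r)" if "p \<in> carrier G" "q \<in> carrier G" "r \<in> carrier G" for p q r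
    using that by blast
  obtain n M where M: "0 \<le> M" "\<forall>W\<in>carrier G. M \<le> real (wl W) \<longrightarrow> (\<exists>w f l s B. length w = n \<and> axis_line f l s \<and>
     (\<forall>k :: int. \<exists>i. e (cmt W (sqw G a b w) [^] k) (l i) \<le> M) \<and> (\<exists>i. e W (l i) \<le> M) \<and>
     (\<forall>i. \<exists>k :: int. e (l i) (cmt W (sqw G a b w) [^] k) \<le> B))" using good_lines by blast
  obtain w0 where w0: "M \<le> real (wl (sqw G a b w0))" using long_square_word by blast
  define W where "W = sqw G a b w0"
  have W: "W \<in> carrier G" "M \<le> real (wl W)" using w0 sqw_closed[OF ab] by (auto simp: W_def)
  obtain w f l s B where w: "axis_line f l s" "\<forall>k :: int. \<exists>i. e (cmt W (sqw G a b w) [^] k) (l i) \<le> M"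
     "\<forall>i. \<exists>k :: int. e (l i) (cmt W (sqw G a b w) [^] k) \<le> B"
    using M(2) W by blast
  define h where "h = sqw G a b w"
  have h: "h \<in> carrier G" using sqw_closed[OF ab] h_def by simp
  define g where "g = cmt W h"
  have g: "g \<in> carrier G" using cmt_closed W h by (simp add: g_def)
  have gk: "g [^] k \<in> carrier G" for k :: int using g by simp
  note lX = axis_lineD(4)[OF w(1)] and fH = axis_lineD(1)[OF w(1)]
  define E where "E = Lp * M"
  have E0: "0 \<le> E" using Lp(1) M(1) by (simp add: E_def)
  have "\<forall>k :: int. \<exists>i. e (g [^] k) (l i) \<le> M" using w(2) unfolding g_def h_def .
  from choice[OF this] obtain ix where ix: "\<forall>k :: int. e (g [^] k) (l (ix k)) \<le> M" ..
  \<comment> \<open>A time at which the line passes near the orbit point of the k-th power of g; the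
    order of these times is not yet known.\<close>
  define \<sigma> where "\<sigma> k = s (ix k)" for k
  have near: "hdist (orb (g [^] k)) (f (\<sigma> k)) \<le> E" for k
    unfolding \<sigma>_def axis_lineD(6)[OF w(1)] E_def using orb_lipschitz_le[OF gk lX] ix by blast
  have near': "hdist (f (\<sigma> k)) (orb (g [^] k)) \<le> E" for k using near[of k] hdist_sym by metis
  have dd: "hdist (orb (g [^] k)) (orb (g [^] j)) = disp x (g [^] (j - k))" for k j :: int
  proof -
    have "inv (g [^] k) \<otimes> g [^] j = g [^] (j - k)"
      using int_pow_mult[OF g, of "- k" j] g by (simp add: int_pow_neg)
    then show ?thesis using hdist_act[OF xH gk gk] by simp
  qed
  have lo: "\<bar>\<sigma> k - \<sigma> j\<bar> \<le> K * (disp x (g [^] (j - k)) + 2 * E + C)" for k j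
  proof -
    have "hdist (f (\<sigma> k)) (f (\<sigma> j)) \<le> disp x (g [^] (j - k)) + 2 * E"
      using hdist_triangle[OF fH orbH[OF gk] fH, of "\<sigma> k" "\<sigma> j" k] hdist_triangle[OF orbH[OF gk] orbH[OF gk] fH, of k "\<sigma> j" j]
        near[of j] near'[of k] dd[of k j] by linarith
    then show ?thesis by (rule axis_line_param[OF w(1)])
  qed
  have up: "disp x (g [^] (j - k)) \<le> K * \<bar>\<sigma> k - \<sigma> j\<bar> + C + 2 * E" for k j
    using hdist_triangle[OF orbH[OF gk] fH orbH[OF gk], of k j "\<sigma> k"] hdist_triangle[OF fH fH orbH[OF gk], of "\<sigma> k" j "\<sigma> j"]
      near[of k] near'[of j] dd[of k j] axis_lineD(3)[OF w(1), of "\<sigma> k" "\<sigma> j"] by linarith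
  define \<delta> where "\<delta> = disp x g"
  have \<delta>0: "0 \<le> \<delta>" using disp_nonneg[OF xH g] \<delta>_def by simp
  define c where "c = K * (\<delta> + 2 * E + C)"
  have c0: "0 \<le> c" unfolding c_def using K \<delta>0 E0 C by simp
  have step: "\<bar>\<sigma> (k + 1) - \<sigma> k\<bar> \<le> c" for k
    using lo[of k "k + 1"] g unfolding c_def \<delta>_def by (simp add: abs_minus_commute int_pow_1)
  define U where "U = K * (Lp + Lp * B + E + C)"
  \<comment> \<open>Every point of the line is near an orbit point of the axis, which is near a
    power of g. Hence the times \<sigma> k are unbounded, and some power of g displaces x
    arbitrarily far.\<close>
  have dense: "\<exists>k. \<bar>t - \<sigma> k\<bar> \<le> U" for t
  proof -
    obtain i where i: "hdist (f t) (orb (l i)) \<le> Lp" using axis_lineD(7)[OF w(1)] by blast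
    obtain k :: int where k: "e (l i) (g [^] k) \<le> B" using w(3) unfolding g_def h_def by blast
    have "hdist (orb (l i)) (orb (g [^] k)) \<le> Lp * B" using orb_lipschitz_le[OF lX gk k] .
    then have "hdist (f t) (f (\<sigma> k)) \<le> Lp + Lp * B + E"
      using hdist_triangle[OF fH orbH[OF lX] fH, of t "\<sigma> k" i] hdist_triangle[OF orbH[OF lX] orbH[OF gk] fH, of i "\<sigma> k" k]
        near[of k] i by linarith
    then show ?thesis unfolding U_def using axis_line_param[OF w(1)] by blast
  qed
  have dinv: "disp x (g [^] (- k)) = disp x (g [^] k)" for k :: int
    using disp_inv[OF xH gk, of k] g by (simp add: int_pow_neg)
  have dabs: "disp x (g [^] k) = disp x (g [^] nat \<bar>k\<bar>)" for k :: int
  proof (cases "0 \<le> k")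
    case True
    then show ?thesis by (metis abs_of_nonneg int_pow_int nat_0_le)
  next
    case False
    then have "disp x (g [^] k) = disp x (g [^] (int (nat \<bar>k\<bar>)))" using dinv[of k] by simp
    then show ?thesis by (simp add: int_pow_int)
  qed
  \<comment> \<open>By \<open>up\<close>, a displacement of V makes the corresponding times differ
    by at least c + 2, as \<open>block_increments_linear\<close> requires.\<close>
  define V where "V = K * (c + 2) + C + 2 * E"
  have "\<exists>j :: nat. 0 < j \<and> V \<le> disp x (g [^] j)"
  proof -
    obtain k1 where k1: "\<bar>0 - \<sigma> k1\<bar> \<le> U" using dense by blast
    obtain k2 where k2: "\<bar>(K * (V + 2 * E + C) + 2 * U) - \<sigma> k2\<bar> \<le> U" using dense by blast
    have "K * (V + 2 * E + C) \<le> \<bar>\<sigma> k1 - \<sigma> k2\<bar>" using k1 k2 by linarith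
    then have "K * (V + 2 * E + C) \<le> K * (disp x (g [^] (k2 - k1)) + 2 * E + C)" using lo[of k1 k2] by linarith
    then have V: "V \<le> disp x (g [^] (k2 - k1))" using K by (simp add: mult_le_cancel_left_pos)
    have "0 < V" unfolding V_def using K c0 C E0 by (simp add: add_pos_nonneg)
    then have "k2 - k1 \<noteq> 0" using V disp_one[OF xH] by (metis int_pow_0 less_le_not_le)
    then show ?thesis using V dabs[of "k2 - k1"] by (intro exI[of _ "nat \<bar>k2 - k1\<bar>"]) simp
  qed
  then obtain j :: nat where j: "0 < j" "V \<le> disp x (g [^] j)" by blast
  have big: "c + 2 \<le> \<bar>\<sigma> (k + int j) - \<sigma> k\<bar>" for k
  proof -
    have "V \<le> K * \<bar>\<sigma> k - \<sigma> (k + int j)\<bar> + C + 2 * E" using up[of "k + int j" k] j(2) by (simp add: int_pow_int)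
    then have "K * (c + 2) \<le> K * \<bar>\<sigma> k - \<sigma> (k + int j)\<bar>" unfolding V_def by linarith
    then have "c + 2 \<le> \<bar>\<sigma> k - \<sigma> (k + int j)\<bar>" using K by (simp add: mult_le_cancel_left_pos)
    then show ?thesis by (simp add: abs_minus_commute)
  qed
  have lin: "real m / real j - 1 - real j * c \<le> \<bar>\<sigma> (k + int m) - \<sigma> k\<bar>" for m k
  proof (rule block_increments_linear[where s = \<sigma> and c = c and N = j, OF step])
    show "c < \<bar>\<sigma> (i + int j) - \<sigma> i\<bar>" for i using big[of i] by linarith
    show "1 \<le> \<bar>\<sigma> (i + int j) - \<sigma> i\<bar>" for i using big[of i] c0 by linarith
  qed
  define K1 where "K1 = real j * K"
  define C1 where "C1 = 1 + real j * c + 2 * E + C"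
  have K1: "1 \<le> K1"
  proof -
    have "1 * 1 \<le> real j * K" using K j(1) by (intro mult_mono) auto
    then show ?thesis by (simp add: K1_def)
  qed
  have C10: "0 \<le> C1" unfolding C1_def using c0 E0 C by simp
  \<comment> \<open>Linear growth for every power of g, obtained from a single power with large
    displacement. The orbit of x under powers of g is thereby a quasi-geodesic.\<close>
  have grow: "real m / K1 - C1 \<le> disp x (g [^] m)" for m :: nat
  proof -
    have "real m / real j - (1 + real j * c) \<le> K * (disp x (g [^] m) + 2 * E + C)"
      using lin[of m 0] lo[of 0 "int m"] by (simp add: abs_minus_commute int_pow_int)
    then have "(real m / real j - (1 + real j * c)) / K \<le> disp x (g [^] m) + 2 * E + C"
      using K by (simp add: pos_divide_le_eq mult.commute)
    moreover have "(real m / real j - (1 + real j * c)) / K = real m / K1 - (1 + real j * c) / K"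
      by (simp add: K1_def diff_divide_distrib)
    moreover have "(1 + real j * c) / K \<le> 1 + real j * c"
    proof -
      have "0 \<le> 1 + real j * c" using c0 by simp
      then show ?thesis using K by (simp add: pos_divide_le_eq mult_le_cancel_left1)
    qed
    ultimately show ?thesis unfolding C1_def by linarith
  qed
  define K2 where "K2 = max K1 \<delta>"
  have K2: "1 \<le> K2" "K1 \<le> K2" "\<delta> \<le> K2" using K1 by (auto simp: K2_def)
  obtain Mm where Mm: "\<And>f n u m. \<lbrakk>H3.quasi_path K2 C1 f n; u \<in> H3; gprod hdist u (f 0) (f n) \<le> m\<rbrakk> \<Longrightarrow> \<exists>i\<le>n. hdist u (f i) \<le> Mm + m"
    using H3.morse_near[OF K2(1) C10] by blast
  define D1 where "D1 = Mm + M0"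
  \<comment> \<open>For large N the orbit points of the N-th powers of g and its inverse are far
    from each other and roughly equally far from the orbit point of q. Alignment then leaves only
    the option that q is coarsely between them, and the Morse lemma gives a nearby power.\<close>
  have close: "\<exists>k :: int. hdist (orb q) (orb (g [^] k)) \<le> D1" if q: "q \<in> carrier G" for q
  proof -
    obtain N :: nat where N: "K1 * (C1 + 2 * \<bar>M0\<bar> + 2 * disp x q + 1) \<le> real N" using real_arch_simple by blast
    have far: "2 * M0 + 2 * disp x q < disp x (g [^] (2 * int N))"
    proof -
      have "C1 + 2 * \<bar>M0\<bar> + 2 * disp x q + 1 \<le> real N / K1" using N K1 by (simp add: pos_le_divide_eq mult.commute)
      also have "\<dots> \<le> real (2 * N) / K1" using K1 by (intro divide_right_mono) auto
      finally have "2 * \<bar>M0\<bar> + 2 * disp x q + 1 \<le> disp x (g [^] (2 * N))" using grow[of "2 * N"] by linarith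
      moreover have "g [^] (2 * N) = g [^] (2 * int N)" using int_pow_int[of G g "2 * N"] by simp
      ultimately show ?thesis by simp
    qed
    define p where "p i = orb (g [^] (int i - int N))" for i :: nat
    have pH: "p i \<in> H3" for i unfolding p_def using orbH gk by blast
    have pd: "hdist (p i) (p k) = disp x (g [^] nat \<bar>int k - int i\<bar>)" for i k
      unfolding p_def dd using dabs[of "int k - int i"] by simp
    have qp: "H3.quasi_path K2 C1 p (2 * N)"
      unfolding H3.quasi_path_def
    proof (intro conjI allI impI)
      fix i k :: nat
      define m where "m = nat \<bar>int k - int i\<bar>"
      have m: "real m = \<bar>real i - real k\<bar>" by (simp add: m_def)
      show "p i \<in> H3" by (rule pH)
      have "real m / K2 \<le> real m / K1" using K1 K2 by (intro divide_left_mono) auto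
      then show "\<bar>real i - real k\<bar> / K2 - C1 \<le> hdist (p i) (p k)" using grow[of m] pd[of i k] m unfolding m_def by simp
      have "disp x (g [^] m) \<le> real m * \<delta>" unfolding \<delta>_def by (rule disp_pow_le[OF xH g])
      also have "\<dots> \<le> K2 * real m" using mult_right_mono[OF K2(3), of "real m"] by (simp add: mult.commute)
      finally show "hdist (p i) (p k) \<le> K2 * \<bar>real i - real k\<bar> + C1" using pd[of i k] m C10 unfolding m_def by simp
    qed
    have pe: "p 0 = orb (g [^] (- int N))" "p (2 * N) = orb (g [^] int N)" by (simp_all add: p_def)
    have ends: "hdist (p 0) (p (2 * N)) = disp x (g [^] (2 * int N))" unfolding pe dd by simp
    have xe: "hdist x (p 0) = disp x (g [^] N)" "hdist x (p (2 * N)) = disp x (g [^] N)"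
      unfolding pe using dinv[of "int N"] by (simp_all add: disp_def int_pow_int)
    have qx: "hdist x (orb q) = disp x q" by (simp add: disp_def)
    have H: "orb q \<in> H3" "p 0 \<in> H3" "p (2 * N) \<in> H3" using pH orbH[OF q] by auto
    have tri: "hdist (p 0) (orb q) \<le> disp x (g [^] N) + disp x q" "disp x (g [^] N) - disp x q \<le> hdist (p 0) (orb q)"
      "hdist (p (2 * N)) (orb q) \<le> disp x (g [^] N) + disp x q" "disp x (g [^] N) - disp x q \<le> hdist (p (2 * N)) (orb q)"
      using hdist_triangle[OF H(2) xH H(1)] hdist_triangle[OF xH H(1,2)] hdist_triangle[OF H(3) xH H(1)] hdist_triangle[OF xH H(1,3)]
        xe qx hdist_sym[of x "p 0"] hdist_sym[of x "p (2 * N)"] hdist_sym[of "orb q" "p 0"] hdist_sym[of "orb q" "p (2 * N)"]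
      by linarith+
    have "aligned M0 (orb q) (p 0) (p (2 * N))" unfolding pe using al q gk by blast
    moreover have "\<not> gprod hdist (p 0) (orb q) (p (2 * N)) \<le> M0"
    proof -
      have "2 * gprod hdist (p 0) (orb q) (p (2 * N)) = hdist (p 0) (orb q) + hdist (p 0) (p (2 * N)) - hdist (orb q) (p (2 * N))"
        by (simp add: gprod_def)
      then show ?thesis using tri ends far hdist_sym[of "orb q" "p (2 * N)"] by linarith
    qed
    moreover have "\<not> gprod hdist (p (2 * N)) (orb q) (p 0) \<le> M0"
    proof -
      have "2 * gprod hdist (p (2 * N)) (orb q) (p 0) = hdist (p (2 * N)) (orb q) + hdist (p (2 * N)) (p 0) - hdist (orb q) (p 0)"
        by (simp add: gprod_def)
      then show ?thesis using tri ends far hdist_sym[of "orb q" "p 0"] hdist_sym[of "p (2 * N)" "p 0"] by linarith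
    qed
    ultimately have "gprod hdist (orb q) (p 0) (p (2 * N)) \<le> M0" unfolding aligned_def by blast
    from Mm[OF qp H(1) this] obtain i where "hdist (orb q) (p i) \<le> D1" unfolding D1_def by blast
    then show ?thesis unfolding p_def by blast
  qed
  define D2 where "D2 = 2 * D1 + \<delta>"
  \<comment> \<open>The orbit point of \<open>inv q\<close> times a power of g is near that of some
    power of g. So the orbit point of g^k is near that of q g^m, where the conjugate of g by q
    displaces by exactly \<delta>.\<close>
  have conj_bound: "disp x (inv (g [^] k) \<otimes> (q \<otimes> g \<otimes> inv q) \<otimes> g [^] k) \<le> D2" if q: "q \<in> carrier G" for q and k :: int
  proof -
    define c' where "c' = q \<otimes> g \<otimes> inv q"
    have c': "c' \<in> carrier G" using q g by (simp add: c'_def)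
    obtain m :: int where m: "hdist (orb (inv q \<otimes> g [^] k)) (orb (g [^] m)) \<le> D1" using close[of "inv q \<otimes> g [^] k"] q gk by blast
    have d1: "hdist (orb (g [^] k)) (orb (q \<otimes> g [^] m)) \<le> D1"
    proof -
      have "hdist (orb (g [^] k)) (orb (q \<otimes> g [^] m)) = disp x (inv (g [^] k) \<otimes> (q \<otimes> g [^] m))"
        using hdist_act[OF xH gk] q gk by simp
      also have "\<dots> = hdist (orb (inv q \<otimes> g [^] k)) (orb (g [^] m))"
        using hdist_act[OF xH _ gk, of "inv q \<otimes> g [^] k" m] q gk by (simp add: inv_mult_group m_assoc)
      finally show ?thesis using m by simp
    qed
    have "hdist (orb (q \<otimes> g [^] m)) (orb (c' \<otimes> (q \<otimes> g [^] m))) = \<delta>"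
    proof -
      have "g \<otimes> g [^] m = g [^] m \<otimes> g" using int_pow_mult[OF g, of 1 m] int_pow_mult[OF g, of m 1] g by (simp add: int_pow_1 add.commute)
      then have "c' \<otimes> (q \<otimes> g [^] m) = q \<otimes> g [^] m \<otimes> g" using q g gk by (simp add: c'_def m_assoc)
      then have "hdist (orb (q \<otimes> g [^] m)) (orb (c' \<otimes> (q \<otimes> g [^] m))) = disp x (inv (q \<otimes> g [^] m) \<otimes> (q \<otimes> g [^] m \<otimes> g))"
        using hdist_act[OF xH, of "q \<otimes> g [^] m" "q \<otimes> g [^] m \<otimes> g"] q g gk by simp
      also have "inv (q \<otimes> g [^] m) \<otimes> (q \<otimes> g [^] m \<otimes> g) = g" using q g gk by simp
      finally show ?thesis by (simp add: \<delta>_def)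
    qed
    moreover have "hdist (orb (c' \<otimes> (q \<otimes> g [^] m))) (orb (c' \<otimes> g [^] k)) \<le> D1"
      using d1 hdist_sym[of "orb (g [^] k)"] act_isometry[OF c', of "orb (q \<otimes> g [^] m)" "orb (g [^] k)"] orbH gk q act_mult[OF c' _ xH] by simp
    moreover have "hdist (orb (g [^] k)) (orb (c' \<otimes> g [^] k)) \<le> hdist (orb (g [^] k)) (orb (q \<otimes> g [^] m)) +
        hdist (orb (q \<otimes> g [^] m)) (orb (c' \<otimes> (q \<otimes> g [^] m))) + hdist (orb (c' \<otimes> (q \<otimes> g [^] m))) (orb (c' \<otimes> g [^] k))"
    proof -
      have "orb (g [^] k) \<in> H3" "orb (q \<otimes> g [^] m) \<in> H3" "orb (c' \<otimes> (q \<otimes> g [^] m)) \<in> H3" "orb (c' \<otimes> g [^] k) \<in> H3"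
        using orbH gk q c' by auto
      then show ?thesis using hdist_triangle by (meson add_mono order_refl order_trans)
    qed
    moreover have "hdist (orb (g [^] k)) (orb (c' \<otimes> g [^] k)) = disp x (inv (g [^] k) \<otimes> c' \<otimes> g [^] k)"
      using hdist_act[OF xH gk, of "c' \<otimes> g [^] k"] c' gk by (simp add: m_assoc)
    ultimately show ?thesis using d1 unfolding D2_def c'_def[symmetric] by linarith
  qed
  define A where "A = R g"
  have A1: "det A = 1" using R(2)[OF g] A_def by simp
  obtain Qm where Qm: "pm (R (inv g)) Qm" "A ** Qm = mat 1" "Qm ** A = mat 1" using R_inv_ex[OF g] unfolding A_def by blast
  have pmA: "pm (R (g [^] n)) (mpow A n)" for n :: nat unfolding A_def by (rule R_pow_pm[OF g])
  have pmQ: "pm (R (inv (g [^] n))) (mpow Qm n)" for n :: nat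
    using pm_trans[OF R_pow_pm[OF inv_closed[OF g], of n] mpow_pm[OF Qm(1)]] g by (simp add: nat_pow_inv)
  obtain l' m' where lm: "l' + m' = A$1$1 + A$2$2" "l' * m' = 1" "1 \<le> cmod l'" using eigenvalues_exist by blast
  \<comment> \<open>With eigenvalues on the unit circle the powers of A would have at most linear
    norm and hence logarithmic displacement, against the linear growth in
    \<open>grow\<close>.\<close>
  have l1: "1 < cmod l'"
  proof (rule ccontr)
    assume "\<not> ?thesis"
    then have "cmod l' = 1" using lm(3) by simp
    define k1 where "k1 = norm (mat 1 :: complex^2^2) + norm (shift m' A) + 1"
    have k1: "1 \<le> k1" by (simp add: k1_def)
    have "real n / K1 - C1 - 2 * hdist x base \<le> 2 * ln (k1 * (real n + 1)) + 1" for n :: nat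
    proof -
      have gn: "g [^] n \<in> carrier G" using g by simp
      have "norm (R (g [^] n)) = norm (mpow A n)" by (rule pm_norm[OF pmA])
      also have "\<dots> \<le> norm (mat 1 :: complex^2^2) + real n * norm (shift m' A)"
        by (rule unit_eigenvalue_linear_growth[OF A1 lm(1,2) \<open>cmod l' = 1\<close>])
      also have "\<dots> \<le> k1 * (real n + 1)" by (simp add: k1_def algebra_simps)
      finally have "norm (R (g [^] n)) \<le> k1 * (real n + 1)" .
      moreover have "1 \<le> k1 * (real n + 1)"
      proof -
        have "1 * 1 \<le> k1 * (real n + 1)" using k1 by (intro mult_mono) auto
        then show ?thesis by simp
      qed
      ultimately have "disp base (g [^] n) \<le> 2 * ln (k1 * (real n + 1)) + 1"
        using hdist_base_le[OF R(2)[OF gn]] act_mob[OF gn] by (simp add: disp_def)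
      then show ?thesis using grow[of n] disp_change_base[OF base_H3 xH gn] hdist_sym[of base x] by linarith
    qed
    note upper = this
    have "eventually (\<lambda>n :: nat. 2 * ln (k1 * (real n + 1)) + 1 < real n / K1 - (C1 + 2 * hdist x base)) sequentially"
      using k1 K1 by real_asymp
    then obtain n :: nat where "2 * ln (k1 * (real n + 1)) + 1 < real n / K1 - (C1 + 2 * hdist x base)"
      unfolding eventually_sequentially by blast
    then show False using upper[of n] by linarith
  qed
  note ns = expanding_not_scalar[OF A1 lm(1,2) l1]
  have squares: "A ** (R q ** R q) = (R q ** R q) ** A" if q: "q \<in> carrier G" for q
  proof -
    obtain B' where B': "pm (R (inv q)) B'" "R q ** B' = mat 1" "B' ** R q = mat 1" using R_inv_ex[OF q] by blast
    define T where "T = R q ** A ** B'"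
    define c' where "c' = q \<otimes> g \<otimes> inv q"
    have c': "c' \<in> carrier G" using q g by (simp add: c'_def)
    have "pm (R c') (R (q \<otimes> g) ** R (inv q))" unfolding c'_def using R_mult_pm q g by simp
    moreover have "pm (R (q \<otimes> g) ** R (inv q)) (R q ** R g ** B')" using R_mult_pm[OF q g] B'(1) pm_mult by blast
    ultimately have pT: "pm (R c') T" unfolding T_def A_def by (rule pm_trans)
    define b0 where "b0 = sqrt (2 * cosh (D2 + 2 * hdist x base))"
    have n1: "norm (mpow Qm n ** T ** mpow A n) \<le> b0" for n
    proof -
      have gn: "g [^] n \<in> carrier G" using g by simp
      have "pm (R (inv (g [^] n) \<otimes> c' \<otimes> g [^] n)) (R (inv (g [^] n) \<otimes> c') ** R (g [^] n))" using R_mult_pm c' gn by simp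
      moreover have "pm (R (inv (g [^] n) \<otimes> c') ** R (g [^] n)) (mpow Qm n ** T ** mpow A n)"
        using pm_mult[OF pm_trans[OF R_mult_pm pm_mult[OF pmQ pT]] pmA] gn c' by simp
      ultimately have "norm (R (inv (g [^] n) \<otimes> c' \<otimes> g [^] n)) = norm (mpow Qm n ** T ** mpow A n)" using pm_norm pm_trans by blast
      moreover have "disp x (inv (g [^] n) \<otimes> c' \<otimes> g [^] n) \<le> D2" using conj_bound[OF q, of "int n"] by (simp add: c'_def int_pow_int)
      ultimately show ?thesis using R_norm_le[OF _ xH, of "inv (g [^] n) \<otimes> c' \<otimes> g [^] n" D2] gn c' by (simp add: b0_def)
    qed
    have n2: "norm (mpow A n ** T ** mpow Qm n) \<le> b0" for n
    proof -
      have gn: "g [^] n \<in> carrier G" using g by simp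
      have "pm (R (g [^] n \<otimes> c' \<otimes> inv (g [^] n))) (R (g [^] n \<otimes> c') ** R (inv (g [^] n)))" using R_mult_pm c' gn by simp
      moreover have "pm (R (g [^] n \<otimes> c') ** R (inv (g [^] n))) (mpow A n ** T ** mpow Qm n)"
        using pm_mult[OF pm_trans[OF R_mult_pm pm_mult[OF pmA pT]] pmQ] gn c' by simp
      ultimately have "norm (R (g [^] n \<otimes> c' \<otimes> inv (g [^] n))) = norm (mpow A n ** T ** mpow Qm n)" using pm_norm pm_trans by blast
      moreover have "disp x (g [^] n \<otimes> c' \<otimes> inv (g [^] n)) \<le> D2"
        using conj_bound[OF q, of "- int n"] g by (simp add: c'_def int_pow_neg int_pow_int)
      ultimately show ?thesis using R_norm_le[OF _ xH, of "g [^] n \<otimes> c' \<otimes> inv (g [^] n)" D2] gn c' by (simp add: b0_def)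
    qed
    have "A ** T = T ** A" by (rule bounded_conjugates_commute[OF A1 lm(1,2) l1 Qm(2,3) n1 n2])
    then show ?thesis using square_commutes[OF A1 ns B'(2,3)] unfolding T_def by blast
  qed
  have words: "A ** R (sqw G a b v) = R (sqw G a b v) ** A" for v
  proof (induction v)
    case Nil
    show ?case using R_one by (auto simp: sqw_simps minus_mat_mult)
  next
    case (Cons z v)
    define y where "y = (if z then b else a)"
    have y: "y \<in> carrier G" using ab by (simp add: y_def)
    have v: "sqw G a b v \<in> carrier G" by (rule sqw_closed[OF ab])
    have "pm (R (y \<otimes> (y \<otimes> sqw G a b v))) (R y ** R (y \<otimes> sqw G a b v))" using R_mult_pm y v by simp
    moreover have "pm (R y ** R (y \<otimes> sqw G a b v)) (R y ** (R y ** R (sqw G a b v)))"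
      using pm_mult[OF pm_refl R_mult_pm[OF y v]] .
    ultimately have "pm (R (sqw G a b (z # v))) (R y ** (R y ** R (sqw G a b v)))"
      unfolding sqw_simps y_def[symmetric] by (rule pm_trans)
    moreover have "A ** (R y ** (R y ** R (sqw G a b v))) = (R y ** (R y ** R (sqw G a b v))) ** A"
      using squares[OF y] Cons by (simp add: matrix_mul_assoc) (simp add: matrix_mul_assoc[symmetric])
    ultimately show ?case by (rule pm_commute)
  qed
  have "R W ** R h = R h ** R W" unfolding W_def h_def by (rule centralizer_commutative[OF ns(1) words words])
  then have comm: "act (W \<otimes> h) y = act (h \<otimes> W) y" if "y \<in> H3" for y
    using mob_mult[OF R(2)[OF W(1)] R(2)[OF h] that] mob_mult[OF R(2)[OF h] R(2)[OF W(1)] that]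
      act_mult[OF W(1) h that] act_mult[OF h W(1) that] act_mob[OF W(1)] act_mob[OF h] by metis
  have "orb g = x"
  proof -
    define y where "y = act (inv (h \<otimes> W)) x"
    have hW: "h \<otimes> W \<in> carrier G" using h W by simp
    have y: "y \<in> H3" "act (h \<otimes> W) y = x" unfolding y_def using act_H3 act_inv(2)[OF hW xH] hW xH by auto
    have "g \<otimes> (h \<otimes> W) = W \<otimes> h" using W h by (simp add: g_def cmt_def m_assoc)
    then have "act g (act (h \<otimes> W) y) = act (W \<otimes> h) y" using act_mult[OF g hW y(1)] by simp
    then show ?thesis using comm[OF y(1)] y(2) by simp
  qed
  then have "\<delta> = 0" using hdist_refl by (simp add: \<delta>_def disp_def)
  \<comment> \<open>If g fixes x, so do all its powers, and \<open>grow\<close> fails.\<close>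
  then have z: "disp x (g [^] m) \<le> 0" for m :: nat using disp_pow_le[OF xH g, of m] by (simp add: \<delta>_def)
  obtain m :: nat where m: "K1 * (C1 + 1) \<le> real m" using real_arch_simple by blast
  then have "C1 + 1 \<le> real m / K1" using K1 by (simp add: pos_le_divide_eq mult.commute)
  then show False using grow[of m] z[of m] by linarith
qed

lemma stable_imp_qi: qi
  using proper_imp_qi orbit_proper tripod_exists by blast

end

section \<open>The equivalence of the three conditions\<close>

theorem mainTheorem3:
  fixes G :: "('g, 'b) monoid_scheme" and S :: "'g set" and \<rho> :: "'g \<Rightarrow> (complex^2^2) set"
  assumes "hyperbolic_group G" and "non_elementary G"
    and "finite_gen_set G S"
    and "\<rho> \<in> hom G PSL2"
  shows "(convex_cocompact G \<rho> \<longleftrightarrow> stable_on G S (derived_set G (carrier G)) \<rho>)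
       \<and> (stable_on G S (derived_set G (carrier G)) \<rho> \<longleftrightarrow> well_displacing_on G S (derived G (carrier G)) \<rho>)"
proof -
  obtain dl where dl: "cayley G S" "gromov_hyperbolic (carrier G) (word_dist G S) dl"
    using hyperbolic_group_any_generators[OF assms(1,3)] by blast
  interpret cayley G S by (rule dl(1))
  interpret gromov_hyperbolic "carrier G" "word_dist G S" dl by (rule dl(2))
  interpret hyp_rep G S \<rho> dl by unfold_locales (rule assms(4))
  obtain a b where ab: "a \<in> carrier G" "b \<in> carrier G" and free: "\<And>w. \<lbrakk>w \<noteq> []; reduced2 w\<rbrakk> \<Longrightarrow> eval2 G a b w \<noteq> \<one>\<^bsub>G\<^esub>"
    using assms(2) unfolding non_elementary_def by blast
  have "qi" if st: "stable_on G S (derived_set G (carrier G)) \<rho>"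
  proof -
    obtain K C x where K: "1 \<le> K" "0 \<le> C" "x \<in> H3" "\<forall>c\<in>derived_set G (carrier G). infinite_order G c \<longrightarrow>
      (\<forall>l\<in>geodesics_axis G S c. quasi_geodesic K C (orbit_image \<rho> x l))"
      using st unfolding stable_on_def by blast
    interpret stable_rep G S \<rho> dl a b K C x
      by unfold_locales (use ab free K in blast)+
    show qi by (rule stable_imp_qi)
  qed
  moreover have "qi" if "well_displacing_on G S (derived G (carrier G)) \<rho>"
    by (rule well_displacing_imp_qi[OF ab free that])
  moreover have "stable_on G S (derived_set G (carrier G)) \<rho>" if qi by (rule qi_imp_stable[OF that])
  moreover have "well_displacing_on G S (derived G (carrier G)) \<rho>" if qi
    by (rule qi_imp_well_displacing[OF that derived_carrier])
  ultimately show ?thesis using convex_cocompact_imp_qi qi_imp_convex_cocompact by blast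
qed

end
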